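(* Let $N\ge4$ be an integer. Given any initial condition $u(\cdot,0)\in L^2(N+1)\times L^2(\Omega)$, there exist constants $\tilde C_j=\tilde C_j(\|u(\cdot,0)\|_{L^2(N+1)\times L^2(\Omega)})$, $j=1,2$, such that the solution of $$u_t=\nu\Delta u-A\chi(y,z)u_x,\qquad x\in\mathbb{R},\ (y,z)\in\Omega,\qquad\frac{\partial u}{\partial n}\Big|_{\partial\Omega}=0,$$ with this initial condition satisfies, for all $t\ge0$, $$\left\|u(x,y,z,t)-\frac{\tilde C_1}{\sqrt{4\pi(\nu+A^2\|\chi\|_\mu^2/\nu)(t+1/\nu)}}\,e^{-\frac{x^2}{4(\nu+A^2\|\chi\|_\mu^2/\nu)(t+1/\nu)}}\right\|_{L^2(\mathbb{R}\times\Omega)}\le\frac{\tilde C_2}{(1+\nu t)^{3/4}} .$$ The constant $\tilde C_1$ is given explicitly by $\tilde C_1=\int_{\mathbb{R}}\int_\Omega u(x,y,z,0)\,dx\,dy\,dz$.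
   Context: $\Omega\subset\mathbb{R}^2$ is compact with smooth boundary, $0<\nu\ll1$ is a small positive constant. $V:\Omega\to\mathbb{R}$ is smooth, $A=\frac1{\mathrm{vol}(\Omega)}\int_\Omega V$ (nonzero), $V=A(1+\chi)$, $\chi\in H^2(\Omega)$, so $\int_\Omega\chi=0$. $\{\psi_n\}_{n\ge0}$ is a real orthonormal basis of $L^2(\Omega)$ of eigenfunctions of $\partial_y^2+\partial_z^2$ with Neumann boundary conditions, $\psi_0\equiv1$ (so $\mathrm{vol}(\Omega)$ is normalized to $1$), with eigenvalues $-\mu_n$, $0=\mu_0<\mu_1\le\mu_2\le\cdots$. $\chi_n=\int_\Omega\chi\psi_n$ and $\|\chi\|_\mu^2=\sum_{m\ge1}\chi_m^2/\mu_m$. $\Delta=\partial_x^2+\partial_y^2+\partial_z^2$. The space of initial data is $$L^2(N+1)\times L^2(\Omega)=\Big\{u\in L^2(\mathbb{R}\times\Omega):\ \|u\|^2_{L^2(N+1)\times L^2(\Omega)}:=\int_{\mathbb{R}}\int_\Omega(1+x^2)^{N+1}|u(x,y,z)|^2\,dx\,dy\,dz<\infty\Big\}.$$ *)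

theory Defs
  imports "HOL-Analysis.Analysis"
begin

section \<open>Differentiability up to the boundary\<close>

text \<open>All derivatives are Frechet derivatives \<^emph>\<open>within\<close> \<open>S\<close>. On open sets they are the ordinary ones;
  the closed domains \<open>S\<close> used below have smooth boundary, so that the derivative within \<open>S\<close>
  is also unique at boundary points and only depends on the values of \<open>f\<close> on \<open>S\<close>.\<close>

definition ddir :: "'a::euclidean_space set \<Rightarrow> 'a \<Rightarrow> ('a \<Rightarrow> real) \<Rightarrow> 'a \<Rightarrow> real" where
  "ddir S v f p = frechet_derivative f (at p within S) v"

primrec Ck_on :: "nat \<Rightarrow> 'a::euclidean_space set \<Rightarrow> ('a \<Rightarrow> real) \<Rightarrow> bool" where
  "Ck_on 0 S f \<longleftrightarrow> continuous_on S f"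
| "Ck_on (Suc k) S f \<longleftrightarrow> f differentiable_on S \<and> (\<forall>v. Ck_on k S (ddir S v f))"

definition smooth_on :: "'a::euclidean_space set \<Rightarrow> ('a \<Rightarrow> real) \<Rightarrow> bool" where
  "smooth_on S f \<longleftrightarrow> (\<forall>k. Ck_on k S f)"

definition laplacian_on :: "'a::euclidean_space set \<Rightarrow> ('a \<Rightarrow> real) \<Rightarrow> 'a \<Rightarrow> real" where
  "laplacian_on S f p = (\<Sum>b\<in>Basis. ddir S b (ddir S b f) p)"


section \<open>Smooth boundary and the outward normal\<close>

definition local_defining_function ::
  "'a::euclidean_space set \<Rightarrow> 'a \<Rightarrow> 'a set \<Rightarrow> ('a \<Rightarrow> real) \<Rightarrow> bool" where
  "local_defining_function \<Omega> p U \<rho> \<longleftrightarrow>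
     open U \<and> p \<in> U \<and> smooth_on U \<rho> \<and> \<Omega> \<inter> U = {q \<in> U. \<rho> q \<le> 0} \<and>
     (\<exists>v. ddir U v \<rho> p \<noteq> 0)"

definition smooth_boundary :: "'a::euclidean_space set \<Rightarrow> bool" where
  "smooth_boundary \<Omega> \<longleftrightarrow> (\<forall>p\<in>frontier \<Omega>. \<exists>U \<rho>. local_defining_function \<Omega> p U \<rho>)"

text \<open>\<open>n\<close> is the normalized gradient of a local defining function; \<open>c\<close> is the length of the gradient.\<close>

definition outward_normal :: "'a::euclidean_space set \<Rightarrow> 'a \<Rightarrow> 'a \<Rightarrow> bool" where
  "outward_normal \<Omega> p n \<longleftrightarrow> norm n = 1 \<and>
     (\<exists>U \<rho> c. local_defining_function \<Omega> p U \<rho> \<and> c > 0 \<and> (\<forall>v. ddir U v \<rho> p = c * (n \<bullet> v)))"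


section \<open>Square-integrable functions\<close>

text \<open>Elements of \<open>L\<^sup>2\<close> are represented by functions; equality almost everywhere is not factored out.\<close>

definition L2 :: "'a measure \<Rightarrow> ('a \<Rightarrow> real) set" where
  "L2 M = {f \<in> borel_measurable M. integrable M (\<lambda>p. (f p)\<^sup>2)}"

definition L2_norm :: "'a measure \<Rightarrow> ('a \<Rightarrow> real) \<Rightarrow> real" where
  "L2_norm M f = sqrt (LINT p|M. (f p)\<^sup>2)"

definition L2_inner :: "'a measure \<Rightarrow> ('a \<Rightarrow> real) \<Rightarrow> ('a \<Rightarrow> real) \<Rightarrow> real" where
  "L2_inner M f g = (LINT p|M. f p * g p)"

definition orthonormal_basis_L2 :: "'a measure \<Rightarrow> (nat \<Rightarrow> 'a \<Rightarrow> real) \<Rightarrow> bool" where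
  "orthonormal_basis_L2 M \<psi> \<longleftrightarrow>
     (\<forall>n. \<psi> n \<in> L2 M) \<and>
     (\<forall>m n. L2_inner M (\<psi> m) (\<psi> n) = (if m = n then 1 else 0)) \<and>
     (\<forall>f\<in>L2 M. (\<lambda>k. L2_norm M (\<lambda>p. f p - (\<Sum>n<k. L2_inner M f (\<psi> n) * \<psi> n p))) \<longlonglongrightarrow> 0)"


section \<open>The cross section\<close>

definition neumann_eigenfunction ::
  "'a::euclidean_space set \<Rightarrow> ('a \<Rightarrow> real) \<Rightarrow> real \<Rightarrow> bool" where
  "neumann_eigenfunction \<Omega> \<phi> \<mu> \<longleftrightarrow>
     Ck_on 2 \<Omega> \<phi> \<and>
     (\<forall>q\<in>\<Omega>. laplacian_on \<Omega> \<phi> q = - \<mu> * \<phi> q) \<and>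
     (\<forall>q\<in>frontier \<Omega>. \<forall>n. outward_normal \<Omega> q n \<longrightarrow> ddir \<Omega> n \<phi> q = 0)"

text \<open>The square \<open>\<parallel>\<chi>\<parallel>\<^sub>\<mu>\<^sup>2\<close>; the summation index is shifted because the sum starts at \<open>m = 1\<close>.\<close>

definition mu_norm_sq ::
  "'a::euclidean_space set \<Rightarrow> (nat \<Rightarrow> 'a \<Rightarrow> real) \<Rightarrow> (nat \<Rightarrow> real) \<Rightarrow> ('a \<Rightarrow> real) \<Rightarrow> real" where
  "mu_norm_sq \<Omega> \<psi> \<mu> chi = (\<Sum>m. (L2_inner (lebesgue_on \<Omega>) chi (\<psi> (Suc m)))\<^sup>2 / \<mu> (Suc m))"


section \<open>The cylinder and the evolution equation\<close>

text \<open>A point of the cylinder is \<open>(x, y, z) = (x, (y, z))\<close> with cross-sectional part \<open>(y, z)\<close>.\<close>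

abbreviation cylinder :: "(real \<times> real) set \<Rightarrow> (real \<times> real \<times> real) measure" where
  "cylinder \<Omega> \<equiv> lebesgue_on (UNIV \<times> \<Omega>)"

definition weighted_L2 :: "nat \<Rightarrow> (real \<times> real) set \<Rightarrow> (real \<times> real \<times> real \<Rightarrow> real) set" where
  "weighted_L2 m \<Omega> = {f \<in> borel_measurable (cylinder \<Omega>).
     integrable (cylinder \<Omega>) (\<lambda>(x, q). (1 + x\<^sup>2) ^ m * (f (x, q))\<^sup>2)}"

definition weighted_L2_norm :: "nat \<Rightarrow> (real \<times> real) set \<Rightarrow> (real \<times> real \<times> real \<Rightarrow> real) \<Rightarrow> real" where
  "weighted_L2_norm m \<Omega> f = sqrt (LINT (x, q)|cylinder \<Omega>. (1 + x\<^sup>2) ^ m * (f (x, q))\<^sup>2)"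

text \<open>Solutions with \<open>L\<^sup>2\<close> initial data: a continuous curve \<open>u\<close> from \<open>[0,\<infinity>)\<close> into \<open>L\<^sup>2(\<real> \<times> \<Omega>)\<close>
  (which gives \<open>u 0\<close> its meaning as initial value) that satisfies the equation and the Neumann
  condition classically, up to the boundary, for \<open>t > 0\<close>. The uncurried function
  \<open>w (t, x, y, z) = u t (x, y, z)\<close> is differentiated in space-time \<open>S = (0,\<infinity>) \<times> \<real> \<times> \<Omega>\<close>.\<close>

definition advection_diffusion_solution ::
  "(real \<times> real) set \<Rightarrow> real \<Rightarrow> real \<Rightarrow> (real \<times> real \<Rightarrow> real) \<Rightarrow>
   (real \<Rightarrow> real \<times> real \<times> real \<Rightarrow> real) \<Rightarrow> bool" where
  "advection_diffusion_solution \<Omega> \<nu> A chi u \<longleftrightarrow>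
     (\<forall>t\<ge>0. u t \<in> L2 (cylinder \<Omega>)) \<and>
     (\<forall>t\<ge>0. ((\<lambda>s. L2_norm (cylinder \<Omega>) (\<lambda>p. u s p - u t p)) \<longlongrightarrow> 0) (at t within {0..})) \<and>
     (let S = {0<..} \<times> UNIV \<times> \<Omega>; w = (\<lambda>(t, p). u t p) in
       Ck_on 2 S w \<and>
       (\<forall>t>0. \<forall>x. \<forall>q\<in>\<Omega>.
          ddir S (1, 0) w (t, x, q) =
            \<nu> * (\<Sum>b\<in>Basis. ddir S (0, b) (ddir S (0, b) w) (t, x, q))
            - A * chi q * ddir S (0, 1, 0) w (t, x, q)) \<and>
       (\<forall>t>0. \<forall>x. \<forall>q\<in>frontier \<Omega>. \<forall>n. outward_normal \<Omega> q n \<longrightarrow>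
          ddir S (0, 0, n) w (t, x, q) = 0))"

definition heat_gaussian :: "real \<Rightarrow> real \<Rightarrow> real \<Rightarrow> real" where
  "heat_gaussian D \<tau> x = exp (- (x\<^sup>2 / (4 * D * \<tau>))) / sqrt (4 * pi * D * \<tau>)"

end

theory Submission
 imports Defs "HOL-Probability.Probability"
begin

text \<open>Fourier transform in \<open>x\<close> and expansion in the \<open>\<psi>\<^sub>n\<close> turn the equation, in the time \<open>\<nu> t\<close>, into linear
 systems with parameter \<open>\<kappa> = k A / \<nu>\<close> in which the mean \<open>a\<close> is coupled to the other modes \<open>z\<^sub>n\<close> only through
 \<open>\<kappa>\<close>. For small \<open>\<kappa>\<close> the combination \<open>a - i \<kappa> \<Sum> (\<chi>\<^sub>n / \<mu>\<^sub>n) z\<^sub>n\<close> decouples up to order \<open>\<kappa>\<^sup>2\<close> and decays like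
 \<open>exp (-(k\<^sup>2 + \<kappa>\<^sup>2 |\<chi>|\<^sub>\<mu>\<^sup>2) \<nu> t)\<close>, the transform of the Gaussian; the error is of order
 \<open>\<kappa> exp (-c \<kappa>\<^sup>2 \<nu> t)\<close>, and integrating its square over \<open>\<kappa>\<close> gives the rate \<open>3/4\<close>. For \<open>\<kappa>\<close> bounded away from
 \<open>0\<close> the functional \<open>|z|\<^sup>2 + (\<epsilon> / \<kappa>) Im (conj a * \<Sum> (\<chi>\<^sub>n / \<mu>\<^sub>n) z\<^sub>n)\<close> decays exponentially. If all \<open>\<chi>\<^sub>n\<close> vanish, the
 mean decouples completely. Solutions are only known to be square integrable in \<open>x\<close>, so all transforms
 are taken of windowed solutions; the commutator with a window of radius \<open>R\<close> is of order \<open>R\<^sup>-\<^sup>1\<^sup>/\<^sup>2\<close>.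
 In names, \<open>kp, rr, dl, Om, ps\<close> stand for \<open>\<kappa>, \<rho>, \<delta>, \<Omega>, \<psi>\<close>.\<close>

text \<open>The combination \<open>a - i kp b\<close> is forced. With \<open>b\<close> the pairing
  of the remainder with the Neumann inverse of the profile, \<open>b'\<close> contains exactly
  \<open>- h\<close>, so \<open>- i kp b\<close> cancels the coupling \<open>- i kp h\<close> in
  \<open>a'\<close> and leaves \<open>- kp^2 d a\<close>. This is the origin of
  \<open>|\<chi>|_\<mu>^2\<close>. The mode equations never close: a window produces commutators,
  and keeping finitely many modes produces a tail. Both are treated as a forcing of size
  \<open>dl\<close>. At a fixed time and frequency one chooses the window radius, then so many modes
  that the tail is small uniformly in time, and only then lets the radius grow. Constants that
  multiply \<open>dl\<close> may therefore depend on everything fixed so far, whereas rates and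
  prefactors must be uniform in the truncation, the frequency and \<open>nu\<close>. This dictates
  the order of the quantifiers throughout. The shift of the Gaussian by the time
  \<open>1 / nu\<close> is one unit of rescaled time. It costs one factor of frequency, as does
  replacing the initial mean mode by the total mass, so both errors have the order of the main
  one.\<close>

notation LIMSEQ ("((_)/ ----> (_))" [60, 60] 60)

abbreviation eventually_sequentially_binder :: "(nat => bool) => bool" (binder "EVS " 10)
 where "eventually_sequentially_binder P == eventually P sequentially"

lemmas LINT_bound = Bochner_Integration.integrable_bound
lemmas LINT_cong = Bochner_Integration.integral_cong
lemmas LINT_nonneg = Bochner_Integration.integral_nonneg
lemmas LINT_sum = Bochner_Integration.integral_sum
lemmas LINT_diff = Bochner_Integration.integral_diff

section \<open>Green's identity with Neumann boundary conditions\<close>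

text \<open>Difference quotients of \<open>g\<close> integrate to 0 by translation invariance; the
  Lipschitz constant and the compact support dominate them. The fundamental theorem of calculus is
  avoided because \<open>g'\<close> is only known to exist and to be bounded; even its measurability
  is obtained from the limit.\<close>

lemma integral_directional_derivative_eq_0:
 fixes g :: "'a::euclidean_space => real"
 assumes der: "!!x. (g has_derivative g' x) (at x)"
  and bnd: "!!x v. \<bar>g' x v\<bar> <= L * norm v"
  and supp: "!!x. x \<notin> cball 0 R ==> g x = 0"
 shows "(%x. g' x b) \<in> borel_measurable borel"
  and "integrable lborel (%x. g' x b)"
  and "(LINT x|lborel. g' x b) = 0"
proof -
 define h :: "nat => real" where "h n = 1 / real (Suc n)" for n
 have h0: "h n > 0" "h n <= 1" for n by (auto simp: h_def)
 have hlim: "h ----> 0" unfolding h_def by (rule LIMSEQ_inverse_real_of_nat[unfolded inverse_eq_divide])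
 define q where "q n x = (g (x + h n *\<^sub>R b) - g x) / h n" for n x
 have L0: "L \<ge> 0"
 proof -
  obtain v :: 'a where "v \<in> Basis" using nonempty_Basis by blast
  thus ?thesis using bnd[of 0 v] by simp
 qed
 have contg: "continuous_on UNIV g"
  using der by (meson continuous_at_imp_continuous_on has_derivative_continuous)
 have gm [measurable]: "g \<in> borel_measurable borel"
  using contg by (rule borel_measurable_continuous_onI)
 have qm [measurable]: "q n \<in> borel_measurable borel" for n
  unfolding q_def by measurable
 have lip: "\<bar>g y - g x\<bar> <= L * norm (y - x)" for x y
 proof -
  have "norm (g y - g x) <= L * norm (y - x)"
  proof (rule differentiable_bound[of UNIV g g'])
   show "!!x. x \<in> UNIV ==> onorm (g' x) <= L"
   using bnd by (intro onorm_le) auto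
  qed (use der in auto)
  thus ?thesis by simp
 qed
 have qlim: "(%n. q n x) ----> g' x b" for x
 proof -
  have "((%t. g (x + t *\<^sub>R b)) has_derivative (%t. g' x (t *\<^sub>R b))) (at 0)"
   by (rule derivative_eq_intros has_derivative_compose[of "%t. x + t *\<^sub>R b", where g=g] | simp add: der)+
  moreover have "g' x (t *\<^sub>R b) = g' x b * t" for t
   using linear_scale[OF has_derivative_linear[OF der]] by simp
  ultimately have "((%t. g (x + t *\<^sub>R b)) has_field_derivative g' x b) (at 0)"
   by (simp add: has_field_derivative_def mult.commute[of _ "g' x b"])
  hence "((%t. (g (x + t *\<^sub>R b) - g x) / t) \<longlongrightarrow> g' x b) (at 0)"
   by (simp add: DERIV_def)
  thus ?thesis unfolding q_def
   by (rule filterlim_compose) (use hlim h0 in "auto simp: filterlim_at order_less_imp_not_eq2")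
 qed
 show m: "(%x. g' x b) \<in> borel_measurable borel"
  by (rule borel_measurable_LIMSEQ_real[where u=q]) (auto simp: qlim)
 \<comment> \<open>The steps \<open>h n\<close> are at most 1, so no difference quotient sees more
   than the support enlarged by \<open>norm b\<close>.\<close>
 let ?w = "%x. L * norm b * indicator (cball 0 (R + norm b)) x :: real"
 have wint: "integrable lborel ?w"
  by (intro integrable_mult_right integrable_real_indicator)
   (auto intro!: emeasure_bounded_finite simp: infinity_ennreal_def[symmetric] simp del: infinity_ennreal_def)
 have qb: "norm (q n x) <= ?w x" for n x
 proof (cases "x \<in> cball 0 (R + norm b)")
  case True
  have "\<bar>g (x + h n *\<^sub>R b) - g x\<bar> <= L * (h n * norm b)"
   using lip[of "x + h n *\<^sub>R b" x] h0[of n] by simp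
  thus ?thesis using True h0[of n] by (simp add: q_def divide_simps mult.commute mult.left_commute)
 next
  case False
  hence 1: "norm x > R + norm b" by simp
  have "norm x <= norm (x + h n *\<^sub>R b) + norm (h n *\<^sub>R b)"
   using norm_triangle_ineq4[of "x + h n *\<^sub>R b" "h n *\<^sub>R b"] by simp
  also have "norm (h n *\<^sub>R b) <= norm b" using h0[of n] by (simp add: mult_left_le_one_le)
  finally have "norm (x + h n *\<^sub>R b) > R" using 1 by simp
  hence "g (x + h n *\<^sub>R b) = 0" "g x = 0" using 1 by (auto intro!: supp simp: add.commute)
   (smt (verit) norm_ge_zero)
  thus ?thesis using False by (simp add: q_def)
 qed
 have conv: "integrable lborel (%x. g' x b)" "(%n. LINT x|lborel. q n x) ----> (LINT x|lborel. g' x b)"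
  by (rule integrable_dominated_convergence[where w="?w" and s=q] integral_dominated_convergence[where w="?w" and s=q];
   use m wint qb qlim in auto)+
 show "integrable lborel (%x. g' x b)" by fact
 have gint: "integrable lborel g"
 proof -
  have "integrable lborel (%x. indicator (cball 0 R) x *\<^sub>R g x)"
   using borel_integrable_compact[of "cball 0 R" g] contg
   by (simp add: continuous_on_subset scaleR_conv_of_real)
  also have "(%x. indicator (cball 0 R) x *\<^sub>R g x) = g"
   using supp by (auto simp: indicator_def fun_eq_iff)
  finally show ?thesis .
 qed
 have "(LINT x|lborel. q n x) = 0" for n
 proof -
  have "integrable lborel (%x. g (h n *\<^sub>R b + x))"
   using gint by (subst (asm) lborel_distr_plus[symmetric, of "h n *\<^sub>R b"])
   (simp add: integrable_distr_eq)
  moreover have "(LINT x|lborel. g (h n *\<^sub>R b + x)) = (LINT x|lborel. g x)"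
   by (subst (2) lborel_distr_plus[symmetric, of "h n *\<^sub>R b"]) (simp add: integral_distr)
  ultimately show ?thesis using gint by (simp add: q_def add.commute)
 qed
 with conv(2) show "(LINT x|lborel. g' x b) = 0"
  by (simp add: LIMSEQ_const_iff)
qed


text \<open>Serves to differentiate functions extended by 0 at points of the seam, where no open-set
  argument applies.\<close>

lemma has_derivative_0_quadratic:
 fixes g :: "'a::real_normed_vector => real"
 assumes "\<forall>\<^sub>F y in nhds x. \<bar>g y\<bar> <= C * (norm (y - x))^2"
 shows "(g has_derivative (%_. 0)) (at x)"
proof -
 have g0: "g x = 0"
  using eventually_nhds_x_imp_x[OF assms] by simp
 have "((%y. C * norm (y - x)) \<longlongrightarrow> C * norm (x - x)) (at x)"
  by (intro tendsto_intros)
 hence *: "((%y. C * norm (y - x)) \<longlongrightarrow> 0) (at x)" by simp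
 have "((%y. norm (g y - g x - 0) / norm (y - x)) \<longlongrightarrow> 0) (at x)"
 proof (rule tendsto_sandwich[OF _ _ tendsto_const *])
  show "\<forall>\<^sub>F y in at x. norm (g y - g x - 0) / norm (y - x) <= C * norm (y - x)"
   using assms unfolding eventually_at_filter
   by eventually_elim (auto simp: g0 divide_simps power2_eq_square mult.assoc)
 qed auto
 thus ?thesis
  unfolding has_derivative_iff_norm by (simp add: bounded_linear_zero)
qed

text \<open>A function with these properties serves, on the ball, both as a defining function near a
 boundary point and (with value \<open>-1\<close>) near an interior point.\<close>

definition boundary_chart ::
 "'a::euclidean_space set => ('a => 'a) => 'a => real => ('a => real) => ('a => 'a => real) => real => bool" where
 "boundary_chart Om F p r rr rr' C \<longleftrightarrow> 0 < r \<and> 0 <= C \<and>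
   (\<forall>q\<in>ball p r. (rr has_derivative rr' q) (at q)) \<and>
   (\<forall>q\<in>ball p r. \<forall>v. \<bar>rr' q v\<bar> <= C * norm v) \<and>
   Om \<inter> ball p r = {q \<in> ball p r. rr q <= 0} \<and>
   (\<forall>q\<in>Om \<inter> ball p r. \<bar>rr' q (F q)\<bar> <= C * \<bar>rr q\<bar>) \<and>
   negligible {q \<in> ball p r. rr q = 0}"

text \<open>The square makes the extension by 0 differentiable across the sphere: near points off
  the ball the function is quadratically small.\<close>

definition bump :: "'a::euclidean_space => real => 'a => real" where
 "bump p r q = (max 0 (r^2 - (dist q p)^2))^2"

definition bump' :: "'a::euclidean_space => real => 'a => 'a => real" where
 "bump' p r q v = - 4 * max 0 (r^2 - (dist q p)^2) * ((q - p) \<bullet> v)"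

lemma bump_nonneg [simp]: "0 <= bump p r q"
 by (simp add: bump_def)

lemma abs_bump [simp]: "\<bar>bump p r q\<bar> = bump p r q"
 by (simp add: bump_nonneg)

lemma bump_pos: "q \<in> ball p r ==> 0 < bump p r q"
 using power_strict_mono[of "dist p q" r 2] by (simp add: bump_def dist_commute)

lemma bump_outside: "0 < r ==> q \<notin> ball p r ==> bump p r q = 0"
 by (auto simp: bump_def dist_commute max_def power_mono)

lemma bump'_outside: "0 < r ==> q \<notin> ball p r ==> bump' p r q v = 0"
 by (auto simp: bump'_def dist_commute max_def power_mono)

lemma bump_le: "0 < r ==> bump p r q <= r ^ 4"
 unfolding bump_def using power_mono[of "max 0 (r^2 - (dist q p)^2)" "r^2" 2] by simp

lemma bump'_le: assumes "0 < r" shows "\<bar>bump' p r q v\<bar> <= 4 * r ^ 3 * norm v"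
proof (cases "q \<in> ball p r")
 case True
 hence d: "norm (q - p) <= r" by (simp add: dist_norm norm_minus_commute)
 have "\<bar>bump' p r q v\<bar> = 4 * max 0 (r^2 - (dist q p)^2) * \<bar>(q - p) \<bullet> v\<bar>"
  by (simp add: bump'_def abs_mult)
 also have "... <= 4 * r^2 * (r * norm v)"
  by (intro mult_mono order_trans[OF Cauchy_Schwarz_ineq2] mult_right_mono d) (use assms in auto)
 finally show ?thesis by (simp add: power2_eq_square power3_eq_cube mult.assoc)
qed (use assms in "simp add: bump'_outside")

text \<open>\<open>r^2 - (dist y p)^2\<close> factors; one factor is at most \<open>2 * r\<close>,
  the other at most the distance from \<open>y\<close> to a point outside the ball.\<close>

lemma bump_quadratic:
 assumes "0 < r" "q \<notin> ball p r"
 shows "bump p r y <= (2 * r * norm (y - q))^2"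
proof (cases "y \<in> ball p r")
 case True
 have "r - dist y p <= norm (y - q)"
  using assms norm_triangle_ineq4[of "y - p" "y - q"] by (auto simp: dist_norm norm_minus_commute)
 moreover have "r^2 - (dist y p)^2 = (r + dist y p) * (r - dist y p)"
  by (simp add: power2_eq_square algebra_simps)
 moreover have "dist y p < r" using True by (simp add: dist_commute)
 ultimately have "max 0 (r^2 - (dist y p)^2) <= 2 * r * norm (y - q)"
  using assms by (auto intro!: mult_mono)
 thus ?thesis unfolding bump_def by (rule power_mono) simp
qed (use assms in "simp add: bump_outside")

lemma has_derivative_bump:
 assumes r: "0 < r"
 shows "(bump p r has_derivative bump' p r q) (at q)"
proof (cases "q \<in> ball p r")
 case True
 have "((%q. (r^2 - (q - p) \<bullet> (q - p))^2) has_derivative bump' p r q) (at q)"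
 proof -
  have "r^2 - (q - p) \<bullet> (q - p) \<ge> 0"
   using True r by (auto simp: dist_norm norm_minus_commute power_mono simp flip: power2_norm_eq_inner)
  hence "bump' p r q = (%v. 2 * (r^2 - (q - p) \<bullet> (q - p)) * (- ((q - p) \<bullet> v + v \<bullet> (q - p))))"
   by (auto simp: bump'_def fun_eq_iff dist_norm power2_norm_eq_inner inner_commute; algebra)
  thus ?thesis
   by (auto intro!: derivative_eq_intros simp: fun_eq_iff inner_commute; algebra)
 qed
 thus ?thesis
 proof (rule has_derivative_transform_within_open[where s="ball p r"])
  show "(r^2 - (y - p) \<bullet> (y - p))^2 = bump p r y" if "y \<in> ball p r" for y
   using that r by (auto simp: bump_def dist_norm norm_minus_commute power_mono max_def simp flip: power2_norm_eq_inner)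
 qed (use True in auto)
next
 case False
 have "(bump p r has_derivative (%_. 0)) (at q)"
  by (rule has_derivative_0_quadratic[where C="(2 * r)^2"])
   (use bump_quadratic[OF r False] in "auto simp: power_mult_distrib bump_nonneg abs_of_nonneg intro!: always_eventually")
 moreover have "bump' p r q = (%_. 0)" using bump'_outside[OF r False] by auto
 ultimately show ?thesis by simp
qed


lemma bounded_C1_on_compact:
 fixes F :: "'a::euclidean_space => 'b::real_normed_vector"
 assumes "compact Om"
  and F: "!!q. q \<in> Om ==> (F has_derivative F' q) (at q within Om)"
  and F'c: "!!v. continuous_on Om (%q. F' q v)"
 obtains K where "0 <= K" "!!q. q \<in> Om ==> norm (F q) <= K" "!!q v. q \<in> Om ==> norm (F' q v) <= K * norm v"
proof -
 have cont: "continuous_on Om F"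
  using F by (meson differentiable_def differentiable_imp_continuous_on differentiable_on_def)
 have *: "\<exists>B. \<forall>q\<in>Om. norm (f q) <= B" if "continuous_on Om f" for f :: "'a => 'b"
  using compact_imp_bounded[OF compact_continuous_image[OF that \<open>compact Om\<close>]]
  by (auto simp: bounded_iff)
 obtain B0 B where B0: "!!q. q \<in> Om ==> norm (F q) <= B0"
  and B: "!!v q. q \<in> Om ==> norm (F' q v) <= B v"
 proof -
  have "\<forall>v. \<exists>B. \<forall>q\<in>Om. norm (F' q v) <= B" using * F'c by blast
  then obtain B where "\<forall>v. \<forall>q\<in>Om. norm (F' q v) <= B v" by metis
  moreover obtain B0 where "\<forall>q\<in>Om. norm (F q) <= B0" using * cont by blast
  ultimately show ?thesis using that by blast
 qed
 define K where "K = abs B0 + (\<Sum>b\<in>Basis. \<bar>B b\<bar>)"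
 have "norm (F' q v) <= K * norm v" if "q \<in> Om" for q v
 proof -
  interpret bounded_linear "F' q" using F[OF that] by (rule has_derivative_bounded_linear)
  have "F' q v = F' q (\<Sum>b\<in>Basis. (v \<bullet> b) *\<^sub>R b)" by (simp add: euclidean_representation)
  also have "... = (\<Sum>b\<in>Basis. (v \<bullet> b) *\<^sub>R F' q b)" by (simp add: sum scaleR)
  also have "norm ... <= (\<Sum>b\<in>Basis. norm v * \<bar>B b\<bar>)"
   by (intro order_trans[OF norm_sum] sum_mono)
   (use B[OF that] Basis_le_norm in "auto intro!: mult_mono order_trans[OF B[OF that] abs_ge_self]")
  also have "... <= K * norm v"
   by (simp add: K_def algebra_simps sum_distrib_left)
  finally show ?thesis .
 qed
 moreover have "0 <= K" unfolding K_def by (intro add_nonneg_nonneg sum_nonneg) auto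
 moreover have "norm (F q) <= K" if "q \<in> Om" for q
 proof -
  have "norm (F q) <= abs B0" using B0[OF that] by simp
  moreover have "0 <= (\<Sum>b\<in>(Basis::'a set). \<bar>B b\<bar>)" by (intro sum_nonneg) auto
  ultimately show ?thesis unfolding K_def by linarith
 qed
 ultimately show ?thesis using that by blast
qed

text \<open>No surface integral appears. The localized field is multiplied by
  \<open>h e = rr^2 / (e^2 + rr^2)\<close>, which vanishes to second order on the boundary, so that
  the product extended by 0 is differentiable on the whole space and its divergence integrates to 0.
  As \<open>e\<close> tends to 0 this factor tends to 1 inside. The new term, which contains
  \<open>rr' q (F q)\<close>, has a coefficient of size up to \<open>1 / e\<close>, but tangency
  bounds \<open>rr' q (F q)\<close> by \<open>C * |rr q|\<close>, and this makes the term bounded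
  and its limit 0.\<close>

lemma divergence_bump:
 fixes F :: "'a::euclidean_space => 'a"
 assumes comp: "compact Om" and chart: "boundary_chart Om F p r rr rr' C"
  and F: "!!q. q \<in> Om ==> (F has_derivative F' q) (at q within Om)"
  and F'c: "!!v. continuous_on Om (%q. F' q v)"
 defines "J0 \<equiv> %q. bump p r q * (\<Sum>b\<in>Basis. F' q b \<bullet> b) + bump' p r q (F q)"
 shows "integrable lborel (%q. indicator Om q * J0 q)"
  and "(LINT q|lborel. indicator Om q * J0 q) = 0"
proof -
 have r: "0 < r" and C: "0 <= C"
  and rr: "!!q. q \<in> ball p r ==> (rr has_derivative rr' q) (at q)"
  and rr': "!!q v. q \<in> ball p r ==> \<bar>rr' q v\<bar> <= C * norm v"
  and Om_rr: "Om \<inter> ball p r = {q \<in> ball p r. rr q <= 0}"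
  and rr_F: "!!q. q \<in> Om \<inter> ball p r ==> \<bar>rr' q (F q)\<bar> <= C * \<bar>rr q\<bar>"
  and null: "negligible {q \<in> ball p r. rr q = 0}"
  using chart unfolding boundary_chart_def by blast+
 obtain K where K: "0 <= K" "!!q. q \<in> Om ==> norm (F q) <= K" "!!q v. q \<in> Om ==> norm (F' q v) <= K * norm v"
  using bounded_C1_on_compact[OF comp F F'c] by metis
 have contF: "continuous_on Om F"
  using F by (meson differentiable_def differentiable_imp_continuous_on differentiable_on_def)
 have cont_rr: "continuous_on (ball p r) rr"
  using rr by (meson continuous_at_imp_continuous_on has_derivative_continuous)
 have closed: "closed Om" using comp by (rule compact_imp_closed)
 define S where "S = {q \<in> ball p r. rr q < 0}"
 have S_Om: "q \<in> S ==> q \<in> Om \<and> q \<in> ball p r" for q using equalityD2[OF Om_rr] by (auto simp: S_def subset_iff)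
 have openS: "open S"
 proof -
  have "S = ball p r \<inter> rr -` {..<0}" by (auto simp: S_def)
  thus ?thesis using continuous_open_preimage[OF cont_rr] by simp
 qed
 define h where "h e q = (rr q)^2 / (e^2 + (rr q)^2)" for e q
 define dh where "dh e q v = 2 * rr q * e^2 / (e^2 + (rr q)^2)^2 * rr' q v" for e q v
 define g where "g e b q = (if q \<in> Om \<inter> ball p r then h e q * bump p r q * (F q \<bullet> b) else 0)" for e b q
 define g' where "g' e b q v = (if q \<in> S then dh e q v * bump p r q * (F q \<bullet> b)
   + h e q * bump' p r q v * (F q \<bullet> b) + h e q * bump p r q * (F' q v \<bullet> b) else 0)" for e b q v
 have h01: "0 <= h e q" "h e q <= 1" for e q
  by (auto simp: h_def divide_le_eq_1 sum_power2_gt_zero_iff add_nonneg_eq_0_iff)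
 have pos: "e^2 + (rr q)^2 > 0" if "e > 0" for e q
  using that by (simp add: pos_add_strict add_pos_nonneg)
 have Fb: "\<bar>F q \<bullet> b\<bar> <= K" if "q \<in> Om" "b \<in> Basis" for q b
  using K(2)[OF that(1)] Basis_le_norm[OF that(2), of "F q"] by linarith
 have F'b: "\<bar>F' q v \<bullet> b\<bar> <= K * norm v" if "q \<in> Om" "b \<in> Basis" for q v b
  using K(3)[OF that(1), of v] Basis_le_norm[OF that(2), of "F' q v"] by linarith
 have gder: "(g e b has_derivative g' e b q) (at q)" if e: "e > 0" and b: "b \<in> Basis" for e b q
 proof (cases "q \<in> S")
  case True
  have "(F has_derivative F' q) (at q within S)"
   using F[of q] S_Om True by (meson has_derivative_subset subsetI)
  hence [derivative_intros]: "(F has_derivative F' q) (at q)"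
   using at_within_open[OF True openS] by simp
  note [derivative_intros] = rr[of q]
  have q: "q \<in> ball p r" using S_Om True by blast
  have hd: "(h e has_derivative dh e q) (at q)"
   unfolding h_def dh_def
   by (rule has_derivative_eq_rhs[OF has_derivative_divide[OF has_derivative_power[OF rr[OF q], of 2]
   has_derivative_add[OF has_derivative_const has_derivative_power[OF rr[OF q], of 2]]]])
   (use pos[OF e, of q] e in "simp_all add: fun_eq_iff divide_simps", simp_all add: power2_eq_square algebra_simps)
  have "((%q. h e q * bump p r q * (F q \<bullet> b)) has_derivative g' e b q) (at q)"
   by (rule has_derivative_eq_rhs[OF has_derivative_mult[OF has_derivative_mult[OF hd has_derivative_bump[OF r, of p q]]
   has_derivative_inner_left[OF \<open>(F has_derivative F' q) (at q)\<close>]]])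
   (use True in "simp add: fun_eq_iff g'_def algebra_simps")
  thus ?thesis
   by (rule has_derivative_transform_within_open[OF _ openS True]) (use S_Om in "auto simp: g_def")
 next
  case False
  \<comment> \<open>Three reasons for a vanishing derivative off \<open>S\<close>: outside the ball
    the bump is quadratically small, outside the closed set \<open>Om\<close> the field is 0 nearby,
    and on the boundary the factor \<open>h e\<close> is quadratically small.\<close>
  have "(g e b has_derivative (%_. 0)) (at q)"
  proof (cases "q \<in> ball p r")
   case out: False
   show ?thesis
   proof (rule has_derivative_0_quadratic[where C="(2 * r)^2 * K"], intro always_eventually allI)
   fix y
   have "\<bar>h e y * bump p r y * (F y \<bullet> b)\<bar> <= 1 * (2 * r * norm (y - q))^2 * K" if "y \<in> Om"
   unfolding abs_mult by (intro mult_mono)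
   (use h01 Fb[OF that b] bump_quadratic[OF r out] bump_nonneg in auto)
   thus "\<bar>g e b y\<bar> <= (2 * r)^2 * K * (norm (y - q))^2"
   using K(1) by (auto simp: g_def power_mult_distrib algebra_simps)
   qed
  next
   case inb: True
   show ?thesis
   proof (cases "q \<in> Om")
   case out: False
   have "\<forall>\<^sub>F y in nhds q. y \<in> - Om"
   using closed out by (intro eventually_nhds_in_open) auto
   thus ?thesis
   by (intro has_derivative_0_quadratic[where C=0]) (auto elim!: eventually_mono simp: g_def)
   next
   case True
   hence "q \<in> {q \<in> ball p r. rr q <= 0}" using inb Om_rr by blast
   with False have 0: "rr q = 0" by (auto simp: S_def)
   have lip: "\<bar>rr y - rr q\<bar> <= C * norm (y - q)" if "y \<in> ball p r" for y
   proof -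
   have "norm (rr y - rr q) <= C * norm (y - q)"
   proof (rule differentiable_bound[of "ball p r" rr rr'])
   show "(rr has_derivative rr' x) (at x within ball p r)" if "x \<in> ball p r" for x
   using rr[OF that] by (rule has_derivative_at_withinI)
   show "onorm (rr' x) <= C" if "x \<in> ball p r" for x
   using rr'[OF that] C by (intro onorm_le) simp
   qed (use that inb in auto)
   thus ?thesis by simp
   qed
   have "\<forall>\<^sub>F y in nhds q. y \<in> ball p r"
   using inb by (intro eventually_nhds_in_open) auto
   thus ?thesis
   proof (intro has_derivative_0_quadratic[where C="C^2 / e^2 * r ^ 4 * K"], elim eventually_mono)
   fix y assume y: "y \<in> ball p r"
   have "(rr y)^2 <= (C * norm (y - q))^2"
   using power_mono[OF lip[OF y], of 2] 0 by simp
   moreover have "h e y <= (rr y)^2 / e^2"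
   unfolding h_def using e by (intro divide_left_mono) (auto intro!: mult_pos_pos add_pos_nonneg)
   ultimately have hy: "h e y <= (C * norm (y - q))^2 / e^2"
   by (smt (verit) divide_right_mono zero_le_power2)
   have "\<bar>h e y * bump p r y * (F y \<bullet> b)\<bar> <= ((C * norm (y - q))^2 / e^2) * r ^ 4 * K" if "y \<in> Om"
   unfolding abs_mult by (intro mult_mono)
   (use h01 hy Fb[OF that b] bump_le[OF r, of p] bump_nonneg r in auto)
   thus "\<bar>g e b y\<bar> <= C^2 / e^2 * r ^ 4 * K * (norm (y - q))^2"
   using K(1) C r by (auto simp: g_def power_mult_distrib algebra_simps)
   qed
   qed
  qed
  moreover have "g' e b q = (%_. 0)" using False by (auto simp: g'_def)
  ultimately show ?thesis by simp
 qed
 have g'bound: "\<bar>g' e b q v\<bar> <= (C / e * r ^ 4 * K + 4 * r ^ 3 * K + r ^ 4 * K) * norm v"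
  if e: "e > 0" and b: "b \<in> Basis" for e b q v
 proof (cases "q \<in> S")
  case True
  hence q: "q \<in> Om" "q \<in> ball p r" using S_Om by auto
  have 1: "2 * \<bar>rr q\<bar> * e^2 / (e^2 + (rr q)^2)^2 <= 1 / e"
  proof -
   have "2 * \<bar>rr q\<bar> * e <= e^2 + (rr q)^2"
   using zero_le_power2[of "\<bar>rr q\<bar> - e"] by (simp add: power2_eq_square algebra_simps)
   moreover have "e^2 <= e^2 + (rr q)^2" by simp
   ultimately have "(2 * \<bar>rr q\<bar> * e) * e^2 <= (e^2 + (rr q)^2) * (e^2 + (rr q)^2)"
   using e by (intro mult_mono) auto
   thus ?thesis using e pos[OF e, of q]
   by (simp add: divide_simps power2_eq_square mult.assoc mult.left_commute)
  qed
  have "\<bar>dh e q v\<bar> <= 1 / e * (C * norm v)"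
   unfolding dh_def abs_mult by (rule mult_mono) (use 1 rr'[OF q(2)] e in "auto simp: abs_mult")
  hence a1: "\<bar>dh e q v * bump p r q * (F q \<bullet> b)\<bar> <= (1 / e * (C * norm v)) * r ^ 4 * K"
   unfolding abs_mult by (intro mult_mono) (use Fb[OF q(1) b] bump_le[OF r, of p] bump_nonneg r e C in auto)
  have a2: "\<bar>h e q * bump' p r q v * (F q \<bullet> b)\<bar> <= 1 * (4 * r ^ 3 * norm v) * K"
   unfolding abs_mult by (intro mult_mono) (use Fb[OF q(1) b] bump'_le[OF r] h01 r e C in auto)
  have a3: "\<bar>h e q * bump p r q * (F' q v \<bullet> b)\<bar> <= 1 * r ^ 4 * (K * norm v)"
   unfolding abs_mult by (intro mult_mono) (use F'b[OF q(1) b] bump_le[OF r, of p] bump_nonneg h01 r e C in auto)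
  show ?thesis using True a1 a2 a3 by (simp add: g'_def algebra_simps)
 qed (use that K(1) C r in "simp add: g'_def")
 have gsupp: "g e b q = 0" if "q \<notin> cball 0 (norm p + r)" for e b q
 proof -
  have "q \<notin> ball p r"
   using that norm_triangle_sub[of q p] by (auto simp: dist_norm norm_minus_commute)
  thus ?thesis by (simp add: g_def)
 qed
 note A = integral_directional_derivative_eq_0[OF gder g'bound gsupp]
 define J where "J e q = (\<Sum>b\<in>Basis. g' e b q b)" for e q
 have Jm: "J e \<in> borel_measurable borel" if "e > 0" for e
  unfolding J_def using A(1)[OF that _ that] by (intro borel_measurable_sum) auto
 have J0: "(LINT q|lborel. J e q) = 0" if "e > 0" for e
  unfolding J_def using A(2,3)[OF that _ that] by (subst LINT_sum) auto
 have Jeq: "J e q = (if q \<in> S then dh e q (F q) * bump p r q + h e q * J0 q else 0)" for e q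
 proof (cases "q \<in> S")
  case True
  hence q: "q \<in> ball p r" using S_Om by auto
  have lin: "(\<Sum>b\<in>Basis. f b * (F q \<bullet> b)) = f (F q)" if "linear f" for f :: "'a => real"
  proof -
   have "f (F q) = f (\<Sum>b\<in>Basis. (F q \<bullet> b) *\<^sub>R b)" by (simp add: euclidean_representation)
   thus ?thesis using that by (simp add: linear_sum linear_scale mult.commute)
  qed
  have 1: "linear (rr' q)" "linear (bump' p r q)"
   using rr[OF q] has_derivative_bump[OF r] by (auto intro: has_derivative_linear)
  have "J e q = 2 * rr q * e^2 / (e^2 + (rr q)^2)^2 * bump p r q * (\<Sum>b\<in>Basis. rr' q b * (F q \<bullet> b))
   + h e q * (\<Sum>b\<in>Basis. bump' p r q b * (F q \<bullet> b))
   + h e q * bump p r q * (\<Sum>b\<in>Basis. F' q b \<bullet> b)"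
   using True unfolding J_def g'_def dh_def
   by (simp add: sum.distrib sum_distrib_left) (simp add: mult_ac)
  thus ?thesis using True unfolding lin[OF 1(1)] lin[OF 1(2)] by (simp add: J0_def dh_def algebra_simps)
 qed (simp add: J_def g'_def)
 have div: "\<bar>\<Sum>b\<in>Basis. F' q b \<bullet> b\<bar> <= real DIM('a) * K" if "q \<in> Om" for q
 proof (rule order_trans[OF sum_abs], rule sum_bounded_above)
  show "\<bar>F' q b \<bullet> b\<bar> <= K" if "b \<in> Basis" for b
   using F'b[OF \<open>q \<in> Om\<close> that, of b] that by simp
 qed
 define W where "W = C * r ^ 4 + (r ^ 4 * (real DIM('a) * K) + 4 * r ^ 3 * K)"
 have J0b: "\<bar>J0 q\<bar> <= r ^ 4 * (real DIM('a) * K) + 4 * r ^ 3 * K" if "q \<in> Om" for q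
 proof -
  have "\<bar>bump p r q * (\<Sum>b\<in>Basis. F' q b \<bullet> b)\<bar> <= r ^ 4 * (real DIM('a) * K)"
   unfolding abs_mult by (intro mult_mono) (use div[OF that] bump_le[OF r, of p] bump_nonneg r in auto)
  moreover have "\<bar>bump' p r q (F q)\<bar> <= 4 * r ^ 3 * K"
   using K(2)[OF that] r by (intro order_trans[OF bump'_le[OF r]] mult_left_mono) auto
  ultimately show ?thesis unfolding J0_def by linarith
 qed
 have Jb: "\<bar>J e q\<bar> <= W * indicator (cball p r) q" if e: "e > 0" for e q
 proof (cases "q \<in> S")
  case True
  hence q: "q \<in> Om" "q \<in> ball p r" using S_Om by auto
  have "\<bar>dh e q (F q)\<bar> <= (2 * \<bar>rr q\<bar> * e^2 / (e^2 + (rr q)^2)^2) * (C * \<bar>rr q\<bar>)"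
   unfolding dh_def abs_mult by (rule mult_mono) (use rr_F q in "auto simp: abs_mult")
  also have "... = C * (2 * e^2 * (rr q)^2 / (e^2 + (rr q)^2)^2)"
   by (simp add: power2_eq_square mult_ac)
  also have "... <= C * 1"
  proof (rule mult_left_mono[OF _ C])
   have "2 * e^2 * (rr q)^2 <= (e^2 + (rr q)^2)^2"
   using zero_le_power2[of "e^2"] zero_le_power2[of "(rr q)^2"]
   by (simp add: power2_sum)
   thus "2 * e^2 * (rr q)^2 / (e^2 + (rr q)^2)^2 <= 1"
   using pos[OF e, of q] by (simp add: divide_le_eq_1)
  qed
  finally have a1: "\<bar>dh e q (F q) * bump p r q\<bar> <= C * r ^ 4"
   unfolding abs_mult by (intro mult_mono) (use bump_le[OF r, of p] bump_nonneg C in auto)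
  have a2: "\<bar>h e q * J0 q\<bar> <= 1 * (r ^ 4 * (real DIM('a) * K) + 4 * r ^ 3 * K)"
   unfolding abs_mult by (intro mult_mono) (use J0b[OF q(1)] h01 in auto)
  show ?thesis using a1 a2 True q by (auto simp: Jeq W_def)
 qed (use C r K(1) in "auto simp: Jeq W_def indicator_def")
 \<comment> \<open>Off \<open>S\<close> every \<open>J e\<close> vanishes, so the limit lives on
   \<open>S\<close>. The zero set of \<open>rr\<close> is part of \<open>Om\<close> but not of
   \<open>S\<close>; it is a null set by the definition of a chart.\<close>
 have Jlim: "(%n. J (1 / real (Suc n)) q) ----> indicator S q * J0 q" for q
 proof (cases "q \<in> S")
  case True
  hence ne: "rr q \<noteq> 0" by (auto simp: S_def)
  have e: "(%n. 1 / real (Suc n)) ----> 0" by (rule LIMSEQ_inverse_real_of_nat[unfolded inverse_eq_divide])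
  have "(%n. dh (1 / real (Suc n)) q (F q) * bump p r q + h (1 / real (Suc n)) q * J0 q)
   ----> (2 * rr q * 0^2 / (0^2 + (rr q)^2)^2 * rr' q (F q)) * bump p r q + (rr q)^2 / (0^2 + (rr q)^2) * J0 q"
   unfolding dh_def h_def by (intro tendsto_intros e) (use ne in auto)
  thus ?thesis using True ne by (simp add: Jeq)
 qed (simp add: Jeq)
 have contJ0: "continuous_on Om J0"
  unfolding J0_def bump_def bump'_def by (intro continuous_intros contF F'c)
 have meas: "(%q. indicator Om q * J0 q) \<in> borel_measurable borel"
  using borel_measurable_continuous_on_indicator[OF _ contJ0] closed by simp
 have Sset: "S \<in> sets borel" using openS by simp
 have "{q \<in> ball p r. rr q = 0} = {q \<in> ball p r. rr q <= 0} - S" by (auto simp: S_def)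
 hence "{q \<in> ball p r. rr q = 0} = Om \<inter> ball p r - S" by (simp only: Om_rr)
 hence "{q \<in> ball p r. rr q = 0} \<in> null_sets lborel"
  using null Sset closed by (simp add: negligible_iff_null_sets null_sets_completion_iff)
 hence "AE q in lborel. q \<notin> {q \<in> ball p r. rr q = 0}" by (rule AE_not_in)
 hence ae: "AE q in lborel. indicator S q * J0 q = indicator Om q * J0 q"
 proof eventually_elim
  case (elim q)
  show ?case
  proof (cases "q \<in> ball p r")
   case True
   hence "q \<in> S \<longleftrightarrow> q \<in> Om" using elim Om_rr by (force simp: S_def)
   thus ?thesis by (simp add: indicator_def)
  next
   case False
   thus ?thesis by (simp add: J0_def bump_outside[OF r] bump'_outside[OF r])
  qed
 qed
 have wint: "integrable lborel (%q. W * indicator (cball p r) q :: real)"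
  by (intro integrable_mult_right integrable_real_indicator)
   (auto intro!: emeasure_bounded_finite simp: infinity_ennreal_def[symmetric] simp del: infinity_ennreal_def)
 have ae': "AE q in lborel. (%n. J (1 / real (Suc n)) q) ----> indicator Om q * J0 q"
  using ae by eventually_elim (use Jlim in "metis (no_types, lifting)")
 have "(%n. LINT q|lborel. J (1 / real (Suc n)) q) ----> (LINT q|lborel. indicator Om q * J0 q)"
  by (rule integral_dominated_convergence[OF _ _ wint ae']) (use meas Jm Jb in auto)
 thus "(LINT q|lborel. indicator Om q * J0 q) = 0"
  by (simp add: J0 LIMSEQ_const_iff)
 show "integrable lborel (%q. indicator Om q * J0 q)"
  by (rule integrable_dominated_convergence[OF _ _ wint ae']) (use meas Jm Jb in auto)
qed

text \<open>The translates by \<open>v / (n + 1)\<close> are pairwise disjoint, have equal measure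
  and lie in one ball, which leaves room only for measure 0.\<close>

lemma negligible_if_disjoint_translates:
 fixes Z :: "'a::euclidean_space set"
 assumes "bounded Z" "Z \<in> sets borel"
  and disj: "!!q s. q \<in> Z ==> 0 < s ==> q + s *\<^sub>R v \<notin> Z"
 shows "negligible Z"
proof -
 define T where "T n = (+) ((1 / real (Suc n)) *\<^sub>R v) ` Z" for n :: nat
 have Zm: "Z \<in> lmeasurable"
  using assms by (intro bounded_set_imp_lmeasurable) auto
 have Tm: "T n \<in> lmeasurable" "measure lebesgue (T n) = measure lebesgue Z" for n
  unfolding T_def using Zm by (auto simp: measure_translation intro: measurable_translation)
 have "1 / real (Suc m) \<noteq> 1 / real (Suc n)" if "m \<noteq> n" for m n using that by simp
 have dT: "T m \<inter> T n = {}" if "m < n" for m n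
 proof (rule ccontr)
  assume "T m \<inter> T n \<noteq> {}"
  then obtain x y where xy: "x \<in> Z" "y \<in> Z"
   and "(1 / real (Suc m)) *\<^sub>R v + x = (1 / real (Suc n)) *\<^sub>R v + y"
   unfolding T_def by blast
  hence "y = x + (1 / real (Suc m) - 1 / real (Suc n)) *\<^sub>R v"
   by (simp add: algebra_simps)
  moreover have "1 / real (Suc m) - 1 / real (Suc n) > 0"
   using that by (simp add: divide_strict_left_mono)
  ultimately show False using disj[OF xy(1)] xy(2) by blast
 qed
 have dis: "disjoint_family_on T {..<N}" for N
  using dT by (auto simp: disjoint_family_on_def) (metis IntI empty_iff nat_neq_iff)
 obtain B where B: "!!x. x \<in> Z ==> norm x <= B"
  using \<open>bounded Z\<close> by (auto simp: bounded_iff)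
 let ?C = "cball (0::'a) (norm v + B)"
 have sub: "T n \<subseteq> ?C" for n
 proof
  fix y assume "y \<in> T n"
  then obtain x where x: "x \<in> Z" "y = (1 / real (Suc n)) *\<^sub>R v + x" unfolding T_def by blast
  have "norm ((1 / real (Suc n)) *\<^sub>R v) <= norm v"
   by (simp add: divide_le_eq mult_le_cancel_left1)
  thus "y \<in> ?C" using norm_triangle_ineq[of "(1 / real (Suc n)) *\<^sub>R v" x] B[OF x(1)] x(2) by simp
 qed
 have "real N * measure lebesgue Z <= measure lebesgue ?C" for N
 proof -
  have "real N * measure lebesgue Z = (\<Sum>n<N. measure lebesgue (T n))" by (simp add: Tm)
  also have "... = measure lebesgue (\<Union>n<N. T n)"
   using Tm(1) by (intro measure_finite_Union[symmetric] dis) (auto dest: fmeasurableD simp: fmeasurableD2[simplified] simp del: emeasure_completion)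
  also have "... <= measure lebesgue ?C"
   by (rule measure_mono_fmeasurable) (use sub Tm(1) in "auto intro!: sets.finite_UN simp: fmeasurableD")
  finally show ?thesis .
 qed
 hence "measure lebesgue Z <= 0"
  by (meson linorder_not_le reals_Archimedean3)
 thus ?thesis using Zm by (simp add: negligible_iff_measure measure_nonneg antisym)
qed

text \<open>Lets a chart made for \<open>F\<close> serve the field divided by a sum of bumps, a sum
  that is known only after the charts have been used to choose a finite cover.\<close>

lemma boundary_chart_scale:
 assumes "boundary_chart Om F p r rr rr' C" and s: "!!q. q \<in> Om ==> \<bar>s q\<bar> <= B"
 shows "boundary_chart Om (%q. s q *\<^sub>R F q) p r rr rr' (C * max 1 B)"
proof -
 have C: "0 <= C" and *: "!!q. q \<in> ball p r ==> linear (rr' q)"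
  using assms(1) by (auto simp: boundary_chart_def intro: has_derivative_linear)
 have "\<bar>rr' q (s q *\<^sub>R F q)\<bar> <= C * max 1 B * \<bar>rr q\<bar>" if "q \<in> Om" "q \<in> ball p r" for q
 proof -
  have "\<bar>rr' q (s q *\<^sub>R F q)\<bar> = \<bar>s q\<bar> * \<bar>rr' q (F q)\<bar>"
   using *[OF that(2)] by (simp add: linear_scale abs_mult)
  also have "... <= max 1 B * (C * \<bar>rr q\<bar>)"
   using assms(1) that s[OF that(1)] by (intro mult_mono) (auto simp: boundary_chart_def)
  finally show ?thesis by (simp add: mult_ac)
 qed
 moreover have "C <= C * max 1 B" using C by (simp add: mult_le_cancel_left1)
 hence "\<bar>rr' q v\<bar> <= C * max 1 B * norm v" if "q \<in> ball p r" for q v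
  using assms(1) that unfolding boundary_chart_def
  by (meson mult_right_mono norm_ge_zero order_trans)
 moreover have "0 <= C * max 1 B" using C by simp
 ultimately show ?thesis using assms(1) unfolding boundary_chart_def by blast
qed

text \<open>The point is the bound of \<open>rr' q (F q)\<close> by \<open>|rr q|\<close>. This
  function is C1 and vanishes on the boundary, where the gradient of \<open>rr\<close> is normal.
  From a point of \<open>Om\<close> one reaches the boundary along a fixed transversal direction
  \<open>v0\<close> after a distance proportional to \<open>|rr q|\<close>, and the mean value
  inequality on that segment gives the bound. Derivatives of \<open>F\<close> exist only within
  \<open>Om\<close>, hence the care that the whole segment stays there.\<close>

lemma boundary_chart_exists:
 fixes F :: "'a::euclidean_space => 'a"
 assumes comp: "compact Om" and smooth: "smooth_boundary Om"
  and F: "!!q. q \<in> Om ==> (F has_derivative F' q) (at q within Om)"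
  and F'c: "!!v. continuous_on Om (%q. F' q v)"
  and tang: "!!q n. q \<in> frontier Om ==> outward_normal Om q n ==> n \<bullet> F q = 0"
  and p: "p \<in> Om"
 shows "\<exists>r rr rr' C. boundary_chart Om F p r rr rr' C"
proof (cases "p \<in> interior Om")
 case True
 then obtain r where "r > 0" "ball p r \<subseteq> Om" by (meson mem_interior)
 hence "boundary_chart Om F p r (%_. -1) (%_ _. 0) 0"
  by (auto simp: boundary_chart_def)
 thus ?thesis by blast
next
 case False
 have closed: "closed Om" using comp by (rule compact_imp_closed)
 with False p have "p \<in> frontier Om" by (simp add: frontier_def)
 then obtain U rr where ldf: "local_defining_function Om p U rr"
  using smooth unfolding smooth_boundary_def by blast
 hence U: "open U" "p \<in> U" and sm: "smooth_on U rr" and Om_U: "Om \<inter> U = {q \<in> U. rr q <= 0}"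
  and nz: "\<exists>v. ddir U v rr p \<noteq> 0"
  unfolding local_defining_function_def by auto
 have Om_U': "q \<in> Om \<longleftrightarrow> rr q <= 0" if "q \<in> U" for q using Om_U that by blast
 define rr' where "rr' q v = ddir U v rr q" for q v
 define D2 where "D2 b q v = ddir U v (ddir U b rr) q" for b q v
 have "Ck_on (Suc (Suc 0)) U rr" using sm unfolding smooth_on_def by blast
 hence d1: "rr differentiable_on U" and d2: "!!b. ddir U b rr differentiable_on U"
  and cD2: "!!b v. continuous_on U (%q. D2 b q v)"
  by (auto simp: D2_def[abs_def])
 have frechet: "(f has_derivative (%v. ddir U v f q)) (at q)" if "f differentiable_on U" "q \<in> U" for f :: "'a => real" and q
  using that U(1) unfolding ddir_def differentiable_on_def
  by (metis at_within_open frechet_derivative_works eta_contract_eq)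
 have rr: "(rr has_derivative rr' q) (at q)" if "q \<in> U" for q
  using frechet[OF d1 that] by (simp add: rr'_def[abs_def])
 have d_rr': "((%q. rr' q b) has_derivative D2 b q) (at q)" if "q \<in> U" for q b
  using frechet[OF d2 that, of b] by (simp add: rr'_def D2_def[abs_def])
 have c_rr': "continuous_on U (%q. rr' q v)" for v
  using d2[of v] by (simp add: rr'_def differentiable_imp_continuous_on)
 have c_rr: "continuous_on U rr" using d1 by (rule differentiable_imp_continuous_on)
 obtain v0 where v0: "rr' p v0 > 0"
 proof -
  obtain v where v: "rr' p v \<noteq> 0" using nz by (auto simp: rr'_def)
  have "rr' p (- v) = - rr' p v"
   using has_derivative_linear[OF rr[OF U(2)]] by (simp add: linear_neg)
  thus ?thesis using v that[of v] that[of "- v"] by linarith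
 qed
 hence v0n: "v0 \<noteq> 0"
  using has_derivative_linear[OF rr[OF U(2)]] linear_0 by force
 define c where "c = rr' p v0 / 2"
 have c: "c > 0" using v0 by (simp add: c_def)
 obtain r0 where r0: "r0 > 0" "cball p r0 \<subseteq> U" "!!q. q \<in> cball p r0 ==> c <= rr' q v0"
 proof -
  have "open (U \<inter> (%q. rr' q v0) -` {c<..})"
   using continuous_open_preimage[OF c_rr' U(1) open_greaterThan] .
  moreover have "p \<in> U \<inter> (%q. rr' q v0) -` {c<..}" using U(2) v0 by (simp add: c_def)
  ultimately obtain e where "e > 0" "cball p e \<subseteq> U \<inter> (%q. rr' q v0) -` {c<..}"
   by (meson open_contains_cball)
  thus ?thesis using that[of e] by (auto simp: subset_iff intro: less_imp_le)
 qed
 have rr_p: "rr p = 0"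
 proof (rule ccontr)
  assume "rr p \<noteq> 0"
  with p Om_U'[OF U(2)] have "rr p < 0" by simp
  hence "p \<in> U \<inter> rr -` {..<0}" using U by simp
  moreover have "open (U \<inter> rr -` {..<0})" by (rule continuous_open_preimage[OF c_rr U(1) open_lessThan])
  moreover have "U \<inter> rr -` {..<0} \<subseteq> Om" using Om_U' by auto
  ultimately show False using False by (meson interiorI)
 qed
 obtain K where K: "0 <= K" "!!q. q \<in> cball p r0 ==> \<bar>rr q\<bar> <= K"
   "!!q v. q \<in> cball p r0 ==> \<bar>rr' q v\<bar> <= K * norm v"
 proof (rule bounded_C1_on_compact[of "cball p r0" rr rr'])
  show "(rr has_derivative rr' q) (at q within cball p r0)" if "q \<in> cball p r0" for q
   using rr r0(2) that by (meson has_derivative_at_withinI subsetD)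
  show "continuous_on (cball p r0) (%q. rr' q v)" for v
   using c_rr' r0(2) by (rule continuous_on_subset)
 qed (auto intro: that)
 define G where "G q = (\<Sum>b\<in>Basis. rr' q b * (F q \<bullet> b))" for q
 define G' where "G' q v = (\<Sum>b\<in>Basis. rr' q b * (F' q v \<bullet> b) + D2 b q v * (F q \<bullet> b))" for q v
 let ?K1 = "Om \<inter> cball p r0"
 have contF: "continuous_on Om F"
  using F by (meson differentiable_def differentiable_imp_continuous_on differentiable_on_def)
 have dG: "(G has_derivative G' q) (at q within ?K1)" if q: "q \<in> ?K1" for q
 proof -
  have 1: "(F has_derivative F' q) (at q within ?K1)" using F[of q] q by (auto intro: has_derivative_subset)
  have 2: "((%q. rr' q b) has_derivative D2 b q) (at q within ?K1)" for b
   using d_rr'[of q b] q r0(2) by (meson IntE has_derivative_at_withinI subsetD)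
  show ?thesis unfolding G_def[abs_def] G'_def[abs_def]
   by (rule has_derivative_sum, rule has_derivative_mult[OF 2 has_derivative_inner_left[OF 1]])
 qed
 obtain KG where KG: "0 <= KG" "!!q. q \<in> ?K1 ==> norm (G q) <= KG" "!!q v. q \<in> ?K1 ==> norm (G' q v) <= KG * norm v"
 proof (rule bounded_C1_on_compact[of ?K1 G G'])
  show "compact ?K1" using comp by (simp add: compact_Int)
  show "continuous_on ?K1 (%q. G' q v)" for v
   unfolding G'_def
   by (intro continuous_intros continuous_on_subset[OF c_rr'] continuous_on_subset[OF F'c]
   continuous_on_subset[OF cD2] continuous_on_subset[OF contF]) (use r0(2) in auto)
 qed (auto intro: that dG)
 have G_rr: "G q = rr' q (F q)" if "q \<in> U" for q
 proof -
  have "rr' q (F q) = rr' q (\<Sum>b\<in>Basis. (F q \<bullet> b) *\<^sub>R b)" by (simp add: euclidean_representation)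
  thus ?thesis using has_derivative_linear[OF rr[OF that]]
   by (simp add: G_def linear_sum linear_scale mult.commute)
 qed
 \<comment> \<open>A segment that starts in the small ball has length at most
   \<open>|rr q| / c * norm v0\<close>; the bound on \<open>|rr|\<close> keeps this below
   \<open>r0 / 2\<close>, so that the segment stays in \<open>cball p r0\<close>.\<close>
 obtain r where r: "r > 0" "r <= r0 / 2" "!!q. q \<in> ball p r ==> \<bar>rr q\<bar> <= c * r0 / (2 * norm v0)"
 proof -
  let ?e = "c * r0 / (2 * norm v0)"
  have "?e > 0" using c r0(1) v0n by simp
  moreover have "isCont rr p" using rr[OF U(2)] by (rule has_derivative_continuous)
  ultimately obtain d where d: "d > 0" "!!q. dist q p < d ==> dist (rr q) (rr p) < ?e"
   unfolding continuous_at_eps_delta by blast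
  show ?thesis
   by (rule that[of "min d (r0 / 2)"]) (use d r0(1) rr_p in "auto simp: dist_commute less_imp_le")
 qed
 have ballU: "ball p r \<subseteq> U" using r(2) r0 by (auto simp: subset_iff)
 have line: "((%s. rr (q + s *\<^sub>R v0)) has_real_derivative rr' (q + s *\<^sub>R v0) v0) (at s)" if "q + s *\<^sub>R v0 \<in> U" for q s
 proof -
  have "((%s. rr (q + s *\<^sub>R v0)) has_derivative (%t. rr' (q + s *\<^sub>R v0) (t *\<^sub>R v0))) (at s)"
   by (rule has_derivative_compose[where f="%s. q + s *\<^sub>R v0" and g=rr, OF _ rr[OF that]])
   (auto intro!: derivative_eq_intros)
  moreover have "rr' (q + s *\<^sub>R v0) (t *\<^sub>R v0) = rr' (q + s *\<^sub>R v0) v0 * t" for t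
   using has_derivative_linear[OF rr[OF that]] by (simp add: linear_scale)
  ultimately show ?thesis by (simp add: has_field_derivative_def)
 qed
 have incr: "rr (q + s *\<^sub>R v0) <= rr (q + t *\<^sub>R v0) - c * (t - s)"
  if st: "s <= t" and in0: "!!x. s <= x ==> x <= t ==> q + x *\<^sub>R v0 \<in> cball p r0" for q s t
 proof -
  have "rr (q + s *\<^sub>R v0) - c * s <= rr (q + t *\<^sub>R v0) - c * t"
  proof (rule DERIV_nonneg_imp_nondecreasing[OF st])
   fix x assume x: "s <= x" "x <= t"
   have "((%s. rr (q + s *\<^sub>R v0) - c * s) has_real_derivative rr' (q + x *\<^sub>R v0) v0 - c) (at x)"
   using in0[OF x] r0(2) by (auto intro!: derivative_eq_intros line)
   thus "\<exists>y. ((%s. rr (q + s *\<^sub>R v0) - c * s) has_real_derivative y) (at x) \<and> 0 <= y"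
   using r0(3)[OF in0[OF x]] by (intro exI[of _ "rr' (q + x *\<^sub>R v0) v0 - c"]) auto
  qed
  thus ?thesis by (simp add: algebra_simps)
 qed
 \<comment> \<open>\<open>rr\<close> increases strictly along \<open>v0\<close>, so points just
   beyond \<open>q\<close> are outside \<open>Om\<close> and \<open>q\<close> lies on the frontier.
   The same \<open>rr\<close> is a local defining function at \<open>q\<close>, and its normalized
   gradient is an outward normal there.\<close>
 have G0: "G q = 0" if q: "q \<in> cball p r0" "rr q = 0" for q
 proof -
  have qU: "q \<in> U" using q r0(2) by blast
  have "q \<in> frontier Om"
  proof -
   have "q \<notin> interior Om"
   proof
   assume "q \<in> interior Om"
   hence "q \<in> U \<inter> interior Om" "open (U \<inter> interior Om)" using qU U(1) by auto
   then obtain e where e: "e > 0" "ball q e \<subseteq> U \<inter> interior Om" by (meson open_contains_ball)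
   have "((%s. rr (q + s *\<^sub>R v0)) has_real_derivative rr' q v0) (at 0)" using line[of q 0] qU by simp
   moreover have "0 < rr' q v0" using r0(3)[OF q(1)] c by linarith
   ultimately obtain d where d: "d > 0" "!!h. 0 < h ==> h < d ==> rr (q + 0 *\<^sub>R v0) < rr (q + (0 + h) *\<^sub>R v0)"
   using DERIV_pos_inc_right by blast
   define s where "s = min (d / 2) (e / (2 * norm v0))"
   have s: "0 < s" "s < d" using d(1) e(1) v0n by (auto simp: s_def min_less_iff_disj)
   have "s * norm v0 <= e / (2 * norm v0) * norm v0"
   by (intro mult_right_mono) (auto simp: s_def)
   hence "s * norm v0 < e" using v0n e(1) by simp
   hence "q + s *\<^sub>R v0 \<in> ball q e" using s by (simp add: dist_norm)
   hence "q + s *\<^sub>R v0 \<in> U" "q + s *\<^sub>R v0 \<in> Om" using e(2) interior_subset by blast+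
   thus False using d(2)[OF s] q(2) Om_U' by fastforce
   qed
   thus ?thesis using Om_U'[OF qU] q(2) by (simp add: frontier_def closure_subset[THEN subsetD])
  qed
  define g where "g = (\<Sum>b\<in>Basis. rr' q b *\<^sub>R b)"
  have g: "rr' q v = g \<bullet> v" for v
  proof -
   have "rr' q v = rr' q (\<Sum>b\<in>Basis. (v \<bullet> b) *\<^sub>R b)" by (simp add: euclidean_representation)
   thus ?thesis using has_derivative_linear[OF rr[OF qU]]
   by (simp add: g_def linear_sum linear_scale inner_sum_left) (simp add: inner_commute mult.commute)
  qed
  have pos: "rr' q v0 > 0" using r0(3)[OF q(1)] c by linarith
  hence gn: "norm g > 0" using g by force
  have "local_defining_function Om q U rr"
   unfolding local_defining_function_def
   by (intro conjI exI[of _ v0] U(1) qU sm Om_U) (use pos in "simp add: rr'_def")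
  hence "outward_normal Om q ((1 / norm g) *\<^sub>R g)"
   unfolding outward_normal_def using gn g
   by (auto intro!: exI[of _ U] exI[of _ rr] exI[of _ "norm g"] simp: rr'_def[symmetric])
  with tang[OF \<open>q \<in> frontier Om\<close>] have "((1 / norm g) *\<^sub>R g) \<bullet> F q = 0" by blast
  thus ?thesis using gn g G_rr[OF qU] by auto
 qed
 \<comment> \<open>\<open>K\<close> bounds the gradient of \<open>rr\<close>;
   \<open>KG * norm v0 / c\<close> is the Lipschitz constant of \<open>G\<close> times the length of
   the segment per unit of \<open>|rr|\<close>.\<close>
 define C where "C = max K (KG * norm v0 / c)"
 have Gb: "\<bar>G q\<bar> <= C * \<bar>rr q\<bar>" if q: "q \<in> Om" "q \<in> ball p r" for q
 proof -
  define s1 where "s1 = \<bar>rr q\<bar> / c"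
  have s1: "s1 \<ge> 0" "s1 * norm v0 <= r0 / 2"
  proof -
   show "s1 \<ge> 0" using c by (simp add: s1_def)
   have "s1 * norm v0 <= (c * r0 / (2 * norm v0)) / c * norm v0"
   unfolding s1_def using r(3)[OF q(2)] c by (intro mult_right_mono divide_right_mono) auto
   thus "s1 * norm v0 <= r0 / 2" using c v0n by simp
  qed
  have inb: "q + x *\<^sub>R v0 \<in> cball p r0" if "0 <= x" "x <= s1" for x
  proof -
   have "dist p (q + x *\<^sub>R v0) <= dist p q + norm (x *\<^sub>R v0)"
   by (metis dist_triangle dist_norm add_diff_cancel_left' dist_commute)
   also have "norm (x *\<^sub>R v0) <= s1 * norm v0" using that by (simp add: mult_right_mono)
   finally show ?thesis using s1(2) q(2) r(2) by simp
  qed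
  have neg: "rr q <= 0" using q Om_U' ballU by blast
  have "rr (q + 0 *\<^sub>R v0) <= rr (q + s1 *\<^sub>R v0) - c * (s1 - 0)" by (rule incr) (use s1 inb in auto)
  hence "0 <= rr (q + s1 *\<^sub>R v0)" using neg c by (simp add: s1_def)
  moreover have "continuous_on {0..s1} (%s. rr (q + s *\<^sub>R v0))"
   by (intro continuous_at_imp_continuous_on ballI DERIV_isCont[OF line]) (use inb r0(2) in auto)
  ultimately obtain s where s: "0 <= s" "s <= s1" "rr (q + s *\<^sub>R v0) = 0"
   using IVT'[of "%s. rr (q + s *\<^sub>R v0)" 0 0 s1] neg s1(1) by auto
  let ?S = "closed_segment q (q + s *\<^sub>R v0)"
  have seg: "?S \<subseteq> ?K1"
  proof
   fix y assume "y \<in> ?S"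
   then obtain u where u: "0 <= u" "u <= 1" "y = q + (u * s) *\<^sub>R v0"
   by (auto simp: in_segment algebra_simps)
   have us: "0 <= u * s" "u * s <= s" using u s by (auto simp: mult_left_le_one_le)
   have "rr y <= rr (q + s *\<^sub>R v0) - c * (s - u * s)"
   unfolding u(3) using us s inb by (intro incr) auto
   hence "rr y <= 0" using s(3) us c by (smt (verit) mult_nonneg_nonneg)
   moreover have "y \<in> cball p r0" unfolding u(3) using us s by (intro inb) auto
   ultimately show "y \<in> ?K1" using Om_U' r0(2) by blast
  qed
  have "norm (G q - G (q + s *\<^sub>R v0)) <= KG * norm (q - (q + s *\<^sub>R v0))"
  proof (rule differentiable_bound[of ?S G G'])
   show "(G has_derivative G' x) (at x within ?S)" if "x \<in> ?S" for x
   using dG seg that by (meson has_derivative_subset subsetD)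
   show "onorm (G' x) <= KG" if "x \<in> ?S" for x
   using KG seg that by (intro onorm_le) blast
  qed auto
  moreover have "G (q + s *\<^sub>R v0) = 0" using s inb by (intro G0) auto
  ultimately have "\<bar>G q\<bar> <= KG * (s * norm v0)" using s(1) by simp
  also have "... <= KG * (s1 * norm v0)" using s KG(1) by (intro mult_left_mono mult_right_mono) auto
  also have "... = KG * norm v0 / c * \<bar>rr q\<bar>" by (simp add: s1_def)
  also have "... <= C * \<bar>rr q\<bar>" by (intro mult_right_mono) (auto simp: C_def)
  finally show ?thesis .
 qed
 \<comment> \<open>In the convex ball \<open>rr\<close> grows strictly along \<open>v0\<close>, so
   the zero set never meets its forward translates.\<close>
 have "negligible {q \<in> ball p r. rr q = 0}"
 proof (rule negligible_if_disjoint_translates[where v=v0])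
  show "bounded {q \<in> ball p r. rr q = 0}" using bounded_ball by (rule bounded_subset) auto
  have "{q \<in> ball p r. rr q = 0} = (ball p r \<inter> rr -` {..0}) \<inter> (ball p r - ball p r \<inter> rr -` {..<0})" by auto
  moreover have "ball p r \<inter> rr -` {..<0} \<in> sets borel"
   using continuous_open_preimage[OF continuous_on_subset[OF c_rr ballU] open_ball open_lessThan] by simp
  moreover have "ball p r \<inter> rr -` {..0} = ball p r \<inter> Om" using Om_U' ballU by auto
  ultimately show "{q \<in> ball p r. rr q = 0} \<in> sets borel" using closed by simp
  fix q s assume q: "q \<in> {q \<in> ball p r. rr q = 0}" and s: "0 < (s::real)"
  show "q + s *\<^sub>R v0 \<notin> {q \<in> ball p r. rr q = 0}"
  proof
   assume q': "q + s *\<^sub>R v0 \<in> {q \<in> ball p r. rr q = 0}"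
   have "rr (q + 0 *\<^sub>R v0) <= rr (q + s *\<^sub>R v0) - c * (s - 0)"
   proof (rule incr)
   fix x assume x: "0 <= x" "x <= s"
   have "q + x *\<^sub>R v0 = (1 - x / s) *\<^sub>R q + (x / s) *\<^sub>R (q + s *\<^sub>R v0)"
   using s by (simp add: algebra_simps)
   also have "... \<in> ball p r"
   using q q' x s by (intro convexD[OF convex_ball]) auto
   finally show "q + x *\<^sub>R v0 \<in> cball p r0" using r(2) r0(1) by auto
   qed (use s in auto)
   thus False using q q' mult_pos_pos[OF c s] by simp
  qed
 qed
 moreover have "\<bar>rr' q v\<bar> <= C * norm v" if "q \<in> ball p r" for q v
 proof -
  have "\<bar>rr' q v\<bar> <= K * norm v" using K(3) that r(2) r0(1) by auto
  also have "... <= C * norm v" by (intro mult_right_mono) (auto simp: C_def)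
  finally show ?thesis .
 qed
 ultimately have "boundary_chart Om F p r rr rr' C"
  unfolding boundary_chart_def
  using r(1) K(1) rr ballU Gb G_rr Om_U' by (auto simp: C_def subset_iff)
 thus ?thesis by blast
qed


text \<open>A partition of unity in disguise: the localized identities for \<open>F / B\<close>,
  with \<open>B\<close> the sum of the bumps of a finite cover, add up to the divergence of
  \<open>B * (F / B)\<close>.\<close>

theorem divergence_tangential:
 fixes F :: "'a::euclidean_space => 'a"
 assumes comp: "compact Om" and smooth: "smooth_boundary Om"
  and F: "!!q. q \<in> Om ==> (F has_derivative F' q) (at q within Om)"
  and F'c: "!!v. continuous_on Om (%q. F' q v)"
  and tang: "!!q n. q \<in> frontier Om ==> outward_normal Om q n ==> n \<bullet> F q = 0"
 shows "(LINT q|lborel. indicator Om q * (\<Sum>b\<in>Basis. F' q b \<bullet> b)) = 0"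
proof -
 have "\<forall>p\<in>Om. \<exists>r rr rr' C. boundary_chart Om F p r rr rr' C"
  using boundary_chart_exists[OF assms] by blast
 then obtain r rr rr' C where chart: "!!p. p \<in> Om ==> boundary_chart Om F p (r p) (rr p) (rr' p) (C p)"
  by metis
 have r: "0 < r p" if "p \<in> Om" for p using chart[OF that] by (simp add: boundary_chart_def)
 obtain P where P: "P \<subseteq> Om" "finite P" "Om \<subseteq> (\<Union>p\<in>P. ball p (r p))"
  by (rule compactE_image[OF comp, of Om "%p. ball p (r p)"]) (use r in force)+
 define B where "B q = (\<Sum>p\<in>P. bump p (r p) q)" for q
 define B' where "B' q v = (\<Sum>p\<in>P. bump' p (r p) q v)" for q v
 have dB: "(B has_derivative B' q) (at q)" for q
  unfolding B_def[abs_def] B'_def[abs_def]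
  using P(1) r by (intro has_derivative_sum has_derivative_bump) auto
 have contB: "continuous_on X B" for X
  using dB by (meson continuous_at_imp_continuous_on has_derivative_continuous)
 have Bpos: "B q > 0" if q: "q \<in> Om" for q
 proof -
  obtain p where p: "p \<in> P" "q \<in> ball p (r p)" using P(3) q by blast
  show ?thesis unfolding B_def
   by (rule sum_pos2[OF P(2) p(1)]) (use bump_pos[OF p(2)] in auto)
 qed
 obtain m where m: "m > 0" "!!q. q \<in> Om ==> m <= B q"
 proof (cases "Om = {}")
  case False
  then obtain q where "q \<in> Om" "\<forall>y\<in>Om. B q <= B y"
   using continuous_attains_inf[OF comp False contB] by blast
  thus ?thesis using Bpos that by blast
 qed (use that[of 1] in auto)
 have contF: "continuous_on Om F"
  using F by (meson differentiable_def differentiable_imp_continuous_on differentiable_on_def)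
 let ?F = "%q. (1 / B q) *\<^sub>R F q"
 define G' where "G' q v = (1 / B q) *\<^sub>R F' q v + (- (B' q v) / (B q)^2) *\<^sub>R F q" for q v
 have dG: "(?F has_derivative G' q) (at q within Om)" if q: "q \<in> Om" for q
 proof -
  have "((%q. 1 / B q) has_derivative (%v. - (B' q v) / (B q)^2)) (at q within Om)"
   by (rule has_derivative_eq_rhs[OF has_derivative_divide[OF has_derivative_const has_derivative_at_withinI[OF dB]]])
   (use Bpos[OF q] in "auto simp: fun_eq_iff power2_eq_square divide_simps")
  from has_derivative_scaleR[OF this F[OF q]] show ?thesis
   by (simp add: G'_def[abs_def])
 qed
 have B'c: "continuous_on Om (%q. B' q v)" for v
  unfolding B'_def bump'_def by (intro continuous_intros)
 have G'c: "continuous_on Om (%q. G' q v)" for v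
  unfolding G'_def by (intro continuous_intros contB F'c contF B'c) (use Bpos in force)+
 have "boundary_chart Om ?F p (r p) (rr p) (rr' p) (C p * max 1 (1 / m))" if "p \<in> P" for p
  using chart P(1) that m Bpos
  by (intro boundary_chart_scale) (auto intro!: divide_left_mono mult_pos_pos simp: abs_of_pos)
 note D = divergence_bump[OF comp this dG G'c]
 let ?J = "%p q. bump p (r p) q * (\<Sum>b\<in>Basis. G' q b \<bullet> b) + bump' p (r p) q (?F q)"
 have "0 = (\<Sum>p\<in>P. LINT q|lborel. indicator Om q * ?J p q)"
  using D(2) by simp
 also have "... = (LINT q|lborel. (\<Sum>p\<in>P. indicator Om q * ?J p q))"
  using D(1) by (subst LINT_sum) auto
 also have "... = (LINT q|lborel. indicator Om q * (\<Sum>b\<in>Basis. F' q b \<bullet> b))"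
 proof (rule LINT_cong[OF refl])
  fix q
  show "(\<Sum>p\<in>P. indicator Om q * ?J p q) = indicator Om q * (\<Sum>b\<in>Basis. F' q b \<bullet> b)"
  proof (cases "q \<in> Om")
   case True
   have lin: "linear (B' q)" using dB by (rule has_derivative_linear)
   have lB: "(\<Sum>b\<in>Basis. B' q b * (F q \<bullet> b)) = B' q (F q)"
   proof -
   have "B' q (F q) = B' q (\<Sum>b\<in>Basis. (F q \<bullet> b) *\<^sub>R b)" by (simp add: euclidean_representation)
   thus ?thesis using lin by (simp add: linear_sum linear_scale mult.commute)
   qed
   have dv: "(\<Sum>b\<in>Basis. G' q b \<bullet> b) = (1 / B q) * (\<Sum>b\<in>Basis. F' q b \<bullet> b) - B' q (F q) / (B q)^2"
   unfolding lB[symmetric] G'_def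
   by (simp add: inner_add_left inner_diff_left sum_subtractf sum.distrib sum_distrib_left sum_divide_distrib sum_negf)
   have "(\<Sum>p\<in>P. ?J p q) = B q * (\<Sum>b\<in>Basis. G' q b \<bullet> b) + B' q (?F q)"
   by (simp add: B_def B'_def sum.distrib sum_distrib_right)
   also have "... = (\<Sum>b\<in>Basis. F' q b \<bullet> b)"
   unfolding dv linear_scale[OF lin] using Bpos[OF True]
   by (simp add: divide_simps power2_eq_square algebra_simps)
   finally show ?thesis using True by simp
  qed simp
 qed
 finally show ?thesis by simp
qed

text \<open>The Neumann conditions make \<open>f * grad g - g * grad f\<close> tangential, and
  products of first derivatives cancel in its divergence. The gradients are assembled from the
  values of \<open>f1 q\<close> and \<open>g1 q\<close> on the basis.\<close>

lemma green_neumann: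
 fixes f g :: "'a::euclidean_space => real"
 assumes comp: "compact Om" and smooth: "smooth_boundary Om"
  and f: "!!q. q \<in> Om ==> (f has_derivative f1 q) (at q within Om)"
  and f1: "!!q v. q \<in> Om ==> ((%q. f1 q v) has_derivative f2 v q) (at q within Om)"
  and f2: "!!v w. continuous_on Om (%q. f2 v q w)"
  and g: "!!q. q \<in> Om ==> (g has_derivative g1 q) (at q within Om)"
  and g1: "!!q v. q \<in> Om ==> ((%q. g1 q v) has_derivative g2 v q) (at q within Om)"
  and g2: "!!v w. continuous_on Om (%q. g2 v q w)"
  and neumann: "!!q n. q \<in> frontier Om ==> outward_normal Om q n ==> f1 q n = 0"
   "!!q n. q \<in> frontier Om ==> outward_normal Om q n ==> g1 q n = 0"
 shows "(LINT q|lborel. indicator Om q * (f q * (\<Sum>b\<in>Basis. g2 b q b) - g q * (\<Sum>b\<in>Basis. f2 b q b))) = 0"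
proof -
 define F where "F q = (\<Sum>b\<in>Basis. (f q * g1 q b - g q * f1 q b) *\<^sub>R b)" for q
 define F' where "F' q v = (\<Sum>b\<in>Basis. (f q * g2 b q v + f1 q v * g1 q b - (g q * f2 b q v + g1 q v * f1 q b)) *\<^sub>R b)" for q v
 have cont: "continuous_on Om h" if "!!q. q \<in> Om ==> (h has_derivative h1 q) (at q within Om)" for h :: "'a => real" and h1
  using has_derivative_continuous[OF that] by (simp add: continuous_on_eq_continuous_within)
 have "(LINT q|lborel. indicator Om q * (\<Sum>b\<in>Basis. F' q b \<bullet> b)) = 0"
 proof (rule divergence_tangential[OF comp smooth])
  show "(F has_derivative F' q) (at q within Om)" if "q \<in> Om" for q
   unfolding F_def[abs_def] F'_def[abs_def]
   by (rule has_derivative_sum, rule has_derivative_scaleR_left,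
   rule has_derivative_diff[OF has_derivative_mult[OF f[OF that] g1[OF that]] has_derivative_mult[OF g[OF that] f1[OF that]]])
  show "continuous_on Om (%q. F' q v)" for v
   unfolding F'_def by (intro continuous_intros f2 g2 cont[OF f] cont[OF g] cont[OF f1] cont[OF g1]) assumption+
  fix q n assume q: "q \<in> frontier Om" and n: "outward_normal Om q n"
  have q_Om: "q \<in> Om" using q comp frontier_subset_closed compact_imp_closed by blast
  have lin: "h n = (\<Sum>b\<in>Basis. h b * (n \<bullet> b))" if "linear h" for h :: "'a => real"
  proof -
   have "h n = h (\<Sum>b\<in>Basis. (n \<bullet> b) *\<^sub>R b)" by (simp add: euclidean_representation)
   thus ?thesis using that by (simp add: linear_sum linear_scale mult.commute)
  qed
  have "n \<bullet> F q = f q * (\<Sum>b\<in>Basis. g1 q b * (n \<bullet> b)) - g q * (\<Sum>b\<in>Basis. f1 q b * (n \<bullet> b))"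
   by (simp add: F_def inner_sum_right sum_subtractf sum_distrib_left algebra_simps)
  thus "n \<bullet> F q = 0"
   using neumann[OF q n] lin[OF has_derivative_linear[OF f[OF q_Om]]] lin[OF has_derivative_linear[OF g[OF q_Om]]]
   by simp
 qed
 moreover have "F' q b \<bullet> b = f q * g2 b q b - g q * f2 b q b" if "b \<in> Basis" for q b
  using that by (simp add: F'_def inner_sum_left_Basis)
 ultimately show ?thesis
  by (simp add: sum_subtractf sum_distrib_left)
qed

section \<open>Decay of the truncated mode systems\<close>

text \<open>An integrating factor with both sources subtracted explicitly. The source
  \<open>B\<close> must decay more slowly than the homogeneous solution and then passes its rate
  \<open>\<gamma>\<close> on to the result; the alternative \<open>B = 0\<close> relies on
  \<open>0 / x = 0\<close>. The treatment of \<open>G\<close> is wasteful in \<open>T\<close>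
  because \<open>G\<close> will always carry a factor \<open>dl\<close>. Negative
  \<open>\<alpha>\<close> occurs in the a priori bound.\<close>

lemma gronwall_exp:
 fixes \<Phi> :: "real => real"
 assumes T: "0 <= T" and cont: "continuous_on {0..T} \<Phi>"
  and der: "!!s. 0 < s ==> s < T ==> (\<Phi> has_real_derivative \<Phi>' s) (at s)"
  and bound: "!!s. 0 < s ==> s < T ==> \<Phi>' s <= - \<alpha> * \<Phi> s + B * exp (- \<gamma> * s) + G"
  and B: "0 <= B" "B = 0 \<or> \<gamma> < \<alpha>" and G: "0 <= G"
 shows "\<Phi> T <= exp (- \<alpha> * T) * \<Phi> 0 + B / (\<alpha> - \<gamma>) * exp (- \<gamma> * T) + G * T * exp (max 0 (- \<alpha>) * T)"
proof -
 define E where "E = exp (\<alpha> * T) * exp (max 0 (- \<alpha>) * T)"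
 define bt where "bt = B / (\<alpha> - \<gamma>)"
 have bt: "B = bt * (\<alpha> - \<gamma>)" "0 <= bt" using B by (auto simp: bt_def)
 define \<Psi> where "\<Psi> s = exp (\<alpha> * s) * \<Phi> s - bt * exp ((\<alpha> - \<gamma>) * s) - G * E * s" for s
 have E: "exp (\<alpha> * s) <= E" if "0 <= s" "s <= T" for s
 proof (cases "\<alpha> \<ge> 0")
  case True
  thus ?thesis using that by (simp add: E_def max_def mult_left_mono)
 next
  case False
  thus ?thesis using that by (simp add: E_def max_def mult_nonpos_nonneg flip: exp_add)
 qed
 have "\<Psi> T <= \<Psi> 0"
 proof (rule DERIV_nonpos_imp_decreasing_open[OF T])
  fix s assume s: "0 < s" "s < T"
  let ?D = "exp (\<alpha> * s) * (\<Phi>' s + \<alpha> * \<Phi> s) - bt * (exp ((\<alpha> - \<gamma>) * s) * (\<alpha> - \<gamma>)) - G * E"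
  have "(\<Psi> has_real_derivative ?D) (at s)"
   unfolding \<Psi>_def[abs_def] by (auto intro!: derivative_eq_intros der s simp: algebra_simps)
  moreover have "?D <= 0"
  proof -
   have "exp (\<alpha> * s) * (\<Phi>' s + \<alpha> * \<Phi> s) <= exp (\<alpha> * s) * (B * exp (- \<gamma> * s) + G)"
   using bound[OF s] by (intro mult_left_mono) auto
   also have "... = B * exp ((\<alpha> - \<gamma>) * s) + exp (\<alpha> * s) * G"
   by (simp add: algebra_simps flip: exp_add)
   also have "exp (\<alpha> * s) * G <= E * G" using E[of s] s G by (intro mult_right_mono) auto
   finally show ?thesis unfolding bt(1) by (simp add: algebra_simps)
  qed
  ultimately show "\<exists>y. (\<Psi> has_real_derivative y) (at s) \<and> y <= 0" by blast
 qed (auto simp: \<Psi>_def intro!: continuous_intros cont)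
 also have "\<Psi> 0 <= \<Phi> 0" using bt(2) by (simp add: \<Psi>_def)
 finally have "exp (- \<alpha> * T) * \<Psi> T <= exp (- \<alpha> * T) * \<Phi> 0" by (intro mult_left_mono) auto
 moreover have "exp (- \<alpha> * T) * \<Psi> T = \<Phi> T - bt * exp (- \<gamma> * T) - G * T * exp (max 0 (- \<alpha>) * T)"
  unfolding \<Psi>_def E_def by (simp add: algebra_simps exp_diff exp_minus field_simps)
 ultimately show ?thesis unfolding bt_def by linarith
qed

lemma has_real_derivative_cmod_squared:
 fixes f :: "real => complex"
 assumes "(f has_vector_derivative f') (at s)"
 shows "((%s. (cmod (f s))^2) has_real_derivative 2 * Re (cnj (f s) * f')) (at s)"
proof -
 have "((%s. Re (f s)) has_real_derivative Re f') (at s)" "((%s. Im (f s)) has_real_derivative Im f') (at s)"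
  using bounded_linear.has_vector_derivative[OF bounded_linear_Re assms]
   bounded_linear.has_vector_derivative[OF bounded_linear_Im assms]
  by (simp_all add: has_real_derivative_iff_has_vector_derivative)
 from DERIV_add[OF DERIV_power[OF this(1), of 2] DERIV_power[OF this(2), of 2]] show ?thesis
  unfolding cmod_power2 by (rule DERIV_cong) (simp add: algebra_simps)
qed

lemma AM_GM_weighted: "2 * x * y <= c * x^2 + y^2 / c" if "0 < c" for x y c :: real
proof -
 have "0 <= (c * x - y)^2 / c" using that by simp
 also have "... = c * x^2 + y^2 / c - 2 * x * y"
  using that by (simp add: power2_eq_square field_simps)
 finally show ?thesis by simp
qed

lemma AM_GM_weighted': "x * y <= (c * x^2 + y^2 / c) / 2" if "0 < c" for x y c :: real
 using AM_GM_weighted[OF that, of x y] by simp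

text \<open>The reduced system: \<open>a\<close> is the cross-sectional mean, \<open>rr\<close> the squared norm of the remainder
 \<open>r\<close>, \<open>h\<close> and \<open>b\<close> are the pairings of \<open>r\<close> with \<open>\<chi>\<close> and with \<open>(-\<Delta>)\<^sup>-\<^sup>1 \<chi>\<close>.\<close>

locale taylor_system =
 fixes K m d kp k dl T :: real
  and a b h e f0 f1 :: "real => complex" and rr rr' :: "real => real"
 assumes K: "1 <= K" and m: "0 < m" and d: "0 <= d" "d <= K" and dl: "0 <= dl" and T: "0 <= T"
  and cont: "continuous_on {0..T} a" "continuous_on {0..T} b" "continuous_on {0..T} rr"
  and a': "!!s. 0 < s ==> s < T ==>
   (a has_vector_derivative (- of_real (k^2) * a s - \<i> * of_real kp * h s + f0 s)) (at s)"
  and b': "!!s. 0 < s ==> s < T ==>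
   (b has_vector_derivative (- h s - of_real (k^2) * b s - \<i> * of_real kp * (of_real d * a s + e s) + f1 s)) (at s)"
  and rr': "!!s. 0 < s ==> s < T ==> (rr has_real_derivative rr' s) (at s)"
  and rr'_le: "!!s. 0 < s ==> s < T ==>
   rr' s <= - 2 * (m + k^2) * rr s + 2 * kp * Im (a s * cnj (h s)) + 2 * dl * sqrt (rr s)"
  and rr0: "!!s. 0 <= rr s"
  and h: "!!s. cmod (h s) <= K * sqrt (rr s)" and b: "!!s. cmod (b s) <= K * sqrt (rr s)"
  and e: "!!s. cmod (e s) <= K * sqrt (rr s)"
  and f0: "!!s. 0 < s ==> s < T ==> cmod (f0 s) <= dl" and f1: "!!s. 0 < s ==> s < T ==> cmod (f1 s) <= K * dl"
begin

definition En :: "real => real" where "En s = (cmod (a s))^2 + rr s"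

lemma En_nonneg: "0 <= En s" using rr0 by (simp add: En_def)

lemma a_le_En: "cmod (a s) <= sqrt (En s)"
 using rr0[of s] by (intro real_le_rsqrt) (simp add: En_def)

lemma rho_le_En: "sqrt (rr s) <= sqrt (En s)" by (simp add: En_def)

text \<open>Transport by a real profile is skew-adjoint after the transform, so the two coupling
  terms with \<open>kp\<close> cancel. The mean itself gains only the damping \<open>k^2\<close>,
  which is small compared with \<open>kp^2\<close> if \<open>nu\<close> is small; hence the energy
  alone does not give the desired rate.\<close>

lemma En_deriv:
 assumes s: "0 < s" "s < T"
 obtains D where "(En has_real_derivative D) (at s)"
  "D <= - 2 * m * rr s - 2 * k^2 * En s + 4 * dl * sqrt (En s)"
proof
 let ?a' = "- of_real (k^2) * a s - \<i> * of_real kp * h s + f0 s"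
 show "(En has_real_derivative (2 * Re (cnj (a s) * ?a') + rr' s)) (at s)"
  unfolding En_def[abs_def] by (intro DERIV_add has_real_derivative_cmod_squared a' rr' s)
 have "2 * Re (cnj (a s) * ?a') = - 2 * k^2 * (cmod (a s))^2 - 2 * kp * Im (a s * cnj (h s)) + 2 * Re (cnj (a s) * f0 s)"
  unfolding cmod_power2 by (simp add: algebra_simps power2_eq_square)
 moreover have "Re (cnj (a s) * f0 s) <= sqrt (En s) * dl"
 proof -
  have "Re (cnj (a s) * f0 s) <= cmod (cnj (a s) * f0 s)" by (rule complex_Re_le_cmod)
  also have "... <= sqrt (En s) * dl"
   unfolding norm_mult using a_le_En f0[OF s] by (intro mult_mono) (auto simp: En_nonneg)
  finally show ?thesis .
 qed
 moreover have "dl * sqrt (rr s) <= dl * sqrt (En s)"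
  using rho_le_En dl by (rule mult_left_mono)
 ultimately show "2 * Re (cnj (a s) * ?a') + rr' s <= - 2 * m * rr s - 2 * k^2 * En s + 4 * dl * sqrt (En s)"
  using rr'_le[OF s] by (simp add: En_def algebra_simps)
qed

lemma En_cont: "continuous_on {0..T} En"
 unfolding En_def by (intro continuous_intros cont)

lemma En_apriori:
 assumes "0 <= t" "t <= T"
 shows "En t <= exp T * (En 0 + 4 * dl^2 * T)"
proof -
 have "\<exists>D. \<forall>s. 0 < s \<and> s < t --> (En has_real_derivative D s) (at s) \<and> D s <= En s + 4 * dl^2"
 proof -
  have "\<exists>D. (En has_real_derivative D) (at s) \<and> D <= En s + 4 * dl^2" if s: "0 < s" "s < t" for s
  proof -
   obtain D where D: "(En has_real_derivative D) (at s)"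
   "D <= - 2 * m * rr s - 2 * k^2 * En s + 4 * dl * sqrt (En s)"
   by (rule En_deriv[of s]) (use s assms in auto)
   have "4 * dl * sqrt (En s) <= En s + 4 * dl^2"
   using AM_GM_weighted[of 1 "sqrt (En s)" "2 * dl"] En_nonneg[of s] by (simp add: algebra_simps)
   moreover have "0 <= m * rr s" "0 <= k^2 * En s" using m rr0 En_nonneg by auto
   ultimately show ?thesis using D by (intro exI[of _ D]) auto
  qed
  thus ?thesis by metis
 qed
 then obtain D where D: "!!s. 0 < s ==> s < t ==> (En has_real_derivative D s) (at s)"
   "!!s. 0 < s ==> s < t ==> D s <= En s + 4 * dl^2" by blast
 have "En t <= exp (- (-1) * t) * En 0 + 0 / (-1 - 0) * exp (- 0 * t) + 4 * dl^2 * t * exp (max 0 (- (-1)) * t)"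
  by (rule gronwall_exp[OF assms(1) continuous_on_subset[OF En_cont] D(1)]) (use D(2) assms in auto)
 hence "En t <= exp t * (En 0 + 4 * dl^2 * t)" by (simp add: algebra_simps)
 also have "... <= exp T * (En 0 + 4 * dl^2 * T)"
  using assms En_nonneg[of 0] by (intro mult_mono add_mono mult_left_mono) auto
 finally show ?thesis .
qed


text \<open>The growth \<open>exp T\<close> is harmless: the bound enters only as the constant
  \<open>M\<close> of the following estimates, always multiplied by \<open>dl\<close>.\<close>

lemma En_bound:
 assumes "dl <= 1" "En 0 <= Z^2" "0 <= t" "t <= T"
 shows "En t <= exp T * (Z^2 + 4 * T)"
proof -
 have "dl^2 <= 1" using assms(1) dl by (simp add: power_le_one)
 hence "dl^2 * T <= 1 * T" using T by (rule mult_right_mono)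
 hence "En 0 + 4 * dl^2 * T <= Z^2 + 4 * T" using assms(2) by simp
 hence "exp T * (En 0 + 4 * dl^2 * T) <= exp T * (Z^2 + 4 * T)" by (intro mult_left_mono) auto
 thus ?thesis using En_apriori[OF assms(3,4)] by linarith
qed

text \<open>The energy effectively damps only the remainder. The derivative of
  \<open>Im (cnj a * b)\<close> contains \<open>- kp * d * |a|^2\<close>, so adding it with weight
  \<open>ep / kp\<close> damps the mean as well, whatever the sign of \<open>kp\<close>. The
  condition \<open>ep * K <= kp0\<close> keeps the functional between half and three halves of the
  energy, the next condition lets the dissipation of the remainder absorb all cross terms, and the
  conditions on \<open>c\<close> compare what is left with the functional.\<close>

lemma high_frequency:
 assumes d0: "0 < d0" "d0 <= d" and kp0: "0 < kp0" "kp0 <= abs kp"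
  and ep: "0 < ep" "ep * K <= kp0" "ep * K^2 + ep * (K * (1 + 1 / kp0))^2 / (2 * d0) <= m"
  and c: "0 < c" "3 * c <= 2 * m" "3 * c <= ep * d0"
  and M: "!!s. 0 <= s ==> s <= T ==> En s <= M^2" "0 <= M"
 shows "En T <= 3 * exp (- c * T) * En 0 + 2 * (4 + 2 * ep / kp0 * K) * M * T * dl"
proof -
 define P where "P s = Im (cnj (a s) * b s)" for s
 define \<Phi> where "\<Phi> s = En s + ep / kp * P s" for s
 have kp: "kp \<noteq> 0" "\<bar>ep / kp\<bar> <= ep / kp0"
  using kp0 ep by (auto simp: abs_divide intro!: divide_left_mono mult_pos_pos)
 have aR: "2 * cmod (a s) * sqrt (rr s) <= En s" for s
  using sum_squares_bound[of "cmod (a s)" "sqrt (rr s)"] rr0 by (simp add: En_def)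
 have Pb: "\<bar>ep / kp * P s\<bar> <= En s / 2" for s
 proof -
  have "\<bar>P s\<bar> <= cmod (a s) * (K * sqrt (rr s))"
   unfolding P_def using abs_Im_le_cmod[of "cnj (a s) * b s"] b[of s]
   by (simp add: norm_mult) (meson mult_left_mono norm_ge_zero order_trans)
  hence "\<bar>ep / kp * P s\<bar> <= ep / kp0 * (cmod (a s) * (K * sqrt (rr s)))"
   unfolding abs_mult using kp(2) ep(1) kp0(1) by (intro mult_mono) auto
  also have "... = (ep * K / kp0) * (cmod (a s) * sqrt (rr s))" by simp
  also have "... <= 1 * (cmod (a s) * sqrt (rr s))"
   using ep(2) kp0(1) rr0 by (intro mult_right_mono) auto
  finally show ?thesis using aR[of s] by linarith
 qed
 have \<Phi>b: "\<Phi> s <= 3 / 2 * En s" "En s <= 2 * \<Phi> s" for s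
 proof -
  obtain y where y: "y = ep / kp * P s" by blast
  show "\<Phi> s <= 3 / 2 * En s"
   using abs_le_D1[OF Pb[of s]] unfolding \<Phi>_def y[symmetric] by linarith
  show "En s <= 2 * \<Phi> s"
   using abs_le_D2[OF Pb[of s]] unfolding \<Phi>_def y[symmetric] by (simp add: field_simps)
 qed
 have "\<exists>D. (\<Phi> has_real_derivative D) (at s) \<and> D <= - c * \<Phi> s + (4 + 2 * ep / kp0 * K) * M * dl"
  if s: "0 < s" "s < T" for s
 proof -
  obtain D1 where D1: "(En has_real_derivative D1) (at s)"
   "D1 <= - 2 * m * rr s - 2 * k^2 * En s + 4 * dl * sqrt (En s)"
   by (rule En_deriv[OF s]) blast
  define R where "R = sqrt (rr s)"
  define x where "x = cmod (a s)"
  have R: "0 <= R" "R^2 = rr s" using rr0 by (auto simp: R_def)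
  have x: "0 <= x" "En s = x^2 + R^2" by (auto simp: x_def En_def R)
  let ?a' = "- of_real (k^2) * a s - \<i> * of_real kp * h s + f0 s"
  let ?b' = "- h s - of_real (k^2) * b s - \<i> * of_real kp * (of_real d * a s + e s) + f1 s"
  have "((%s. cnj (a s) * b s) has_vector_derivative (cnj (a s) * ?b' + cnj ?a' * b s)) (at s)"
   by (intro has_vector_derivative_mult b'[OF s] has_vector_derivative_cnj a'[OF s])
  from bounded_linear.has_vector_derivative[OF bounded_linear_Im this]
  have P': "(P has_real_derivative Im (cnj (a s) * ?b' + cnj ?a' * b s)) (at s)"
   unfolding P_def[abs_def] has_real_derivative_iff_has_vector_derivative .
  define X1 where "X1 = Re (cnj (h s) * b s)"
  define X2 where "X2 = Im (cnj (a s) * h s)"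
  define X3 where "X3 = Re (cnj (a s) * e s)"
  define X4 where "X4 = Im (cnj (f0 s) * b s) + Im (cnj (a s) * f1 s)"
  have xx: "cnj (a s) * a s = of_real (x^2)"
   unfolding x_def by (metis complex_norm_square mult.commute of_real_power)
  have "cnj (a s) * ?b' + cnj ?a' * b s = - (cnj (a s) * h s) - of_real (2 * k^2) * (cnj (a s) * b s)
   - \<i> * of_real (kp * d) * (cnj (a s) * a s) - \<i> * of_real kp * (cnj (a s) * e s) + cnj (a s) * f1 s
   + \<i> * of_real kp * (cnj (h s) * b s) + cnj (f0 s) * b s"
   by (simp add: algebra_simps)
  hence PX: "Im (cnj (a s) * ?b' + cnj ?a' * b s) = - X2 - 2 * k^2 * P s - kp * d * x^2 - kp * X3 + kp * X1 + X4"
   unfolding xx by (simp add: X1_def X2_def X3_def X4_def P_def)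
  have bnd: "abs X1 <= K^2 * R^2" "abs X2 <= K * (x * R)" "abs X3 <= K * (x * R)"
  proof -
   have "abs X1 <= cmod (h s) * cmod (b s)" unfolding X1_def using abs_Re_le_cmod[of "cnj (h s) * b s"] by (simp add: norm_mult)
   also have "... <= (K * R) * (K * R)" unfolding R_def using h b K rr0 by (intro mult_mono) auto
   finally show "abs X1 <= K^2 * R^2" by (simp add: power2_eq_square mult_ac)
   have "abs X2 <= x * cmod (h s)" unfolding X2_def x_def using abs_Im_le_cmod[of "cnj (a s) * h s"] by (simp add: norm_mult)
   also have "... <= x * (K * R)" using h[of s] x(1) by (intro mult_left_mono) (auto simp: R_def)
   finally show "abs X2 <= K * (x * R)" by (simp add: mult_ac)
   have "abs X3 <= x * cmod (e s)" unfolding X3_def x_def using abs_Re_le_cmod[of "cnj (a s) * e s"] by (simp add: norm_mult)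
   also have "... <= x * (K * R)" using e[of s] x(1) by (intro mult_left_mono) (auto simp: R_def)
   finally show "abs X3 <= K * (x * R)" by (simp add: mult_ac)
  qed
  have EM: "sqrt (En s) <= M" using M s by (intro real_le_lsqrt) auto
  have xM: "x <= M" "R <= M" using a_le_En[of s] rho_le_En[of s] EM unfolding x_def R_def by linarith+
  have X4: "abs X4 <= 2 * K * M * dl"
  proof -
   have "cmod (f0 s) * cmod (b s) <= dl * (K * M)"
   proof (rule mult_mono[OF f0[OF s] _ dl])
   show "cmod (b s) <= K * M" using b[of s] xM(2) K unfolding R_def
   by (meson le_numeral_extra(4) mult_left_mono order_trans zero_le_one)
   qed simp
   moreover have "cmod (a s) * cmod (f1 s) <= M * (K * dl)"
   using f1[OF s] xM(1) M(2) by (intro mult_mono) (auto simp: x_def)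
   moreover have "\<bar>Im (cnj (f0 s) * b s)\<bar> <= cmod (f0 s) * cmod (b s)"
   "\<bar>Im (cnj (a s) * f1 s)\<bar> <= cmod (a s) * cmod (f1 s)"
   using abs_Im_le_cmod[of "cnj (f0 s) * b s"] abs_Im_le_cmod[of "cnj (a s) * f1 s"] by (simp_all add: norm_mult)
   ultimately show ?thesis unfolding X4_def by (simp add: algebra_simps)
  qed
  let ?D = "D1 + ep / kp * Im (cnj (a s) * ?b' + cnj ?a' * b s)"
  have der: "(\<Phi> has_real_derivative ?D) (at s)"
   unfolding \<Phi>_def[abs_def] by (intro DERIV_add D1(1) DERIV_cmult P')
  have "ep / kp * Im (cnj (a s) * ?b' + cnj ?a' * b s) =
   - 2 * k^2 * (ep / kp * P s) - ep * d * x^2 + ep * X1 - ep * X3 + ep / kp * (X4 - X2)"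
   unfolding PX using kp(1) by (simp add: field_simps)
  also have "... <= - 2 * k^2 * (ep / kp * P s) - ep * d0 * x^2 + ep * (K^2 * R^2) + ep * (K * (x * R))
   + (ep / kp0 * (2 * K * M * dl) + ep / kp0 * (K * (x * R)))"
  proof -
   have "ep * d0 * x^2 <= ep * d * x^2" using d0 ep(1) by (intro mult_right_mono mult_left_mono) auto
   moreover have "ep * X1 <= ep * (K^2 * R^2)" "- (ep * X3) <= ep * (K * (x * R))"
   using bnd ep(1) mult_left_mono[of "X1" "K^2 * R^2" ep] mult_left_mono[of "- X3" "K * (x * R)" ep] by auto
   moreover have "ep / kp * (X4 - X2) <= ep / kp0 * (2 * K * M * dl + K * (x * R))"
   proof -
   have "ep / kp * (X4 - X2) <= \<bar>ep / kp\<bar> * \<bar>X4 - X2\<bar>" by (metis abs_ge_self abs_mult)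
   also have "... <= ep / kp0 * (2 * K * M * dl + K * (x * R))"
   using kp(2) ep(1) kp0(1) X4 bnd(2) by (intro mult_mono) auto
   finally show ?thesis .
   qed
   ultimately show ?thesis by (simp add: distrib_left)
  qed
  finally have 1: "?D <= - 2 * m * R^2 - 2 * k^2 * \<Phi> s - ep * d0 * x^2 + ep * K^2 * R^2
   + ep * (x * (K * (1 + 1 / kp0) * R)) + 4 * dl * sqrt (En s) + ep / kp0 * (2 * K * M * dl)"
   using D1(2) by (simp add: \<Phi>_def R algebra_simps)
  \<comment> \<open>Split so that half of the new damping \<open>ep * d0 * x^2\<close> of the mean
    survives.\<close>
  have 2: "ep * (x * (K * (1 + 1 / kp0) * R)) <= ep * d0 * x^2 / 2 + ep * (K * (1 + 1 / kp0))^2 / (2 * d0) * R^2"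
  proof -
   have "x * (K * (1 + 1 / kp0) * R) <= (d0 * x^2 + (K * (1 + 1 / kp0) * R)^2 / d0) / 2"
   by (rule AM_GM_weighted'[OF d0(1)])
   hence "ep * (x * (K * (1 + 1 / kp0) * R)) <= ep * ((d0 * x^2 + (K * (1 + 1 / kp0) * R)^2 / d0) / 2)"
   using ep(1) by (intro mult_left_mono) auto
   also have "... = ep * d0 * x^2 / 2 + ep * (K * (1 + 1 / kp0))^2 / (2 * d0) * R^2"
   using d0(1) unfolding power_mult_distrib by (simp add: field_simps)
   finally show ?thesis .
  qed
  have 3: "(ep * K^2 + ep * (K * (1 + 1 / kp0))^2 / (2 * d0)) * R^2 <= m * R^2"
   using ep(3) by (intro mult_right_mono) auto
  have 4: "0 <= k^2 * \<Phi> s" using \<Phi>b(2)[of s] En_nonneg[of s] by (intro mult_nonneg_nonneg) auto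
  have 5: "4 * dl * sqrt (En s) <= 4 * dl * M" using EM dl by (intro mult_left_mono) auto
  have 6: "c * \<Phi> s <= m * R^2 + ep * d0 * x^2 / 2"
  proof -
   have "c * \<Phi> s <= c * (3 / 2 * (x^2 + R^2))"
   using \<Phi>b(1)[of s] c x(2) by (intro mult_left_mono) auto
   moreover have "3 * c * R^2 <= 2 * m * R^2" "3 * c * x^2 <= ep * d0 * x^2"
   using c by (auto intro: mult_right_mono)
   ultimately show ?thesis by (simp add: algebra_simps)
  qed
  have "?D <= - c * \<Phi> s + (4 + 2 * ep / kp0 * K) * M * dl"
   using 1 2 3 4 5 6 by (simp add: algebra_simps)
  thus ?thesis using der by blast
 qed
 then obtain D where D: "!!s. 0 < s ==> s < T ==> (\<Phi> has_real_derivative D s) (at s)"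
  "!!s. 0 < s ==> s < T ==> D s <= - c * \<Phi> s + (4 + 2 * ep / kp0 * K) * M * dl" by metis
 have "continuous_on {0..T} \<Phi>"
  unfolding \<Phi>_def P_def by (intro continuous_intros En_cont cont)
 from gronwall_exp[OF T this D(1), where \<alpha>=c and B=0 and \<gamma>=0 and G="(4 + 2 * ep / kp0 * K) * M * dl"]
 have "\<Phi> T <= exp (- c * T) * \<Phi> 0 + (4 + 2 * ep / kp0 * K) * M * dl * T"
  using D(2) c ep kp0 K M dl by simp
 moreover have "exp (- c * T) * \<Phi> 0 <= exp (- c * T) * (3 / 2 * En 0)"
  using \<Phi>b(1)[of 0] by (intro mult_left_mono) auto
 moreover have "3 * exp (- c * T) * En 0 = 2 * (exp (- c * T) * (3 / 2 * En 0))"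
  "2 * (4 + 2 * ep / kp0 * K) * M * T * dl = 2 * ((4 + 2 * ep / kp0 * K) * M * dl * T)" by simp_all
 ultimately show ?thesis using \<Phi>b(2)[of T] by linarith
qed

text \<open>Put \<open>aa = a - i kp b\<close> and let \<open>p\<close> be the exact exponential
  with its initial value. The deviation \<open>z = aa - p\<close> is driven by the remainder with
  coefficient \<open>kp^2\<close>, and the square of the remainder by the squares of
  \<open>z\<close> and \<open>p\<close>, again with coefficient \<open>kp^2\<close>. In
  \<open>W = |z|^2 + bt * kp^2 * rr\<close> the only source left, apart from \<open>dl\<close>, is
  of order \<open>kp^4 * |p|^2\<close>; dividing by the rate, of order \<open>kp^2\<close>, produces
  the factor \<open>kp^2\<close> of the conclusion. Feeding this back bounds the remainder, up to
  its initial layer \<open>exp (- m * T)\<close>.\<close>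

lemma low_frequency:
 assumes d0: "0 < d0" "d0 <= d" and kp1: "abs kp <= 1"
 defines "C1 \<equiv> 4 * K ^ 4 / d0" and "C2 \<equiv> 4 * K^2 / m"
 defines "bt \<equiv> 2 * C1 / m" and "c \<equiv> d0 / 2"
 assumes kp2: "kp^2 * (4 * K^2) <= m" "bt * C2 * kp^2 <= d0 / 2" "kp^2 * d0 <= m"
 assumes En0: "En 0 <= Z^2" "0 <= Z"
  and M: "!!s. 0 <= s ==> s <= T ==> En s <= M^2" "0 <= M"
 defines "C4 \<equiv> bt + 8 * bt * C2 * K^2 / c"
 defines "M1 \<equiv> 4 * K * (2 * K * M + 2 * K * Z) + 2 * bt * M"
 defines "M2 \<equiv> C2 * M1 * T + 2 * M"
 defines "C5 \<equiv> 2 / m * (C2 * (C4 + 4 * K^2))"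
 shows "(cmod (a T - of_real (exp (- (k^2 + kp^2 * d) * T)) * a 0))^2 + rr T
  <= (3 * C4 + 6 * K^2 + (3 * K^2 + 1) * (C5 + 1)) * Z^2 * (kp^2 * exp (- (c / 2 * kp^2) * T) + exp (- m * T))
   + (3 * M1 + (3 * K^2 + 1) * M2) * T * dl"
proof -
 define lam where "lam = k^2 + kp^2 * d"
 define aa where "aa s = a s - \<i> * of_real kp * b s" for s
 define p where "p s = of_real (exp (- lam * s)) * aa 0" for s
 define z where "z s = aa s - p s" for s
 define P where "P = 2 * K * Z"
 \<comment> \<open>\<open>W\<close> will decay at the rate \<open>c * kp^2\<close>. Its source is
   credited with only half of that, which leaves the gap required by Gronwall's inequality.\<close>
 define Q where "Q s = exp (- (c / 2 * kp^2) * s)" for s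
 have c: "0 < c" and C1: "0 <= C1" and C2: "0 <= C2" and bt: "0 <= bt" and C4: "0 <= C4"
  using d0 K m by (simp_all add: c_def C1_def C2_def bt_def C4_def)
 have M1: "0 <= M1" using K M(2) En0(2) bt by (simp add: M1_def)
 have M2: "0 <= M2" using M1 M(2) C2 T by (simp add: M2_def)
 have C5: "0 <= C5" using m C2 C4 by (simp add: C5_def)
 have EM: "sqrt (En s) <= M" if "0 <= s" "s <= T" for s using M that by (intro real_le_lsqrt) auto
 have bR: "cmod (\<i> * of_real kp * b s) <= abs kp * (K * sqrt (rr s))" for s
  using b[of s] by (simp add: norm_mult mult_left_mono)
 have bR': "cmod (\<i> * of_real kp * b s) <= K * sqrt (rr s)" for s
 proof -
  have "abs kp * (K * sqrt (rr s)) <= 1 * (K * sqrt (rr s))" using kp1 K rr0[of s] by (intro mult_right_mono) auto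
  thus ?thesis using bR[of s] by linarith
 qed
 have at_le: "cmod (aa s) <= 2 * K * sqrt (En s)" for s
 proof -
  have "cmod (aa s) <= cmod (a s) + cmod (\<i> * of_real kp * b s)" unfolding aa_def by (rule norm_triangle_ineq4)
  also have "... <= 1 * sqrt (En s) + K * sqrt (En s)"
   using a_le_En[of s] bR'[of s] mult_left_mono[OF rho_le_En[of s], of K] K by linarith
  also have "... <= K * sqrt (En s) + K * sqrt (En s)" using K En_nonneg[of s] by (intro add_right_mono mult_right_mono) auto
  finally show ?thesis by simp
 qed
 have En0Z: "sqrt (En 0) <= Z" using En0 by (intro real_le_lsqrt) auto
 have at0: "cmod (aa 0) <= P"
  using at_le[of 0] mult_left_mono[OF En0Z, of "2 * K"] K unfolding P_def by linarith
 have ps: "cmod (p s) <= P * exp (- (kp^2 * d0) * s)" if "0 <= s" for s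
 proof -
  have "kp^2 * d0 <= lam" using d0 by (simp add: lam_def add_increasing mult_left_mono)
  hence "exp (- lam * s) <= exp (- (kp^2 * d0) * s)" using that by (simp add: mult_right_mono)
  hence "exp (- lam * s) * cmod (aa 0) <= exp (- (kp^2 * d0) * s) * P" using at0 by (rule mult_mono) auto
  thus ?thesis unfolding p_def by (simp add: norm_mult mult.commute)
 qed
 have P0: "0 <= P" using K En0 by (simp add: P_def)
 have pP: "cmod (p s) <= P" if "0 <= s" for s
 proof -
  have "exp (- (kp^2 * d0) * s) <= 1" using d0 that by simp
  hence "P * exp (- (kp^2 * d0) * s) <= P * 1" using P0 by (rule mult_left_mono)
  thus ?thesis using ps[OF that] by simp
 qed
 have p2: "(cmod (p s))^2 <= P^2 * Q s" if "0 <= s" for s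
 proof -
  have "(cmod (p s))^2 <= (P * exp (- (kp^2 * d0) * s))^2" using ps[OF that] by (intro power_mono) auto
  also have "... = P^2 * exp (- (2 * (kp^2 * d0)) * s)" by (simp add: power_mult_distrib flip: exp_of_nat_mult)
  also have "... <= P^2 * Q s"
  proof -
   have "(c / 2 * kp^2) * s <= (2 * (kp^2 * d0)) * s" using d0 that by (intro mult_right_mono) (auto simp: c_def)
   thus ?thesis unfolding Q_def by (intro mult_left_mono) auto
  qed
  finally show ?thesis .
 qed
 have z_le: "cmod (z s) <= 2 * K * M + P" if "0 <= s" "s <= T" for s
 proof -
  have "cmod (z s) <= cmod (aa s) + cmod (p s)" unfolding z_def by (rule norm_triangle_ineq4)
  also have "cmod (aa s) <= 2 * K * M"
   using at_le[of s] mult_left_mono[OF EM[OF that], of "2 * K"] K by linarith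
  finally show ?thesis using pP[OF that(1)] by linarith
 qed
 have z0: "z 0 = 0" by (simp add: z_def p_def)
 have conts: "continuous_on {0..T} z" unfolding z_def aa_def p_def by (intro continuous_intros cont)
 have rr_M: "sqrt (rr s) <= M" if "0 <= s" "s <= T" for s using EM[OF that] rho_le_En[of s] by linarith
 have zder: "\<exists>D. ((%s. (cmod (z s))^2) has_real_derivative D) (at s) \<and>
   D <= - (kp^2 * d0) * (cmod (z s))^2 + kp^2 * C1 * rr s + 4 * K * (2 * K * M + P) * dl" if s: "0 < s" "s < T" for s
 proof -
  let ?a' = "- of_real (k^2) * a s - \<i> * of_real kp * h s + f0 s"
  let ?b' = "- h s - of_real (k^2) * b s - \<i> * of_real kp * (of_real d * a s + e s) + f1 s"
  define z' where "z' = ?a' - \<i> * of_real kp * ?b' + of_real lam * p s"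
  define E where "E = e s + \<i> * of_real (kp * d) * b s"
  have dp: "(p has_vector_derivative - of_real lam * p s) (at s)"
  proof -
   have "((%s. exp (- lam * s)) has_real_derivative - lam * exp (- lam * s)) (at s)"
   by (auto intro!: derivative_eq_intros)
   from has_vector_derivative_mult_left[OF has_vector_derivative_of_real[OF this], of "aa 0"]
   show ?thesis unfolding p_def[abs_def] by (simp add: mult_ac)
  qed
  have "(z has_vector_derivative (?a' - \<i> * of_real kp * ?b' - (- of_real lam * p s))) (at s)"
   unfolding z_def[abs_def] aa_def
   by (intro has_vector_derivative_diff a'[OF s] dp has_vector_derivative_mult_right b'[OF s])
  hence dz: "(z has_vector_derivative z') (at s)" by (simp add: z'_def)
  have z': "z' = - of_real lam * z s - of_real (kp^2) * E + (f0 s - \<i> * of_real kp * f1 s)"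
   unfolding z'_def z_def aa_def E_def lam_def by (simp add: algebra_simps power2_eq_square)
  define R where "R = sqrt (rr s)"
  define x where "x = cmod (z s)"
  have R: "0 <= R" "R^2 = rr s" using rr0 by (auto simp: R_def)
  have x0: "0 <= x" by (simp add: x_def)
  have E: "cmod E <= 2 * K^2 * R"
  proof -
   have "cmod E <= cmod (e s) + cmod (\<i> * of_real (kp * d) * b s)" unfolding E_def by (rule norm_triangle_ineq)
   also have "... = cmod (e s) + (abs kp * d) * cmod (b s)" using d by (simp add: norm_mult abs_mult)
   also have "... <= K * R + (1 * K) * (K * R)"
   using e[of s] b[of s] d kp1 K rr0[of s] unfolding R_def by (intro add_mono mult_mono) auto
   finally have "cmod E <= K * R + K^2 * R" by (simp add: power2_eq_square)
   moreover have "K * R <= K^2 * R" using K R by (intro mult_right_mono) (auto simp: power2_eq_square)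
   ultimately show ?thesis by linarith
  qed
  have F: "cmod (f0 s - \<i> * of_real kp * f1 s) <= 2 * K * dl"
  proof -
   have "cmod (f0 s - \<i> * of_real kp * f1 s) <= cmod (f0 s) + cmod (\<i> * of_real kp * f1 s)" by (rule norm_triangle_ineq4)
   also have "... = cmod (f0 s) + abs kp * cmod (f1 s)" by (simp add: norm_mult)
   also have "... <= 1 * dl + 1 * (K * dl)" using f0[OF s] f1[OF s] kp1 by (intro add_mono mult_mono) auto
   also have "1 * dl <= K * dl" using K dl by (intro mult_right_mono) auto
   finally show ?thesis by simp
  qed
  have "2 * Re (cnj (z s) * z') = - 2 * lam * x^2 - 2 * kp^2 * Re (cnj (z s) * E) + 2 * Re (cnj (z s) * (f0 s - \<i> * of_real kp * f1 s))"
   unfolding z' x_def cmod_power2 by (simp add: algebra_simps power2_eq_square)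
  moreover have "- (kp^2 * Re (cnj (z s) * E)) <= kp^2 * (x * (2 * K^2 * R))"
  proof -
   have "- Re (cnj (z s) * E) <= x * cmod E" using abs_Re_le_cmod[of "cnj (z s) * E"] by (simp add: norm_mult x_def)
   also have "... <= x * (2 * K^2 * R)" using E x0 by (rule mult_left_mono)
   finally have "kp^2 * (- Re (cnj (z s) * E)) <= kp^2 * (x * (2 * K^2 * R))" by (rule mult_left_mono) simp
   thus ?thesis by (simp only: mult_minus_right)
  qed
  moreover have "Re (cnj (z s) * (f0 s - \<i> * of_real kp * f1 s)) <= (2 * K * M + P) * (2 * K * dl)"
  proof -
   have "Re (cnj (z s) * (f0 s - \<i> * of_real kp * f1 s)) <= cmod (z s) * cmod (f0 s - \<i> * of_real kp * f1 s)"
   using complex_Re_le_cmod[of "cnj (z s) * (f0 s - \<i> * of_real kp * f1 s)"] by (simp add: norm_mult)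
   also have "... <= (2 * K * M + P) * (2 * K * dl)"
   using z_le[of s] s F K M(2) P0 by (intro mult_mono) auto
   finally show ?thesis .
  qed
  moreover have "2 * x * (2 * K^2 * R) <= d0 * x^2 + C1 * rr s"
   using AM_GM_weighted[OF d0(1), of x "2 * K^2 * R"] by (simp add: C1_def power_mult_distrib R(2))
  from mult_left_mono[OF this, of "kp^2"]
  have "2 * (kp^2 * (x * (2 * K^2 * R))) <= kp^2 * d0 * x^2 + kp^2 * C1 * rr s" by (simp add: algebra_simps)
  moreover have "kp^2 * d0 * x^2 <= lam * x^2"
   using d0 by (intro mult_right_mono) (auto simp: lam_def add_increasing mult_left_mono)
  ultimately have "2 * Re (cnj (z s) * z') <= - (kp^2 * d0) * x^2 + kp^2 * C1 * rr s + 4 * K * (2 * K * M + P) * dl"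
   by (simp add: algebra_simps)
  thus ?thesis using has_real_derivative_cmod_squared[OF dz] unfolding x_def by blast
 qed
 have rr'_le': "rr' s <= - m * rr s + kp^2 * C2 * ((cmod (z s))^2 + (cmod (p s))^2) + 2 * M * dl" if s: "0 < s" "s < T" for s
 proof -
  define R where "R = sqrt (rr s)"
  define x where "x = cmod (z s) + cmod (p s)"
  have R: "0 <= R" "R^2 = rr s" using rr0 by (auto simp: R_def)
  have "a s = z s + p s + \<i> * of_real kp * b s" by (simp add: z_def aa_def)
  hence "cmod (a s) <= x + abs kp * (K * R)"
   using norm_triangle_ineq[of "z s + p s" "\<i> * of_real kp * b s"] norm_triangle_ineq[of "z s" "p s"] bR[of s]
   by (simp add: x_def R_def)
  hence "cmod (a s) * cmod (h s) <= (x + abs kp * (K * R)) * (K * R)"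
   using h[of s] K R(1) by (intro mult_mono) (auto simp: R_def x_def)
  moreover have "kp * Im (a s * cnj (h s)) <= abs kp * (cmod (a s) * cmod (h s))"
  proof -
   have "kp * Im (a s * cnj (h s)) <= abs kp * \<bar>Im (a s * cnj (h s))\<bar>" by (metis abs_ge_self abs_mult)
   also have "... <= abs kp * (cmod (a s) * cmod (h s))"
   using abs_Im_le_cmod[of "a s * cnj (h s)"] by (intro mult_left_mono) (auto simp: norm_mult)
   finally show ?thesis .
  qed
  moreover define I where "I = Im (a s * cnj (h s))"
  ultimately have "kp * I <= abs kp * ((x + abs kp * (K * R)) * (K * R))"
   by (meson abs_ge_zero mult_left_mono order_trans)
  also have "... = abs kp * K * R * x + kp^2 * K^2 * R^2"
  proof -
   obtain j where j: "j = abs kp" by blast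
   hence "kp^2 = j^2" by simp
   thus ?thesis unfolding j[symmetric] by (simp add: algebra_simps power2_eq_square)
  qed
  finally have "2 * kp * I <= 2 * R * (abs kp * K * x) + 2 * kp^2 * K^2 * rr s" by (simp add: R(2) mult_ac)
  hence 1: "2 * kp * Im (a s * cnj (h s)) <= 2 * R * (abs kp * K * x) + 2 * kp^2 * K^2 * rr s" by (simp only: I_def)
  have 2: "2 * R * (abs kp * K * x) <= m / 2 * rr s + kp^2 * C2 * ((cmod (z s))^2 + (cmod (p s))^2)"
  proof -
   have "2 * R * (abs kp * K * x) <= m / 2 * R^2 + (abs kp * K * x)^2 / (m / 2)"
   using m by (intro AM_GM_weighted) auto
   also have "(abs kp * K * x)^2 / (m / 2) = kp^2 * (2 * K^2 / m) * x^2" by (simp add: power_mult_distrib)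
   also have "x^2 <= 2 * ((cmod (z s))^2 + (cmod (p s))^2)"
   using sum_squares_bound[of "cmod (z s)" "cmod (p s)"] by (simp add: x_def power2_sum)
   hence "kp^2 * (2 * K^2 / m) * x^2 <= kp^2 * (2 * K^2 / m) * (2 * ((cmod (z s))^2 + (cmod (p s))^2))"
   using m by (intro mult_left_mono) auto
   finally show ?thesis by (simp add: R(2) C2_def algebra_simps add_divide_distrib)
  qed
  have 3: "2 * kp^2 * K^2 * rr s <= m / 2 * rr s"
   using kp2(1) rr0 by (intro mult_right_mono) auto
  have 4: "2 * dl * sqrt (rr s) <= 2 * dl * M" using rr_M s dl by (intro mult_left_mono) auto
  have "0 <= k^2 * rr s" using rr0 by simp
  thus ?thesis using rr'_le[OF s] 1 2 3 4 by (simp add: algebra_simps)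
 qed
 obtain D where D: "!!s. 0 < s ==> s < T ==> ((%s. (cmod (z s))^2) has_real_derivative D s) (at s)"
   "!!s. 0 < s ==> s < T ==> D s <= - (kp^2 * d0) * (cmod (z s))^2 + kp^2 * C1 * rr s + 4 * K * (2 * K * M + P) * dl"
  using zder by metis
 \<comment> \<open>\<open>bt * m = 2 * C1\<close>: the damping of the second term is twice what the
   equation of \<open>z\<close> requires, and the other half gives \<open>W\<close> its own decay.
   \<open>C1\<close> and \<open>C2\<close> are the costs of the weighted arithmetic-geometric mean
   in the equations of \<open>z\<close> and of the remainder.\<close>
 define W where "W s = (cmod (z s))^2 + bt * kp^2 * rr s" for s
 have contW: "continuous_on {0..T} W" unfolding W_def by (intro continuous_intros conts cont)
 have zW: "(cmod (z t))^2 <= C4 * kp^2 * Z^2 * Q t + M1 * T * dl" if t: "0 <= t" "t <= T" for t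
 proof -
  have "W t <= exp (- (c * kp^2) * t) * W 0
   + bt * C2 * kp ^ 4 * P^2 / (c * kp^2 - c / 2 * kp^2) * exp (- (c / 2 * kp^2) * t)
   + M1 * dl * t * exp (max 0 (- (c * kp^2)) * t)"
  proof (rule gronwall_exp[OF t(1)])
   show "continuous_on {0..t} W" by (rule continuous_on_subset[OF contW]) (use t in auto)
   show "(W has_real_derivative (D s + bt * kp^2 * rr' s)) (at s)" if "0 < s" "s < t" for s
   unfolding W_def[abs_def] using that t by (intro DERIV_add D(1) DERIV_cmult rr') auto
   show "0 <= bt * C2 * kp ^ 4 * P^2" "0 <= M1 * dl" using bt C2 M1 dl by auto
   show "bt * C2 * kp ^ 4 * P^2 = 0 \<or> c / 2 * kp^2 < c * kp^2" using c by (cases "kp = 0") auto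
   fix s assume "0 < s" "s < t"
   hence s: "0 < s" "s < T" using t by auto
   define X1 where "X1 = kp^2 * (cmod (z s))^2"
   define X2 where "X2 = kp^2 * C1 * rr s"
   define X3 where "X3 = bt * C2 * kp ^ 4 * P^2 * exp (- (c / 2 * kp^2) * s)"
   have k4: "kp ^ 4 = kp^2 * kp^2" by (simp flip: power_add)
   have e0: "D s <= - d0 * X1 + X2 + 4 * K * (2 * K * M + P) * dl"
   using D(2)[OF s] by (simp add: X1_def X2_def algebra_simps)
   have e1: "bt * kp^2 * rr' s <= - 2 * X2 + d0 / 2 * X1 + X3 + bt * 1 * (2 * M * dl)"
   proof -
   have "bt * kp^2 * rr' s <= bt * kp^2 * (- m * rr s + kp^2 * C2 * ((cmod (z s))^2 + (cmod (p s))^2) + 2 * M * dl)"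
   using rr'_le'[OF s] bt by (intro mult_left_mono) auto
   also have "... = - (bt * m) * (kp^2 * rr s) + (bt * C2 * kp^2) * X1
   + bt * C2 * kp ^ 4 * (cmod (p s))^2 + bt * kp^2 * (2 * M * dl)"
   unfolding k4 X1_def by (simp add: algebra_simps)
   also have "bt * m = 2 * C1" using m by (simp add: bt_def)
   finally have 1: "bt * kp^2 * rr' s <= - (2 * C1) * (kp^2 * rr s) + (bt * C2 * kp^2) * X1
   + bt * C2 * kp ^ 4 * (cmod (p s))^2 + bt * kp^2 * (2 * M * dl)" .
   have 2: "(bt * C2 * kp^2) * X1 <= d0 / 2 * X1"
   using kp2(2) by (intro mult_right_mono) (auto simp: X1_def)
   have "bt * C2 * kp ^ 4 * (cmod (p s))^2 <= bt * C2 * kp ^ 4 * (P^2 * Q s)"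
   using p2[of s] s bt C2 by (intro mult_left_mono) auto
   hence 3: "bt * C2 * kp ^ 4 * (cmod (p s))^2 <= X3" by (simp add: X3_def Q_def mult_ac)
   have 4: "bt * kp^2 * (2 * M * dl) <= bt * 1 * (2 * M * dl)"
   using kp1 bt M(2) dl by (intro mult_right_mono mult_left_mono) (auto simp: abs_square_le_1)
   have "- (2 * C1) * (kp^2 * rr s) = - 2 * X2" by (simp add: X2_def)
   thus ?thesis using 1 2 3 4 by linarith
   qed
   have e2: "c * kp^2 * W s <= d0 / 2 * X1 + X2"
   proof -
   have "c * kp^2 * bt = C1 / m * (kp^2 * d0)" by (simp add: c_def bt_def)
   also have "... <= C1 / m * m" using kp2(3) C1 m by (intro mult_left_mono) auto
   finally have "c * kp^2 * bt * (kp^2 * rr s) <= C1 * (kp^2 * rr s)"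
   using m rr0 by (intro mult_right_mono) auto
   hence "c * kp^2 * (bt * kp^2 * rr s) <= X2" by (simp add: X2_def mult_ac)
   moreover have "c * kp^2 * (cmod (z s))^2 = d0 / 2 * X1" by (simp add: c_def X1_def)
   moreover have "c * kp^2 * W s = c * kp^2 * (cmod (z s))^2 + c * kp^2 * (bt * kp^2 * rr s)"
   by (simp add: W_def distrib_left)
   ultimately show ?thesis by linarith
   qed
   have "M1 * dl = 4 * K * (2 * K * M + P) * dl + bt * 1 * (2 * M * dl)"
   by (simp add: M1_def P_def algebra_simps)
   hence "D s + bt * kp^2 * rr' s <= - (c * kp^2 * W s) + X3 + M1 * dl"
   using e0 e1 e2 by linarith
   thus "D s + bt * kp^2 * rr' s <= - (c * kp^2) * W s + bt * C2 * kp ^ 4 * P^2 * exp (- (c / 2 * kp^2) * s) + M1 * dl"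
   by (simp add: X3_def)
  qed
  also have "exp (- (c * kp^2) * t) * W 0 <= Q t * (bt * kp^2 * Z^2)"
  proof (rule mult_mono)
   show "exp (- (c * kp^2) * t) <= Q t" unfolding Q_def using c t by (simp add: mult_right_mono)
   show "W 0 <= bt * kp^2 * Z^2" using En0 bt z0 unfolding W_def En_def
   by (auto intro!: mult_left_mono order_trans[OF _ En0(1)] simp: En_def)
  qed (use bt rr0 in "auto simp: Q_def W_def")
  also have "bt * C2 * kp ^ 4 * P^2 / (c * kp^2 - c / 2 * kp^2) * exp (- (c / 2 * kp^2) * t)
   = (8 * bt * C2 * K^2 / c) * kp^2 * Z^2 * Q t"
   using c by (cases "kp = 0") (auto simp: Q_def P_def field_simps power2_eq_square power4_eq_xxxx)
  also have "M1 * dl * t * exp (max 0 (- (c * kp^2)) * t) <= M1 * dl * T"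
  proof -
   have "max 0 (- (c * kp^2)) = 0" using c by simp
   thus ?thesis using t M1 dl by (simp add: mult_left_mono)
  qed
  finally have "W t <= C4 * kp^2 * Z^2 * Q t + M1 * T * dl"
   by (simp add: C4_def algebra_simps)
  moreover have "(cmod (z t))^2 <= W t" using bt rr0 by (simp add: W_def)
  ultimately show ?thesis by simp
 qed
 \<comment> \<open>Gronwall's inequality once more, now at the fixed rate \<open>m\<close>, with the
   squares of \<open>z\<close> and \<open>p\<close> as a source whose decay is already
   known.\<close>
 have rr_T: "rr T <= exp (- m * T) * Z^2 + C5 * kp^2 * Z^2 * Q T + M2 * T * dl"
 proof -
  have "rr T <= exp (- m * T) * rr 0
   + kp^2 * (C2 * (C4 + 4 * K^2)) * Z^2 / (m - c / 2 * kp^2) * exp (- (c / 2 * kp^2) * T)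
   + M2 * dl * T * exp (max 0 (- m) * T)"
  proof (rule gronwall_exp[OF T cont(3) rr'])
   show "0 <= kp^2 * (C2 * (C4 + 4 * K^2)) * Z^2" "0 <= M2 * dl" using C2 C4 M2 dl by auto
   have "c / 2 * kp^2 < m" using kp2(3) m unfolding c_def by (simp add: mult.commute)
   thus "kp^2 * (C2 * (C4 + 4 * K^2)) * Z^2 = 0 \<or> c / 2 * kp^2 < m" ..
   fix s assume s: "0 < s" "s < T"
   have "(cmod (z s))^2 + (cmod (p s))^2 <= (C4 * kp^2 * Z^2 * Q s + M1 * T * dl) + P^2 * Q s"
   using zW[of s] p2[of s] s by (intro add_mono) auto
   also have "... <= (C4 * 1 * Z^2 * Q s + M1 * T * dl) + P^2 * Q s"
   using kp1 C4 by (intro add_right_mono mult_right_mono mult_left_mono) (auto simp: abs_square_le_1 Q_def)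
   also have "... = (C4 + 4 * K^2) * Z^2 * Q s + M1 * T * dl"
   by (simp add: P_def algebra_simps power_mult_distrib)
   finally have "kp^2 * C2 * ((cmod (z s))^2 + (cmod (p s))^2) <= kp^2 * C2 * ((C4 + 4 * K^2) * Z^2 * Q s + M1 * T * dl)"
   using C2 by (intro mult_left_mono) auto
   moreover have "kp^2 * (C2 * (M1 * T * dl)) <= 1 * (C2 * (M1 * T * dl))"
   using kp1 C2 M1 T dl by (intro mult_right_mono) (auto simp: abs_square_le_1)
   ultimately show "rr' s <= - m * rr s + kp^2 * (C2 * (C4 + 4 * K^2)) * Z^2 * exp (- (c / 2 * kp^2) * s) + M2 * dl"
   using rr'_le'[OF s] by (simp add: Q_def M2_def algebra_simps)
  qed
  also have "exp (- m * T) * rr 0 <= exp (- m * T) * Z^2"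
   using En0(1) unfolding En_def by (intro mult_left_mono) (auto intro: order_trans[rotated])
  also have "kp^2 * (C2 * (C4 + 4 * K^2)) * Z^2 / (m - c / 2 * kp^2) * exp (- (c / 2 * kp^2) * T)
   <= kp^2 * (C2 * (C4 + 4 * K^2)) * Z^2 / (m / 2) * Q T"
  proof -
   have "m / 2 <= m - c / 2 * kp^2" using kp2(3) m unfolding c_def by (simp add: mult.commute)
   thus ?thesis unfolding Q_def using C2 C4 m
   by (intro mult_right_mono divide_left_mono) auto
  qed
  also have "... = C5 * kp^2 * Z^2 * Q T" using m by (simp add: C5_def)
  also have "M2 * dl * T * exp (max 0 (- m) * T) = M2 * T * dl" using m by (simp add: max_def)
  finally show ?thesis by simp
 qed
 \<comment> \<open>The way back from \<open>aa\<close> to \<open>a\<close>: both corrections are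
   \<open>kp\<close> times a value of \<open>b\<close>, which the remainder bounds.\<close>
 define w1 where "w1 = \<i> * of_real kp * b T"
 define w2 where "w2 = of_real (exp (- lam * T)) * (\<i> * of_real kp * b 0)"
 have dec: "a T - of_real (exp (- lam * T)) * a 0 = z T + w1 - w2"
  by (simp add: z_def p_def aa_def w1_def w2_def algebra_simps)
 have tri: "(cmod (x + y - w))^2 <= 3 * ((cmod x)^2 + (cmod y)^2 + (cmod w)^2)" for x y w :: complex
 proof -
  have "(cmod (x + y - w))^2 <= (cmod x + cmod y + cmod w)^2"
   using norm_triangle_ineq4[of "x + y" w] norm_triangle_ineq[of x y] by (intro power_mono) auto
  also have "... <= 3 * ((cmod x)^2 + (cmod y)^2 + (cmod w)^2)"
   using sum_squares_bound[of "cmod x" "cmod y"] sum_squares_bound[of "cmod x" "cmod w"] sum_squares_bound[of "cmod y" "cmod w"]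
   by (simp add: power2_eq_square algebra_simps)
  finally show ?thesis .
 qed
 have w1: "(cmod w1)^2 <= K^2 * rr T"
  using power_mono[OF bR'[of T], of 2] rr0 by (simp add: w1_def power_mult_distrib)
 have w2: "(cmod w2)^2 <= 2 * K^2 * Z^2 * (kp^2 * Q T)"
 proof -
  have "sqrt (rr 0) <= Z" using En0Z rho_le_En[of 0] by linarith
  hence "cmod (\<i> * of_real kp * b 0) <= abs kp * (K * Z)"
   using bR[of 0] K by (meson abs_ge_zero mult_left_mono order_trans zero_le_one)
  moreover have "exp (- lam * T) <= exp (- (kp^2 * d0) * T)"
  proof -
   have "kp^2 * d0 <= lam" using d0 by (simp add: lam_def add_increasing mult_left_mono)
   thus ?thesis using T by (simp add: mult_right_mono)
  qed
  ultimately have "cmod w2 <= exp (- (kp^2 * d0) * T) * (abs kp * (K * Z))"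
   unfolding w2_def norm_mult[of "of_real (exp (- lam * T))"] by (intro mult_mono) auto
  hence "(cmod w2)^2 <= (exp (- (kp^2 * d0) * T) * (abs kp * (K * Z)))^2" by (intro power_mono) auto
  also have "... = exp (- (2 * (kp^2 * d0)) * T) * (kp^2 * (K^2 * Z^2))"
   by (simp add: power_mult_distrib flip: exp_of_nat_mult)
  also have "... <= Q T * (kp^2 * (K^2 * Z^2))"
  proof -
   have "(c / 2 * kp^2) * T <= (2 * (kp^2 * d0)) * T" using d0 T by (intro mult_right_mono) (auto simp: c_def)
   thus ?thesis unfolding Q_def by (intro mult_right_mono) auto
  qed
  also have "... <= 2 * (Q T * (kp^2 * (K^2 * Z^2)))" by (simp add: Q_def)
  finally show ?thesis by (simp add: mult_ac)
 qed
 define X where "X = kp^2 * Q T"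
 define Y where "Y = exp (- m * T)"
 have XY: "0 <= X" "0 <= Y" by (auto simp: X_def Y_def Q_def)
 have "(cmod (a T - of_real (exp (- lam * T)) * a 0))^2 + rr T
   <= 3 * ((C4 * Z^2 * X + M1 * T * dl) + K^2 * rr T + 2 * K^2 * Z^2 * X) + rr T"
  unfolding dec using tri[of "z T" w1 w2] zW[OF T order_refl] w1 w2 by (simp add: X_def mult_ac)
 also have "... = (3 * C4 + 6 * K^2) * Z^2 * X + (3 * K^2 + 1) * rr T + 3 * M1 * T * dl"
  by (simp add: algebra_simps)
 finally have s1: "(cmod (a T - of_real (exp (- lam * T)) * a 0))^2 + rr T
   <= (3 * C4 + 6 * K^2) * Z^2 * X + (3 * K^2 + 1) * rr T + 3 * M1 * T * dl" .
 have s2: "(3 * K^2 + 1) * rr T <= (3 * K^2 + 1) * (Y * Z^2 + C5 * Z^2 * X + M2 * T * dl)"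
  using rr_T by (intro mult_left_mono) (auto simp: X_def Y_def mult_ac)
 have s3: "(3 * C4 + 6 * K^2) * Z^2 * X + (3 * K^2 + 1) * (Y * Z^2 + C5 * Z^2 * X + M2 * T * dl) + 3 * M1 * T * dl
   <= (3 * C4 + 6 * K^2 + (3 * K^2 + 1) * (C5 + 1)) * Z^2 * (X + Y) + (3 * M1 + (3 * K^2 + 1) * M2) * T * dl"
 proof -
  have "0 <= (3 * C4 + 6 * K^2) * (Z^2 * Y)" "0 <= (3 * K^2 + 1) * (C5 * (Z^2 * Y))" "0 <= (3 * K^2 + 1) * (Z^2 * X)"
   using C4 C5 XY by auto
  thus ?thesis by (simp add: algebra_simps)
 qed
 have "(cmod (a T - of_real (exp (- lam * T)) * a 0))^2 + rr T
   <= (3 * C4 + 6 * K^2 + (3 * K^2 + 1) * (C5 + 1)) * Z^2 * (X + Y) + (3 * M1 + (3 * K^2 + 1) * M2) * T * dl"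
  using s1 s2 s3 by linarith
 thus ?thesis unfolding lam_def X_def Y_def Q_def .
qed

end

context taylor_system begin

text \<open>The mean obeys a scalar equation solved by the exponential up to the forcing, so its
  deviation grows only through \<open>dl\<close>; the remainder decays by itself.\<close>

lemma decoupled:
 assumes h0: "!!s. h s = 0"
  and M: "!!s. 0 <= s ==> s <= T ==> En s <= M^2" "0 <= M"
 shows "(cmod (a T - of_real (exp (- (k^2) * T)) * a 0))^2 + rr T <= exp (- m * T) * En 0 + 6 * M * T * dl"
proof -
 define p where "p s = of_real (exp (- (k^2) * s)) * a 0" for s
 define z where "z s = a s - p s" for s
 have EM: "sqrt (En s) <= M" if "0 <= s" "s <= T" for s using M that by (intro real_le_lsqrt) auto
 have aM: "cmod (a s) <= M" "sqrt (rr s) <= M" if "0 <= s" "s <= T" for s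
  using EM[OF that] a_le_En[of s] rho_le_En[of s] by linarith+
 have zM: "cmod (z s) <= 2 * M" if "0 <= s" "s <= T" for s
 proof -
  have "cmod (p s) <= 1 * M"
   unfolding p_def norm_mult using aM(1)[of 0] T that by (intro mult_mono) (auto simp: mult_nonneg_nonneg)
  thus ?thesis using norm_triangle_ineq4[of "a s" "p s"] aM(1)[OF that] unfolding z_def by linarith
 qed
 have zder: "\<exists>D. ((%s. (cmod (z s))^2) has_real_derivative D) (at s) \<and> D <= 4 * M * dl" if s: "0 < s" "s < T" for s
 proof -
  have "((%s. exp (- (k^2) * s)) has_real_derivative - (k^2) * exp (- (k^2) * s)) (at s)"
   by (auto intro!: derivative_eq_intros)
  from has_vector_derivative_mult_left[OF has_vector_derivative_of_real[OF this], of "a 0"]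
  have "(p has_vector_derivative - of_real (k^2) * p s) (at s)"
   unfolding p_def[abs_def] by (simp add: mult_ac)
  from has_vector_derivative_diff[OF a'[OF s] this]
  have "(z has_vector_derivative (- of_real (k^2) * z s + f0 s)) (at s)"
   unfolding z_def[abs_def] by (simp add: h0 algebra_simps)
  from has_real_derivative_cmod_squared[OF this]
  have D: "((%s. (cmod (z s))^2) has_real_derivative 2 * Re (cnj (z s) * (- of_real (k^2) * z s + f0 s))) (at s)" .
  have "Re (cnj (z s) * (- of_real (k^2) * z s + f0 s)) = - (k^2) * (cmod (z s))^2 + Re (cnj (z s) * f0 s)"
   unfolding cmod_power2 by (simp add: algebra_simps power2_eq_square)
  moreover have "Re (cnj (z s) * f0 s) <= (2 * M) * dl"
  proof -
   have "Re (cnj (z s) * f0 s) <= cmod (z s) * cmod (f0 s)"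
   using complex_Re_le_cmod[of "cnj (z s) * f0 s"] by (simp add: norm_mult)
   also have "... <= (2 * M) * dl" using zM[of s] f0[OF s] s M by (intro mult_mono) auto
   finally show ?thesis .
  qed
  moreover have "0 <= k^2 * (cmod (z s))^2" by simp
  ultimately have "2 * Re (cnj (z s) * (- of_real (k^2) * z s + f0 s)) <= 4 * M * dl" by linarith
  with D show ?thesis by blast
 qed
 then obtain D where D: "!!s. 0 < s ==> s < T ==> ((%s. (cmod (z s))^2) has_real_derivative D s) (at s)"
   "!!s. 0 < s ==> s < T ==> D s <= 4 * M * dl" by metis
 have "continuous_on {0..T} (%s. (cmod (z s))^2)" unfolding z_def p_def by (intro continuous_intros cont)
 from gronwall_exp[OF T this D(1), where \<alpha>=0 and B=0 and \<gamma>=0 and G="4 * M * dl"]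
 have "(cmod (z T))^2 <= 4 * M * dl * T" using D(2) M(2) dl by (simp add: z_def p_def)
 moreover have "rr T <= exp (- m * T) * rr 0 + 2 * M * dl * T"
 proof -
  have le: "rr' s <= - m * rr s + 2 * M * dl" if s: "0 < s" "s < T" for s
  proof -
   have "0 <= k^2 * rr s" "0 <= m * rr s" using rr0 m by auto
   moreover have "2 * dl * sqrt (rr s) <= 2 * dl * M" using aM(2) s dl by (intro mult_left_mono) auto
   ultimately show ?thesis using rr'_le[OF s] by (simp add: h0 algebra_simps)
  qed
  from gronwall_exp[OF T cont(3) rr', where \<alpha>=m and B=0 and \<gamma>=0 and G="2 * M * dl"]
  show ?thesis using le M(2) dl m by (simp add: max_def)
 qed
 moreover have "exp (- m * T) * rr 0 <= exp (- m * T) * En 0" by (intro mult_left_mono) (auto simp: En_def)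
 moreover have "6 * M * T * dl = 4 * M * dl * T + 2 * M * dl * T" by simp
 ultimately show ?thesis unfolding z_def p_def by linarith
qed

end

section \<open>Galerkin truncations as instances of the reduced system\<close>

lemma cmod_sum_mult_le:
 fixes f :: "'i => real" and g :: "'i => complex"
 shows "cmod (\<Sum>i\<in>A. of_real (f i) * g i) <= sqrt (\<Sum>i\<in>A. (f i)^2) * sqrt (\<Sum>i\<in>A. (cmod (g i))^2)"
proof -
 have "cmod (\<Sum>i\<in>A. of_real (f i) * g i) <= (\<Sum>i\<in>A. \<bar>f i\<bar> * \<bar>cmod (g i)\<bar>)"
  by (rule order_trans[OF norm_sum]) (simp add: norm_mult)
 also have "... <= sqrt (\<Sum>i\<in>A. (f i)^2) * sqrt (\<Sum>i\<in>A. (cmod (g i))^2)"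
  using L2_set_mult_ineq[of f "%i. cmod (g i)" A] by (simp add: L2_set_def)
 finally show ?thesis .
qed

text \<open>\<open>M\<close> stands for the matrix of multiplication by the profile;
  \<open>MK\<close> bounds its operator norm independently of \<open>N\<close>. \<open>f\<close>
  collects commutators and the effect of truncation. The equation is required only inside the
  interval, because solutions are classical for positive times only; continuity carries the
  estimates to the endpoints.\<close>

locale galerkin_modes =
 fixes N :: nat and M :: "nat => nat => real" and mu :: "nat => real" and z f :: "nat => real => complex"
  and kp k dl T K m :: real
 assumes N: "0 < N" and sym: "!!i j. M i j = M j i" and M00: "M 0 0 = 0" and mu0: "mu 0 = 0"
  and mu: "!!n. 0 < n ==> m <= mu n" and m: "0 < m" and K: "1 <= K"
  and MK: "!!v. (\<Sum>i<N. (\<Sum>j<N. M i j * v j)^2) <= K^2 * (\<Sum>j<N. (v j)^2)"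
  and dl: "0 <= dl" and T: "0 <= T"
  and cont: "!!n. continuous_on {0..T} (z n)"
  and ode: "!!n s. n < N ==> 0 < s ==> s < T ==>
   (z n has_vector_derivative (- of_real (mu n + k^2) * z n s
   - \<i> * of_real kp * (\<Sum>j<N. of_real (M n j) * z j s) + f n s)) (at s)"
  and f: "!!s. 0 < s ==> s < T ==> (\<Sum>n<N. (cmod (f n s))^2) <= dl^2"
begin

definition I where "I = {1..<N}"

lemma lessThan_I: "{..<N} = insert 0 I" "0 \<notin> I" "finite I" using N by (auto simp: I_def)

lemma sum_lessThan_I: "(\<Sum>n<N. F n) = F 0 + (\<Sum>n\<in>I. F n)" for F :: "nat => 'x::comm_monoid_add"
 unfolding lessThan_I(1) using lessThan_I by simp

definition dN where "dN = (\<Sum>n\<in>I. (M 0 n)^2 / mu n)"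
definition et where "et n = M 0 n / mu n"
definition hN where "hN s = (\<Sum>n\<in>I. of_real (M 0 n) * z n s)"
definition bN where "bN s = (\<Sum>n\<in>I. of_real (et n) * z n s)"
definition eN where "eN s = (\<Sum>j\<in>I. of_real (\<Sum>n\<in>I. M j n * et n) * z j s)"
definition rr_N where "rr_N s = (\<Sum>n\<in>I. (cmod (z n s))^2)"

lemma mu_pos: "n \<in> I ==> 0 < mu n" using mu[of n] m by (auto simp: I_def)

text \<open>\<open>MK\<close> applied to the zeroth unit vector bounds the zeroth column, which by
  symmetry is the zeroth row.\<close>

lemma M0_bound: "(\<Sum>n\<in>I. (M 0 n)^2) <= K^2"
proof -
 have "(\<Sum>i<N. (\<Sum>j<N. M i j * of_bool (j = 0))^2) <= K^2 * (\<Sum>j<N. (of_bool (j = 0))^2)" by (rule MK)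
 moreover have "(\<Sum>j<N. M i j * of_bool (j = 0)) = M i 0" for i
  unfolding sum_lessThan_I using lessThan_I(2) by (subst sum.neutral) auto
 moreover have "(\<Sum>j<N. (of_bool (j = 0))^2) = (1::real)"
  unfolding sum_lessThan_I by (subst sum.neutral) (auto simp: I_def)
 moreover have "(\<Sum>n\<in>I. (M 0 n)^2) <= (\<Sum>i<N. (M i 0)^2)"
 proof -
  have "(\<Sum>n\<in>I. (M 0 n)^2) = (\<Sum>n\<in>I. (M n 0)^2)" by (intro sum.cong refl) (metis sym)
  thus ?thesis unfolding sum_lessThan_I[of "%i. (M i 0)^2"] by simp
 qed
 ultimately show ?thesis by simp
qed

lemma et_bound: "(\<Sum>n\<in>I. (et n)^2) <= (K / m)^2"
proof -
 have "(\<Sum>n\<in>I. (et n)^2) <= (\<Sum>n\<in>I. (M 0 n)^2 / m^2)"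
 proof (rule sum_mono)
  fix n assume "n \<in> I"
  hence "m <= mu n" using mu by (simp add: I_def)
  hence "m^2 <= (mu n)^2" using m by (intro power_mono) auto
  thus "(et n)^2 <= (M 0 n)^2 / m^2"
   unfolding et_def power_divide using m by (intro divide_left_mono mult_pos_pos) auto
 qed
 also have "... <= K^2 / m^2" unfolding sum_divide_distrib[symmetric] by (intro divide_right_mono M0_bound) auto
 finally show ?thesis by (simp add: power_divide)
qed

text \<open>One constant that dominates \<open>K\<close> for \<open>hN\<close>, \<open>K / m\<close>
  for \<open>bN\<close>, and \<open>K^2 / m\<close> for \<open>eN\<close> and
  \<open>dN\<close>.\<close>

definition Khat where "Khat = K * (1 + K / m)"

lemma Khat: "K <= Khat" "K / m <= Khat" "K^2 / m <= Khat" "1 <= Khat"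
proof -
 have 1: "K <= K^2" using K by (simp add: power2_eq_square)
 hence 2: "K / m <= K^2 / m" using m by (simp add: divide_right_mono)
 have 3: "Khat = K + K^2 / m" by (simp add: Khat_def power2_eq_square algebra_simps)
 have "0 <= K / m" "0 <= K^2 / m" using m K by auto
 thus "K <= Khat" "K / m <= Khat" "K^2 / m <= Khat" "1 <= Khat" using 2 3 K by linarith+
qed

lemma dN_nonneg: "0 <= dN" unfolding dN_def using mu_pos by (intro sum_nonneg) (auto intro!: divide_nonneg_pos)

lemma dN_le: "dN <= K^2 / m"
proof -
 have "dN <= (\<Sum>n\<in>I. (M 0 n)^2 / m)"
  unfolding dN_def using mu_pos mu m by (intro sum_mono divide_left_mono mult_pos_pos) (auto simp: I_def)
 also have "... <= K^2 / m" unfolding sum_divide_distrib[symmetric] using m by (intro divide_right_mono M0_bound) auto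
 finally show ?thesis .
qed

lemma rr_N_nonneg: "0 <= rr_N s" unfolding rr_N_def by (intro sum_nonneg) auto

lemma f_bound: assumes s: "0 < s" "s < T" shows "cmod (f 0 s) <= dl" "sqrt (\<Sum>n\<in>I. (cmod (f n s))^2) <= dl"
proof -
 have "(cmod (f 0 s))^2 + (\<Sum>n\<in>I. (cmod (f n s))^2) <= dl^2" using f[OF s] unfolding sum_lessThan_I .
 moreover have "0 <= (\<Sum>n\<in>I. (cmod (f n s))^2)" by (intro sum_nonneg) auto
 ultimately have "(cmod (f 0 s))^2 <= dl^2" "(\<Sum>n\<in>I. (cmod (f n s))^2) <= dl^2"
  by (smt (verit) zero_le_power2)+
 thus "cmod (f 0 s) <= dl" "sqrt (\<Sum>n\<in>I. (cmod (f n s))^2) <= dl"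
  using dl by (auto intro: power2_le_imp_le real_le_lsqrt)
qed

text \<open>The weights \<open>et n = M 0 n / mu n\<close> are chosen so that the damping of the
  single modes adds up to exactly \<open>- hN\<close> in the derivative of \<open>bN\<close>; the
  coupling of \<open>bN\<close> to the mean then has the coefficient \<open>dN\<close>, and the
  coupling among the higher modes becomes \<open>eN\<close>.\<close>

lemma taylor: "taylor_system Khat m dN kp k dl T (z 0) bN hN eN (f 0)
  (%s. \<Sum>n\<in>I. of_real (et n) * f n s) rr_N
  (%s. \<Sum>n\<in>I. 2 * Re (cnj (z n s) * (- of_real (mu n + k^2) * z n s
   - \<i> * of_real kp * (\<Sum>j<N. of_real (M n j) * z j s) + f n s)))"
proof
 show "1 <= Khat" "0 < m" "0 <= dN" "0 <= dl" "0 <= T" by (fact Khat m dN_nonneg dl T)+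
 show "dN <= Khat" using dN_le Khat(3) by linarith
 show "continuous_on {0..T} (z 0)" by (rule cont)
 show "continuous_on {0..T} bN" unfolding bN_def by (intro continuous_intros cont)
 show "continuous_on {0..T} rr_N" unfolding rr_N_def by (intro continuous_intros cont)
 show "0 <= rr_N s" for s by (rule rr_N_nonneg)
 show "cmod (hN s) <= Khat * sqrt (rr_N s)" for s
 proof -
  have "cmod (hN s) <= sqrt (\<Sum>n\<in>I. (M 0 n)^2) * sqrt (rr_N s)" unfolding hN_def rr_N_def by (rule cmod_sum_mult_le)
  also have "... <= Khat * sqrt (rr_N s)"
   using Khat(1) K M0_bound rr_N_nonneg by (intro mult_right_mono order_trans[OF real_sqrt_le_mono[OF M0_bound]]) auto
  finally show ?thesis .
 qed
 have et_K: "sqrt (\<Sum>n\<in>I. (et n)^2) <= K / m" using et_bound K m by (intro real_le_lsqrt) auto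
 show "cmod (bN s) <= Khat * sqrt (rr_N s)" for s
 proof -
  have "cmod (bN s) <= sqrt (\<Sum>n\<in>I. (et n)^2) * sqrt (rr_N s)" unfolding bN_def rr_N_def by (rule cmod_sum_mult_le)
  also have "... <= Khat * sqrt (rr_N s)"
   using Khat(2) et_K rr_N_nonneg by (intro mult_right_mono) auto
  finally show ?thesis .
 qed
 have eK: "sqrt (\<Sum>j\<in>I. (\<Sum>n\<in>I. M j n * et n)^2) <= K^2 / m"
 proof -
  define v where "v n = (if n = 0 then 0 else et n)" for n
  have v0: "v 0 = 0" and vI': "n \<in> I ==> v n = et n" for n by (auto simp: v_def I_def)
  have vI: "(\<Sum>n<N. M j n * v n) = (\<Sum>n\<in>I. M j n * et n)" for j
   unfolding sum_lessThan_I by (simp add: v0 vI')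
  have "(\<Sum>n<N. (v n)^2) = (\<Sum>n\<in>I. (et n)^2)"
   unfolding sum_lessThan_I by (simp add: v0 vI')
  hence "(\<Sum>i<N. (\<Sum>n\<in>I. M i n * et n)^2) <= K^2 * (\<Sum>n\<in>I. (et n)^2)"
   using MK[of v] by (simp add: vI)
  moreover have "(\<Sum>j\<in>I. (\<Sum>n\<in>I. M j n * et n)^2) <= (\<Sum>i<N. (\<Sum>n\<in>I. M i n * et n)^2)"
   unfolding sum_lessThan_I[of "%i. (\<Sum>n\<in>I. M i n * et n)^2"] by simp
  moreover have "K^2 * (\<Sum>n\<in>I. (et n)^2) <= K^2 * (K / m)^2" by (intro mult_left_mono et_bound) auto
  ultimately have "(\<Sum>j\<in>I. (\<Sum>n\<in>I. M j n * et n)^2) <= (K^2 / m)^2"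
   by (simp add: power2_eq_square)
  thus ?thesis using m by (intro real_le_lsqrt) auto
 qed
 show "cmod (eN s) <= Khat * sqrt (rr_N s)" for s
 proof -
  have "cmod (eN s) <= sqrt (\<Sum>j\<in>I. (\<Sum>n\<in>I. M j n * et n)^2) * sqrt (rr_N s)" unfolding eN_def rr_N_def by (rule cmod_sum_mult_le)
  also have "... <= Khat * sqrt (rr_N s)"
   using Khat(3) eK rr_N_nonneg by (intro mult_right_mono) auto
  finally show ?thesis .
 qed
 fix s assume s: "0 < s" "s < T"
 show "cmod (f 0 s) <= dl" by (rule f_bound(1)[OF s])
 show "cmod (\<Sum>n\<in>I. of_real (et n) * f n s) <= Khat * dl"
 proof -
  have "cmod (\<Sum>n\<in>I. of_real (et n) * f n s) <= sqrt (\<Sum>n\<in>I. (et n)^2) * sqrt (\<Sum>n\<in>I. (cmod (f n s))^2)" by (rule cmod_sum_mult_le)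
  also have "... <= Khat * dl"
   using Khat et_K f_bound(2)[OF s] by (intro mult_mono) (auto intro: sum_nonneg)
  finally show ?thesis .
 qed
 have nI: "n < N" if "n \<in> I" for n using that by (simp add: I_def)
 show "(z 0 has_vector_derivative - complex_of_real (k^2) * z 0 s - \<i> * complex_of_real kp * hN s + f 0 s) (at s)"
  using ode[OF N s] unfolding sum_lessThan_I by (simp add: mu0 M00 hN_def)
 show "(rr_N has_real_derivative
   (\<Sum>n\<in>I. 2 * Re (cnj (z n s) * (- of_real (mu n + k^2) * z n s
   - \<i> * of_real kp * (\<Sum>j<N. of_real (M n j) * z j s) + f n s)))) (at s)"
  unfolding rr_N_def[abs_def] by (intro DERIV_sum has_real_derivative_cmod_squared ode nI s) assumption
 have split: "(\<Sum>j<N. of_real (M n j) * z j s) = of_real (M 0 n) * z 0 s + (\<Sum>j\<in>I. of_real (M n j) * z j s)" for n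
  unfolding sum_lessThan_I by (simp add: sym[of n 0])
 show "(bN has_vector_derivative
   - hN s - complex_of_real (k^2) * bN s - \<i> * complex_of_real kp * (complex_of_real dN * z 0 s + eN s) +
   (\<Sum>n\<in>I. complex_of_real (et n) * f n s)) (at s)"
 proof -
  have "(bN has_vector_derivative (\<Sum>n\<in>I. of_real (et n) * (- of_real (mu n + k^2) * z n s
   - \<i> * of_real kp * (\<Sum>j<N. of_real (M n j) * z j s) + f n s))) (at s)"
   unfolding bN_def[abs_def] by (intro has_vector_derivative_sum has_vector_derivative_mult_right ode nI s) assumption
  also have "(\<Sum>n\<in>I. of_real (et n) * (- of_real (mu n + k^2) * z n s
   - \<i> * of_real kp * (\<Sum>j<N. of_real (M n j) * z j s) + f n s))
   = - (\<Sum>n\<in>I. of_real (et n * mu n) * z n s) - of_real (k^2) * bN s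
   - \<i> * of_real kp * (of_real (\<Sum>n\<in>I. et n * M 0 n) * z 0 s + (\<Sum>n\<in>I. \<Sum>j\<in>I. of_real (et n * M n j) * z j s))
   + (\<Sum>n\<in>I. of_real (et n) * f n s)"
   unfolding split bN_def of_real_sum sum_distrib_left sum_distrib_right sum.distrib[symmetric] sum_subtractf[symmetric] sum_negf[symmetric]
   by (intro sum.cong refl) (simp add: algebra_simps sum_distrib_left)
  also have "(\<Sum>n\<in>I. of_real (et n * mu n) * z n s) = hN s"
   unfolding hN_def by (intro sum.cong refl) (use mu_pos in "force simp: et_def")
  also have "(\<Sum>n\<in>I. et n * M 0 n) = dN"
   unfolding dN_def by (intro sum.cong refl) (simp add: et_def power2_eq_square)
  also have "(\<Sum>n\<in>I. \<Sum>j\<in>I. of_real (et n * M n j) * z j s) = eN s"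
   unfolding eN_def of_real_sum sum_distrib_right
   by (subst sum.swap, intro sum.cong refl) (simp add: sym mult.commute)
  finally show ?thesis .
 qed
 show "(\<Sum>n\<in>I. 2 * Re (cnj (z n s) * (- of_real (mu n + k^2) * z n s
   - \<i> * of_real kp * (\<Sum>j<N. of_real (M n j) * z j s) + f n s)))
   <= - 2 * (m + k^2) * rr_N s + 2 * kp * Im (z 0 s * cnj (hN s)) + 2 * dl * sqrt (rr_N s)"
 proof -
  \<comment> \<open>The block of \<open>M\<close> on the higher modes is real and symmetric, so this
    form is real. It enters the energy multiplied by \<open>i\<close> and hence contributes
    nothing.\<close>
  define S where "S = (\<Sum>n\<in>I. \<Sum>j\<in>I. of_real (M n j) * (cnj (z n s) * z j s))"
  have "cnj S = (\<Sum>n\<in>I. \<Sum>j\<in>I. of_real (M n j) * (z n s * cnj (z j s)))" by (simp add: S_def)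
  also have "... = S" unfolding S_def
   by (subst sum.swap) (intro sum.cong refl, simp add: sym mult.commute)
  finally have S: "Im S = 0" by (metis Reals_cnj_iff complex_is_Real_iff)
  have summand: "2 * Re (cnj (z n s) * (- of_real (mu n + k^2) * z n s
   - \<i> * of_real kp * (\<Sum>j<N. of_real (M n j) * z j s) + f n s))
   = - 2 * (mu n + k^2) * (cmod (z n s))^2 + 2 * kp * Im (of_real (M 0 n) * (z 0 s * cnj (z n s)))
   + 2 * kp * Im (\<Sum>j\<in>I. of_real (M n j) * (cnj (z n s) * z j s)) + 2 * Re (cnj (z n s) * f n s)" for n
  proof -
   have *: "cnj (z n s) * z n s = of_real ((cmod (z n s))^2)"
   by (metis complex_norm_square mult.commute of_real_power)
   have "cnj (z n s) * (- of_real (mu n + k^2) * z n s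
   - \<i> * of_real kp * (\<Sum>j<N. of_real (M n j) * z j s) + f n s)
   = - of_real (mu n + k^2) * (cnj (z n s) * z n s) - \<i> * of_real kp * (of_real (M 0 n) * (z 0 s * cnj (z n s)))
   - \<i> * of_real kp * (\<Sum>j\<in>I. of_real (M n j) * (cnj (z n s) * z j s)) + cnj (z n s) * f n s"
   unfolding split by (simp add: algebra_simps sum_distrib_left)
   thus ?thesis unfolding * by simp
  qed
  have "(\<Sum>n\<in>I. 2 * Re (cnj (z n s) * (- of_real (mu n + k^2) * z n s
   - \<i> * of_real kp * (\<Sum>j<N. of_real (M n j) * z j s) + f n s)))
   = (\<Sum>n\<in>I. - 2 * (mu n + k^2) * (cmod (z n s))^2) + 2 * kp * Im (z 0 s * cnj (hN s)) + 2 * kp * Im S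
   + 2 * Re (\<Sum>n\<in>I. cnj (z n s) * f n s)"
  proof -
   have 1: "z 0 s * cnj (hN s) = (\<Sum>n\<in>I. of_real (M 0 n) * (z 0 s * cnj (z n s)))"
   by (simp add: hN_def sum_distrib_left mult.left_commute)
   show ?thesis unfolding summand sum.distrib 1 S_def Im_sum Re_sum by (simp add: sum_distrib_left)
  qed
  moreover have "(\<Sum>n\<in>I. - 2 * (mu n + k^2) * (cmod (z n s))^2) <= - 2 * (m + k^2) * rr_N s"
   unfolding rr_N_def sum_distrib_left using mu by (intro sum_mono mult_right_mono) (auto simp: I_def)
  moreover have "Re (\<Sum>n\<in>I. cnj (z n s) * f n s) <= dl * sqrt (rr_N s)"
  proof -
   have "Re (\<Sum>n\<in>I. cnj (z n s) * f n s) <= cmod (\<Sum>n\<in>I. cnj (z n s) * f n s)" by (rule complex_Re_le_cmod)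
   also have "... <= (\<Sum>n\<in>I. \<bar>cmod (z n s)\<bar> * \<bar>cmod (f n s)\<bar>)" by (rule order_trans[OF norm_sum]) (simp add: norm_mult)
   also have "... <= sqrt (rr_N s) * sqrt (\<Sum>n\<in>I. (cmod (f n s))^2)"
   using L2_set_mult_ineq[of "%n. cmod (z n s)" "%n. cmod (f n s)" I] by (simp add: L2_set_def rr_N_def)
   also have "... <= sqrt (rr_N s) * dl" using f_bound(2)[OF s] rr_N_nonneg by (intro mult_left_mono) auto
   finally show ?thesis by (simp add: mult.commute)
  qed
  ultimately show ?thesis using S by simp
 qed
qed

lemma energy_eq: "taylor_system.En (z 0) rr_N s = (\<Sum>n<N. (cmod (z n s))^2)"
 unfolding taylor_system.En_def[OF taylor] sum_lessThan_I rr_N_def by simp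

end

section \<open>Decay constants independent of the truncation\<close>

lemma modes_apriori:
 assumes "galerkin_modes N M mu z f kp k dl T K m"
 shows "(\<Sum>n<N. (cmod (z n T))^2) <= exp T * ((\<Sum>n<N. (cmod (z n 0))^2) + 4 * dl^2 * T)"
proof -
 interpret galerkin_modes N M mu z f kp k dl T K m by fact
 from taylor_system.En_apriori[OF taylor T order_refl]
 show ?thesis unfolding energy_eq .
qed

lemma modes_decoupled:
 assumes "0 <= Z" "0 <= T"
 shows "\<exists>L\<ge>0. \<forall>N M mu z f kp k dl K m. galerkin_modes N M mu z f kp k dl T K m --> (\<forall>n. M 0 n = 0) --> dl <= 1
   --> (\<Sum>n<N. (cmod (z n 0))^2) <= Z^2 -->
   (cmod (z 0 T - of_real (exp (- (k^2) * T)) * z 0 0))\<^sup>2 + (\<Sum>n=1..<N. (cmod (z n T))^2)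
   <= exp (- m * T) * (\<Sum>n<N. (cmod (z n 0))^2) + L * dl"
proof -
 define B where "B = sqrt (exp T * (Z^2 + 4 * T))"
 have B: "0 <= B" "B^2 = exp T * (Z^2 + 4 * T)" using assms by (auto simp: B_def)
 show ?thesis
 proof (intro exI[of _ "6 * B * T"] conjI allI impI)
  show "0 <= 6 * B * T" using B assms by simp
  fix N M mu z f kp k dl K m
  assume gm: "galerkin_modes N M mu z f kp k dl T K m" and M0: "\<forall>n. M 0 n = 0" and dl1: "dl <= 1"
   and Z: "(\<Sum>n<N. (cmod (z n 0))^2) <= Z^2"
  interpret galerkin_modes N M mu z f kp k dl T K m by fact
  interpret ts: taylor_system Khat m dN kp k dl T "z 0" bN hN eN "f 0"
   "%s. \<Sum>n\<in>I. of_real (et n) * f n s" rr_N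
   "%s. \<Sum>n\<in>I. 2 * Re (cnj (z n s) * (- of_real (mu n + k^2) * z n s
   - \<i> * of_real kp * (\<Sum>j<N. of_real (M n j) * z j s) + f n s))" by (rule taylor)
  have "(cmod (z 0 T - of_real (exp (- (k^2) * T)) * z 0 0))^2 + rr_N T <= exp (- m * T) * ts.En 0 + 6 * B * T * dl"
   by (rule ts.decoupled) (use M0 ts.En_bound[OF dl1, of Z] Z B in "auto simp: hN_def energy_eq")
  thus "(cmod (z 0 T - of_real (exp (- (k^2) * T)) * z 0 0))^2 + (\<Sum>n=1..<N. (cmod (z n T))^2)
   <= exp (- m * T) * (\<Sum>n<N. (cmod (z n 0))^2) + 6 * B * T * dl"
   by (simp add: rr_N_def I_def energy_eq)
 qed
qed

text \<open>The order of the quantifiers is the content: \<open>c\<close> is fixed before the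
  frequency, the size of the data and the time, while \<open>L\<close> may depend on these, since
  \<open>dl\<close> will tend to 0 for each choice of them. Neither depends on the truncation, the
  matrix or the modes. The same holds for the prefactor and the threshold in
  \<open>modes_low\<close>.\<close>

lemma modes_high:
 assumes K: "1 <= K" and m: "0 < m" and d0: "0 < d0" and kp0: "0 < kp0"
 shows "\<exists>c>0. \<forall>kp Z T. kp0 <= abs kp --> 0 <= Z --> 0 <= T --> (\<exists>L\<ge>0. \<forall>N M mu z f k dl.
   galerkin_modes N M mu z f kp k dl T K m --> d0 <= (\<Sum>n=1..<N. (M 0 n)^2 / mu n) --> dl <= 1
   --> (\<Sum>n<N. (cmod (z n 0))^2) <= Z^2 -->
   (\<Sum>n<N. (cmod (z n T))^2) <= 3 * exp (- c * T) * (\<Sum>n<N. (cmod (z n 0))^2) + L * dl)"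
proof -
 define Kh where "Kh = K * (1 + K / m)"
 define G where "G = Kh^2 + (Kh * (1 + 1 / kp0))^2 / (2 * d0)"
 have Kh: "1 <= Kh"
 proof -
  have "1 * 1 <= K * (1 + K / m)" using K m by (intro mult_mono) auto
  thus ?thesis by (simp add: Kh_def)
 qed
 have G: "0 < G" unfolding G_def using Kh d0 by (intro add_pos_nonneg) auto
 \<comment> \<open>The largest value that the two upper bounds for \<open>ep\<close> in
   \<open>high_frequency\<close> allow; \<open>G\<close> collects the cross terms.\<close>
 define ep where "ep = min (kp0 / Kh) (m / G)"
 have ep: "0 < ep" using kp0 Kh m G by (simp add: ep_def)
 have e1: "ep * Kh <= kp0"
 proof -
  have "ep <= kp0 / Kh" by (simp add: ep_def)
  thus ?thesis using Kh by (simp add: field_simps)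
 qed
 have e2: "ep * Kh^2 + ep * (Kh * (1 + 1 / kp0))^2 / (2 * d0) <= m"
 proof -
  have "ep <= m / G" by (simp add: ep_def)
  hence "ep * G <= m" using G by (simp add: field_simps)
  thus ?thesis by (simp add: G_def distrib_left)
 qed
 define c where "c = min (2 * m / 3) (ep * d0 / 3)"
 have c: "0 < c" "3 * c <= 2 * m" "3 * c <= ep * d0" using m ep d0 by (auto simp: c_def min_def)
 show ?thesis
 proof (rule exI[of _ c], rule conjI[OF c(1)], intro allI impI)
  fix kp Z T :: real assume kp: "kp0 <= abs kp" and Z0: "0 <= Z" and T0: "0 <= T"
  define B where "B = sqrt (exp T * (Z^2 + 4 * T))"
  have B: "0 <= B" "B^2 = exp T * (Z^2 + 4 * T)" using T0 by (auto simp: B_def)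
  show "\<exists>L\<ge>0. \<forall>N M mu z f k dl.
   galerkin_modes N M mu z f kp k dl T K m --> d0 <= (\<Sum>n=1..<N. (M 0 n)^2 / mu n) --> dl <= 1
   --> (\<Sum>n<N. (cmod (z n 0))^2) <= Z^2 -->
   (\<Sum>n<N. (cmod (z n T))^2) <= 3 * exp (- c * T) * (\<Sum>n<N. (cmod (z n 0))^2) + L * dl"
  proof (intro exI[of _ "2 * (4 + 2 * ep / kp0 * Kh) * B * T"] conjI allI impI)
   show "0 <= 2 * (4 + 2 * ep / kp0 * Kh) * B * T" using ep kp0 Kh B T0 by simp
   fix N M mu z f k dl
   assume gm: "galerkin_modes N M mu z f kp k dl T K m" and dd: "d0 <= (\<Sum>n=1..<N. (M 0 n)^2 / mu n)" and dl1: "dl <= 1"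
   and Z: "(\<Sum>n<N. (cmod (z n 0))^2) <= Z^2"
   interpret galerkin_modes N M mu z f kp k dl T K m by fact
   interpret ts: taylor_system Khat m dN kp k dl T "z 0" bN hN eN "f 0"
   "%s. \<Sum>n\<in>I. of_real (et n) * f n s" rr_N
   "%s. \<Sum>n\<in>I. 2 * Re (cnj (z n s) * (- of_real (mu n + k^2) * z n s
   - \<i> * of_real kp * (\<Sum>j<N. of_real (M n j) * z j s) + f n s))" by (rule taylor)
   have Kheq: "Khat = Kh" by (simp add: Khat_def Kh_def)
   have "ts.En T <= 3 * exp (- c * T) * ts.En 0 + 2 * (4 + 2 * ep / kp0 * Khat) * B * T * dl"
   proof (rule ts.high_frequency[OF d0 _ kp0 kp ep _ _ c])
   show "d0 <= dN" using dd by (simp add: dN_def I_def)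
   show "ts.En s <= B^2" if "0 <= s" "s <= T" for s
   unfolding B by (rule ts.En_bound[OF dl1 _ that]) (simp add: energy_eq Z)
   qed (use e1 e2 B Kheq in auto)
   thus "(\<Sum>n<N. (cmod (z n T))^2)
   <= 3 * exp (- c * T) * (\<Sum>n<N. (cmod (z n 0))^2) + 2 * (4 + 2 * ep / kp0 * Kh) * B * T * dl"
   unfolding energy_eq Kheq .
  qed
 qed
qed

lemma modes_low:
 assumes K: "1 <= K" and m: "0 < m" and d0: "0 < d0"
 shows "\<exists>kp0>0. \<exists>c>0. \<exists>C\<ge>0. \<forall>kp Z T. abs kp <= kp0 --> 0 <= Z --> 0 <= T --> (\<exists>L\<ge>0. \<forall>N M mu z f k dl.
   galerkin_modes N M mu z f kp k dl T K m --> d0 <= (\<Sum>n=1..<N. (M 0 n)^2 / mu n) --> dl <= 1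
   --> (\<Sum>n<N. (cmod (z n 0))^2) <= Z^2 -->
   (cmod (z 0 T - of_real (exp (- (k^2 + kp^2 * (\<Sum>n=1..<N. (M 0 n)^2 / mu n)) * T)) * z 0 0))\<^sup>2
   + (\<Sum>n=1..<N. (cmod (z n T))^2)
   <= C * Z^2 * (kp^2 * exp (- (c * kp^2) * T) + exp (- c * T)) + L * dl)"
proof -
 define Kh where "Kh = K * (1 + K / m)"
 have Kh: "1 <= Kh"
 proof -
  have "1 * 1 <= K * (1 + K / m)" using K m by (intro mult_mono) auto
  thus ?thesis by (simp add: Kh_def)
 qed
 define C1 where "C1 = 4 * Kh ^ 4 / d0"
 define C2 where "C2 = 4 * Kh^2 / m"
 define bt where "bt = 2 * C1 / m"
 define c where "c = d0 / 2"
 define C4 where "C4 = bt + 8 * bt * C2 * Kh^2 / c"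
 define C5 where "C5 = 2 / m * (C2 * (C4 + 4 * Kh^2))"
 define C where "C = 3 * C4 + 6 * Kh^2 + (3 * Kh^2 + 1) * (C5 + 1)"
 define c' where "c' = min (c / 2) m"
 have nn: "0 <= C1" "0 <= C2" "0 <= bt" "0 < c" "0 <= C4" "0 <= C5" "0 <= C" "0 < c'"
  using Kh d0 m by (simp_all add: C1_def C2_def bt_def c_def C4_def C5_def C_def c'_def)
 \<comment> \<open>Four thresholds for \<open>kp^2\<close>: one for \<open>abs kp <= 1\<close> and
   one for each smallness condition of \<open>low_frequency\<close>. The \<open>+ 1\<close> keeps a
   denominator positive.\<close>
 define s0 where "s0 = min 1 (min (m / (4 * Kh^2)) (min (d0 / (2 * (bt * C2 + 1))) (m / d0)))"
 have s0: "0 < s0" using Kh d0 m nn by (simp add: s0_def add_nonneg_pos)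
 show ?thesis
 proof (rule exI[of _ "sqrt s0"], rule conjI, simp add: s0, rule exI[of _ c'], rule conjI[OF nn(8)],
   rule exI[of _ C], rule conjI[OF nn(7)], intro allI impI)
  fix kp Z T :: real assume kp: "abs kp <= sqrt s0" and Z0: "0 <= Z" and T0: "0 <= T"
  have kp_s: "kp^2 <= s0" using kp s0 power_mono[OF kp, of 2] by simp
  have k1: "abs kp <= 1" using kp_s by (auto simp: s0_def abs_square_le_1)
  have k2: "kp^2 * (4 * Kh^2) <= m" "bt * C2 * kp^2 <= d0 / 2" "kp^2 * d0 <= m"
  proof -
   have "kp^2 <= m / (4 * Kh^2)" using kp_s by (simp add: s0_def)
   thus "kp^2 * (4 * Kh^2) <= m" using Kh by (simp add: pos_le_divide_eq)
   have "kp^2 <= d0 / (2 * (bt * C2 + 1))" using kp_s by (simp add: s0_def)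
   hence "kp^2 * (2 * (bt * C2 + 1)) <= d0" using nn by (simp add: pos_le_divide_eq add_nonneg_pos)
   hence "2 * (bt * C2 * kp^2) + 2 * kp^2 <= d0" by (simp add: algebra_simps)
   thus "bt * C2 * kp^2 <= d0 / 2" using zero_le_power2[of kp] by linarith
   have "kp^2 <= m / d0" using kp_s by (simp add: s0_def)
   thus "kp^2 * d0 <= m" using d0 by (simp add: pos_le_divide_eq)
  qed
  define B where "B = sqrt (exp T * (Z^2 + 4 * T))"
  have B: "0 <= B" "B^2 = exp T * (Z^2 + 4 * T)" using T0 by (auto simp: B_def)
  define M1 where "M1 = 4 * Kh * (2 * Kh * B + 2 * Kh * Z) + 2 * bt * B"
  define M2 where "M2 = C2 * M1 * T + 2 * B"
  have L: "0 <= M1" "0 <= M2" using Kh B Z0 nn T0 by (auto simp: M1_def M2_def)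
  show "\<exists>L\<ge>0. \<forall>N M mu z f k dl.
   galerkin_modes N M mu z f kp k dl T K m --> d0 <= (\<Sum>n=1..<N. (M 0 n)^2 / mu n) --> dl <= 1
   --> (\<Sum>n<N. (cmod (z n 0))^2) <= Z^2 -->
   (cmod (z 0 T - of_real (exp (- (k^2 + kp^2 * (\<Sum>n=1..<N. (M 0 n)^2 / mu n)) * T)) * z 0 0))\<^sup>2
   + (\<Sum>n=1..<N. (cmod (z n T))^2)
   <= C * Z^2 * (kp^2 * exp (- (c' * kp^2) * T) + exp (- c' * T)) + L * dl"
  proof (intro exI[of _ "(3 * M1 + (3 * Kh^2 + 1) * M2) * T"] conjI allI impI)
   show "0 <= (3 * M1 + (3 * Kh^2 + 1) * M2) * T" using L T0 by simp
   fix N M mu z f k dl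
   assume gm: "galerkin_modes N M mu z f kp k dl T K m" and dd: "d0 <= (\<Sum>n=1..<N. (M 0 n)^2 / mu n)" and dl1: "dl <= 1"
   and Z: "(\<Sum>n<N. (cmod (z n 0))^2) <= Z^2"
   interpret galerkin_modes N M mu z f kp k dl T K m by fact
   interpret ts: taylor_system Khat m dN kp k dl T "z 0" bN hN eN "f 0"
   "%s. \<Sum>n\<in>I. of_real (et n) * f n s" rr_N
   "%s. \<Sum>n\<in>I. 2 * Re (cnj (z n s) * (- of_real (mu n + k^2) * z n s
   - \<i> * of_real kp * (\<Sum>j<N. of_real (M n j) * z j s) + f n s))" by (rule taylor)
   have Kheq: "Khat = Kh" by (simp add: Khat_def Kh_def)
   have deq: "(\<Sum>n=1..<N. (M 0 n)^2 / mu n) = dN" by (simp add: dN_def I_def)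
   have "(cmod (z 0 T - of_real (exp (- (k^2 + kp^2 * dN) * T)) * z 0 0))^2 + rr_N T
   <= C * Z^2 * (kp^2 * exp (- (c / 2 * kp^2) * T) + exp (- m * T)) + (3 * M1 + (3 * Kh^2 + 1) * M2) * T * dl"
   unfolding C_def M1_def M2_def C5_def C4_def bt_def C1_def C2_def c_def
   proof (rule ts.low_frequency[unfolded Kheq, OF d0 _ k1 _ _ _ _ Z0 _ B(1)])
   show "d0 <= dN" using dd deq by simp
   show "ts.En s <= B^2" if "0 <= s" "s <= T" for s
   unfolding B by (rule ts.En_bound[OF dl1 _ that]) (simp add: energy_eq Z)
   show "ts.En 0 <= Z^2" by (simp add: energy_eq Z)
   qed (use k2 in "simp_all add: bt_def C1_def C2_def")
   moreover have "kp^2 * exp (- (c / 2 * kp^2) * T) + exp (- m * T) <= kp^2 * exp (- (c' * kp^2) * T) + exp (- c' * T)"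
   proof -
   have 1: "c' <= c / 2" "c' <= m" by (auto simp: c'_def)
   hence "c' * kp^2 * T <= c / 2 * kp^2 * T" using T0 by (intro mult_right_mono) auto
   moreover have "c' * T <= m * T" using 1 T0 by (intro mult_right_mono) auto
   ultimately show ?thesis by (intro add_mono mult_left_mono) auto
   qed
   hence "C * Z^2 * (kp^2 * exp (- (c / 2 * kp^2) * T) + exp (- m * T)) <= C * Z^2 * (kp^2 * exp (- (c' * kp^2) * T) + exp (- c' * T))"
   using nn by (intro mult_left_mono) auto
   ultimately show "(cmod (z 0 T - of_real (exp (- (k^2 + kp^2 * (\<Sum>n=1..<N. (M 0 n)^2 / mu n)) * T)) * z 0 0))^2
   + (\<Sum>n=1..<N. (cmod (z n T))^2)
   <= C * Z^2 * (kp^2 * exp (- (c' * kp^2) * T) + exp (- c' * T)) + (3 * M1 + (3 * Kh^2 + 1) * M2) * T * dl"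
   unfolding deq by (simp add: rr_N_def I_def)
  qed
 qed
qed

section \<open>A windowed Plancherel inequality\<close>

lemma (in pair_sigma_finite) integrable_fst_mult_snd:
 fixes f :: "'a => real" and g :: "'b => real"
 assumes f: "integrable M1 f" and g: "integrable M2 g"
 shows "integrable (M1 \<Otimes>\<^sub>M M2) (%p. f (fst p) * g (snd p))"
proof -
 have [measurable]: "f \<in> borel_measurable M1" "g \<in> borel_measurable M2" using f g by auto
 have "integrable (M1 \<Otimes>\<^sub>M M2) (%(x, y). f x * g y)"
  by (rule Fubini_integrable) (use f g in "auto simp: abs_mult")
 thus ?thesis by (simp add: case_prod_unfold)
qed

text \<open>Unnormalized, so Plancherel's identity carries the factor \<open>2 * pi\<close>.\<close>

definition fourier :: "(real => real) => real => complex" where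
 "fourier f k = (CLINT x|lborel. of_real (f x) * iexp (- (k * x)))"

lemma integrable_mult_iexp:
 assumes "integrable lborel f" "g \<in> borel_measurable borel"
 shows "integrable lborel (%x. complex_of_real (f x) * iexp (g x))"
proof (rule LINT_bound[OF assms(1)])
 show "(%x. complex_of_real (f x) * iexp (g x)) \<in> borel_measurable lborel"
  using assms by measurable
qed (auto simp: norm_mult)

lemma cmod_fourier_le: "cmod (fourier f k) <= (LINT x|lborel. \<bar>f x\<bar>)"
 unfolding fourier_def by (rule order_trans[OF integral_norm_bound]) (simp add: norm_mult)

lemma fourier_measurable [measurable]:
 assumes [measurable]: "f \<in> borel_measurable borel"
 shows "fourier f \<in> borel_measurable borel"
 unfolding fourier_def[abs_def] by measurable

lemma fourier_diff:
 assumes "integrable lborel f" "integrable lborel g"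
 shows "fourier (%x. f x - g x) k = fourier f k - fourier g k"
 unfolding fourier_def
 by (subst LINT_diff[symmetric])
   (auto intro!: integrable_mult_iexp assms simp: left_diff_distrib simp del: of_real_minus of_real_mult)

lemma integrable_gaussian: "0 < s ==> integrable lborel (%k::real. exp (- (s^2 * k^2 / 2)))"
proof -
 assume s: "0 < s"
 have "integrable lborel (%k. sqrt (2 * pi * (1 / s)^2) * normal_density 0 (1 / s) k)"
  using s by (intro integrable_mult_right integrable_normal_density) auto
 thus ?thesis using s by (simp add: normal_density_def power_divide mult.commute)
qed

text \<open>The characteristic function of the standard normal distribution, rescaled.\<close>

lemma gaussian_transform:
 assumes s: "0 < s"
 shows "(CLINT k|lborel. of_real (exp (- (s^2 * k^2 / 2))) * iexp (k * w)) = of_real (2 * pi * normal_density 0 s w)"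
proof -
 have std: "(CLINT x|lborel. of_real (exp (- (x^2 / 2))) * iexp (t * x)) = of_real (sqrt (2 * pi) * exp (- (t^2) / 2))" for t
 proof -
  have "of_real (exp (- (t^2) / 2)) = (CLINT x|std_normal_distribution. iexp (t * x))"
   using char_std_normal_distribution by (simp add: char_def fun_eq_iff)
  also have "... = (CLINT x|lborel. std_normal_density x *\<^sub>R iexp (t * x))"
   by (subst integral_density) auto
  also have "... = (CLINT x|lborel. of_real (1 / sqrt (2 * pi)) * (of_real (exp (- (x^2 / 2))) * iexp (t * x)))"
   by (intro LINT_cong refl) (simp add: normal_density_def scaleR_conv_of_real)
  also have "... = of_real (1 / sqrt (2 * pi)) * (CLINT x|lborel. of_real (exp (- (x^2 / 2))) * iexp (t * x))"
   by (rule integral_mult_right_zero)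
  finally show ?thesis by (simp add: field_simps)
 qed
 have "(CLINT x|lborel. of_real (exp (- (x^2 / 2))) * iexp ((w / s) * x))
   = abs s *\<^sub>R (CLINT k|lborel. of_real (exp (- ((0 + s * k)^2 / 2))) * iexp ((w / s) * (0 + s * k)))"
  using s by (intro lborel_integral_real_affine) auto
 also have "... = of_real s * (CLINT k|lborel. of_real (exp (- (s^2 * k^2 / 2))) * iexp (k * w))"
  using s by (simp add: scaleR_conv_of_real power_mult_distrib mult.commute)
 finally have "of_real s * (CLINT k|lborel. of_real (exp (- (s^2 * k^2 / 2))) * iexp (k * w))
   = complex_of_real (sqrt (2 * pi) * exp (- ((w / s)^2) / 2))" unfolding std ..
 hence "(CLINT k|lborel. of_real (exp (- (s^2 * k^2 / 2))) * iexp (k * w)) = complex_of_real (sqrt (2 * pi) * exp (- ((w / s)^2) / 2) / s)"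
  using s by (simp add: field_simps)
 moreover have "sqrt (2 * pi) * exp (- ((w / s)^2) / 2) / s = 2 * pi * normal_density 0 s w"
  using s by (simp add: normal_density_def real_sqrt_mult power_divide field_simps real_sqrt_mult_self)
 ultimately show ?thesis by (simp only:)
qed

text \<open>The transform of an integrable function is in general merely bounded. The Gaussian
  weight makes its square integrable and is removed by letting \<open>s\<close> tend to 0.\<close>

definition smoothed_energy :: "real => (real => real) => real" where
 "smoothed_energy s f = (LINT k|lborel. exp (- (s^2 * k^2 / 2)) * (cmod (fourier f k))^2)"

lemma integrable_smoothed_energy:
 assumes f: "integrable lborel f" and s: "0 < s"
 shows "integrable lborel (%k. exp (- (s^2 * k^2 / 2)) * (cmod (fourier f k))^2)"
proof (rule LINT_bound)
 show "integrable lborel (%k. exp (- (s^2 * k^2 / 2)) * (LINT x|lborel. \<bar>f x\<bar>)^2)"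
  using integrable_gaussian[OF s] by simp
 have [measurable]: "f \<in> borel_measurable borel" using f by simp
 show "(%k. exp (- (s^2 * k^2 / 2)) * (cmod (fourier f k))^2) \<in> borel_measurable lborel" by measurable
 show "AE k in lborel. norm (exp (- (s^2 * k^2 / 2)) * (cmod (fourier f k))^2) <= norm (exp (- (s^2 * k^2 / 2)) * (LINT x|lborel. \<bar>f x\<bar>)^2)"
  using cmod_fourier_le[of f] by (auto intro!: power_mono)
qed

text \<open>The weight makes the integral over the frequency and two copies of the line absolutely
  convergent. The frequency can then be integrated out first, which leaves a normal density of width
  \<open>s\<close> as a convolution kernel.\<close>

lemma smoothed_energy_kernel:
 assumes f: "integrable lborel f" and s: "0 < s"
 shows "smoothed_energy s f = 2 * pi * (LINT p|(lborel \<Otimes>\<^sub>M lborel). f (fst p) * f (snd p) * normal_density 0 s (snd p - fst p))"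
  and "integrable (lborel \<Otimes>\<^sub>M lborel) (%p. f (fst p) * f (snd p) * normal_density 0 s (snd p - fst p))"
proof -
 let ?P = "lborel \<Otimes>\<^sub>M lborel :: (real \<times> real) measure"
 have [measurable]: "f \<in> borel_measurable borel" using f by simp
 have ff: "integrable ?P (%p. f (fst p) * f (snd p))"
  by (rule lborel_pair.integrable_fst_mult_snd[OF f f])
 interpret sf: sigma_finite_measure ?P by (rule lborel_pair.P.sigma_finite_measure_axioms)
 interpret pr: pair_sigma_finite lborel ?P by unfold_locales
 have prod: "of_real ((cmod (fourier f k))^2) = (CLINT p|?P. of_real (f (fst p) * f (snd p)) * iexp (k * (snd p - fst p)))" for k
 proof -
  have int: "integrable ?P (%(x, y). (of_real (f x) * iexp (- (k * x))) * (of_real (f y) * iexp (k * y)))"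
  proof (rule LINT_bound[OF ff])
   show "(%(x, y). (complex_of_real (f x) * iexp (- (k * x))) * (of_real (f y) * iexp (k * y))) \<in> borel_measurable ?P" by measurable
  qed (auto simp: norm_mult)
  have "cnj (fourier f k) = (CLINT x|lborel. of_real (f x) * iexp (k * x))"
   unfolding fourier_def
   by (subst integral_bounded_linear'[OF bounded_linear_cnj bounded_linear_cnj, symmetric]) (simp_all add: exp_cnj)
  moreover have "of_real ((cmod (fourier f k))^2) = fourier f k * cnj (fourier f k)"
   by (metis complex_norm_square of_real_power)
  ultimately have "of_real ((cmod (fourier f k))^2)
   = (CLINT x|lborel. CLINT y|lborel. (of_real (f x) * iexp (- (k * x))) * (of_real (f y) * iexp (k * y)))"
   by (simp add: fourier_def)
  also have "... = (CLINT p|?P. (case p of (x, y) => (of_real (f x) * iexp (- (k * x))) * (of_real (f y) * iexp (k * y))))"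
   using lborel_pair.integral_fst'[OF int] by simp
  also have "... = (CLINT p|?P. of_real (f (fst p) * f (snd p)) * iexp (k * (snd p - fst p)))"
   by (intro LINT_cong refl) (auto simp: algebra_simps simp flip: exp_add)
  finally show ?thesis .
 qed
 let ?h = "%(k, p). of_real (exp (- (s^2 * k^2 / 2))) * (of_real (f (fst p) * f (snd p)) * iexp (k * (snd p - fst p)))"
 have hint: "integrable (lborel \<Otimes>\<^sub>M ?P) ?h"
 proof (rule LINT_bound[OF pr.integrable_fst_mult_snd[OF integrable_gaussian[OF s] ff]])
  show "?h \<in> borel_measurable (lborel \<Otimes>\<^sub>M ?P)" by measurable
 qed (auto simp: norm_mult)
 have swap: "(CLINT p|?P. CLINT k|lborel. ?h (k, p)) = (CLINT k|lborel. CLINT p|?P. ?h (k, p))"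
  using pr.Fubini_integral[of "%k p. ?h (k, p)"] hint by simp
 have inner: "(CLINT k|lborel. ?h (k, p)) = of_real (2 * pi * (f (fst p) * f (snd p) * normal_density 0 s (snd p - fst p)))" for p
 proof -
  have "(CLINT k|lborel. ?h (k, p)) = (CLINT k|lborel. of_real (f (fst p) * f (snd p)) * (of_real (exp (- (s^2 * k^2 / 2))) * iexp (k * (snd p - fst p))))"
   by (simp add: mult_ac)
  also have "... = of_real (f (fst p) * f (snd p)) * (CLINT k|lborel. of_real (exp (- (s^2 * k^2 / 2))) * iexp (k * (snd p - fst p)))"
   by (rule integral_mult_right_zero)
  finally show ?thesis unfolding gaussian_transform[OF s] by simp
 qed
 have J: "integrable ?P (%p. CLINT k|lborel. ?h (k, p))"
  using pr.integrable_snd[of "%k p. ?h (k, p)"] hint by simp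
 have "integrable ?P (%p. 2 * pi * (f (fst p) * f (snd p) * normal_density 0 s (snd p - fst p)))"
  using integrable_Re[OF J[unfolded inner]] by (simp only: Re_complex_of_real)
 note J2 = this
 from integrable_mult_right[OF J2, of "1 / (2 * pi)"]
 show "integrable ?P (%p. f (fst p) * f (snd p) * normal_density 0 s (snd p - fst p))"
  by simp
 have "of_real (smoothed_energy s f) = (CLINT k|lborel. of_real (exp (- (s^2 * k^2 / 2)) * (cmod (fourier f k))^2))"
  unfolding smoothed_energy_def by (rule integral_of_real[symmetric, OF integrable_smoothed_energy[OF f s]])
 also have "... = (CLINT k|lborel. CLINT p|?P. ?h (k, p))"
  by (simp add: prod flip: of_real_power)
 also have "... = (CLINT p|?P. of_real (2 * pi * (f (fst p) * f (snd p) * normal_density 0 s (snd p - fst p))))"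
  unfolding swap[symmetric] inner ..
 also have "... = of_real (LINT p|?P. 2 * pi * (f (fst p) * f (snd p) * normal_density 0 s (snd p - fst p)))"
  by (rule integral_of_real[OF J2])
 finally show "smoothed_energy s f = 2 * pi * (LINT p|?P. f (fst p) * f (snd p) * normal_density 0 s (snd p - fst p))"
  unfolding of_real_eq_iff by simp
qed

text \<open>Schur's test: the kernel is symmetric, nonnegative and of mass 1, and
  \<open>2 * f x * f y <= (f x)^2 + (f y)^2\<close>.\<close>

lemma smoothed_energy_le:
 assumes f: "integrable lborel f" and f2: "integrable lborel (%x. (f x)^2)" and s: "0 < s"
 shows "smoothed_energy s f <= 2 * pi * (LINT x|lborel. (f x)^2)"
proof -
 let ?P = "lborel \<Otimes>\<^sub>M lborel :: (real \<times> real) measure"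
 have [measurable]: "f \<in> borel_measurable borel" using f by simp
 have nd: "normal_density 0 s (y - x) = normal_density x s y" "normal_density 0 s (y - x) = normal_density y s x" for x y
  by (simp_all add: normal_density_def power2_commute)
 let ?g = "%p. (f (fst p))^2 * normal_density 0 s (snd p - fst p)"
 let ?g' = "%p. (f (snd p))^2 * normal_density 0 s (snd p - fst p)"
 have gi: "integrable ?P (%(x, y). (f x)^2 * normal_density 0 s (y - x))"
 proof (rule lborel_pair.Fubini_integrable)
  show "(%(x, y). (f x)^2 * normal_density 0 s (y - x)) \<in> borel_measurable ?P" by measurable
  have "(%x. LINT y|lborel. norm ((f x)^2 * normal_density x s y)) = (%x. (f x)^2)"
   using s by (simp add: integral_normal_density abs_mult)
  thus "integrable lborel (%x. LINT y|lborel. norm (case (x, y) of (x, y) => (f x)\<^sup>2 * normal_density 0 s (y - x)))"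
   using f2 by (simp add: nd(1))
  show "AE x in lborel. integrable lborel (%y. case (x, y) of (x, y) => (f x)\<^sup>2 * normal_density 0 s (y - x))"
   using s by (simp add: nd(1) integrable_normal_density)
 qed
 have g1: "integrable ?P ?g" "integral\<^sup>L ?P ?g = (LINT x|lborel. (f x)^2)"
 proof -
  show "integrable ?P ?g" using gi by (simp add: case_prod_unfold)
  have "integral\<^sup>L ?P ?g = (LINT x|lborel. LINT y|lborel. (f x)^2 * normal_density 0 s (y - x))"
   using lborel_pair.integral_fst'[OF gi] by (simp add: case_prod_unfold)
  thus "integral\<^sup>L ?P ?g = (LINT x|lborel. (f x)^2)" using s by (simp add: nd(1) integral_normal_density)
 qed
 have sw: "normal_density 0 s (fst p - snd p) = normal_density 0 s (snd p - fst p)" for p :: "real \<times> real"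
  by (metis nd)
 have g2: "integrable ?P ?g'" "integral\<^sup>L ?P ?g' = (LINT x|lborel. (f x)^2)"
  using lborel_pair.integrable_product_swap[OF g1(1)] lborel_pair.integral_product_swap[of ?g] g1
  by (simp_all add: case_prod_unfold sw)
 have "(LINT p|?P. f (fst p) * f (snd p) * normal_density 0 s (snd p - fst p)) <= (LINT p|?P. (?g p + ?g' p) / 2)"
 proof (rule integral_mono)
  show "integrable ?P (%p. (?g p + ?g' p) / 2)" using g1 g2 by simp
  show "f (fst p) * f (snd p) * normal_density 0 s (snd p - fst p) <= (?g p + ?g' p) / 2" for p
  proof -
   have "f (fst p) * f (snd p) <= ((f (fst p))^2 + (f (snd p))^2) / 2"
   using sum_squares_bound[of "f (fst p)" "f (snd p)"] by simp
   from mult_right_mono[OF this, of "normal_density 0 s (snd p - fst p)"]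
   show ?thesis by (simp add: algebra_simps)
  qed
 qed (rule smoothed_energy_kernel(2)[OF f s])
 also have "... = (LINT x|lborel. (f x)^2)" using g1 g2 by simp
 finally show ?thesis unfolding smoothed_energy_kernel(1)[OF f s] by simp
qed

text \<open>The normal kernel is an approximate identity. Continuity and boundedness of
  \<open>f\<close> give two dominated limits, one in the kernel variable at fixed \<open>x\<close>
  and one in \<open>x\<close>.\<close>

lemma smoothed_energy_tendsto:
 assumes f: "integrable lborel f" and cont: "continuous_on UNIV f" and bd: "!!x. \<bar>f x\<bar> <= B"
 shows "(%j. smoothed_energy (1 / real (Suc j)) f) ----> 2 * pi * (LINT x|lborel. (f x)^2)"
proof -
 have [measurable]: "f \<in> borel_measurable borel" using f by simp
 let ?s = "%j. 1 / real (Suc j)"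
 have eq: "smoothed_energy s f = 2 * pi * (LINT x|lborel. f x * (LINT z|lborel. std_normal_density z * f (x + s * z)))" if s: "0 < s" for s
 proof -
  have "(LINT p|(lborel \<Otimes>\<^sub>M lborel). f (fst p) * f (snd p) * normal_density 0 s (snd p - fst p))
   = (LINT x|lborel. LINT y|lborel. f x * f y * normal_density 0 s (y - x))"
   using lborel_pair.integral_fst'[OF smoothed_energy_kernel(2)[OF f s]] by simp
  also have "... = (LINT x|lborel. f x * (LINT z|lborel. std_normal_density z * f (x + s * z)))"
  proof (intro LINT_cong refl)
   fix x
   have "(LINT y|lborel. f x * f y * normal_density 0 s (y - x))
   = abs s *\<^sub>R (LINT z|lborel. f x * f (x + s * z) * normal_density 0 s (x + s * z - x))"
   using s by (intro lborel_integral_real_affine) auto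
   also have "... = (LINT z|lborel. s * (f x * f (x + s * z) * normal_density 0 s (s * z)))" using s by simp
   also have "... = (LINT z|lborel. f x * (std_normal_density z * f (x + s * z)))"
   using s by (intro LINT_cong refl)
   (simp add: normal_density_def real_sqrt_mult power_mult_distrib field_simps)
   finally show "(LINT y|lborel. f x * f y * normal_density 0 s (y - x)) = f x * (LINT z|lborel. std_normal_density z * f (x + s * z))"
   by simp
  qed
  finally show ?thesis unfolding smoothed_energy_kernel(1)[OF f s] by simp
 qed
 have s0: "?s ----> 0" by (rule LIMSEQ_inverse_real_of_nat[unfolded inverse_eq_divide])
 have isc: "isCont f x" for x using cont by (simp add: continuous_on_eq_continuous_at)
 have std_int: "integrable lborel (%z. std_normal_density z * B)"
  by (intro integrable_mult_left integrable_normal_density) auto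
 have inner: "(%j. LINT z|lborel. std_normal_density z * f (x + ?s j * z)) ----> f x" for x
 proof -
  have "(%j. LINT z|lborel. std_normal_density z * f (x + ?s j * z)) ----> (LINT z|lborel. std_normal_density z * f x)"
  proof (rule integral_dominated_convergence[OF _ _ std_int])
   show "AE z in lborel. (%j. std_normal_density z * f (x + ?s j * z)) ----> std_normal_density z * f x"
   proof (intro AE_I2 tendsto_mult tendsto_const)
   fix z
   have "(%j. x + ?s j * z) ----> x + 0 * z" by (intro tendsto_intros s0)
   hence "(%j. x + ?s j * z) ----> x" by (simp only: mult_zero_left add_0_right)
   thus "(%j. f (x + ?s j * z)) ----> f x" by (rule isCont_tendsto_compose[OF isc])
   qed
   show "AE z in lborel. norm (std_normal_density z * f (x + ?s j * z)) <= std_normal_density z * B" for j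
   using bd by (auto simp: abs_mult intro!: mult_left_mono)
  qed auto
  thus ?thesis by (simp add: integral_normal_density)
 qed
 have "(%j. LINT x|lborel. f x * (LINT z|lborel. std_normal_density z * f (x + ?s j * z))) ----> (LINT x|lborel. f x * f x)"
 proof (rule integral_dominated_convergence[where w="%x. \<bar>f x\<bar> * B"])
  show "AE x in lborel. (%j. f x * (LINT z|lborel. std_normal_density z * f (x + ?s j * z))) ----> f x * f x"
   by (intro AE_I2 tendsto_mult tendsto_const inner)
  show "AE x in lborel. norm (f x * (LINT z|lborel. std_normal_density z * f (x + ?s j * z))) <= \<bar>f x\<bar> * B" for j
  proof (intro AE_I2)
   fix x
   have "\<bar>LINT z|lborel. std_normal_density z * f (x + ?s j * z)\<bar> <= (LINT z|lborel. std_normal_density z * B)"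
   using bd std_int by (intro order_trans[OF integral_abs_bound] integral_mono')
   (auto simp: abs_mult intro!: mult_left_mono mult_nonneg_nonneg order_trans[OF abs_ge_zero bd])
   thus "norm (f x * (LINT z|lborel. std_normal_density z * f (x + ?s j * z))) <= \<bar>f x\<bar> * B"
   by (simp add: abs_mult integral_normal_density mult_left_mono)
  qed
 qed (use f in auto)
 hence "(%j. 2 * pi * (LINT x|lborel. f x * (LINT z|lborel. std_normal_density z * f (x + ?s j * z)))) ----> 2 * pi * (LINT x|lborel. f x * f x)"
  by (rule tendsto_mult_left)
 thus ?thesis by (simp add: eq power2_eq_square del: of_nat_Suc)
qed

lemma integrable_window_square:
 fixes g c :: "real => real"
 assumes [measurable]: "g \<in> borel_measurable borel" "c \<in> borel_measurable borel"
  and g2: "integrable lborel (%x. (g x)^2)" and c: "!!x. \<bar>c x\<bar> <= 1"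
 shows "integrable lborel (%x. (c x * g x)^2)"
proof (rule LINT_bound[OF g2])
 show "AE x in lborel. norm ((c x * g x)^2) <= norm ((g x)^2)"
 proof (intro AE_I2)
  fix x
  have "(c x)^2 <= 1" using c by (simp add: abs_square_le_1)
  from mult_right_mono[OF this, of "(g x)^2"] show "norm ((c x * g x)^2) <= norm ((g x)^2)"
   by (simp add: power_mult_distrib)
 qed
qed measurable

lemma window_tail_tendsto_0:
 fixes g :: "real => real" and c :: "nat => real => real"
 assumes [measurable]: "g \<in> borel_measurable borel" "!!j. c j \<in> borel_measurable borel"
  and g2: "integrable lborel (%x. (g x)^2)" and c: "!!j x. 0 <= c j x" "!!j x. c j x <= 1"
  and lim: "!!x. (%j. c j x) ----> 1"
 shows "(%j. LINT x|lborel. ((1 - c j x) * g x)^2) ----> 0"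
proof -
 have "(%j. LINT x|lborel. ((1 - c j x) * g x)^2) ----> (LINT x::real|lborel. 0)"
 proof (rule integral_dominated_convergence[where w="%x. (g x)^2"])
  show "AE x in lborel. (%j. ((1 - c j x) * g x)^2) ----> 0"
  proof (intro AE_I2)
   fix x
   have "(%j. ((1 - c j x) * g x)^2) ----> ((1 - 1) * g x)^2" by (intro tendsto_intros lim)
   thus "(%j. ((1 - c j x) * g x)^2) ----> 0" by simp
  qed
  show "AE x in lborel. norm (((1 - c j x) * g x)^2) <= (g x)^2" for j
  proof (intro AE_I2)
   fix x
   have "(1 - c j x)^2 <= 1" using c[of j x] by (simp add: abs_square_le_1)
   from mult_right_mono[OF this, of "(g x)^2"] show "norm (((1 - c j x) * g x)^2) <= (g x)^2"
   by (simp add: power_mult_distrib)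
  qed
 qed (use g2 in auto)
 thus ?thesis by simp
qed

text \<open>No decay of \<open>g\<close> at infinity is known beyond square integrability, so the transforms are taken of
 windowed functions; comparing two windows costs the factor 2.\<close>

lemma windowed_plancherel_bound:
 fixes g :: "nat => real => real" and c :: "nat => real => real"
 assumes gc: "!!n. n < N ==> continuous_on UNIV (g n)" and g2: "!!n. n < N ==> integrable lborel (%x. (g n x)^2)"
  and cc: "!!j. continuous_on UNIV (c j)" and c: "!!j x. 0 <= c j x" "!!j x. c j x <= 1"
  and supp: "!!j x. x \<notin> {- r j..r j} ==> c j x = 0"
  and lim: "!!x. (%j. c j x) ----> 1"
  and Bm: "!!j. B j \<in> borel_measurable borel"
  and Bi: "!!j s. 0 < s ==> integrable lborel (%k. exp (- (s^2 * k^2 / 2)) * B j k)"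
  and Bd: "!!j s. 0 < s ==> (LINT k|lborel. exp (- (s^2 * k^2 / 2)) * B j k) <= Bd"
  and Bnn: "!!j k. 0 <= B j k"
  and Di: "!!s. 0 < s ==> integrable lborel (%k. exp (- (s^2 * k^2 / 2)) * D k)"
  and FD: "!!j k. (\<Sum>n<N. (cmod (fourier (%x. c j x * g n x) k))^2) <= D k"
  and FB: "!!k e. 0 < e ==> EVS j. (\<Sum>n<N. (cmod (fourier (%x. c j x * g n x) k))^2) <= B j k + e"
 shows "pi * (\<Sum>n<N. LINT x|lborel. (g n x)^2) <= Bd"
proof -
 have gm [measurable]: "g n \<in> borel_measurable borel" if "n < N" for n
  using gc[OF that] by (rule borel_measurable_continuous_onI)
 have cm [measurable]: "c j \<in> borel_measurable borel" for j using cc by (rule borel_measurable_continuous_onI)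
 have c1: "\<bar>c j x\<bar> <= 1" for j x using c by (simp add: abs_le_iff order_trans[OF _ c(1)[of j x]])
 define w where "w j n x = c j x * g n x" for j n x
 have wc: "continuous_on UNIV (w j n)" if "n < N" for j n
  unfolding w_def by (intro continuous_intros cc gc that)
 have wm: "w j n \<in> borel_measurable borel" if "n < N" for j n using wc[OF that] by (rule borel_measurable_continuous_onI)
 have wint: "integrable lborel (w j n)" if "n < N" for j n
 proof -
  have "integrable lborel (%x. indicator {- r j..r j} x *\<^sub>R w j n x)"
   using borel_integrable_compact[of "{- r j..r j}" "w j n"] continuous_on_subset[OF wc[OF that]] by (simp add: compact_Icc)
  also have "(%x. indicator {- r j..r j} x *\<^sub>R w j n x) = w j n"
   using supp[of _ j] by (auto simp: fun_eq_iff w_def indicator_def)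
  finally show ?thesis .
 qed
 have wbd: "\<exists>Bw. \<forall>x. \<bar>w j n x\<bar> <= Bw" if "n < N" for j n
 proof -
  have "compact (w j n ` {- r j..r j})" by (intro compact_continuous_image continuous_on_subset[OF wc[OF that]]) auto
  then obtain Bw where Bw: "!!x. x \<in> {- r j..r j} ==> \<bar>w j n x\<bar> <= Bw"
   using compact_imp_bounded by (force simp: bounded_iff)
  have "\<bar>w j n x\<bar> <= max 0 Bw" for x
   using Bw[of x] supp[of x j] by (cases "x \<in> {- r j..r j}") (auto simp: w_def)
  thus ?thesis by blast
 qed
 have w2: "integrable lborel (%x. (w j n x)^2)" if "n < N" for j n
  unfolding w_def by (rule integrable_window_square[OF gm[OF that] cm g2[OF that] c1])
 define Fj where "Fj j k = (\<Sum>n<N. (cmod (fourier (w j n) k))^2)" for j k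
 have Fm: "Fj j \<in> borel_measurable borel" for j
  unfolding Fj_def using wm by (intro borel_measurable_sum) (measurable, auto)
 \<comment> \<open>\<open>B j\<close> varies with \<open>j\<close> and need not converge, so
   dominated convergence is applied to the excess over it, which tends to 0 at each frequency and is
   bounded by \<open>D\<close>.\<close>
 define E where "E j k = max 0 (Fj j k - B j k)" for j k
 define G where "G s k = exp (- (s^2 * k^2 / 2))" for s k :: real
 have G0: "0 <= G s k" for s k by (simp add: G_def)
 have E0: "0 <= E j k" for j k by (simp add: E_def)
 have Elim: "(%j. E j k) ----> 0" for k
 proof (rule LIMSEQ_I)
  fix e :: real assume e: "0 < e"
  have "EVS j. Fj j k <= B j k + e / 2" using FB[of "e / 2" k] e by (simp add: Fj_def w_def[abs_def])
  hence "EVS j. norm (E j k - 0) < e"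
   by eventually_elim (use e in "auto simp: E_def")
  thus "\<exists>no. \<forall>n\<ge>no. norm (E n k - 0) < e" by (simp add: eventually_sequentially)
 qed
 have D0: "0 <= D k" for k
  using FD[of 0 k] by (rule order_trans[rotated]) (intro sum_nonneg, auto)
 have ED: "E j k <= D k" for j k
  using FD[of j k] Bnn[of j k] D0[of k] by (simp add: E_def Fj_def w_def[abs_def])
 have GE: "(%j. LINT k|lborel. G s k * E j k) ----> 0" and GEi: "integrable lborel (%k. G s k * E j k)" if s: "0 < s" for s j
 proof -
  have Em [measurable]: "E j \<in> borel_measurable borel" for j unfolding E_def using Fm Bm by measurable
  have [measurable]: "G s \<in> borel_measurable borel" unfolding G_def by measurable
  have "(%j. LINT k|lborel. G s k * E j k) ----> (LINT k::real|lborel. 0)"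
  proof (rule integral_dominated_convergence[where w="%k. G s k * D k"])
   show "AE k in lborel. (%j. G s k * E j k) ----> 0"
   using tendsto_mult_left[OF Elim] by (intro AE_I2) fastforce
   show "AE k in lborel. norm (G s k * E j k) <= G s k * D k" for j
   using ED G0 by (intro AE_I2) (auto simp: abs_mult E_def intro!: mult_left_mono)
  qed (use Di[OF s] in "auto simp: G_def[abs_def]")
  thus "(%j. LINT k|lborel. G s k * E j k) ----> 0" by simp
  show "integrable lborel (%k. G s k * E j k)"
   by (rule LINT_bound[OF Di[OF s]])
   (use ED G0 D0 Em in "auto simp: abs_mult abs_of_nonneg[OF E0] G_def intro!: mult_left_mono")
 qed
 have sum_smoothed: "(\<Sum>n<N. smoothed_energy s (w j n)) = (LINT k|lborel. G s k * Fj j k)"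
  and GFi: "integrable lborel (%k. G s k * Fj j k)" if s: "0 < s" for s j
 proof -
  show "(\<Sum>n<N. smoothed_energy s (w j n)) = (LINT k|lborel. G s k * Fj j k)"
   unfolding smoothed_energy_def Fj_def sum_distrib_left G_def
   using integrable_smoothed_energy[OF wint s] by (subst LINT_sum) auto
  show "integrable lborel (%k. G s k * Fj j k)"
   unfolding Fj_def sum_distrib_left G_def
   using integrable_smoothed_energy[OF wint s] by (intro Bochner_Integration.integrable_sum) auto
 qed
 have limsup: "EVS j. (\<Sum>n<N. smoothed_energy s (w j n)) <= Bd + e" if s: "0 < s" and e: "0 < e" for s e
 proof -
  have "EVS j. (LINT k|lborel. G s k * E j k) < e"
   using order_tendstoD(2)[OF GE[OF s] e] .
  thus ?thesis
  proof eventually_elim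
   case (elim j)
   have "(LINT k|lborel. G s k * Fj j k) <= (LINT k|lborel. G s k * B j k + G s k * E j k)"
   proof (rule integral_mono[OF GFi[OF s]])
   show "integrable lborel (%k. G s k * B j k + G s k * E j k)" using Bi[OF s] GEi[OF s] by (simp add: G_def)
   show "G s k * Fj j k <= G s k * B j k + G s k * E j k" for k
   unfolding distrib_left[symmetric] using G0 by (intro mult_left_mono) (auto simp: E_def)
   qed
   also have "... = (LINT k|lborel. G s k * B j k) + (LINT k|lborel. G s k * E j k)"
   using Bi[OF s] GEi[OF s] by (intro Bochner_Integration.integral_add) (auto simp: G_def)
   also have "... <= Bd + e" using Bd[OF s, of j] elim by (simp add: G_def)
   finally show ?case using sum_smoothed[OF s] by simp
  qed
 qed
 define ta where "ta j = (\<Sum>n<N. LINT x|lborel. ((1 - c j x) * g n x)^2)" for j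
 have ta_lim: "ta ----> 0"
 proof -
  have "ta ----> (\<Sum>n<N. 0)"
   unfolding ta_def by (intro tendsto_sum window_tail_tendsto_0[OF gm cm g2 c lim]) auto
  thus ?thesis by simp
 qed
 have t2: "integrable lborel (%x. ((1 - c j x) * g n x)^2)" if "n < N" for j n
  by (rule integrable_window_square[OF gm[OF that] _ g2[OF that]]) (use c in "auto simp: abs_le_iff add_increasing2")
 have compare: "(\<Sum>n<N. smoothed_energy s (w j n)) <= 2 * (\<Sum>n<N. smoothed_energy s (w i n)) + 8 * pi * (ta j + ta i)" if s: "0 < s" for s i j
 proof -
  have "smoothed_energy s (w j n) <= 2 * smoothed_energy s (w i n)
   + 8 * pi * ((LINT x|lborel. ((1 - c j x) * g n x)^2) + (LINT x|lborel. ((1 - c i x) * g n x)^2))" if n: "n < N" for n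
  proof -
   define d where "d x = w j n x - w i n x" for x
   have dint: "integrable lborel d" unfolding d_def using wint[OF n] by simp
   have d_le: "(d x)^2 <= 2 * ((1 - c j x) * g n x)^2 + 2 * ((1 - c i x) * g n x)^2" for x
   proof -
   have "d x = (1 - c i x) * g n x - (1 - c j x) * g n x" by (simp add: d_def w_def algebra_simps)
   thus ?thesis using sum_squares_bound[of "(1 - c i x) * g n x" "- ((1 - c j x) * g n x)"]
   by (simp add: power2_diff)
   qed
   have d2: "integrable lborel (%x. (d x)^2)"
   by (rule LINT_bound[where f="%x. 2 * ((1 - c j x) * g n x)^2 + 2 * ((1 - c i x) * g n x)^2"])
   (use t2[OF n] dint d_le in "auto simp: abs_of_nonneg")
   have "(LINT x|lborel. (d x)^2) <= (LINT x|lborel. 2 * ((1 - c j x) * g n x)^2 + 2 * ((1 - c i x) * g n x)^2)"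
   using d2 t2[OF n] d_le by (intro integral_mono) auto
   also have "... = 2 * (LINT x|lborel. ((1 - c j x) * g n x)^2) + 2 * (LINT x|lborel. ((1 - c i x) * g n x)^2)"
   using t2[OF n] by simp
   finally have d3: "(LINT x|lborel. (d x)^2) <= 2 * (LINT x|lborel. ((1 - c j x) * g n x)^2) + 2 * (LINT x|lborel. ((1 - c i x) * g n x)^2)" .
   have pt: "(cmod (fourier (w j n) k))^2 <= 2 * (cmod (fourier (w i n) k))^2 + 2 * (cmod (fourier d k))^2" for k
   proof -
   have "fourier d k = fourier (w j n) k - fourier (w i n) k"
   unfolding d_def[abs_def] by (rule fourier_diff) (use wint n in auto)
   hence "cmod (fourier (w j n) k) <= cmod (fourier (w i n) k) + cmod (fourier d k)"
   by (metis add.commute norm_triangle_sub)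
   hence "(cmod (fourier (w j n) k))^2 <= (cmod (fourier (w i n) k) + cmod (fourier d k))^2" by (intro power_mono) auto
   also have "... <= 2 * (cmod (fourier (w i n) k))^2 + 2 * (cmod (fourier d k))^2"
   using sum_squares_bound[of "cmod (fourier (w i n) k)" "cmod (fourier d k)"] by (simp add: power2_sum)
   finally show ?thesis .
   qed
   have "smoothed_energy s (w j n) <= (LINT k|lborel. 2 * (G s k * (cmod (fourier (w i n) k))^2) + 2 * (G s k * (cmod (fourier d k))^2))"
   unfolding smoothed_energy_def G_def
   proof (rule integral_mono)
   show "exp (- (s^2 * k^2 / 2)) * (cmod (fourier (w j n) k))^2
   <= 2 * (exp (- (s^2 * k^2 / 2)) * (cmod (fourier (w i n) k))^2) + 2 * (exp (- (s^2 * k^2 / 2)) * (cmod (fourier d k))^2)" for k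
   using mult_left_mono[OF pt[of k], of "exp (- (s^2 * k^2 / 2))"] by (simp add: algebra_simps)
   qed (use integrable_smoothed_energy[OF wint[OF n] s] integrable_smoothed_energy[OF dint s] in auto)
   also have "... = 2 * smoothed_energy s (w i n) + 2 * smoothed_energy s d"
   unfolding smoothed_energy_def G_def
   using integrable_smoothed_energy[OF wint[OF n] s] integrable_smoothed_energy[OF dint s] by simp
   also have "smoothed_energy s d <= 2 * pi * (LINT x|lborel. (d x)^2)" by (rule smoothed_energy_le[OF dint d2 s])
   also have "... <= 2 * pi * (2 * (LINT x|lborel. ((1 - c j x) * g n x)^2) + 2 * (LINT x|lborel. ((1 - c i x) * g n x)^2))"
   using d3 by (intro mult_left_mono) auto
   finally show ?thesis by (simp add: algebra_simps)
  qed
  hence "(\<Sum>n<N. smoothed_energy s (w j n)) <= (\<Sum>n<N. 2 * smoothed_energy s (w i n)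
   + 8 * pi * ((LINT x|lborel. ((1 - c j x) * g n x)^2) + (LINT x|lborel. ((1 - c i x) * g n x)^2)))"
   by (intro sum_mono) auto
  thus ?thesis by (simp add: ta_def sum.distrib sum_distrib_left algebra_simps)
 qed
 \<comment> \<open>The eventual bound holds from an index on that depends on \<open>s\<close>.
   Comparing a fixed window \<open>j\<close> with windows \<open>i\<close> that tend to infinity
   turns it into a bound for every \<open>j\<close> and \<open>s\<close>. Only then may
   \<open>s\<close> tend to 0 with \<open>j\<close> fixed, and \<open>j\<close> to infinity at the
   end.\<close>
 have step1: "(\<Sum>n<N. smoothed_energy s (w j n)) <= 2 * Bd + 8 * pi * ta j" if s: "0 < s" for s j
 proof (rule field_le_epsilon)
  fix e :: real assume e: "0 < e"
  have "\<forall>\<^sub>F i in sequentially. (\<Sum>n<N. smoothed_energy s (w i n)) <= Bd + e / 4" using limsup[OF s] e by simp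
  moreover have "\<forall>\<^sub>F i in sequentially. ta i < e / (16 * pi)"
   using order_tendstoD(2)[OF ta_lim, of "e / (16 * pi)"] e by simp
  ultimately have "\<forall>\<^sub>F i in sequentially. (\<Sum>n<N. smoothed_energy s (w i n)) <= Bd + e / 4 \<and> ta i < e / (16 * pi)"
   by (rule eventually_conj)
  then obtain i where i: "(\<Sum>n<N. smoothed_energy s (w i n)) <= Bd + e / 4" "ta i < e / (16 * pi)"
   by (auto simp: eventually_sequentially)
  have "8 * pi * ta i <= 8 * pi * (e / (16 * pi))" using i(2) by (intro mult_left_mono) auto
  hence "8 * pi * ta i <= e / 2" by simp
  thus "(\<Sum>n<N. smoothed_energy s (w j n)) <= 2 * Bd + 8 * pi * ta j + e"
   using compare[OF s, of j i] i(1) by (simp add: algebra_simps)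
 qed
 have step2: "2 * pi * (\<Sum>n<N. LINT x|lborel. (w j n x)^2) <= 2 * Bd + 8 * pi * ta j" for j
 proof (rule LIMSEQ_le_const2)
  have "(%i. \<Sum>n<N. smoothed_energy (1 / real (Suc i)) (w j n)) ----> (\<Sum>n<N. 2 * pi * (LINT x|lborel. (w j n x)^2))"
  proof (rule tendsto_sum)
   fix n assume "n \<in> {..<N}"
   hence n: "n < N" by simp
   obtain Bw where "!!x. \<bar>w j n x\<bar> <= Bw" using wbd[OF n] by blast
   thus "(%i. smoothed_energy (1 / real (Suc i)) (w j n)) ----> 2 * pi * (LINT x|lborel. (w j n x)^2)"
   by (rule smoothed_energy_tendsto[OF wint[OF n] wc[OF n]])
  qed
  thus "(%i. \<Sum>n<N. smoothed_energy (1 / real (Suc i)) (w j n)) ----> 2 * pi * (\<Sum>n<N. LINT x|lborel. (w j n x)^2)"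
   by (simp add: sum_distrib_left)
  show "\<exists>N0. \<forall>i\<ge>N0. (\<Sum>n<N. smoothed_energy (1 / real (Suc i)) (w j n)) <= 2 * Bd + 8 * pi * ta j"
   using step1 by simp
 qed
 have wlim: "(%j. LINT x|lborel. (w j n x)^2) ----> (LINT x|lborel. (g n x)^2)" if n: "n < N" for n
 proof (rule integral_dominated_convergence[where w="%x. (g n x)^2"])
  show "AE x in lborel. (%j. (w j n x)^2) ----> (g n x)^2"
  proof (intro AE_I2)
   fix x
   have "(%j. (c j x * g n x)^2) ----> (1 * g n x)^2" by (intro tendsto_intros lim)
   thus "(%j. (w j n x)^2) ----> (g n x)^2" by (simp add: w_def)
  qed
  show "AE x in lborel. norm ((w j n x)^2) <= (g n x)^2" for j
  proof (intro AE_I2)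
   fix x
   have "(c j x)^2 <= 1" using c1[of j x] by (simp add: abs_square_le_1)
   from mult_right_mono[OF this, of "(g n x)^2"] show "norm ((w j n x)^2) <= (g n x)^2"
   by (simp add: w_def power_mult_distrib)
  qed
 qed (use gm[OF n] wm[OF n] g2[OF n] in auto)
 have "2 * pi * (\<Sum>n<N. LINT x|lborel. (g n x)^2) <= 2 * Bd + 8 * pi * 0"
 proof (rule LIMSEQ_le)
  show "(%j. 2 * pi * (\<Sum>n<N. LINT x|lborel. (w j n x)^2)) ----> 2 * pi * (\<Sum>n<N. LINT x|lborel. (g n x)^2)"
   by (intro tendsto_mult_left tendsto_sum wlim) auto
  show "(%j. 2 * Bd + 8 * pi * ta j) ----> 2 * Bd + 8 * pi * 0" by (intro tendsto_add tendsto_const tendsto_mult_left ta_lim)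
 qed (use step2 in auto)
 thus ?thesis by simp
qed

section \<open>Windowed modes of a solution\<close>

lemma L2_mult_integrable:
 assumes "f \<in> L2 M" "g \<in> L2 M" shows "integrable M (%q. f q * g q)"
proof (rule LINT_bound[where f="%q. (f q)^2 + (g q)^2"])
 show "AE q in M. norm (f q * g q) <= norm ((f q)^2 + (g q)^2)"
 proof (intro AE_I2)
  fix q
  have "2 * (\<bar>f q\<bar> * \<bar>g q\<bar>) <= (f q)^2 + (g q)^2"
   using sum_squares_bound[of "\<bar>f q\<bar>" "\<bar>g q\<bar>"] by (simp add: mult.assoc)
  moreover have "0 <= \<bar>f q\<bar> * \<bar>g q\<bar>" by simp
  ultimately have "\<bar>f q\<bar> * \<bar>g q\<bar> <= (f q)^2 + (g q)^2" by linarith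
  thus "norm (f q * g q) <= norm ((f q)^2 + (g q)^2)" by (simp add: abs_mult)
 qed
qed (use assms in "auto simp: L2_def")

lemma L2_cmult: "f \<in> L2 M ==> (%q. c * f q) \<in> L2 M"
 by (auto simp: L2_def power_mult_distrib)

lemma L2_diff:
 assumes f: "f \<in> L2 M" and g: "g \<in> L2 M" shows "(%q. f q - g q) \<in> L2 M"
proof -
 have "integrable M (%q. (f q)^2 + (g q)^2 - 2 * (f q * g q))"
  using assms L2_mult_integrable[OF f g] by (auto simp: L2_def)
 thus ?thesis using assms by (auto simp: L2_def power2_diff mult.assoc)
qed

lemma L2_sum: "finite I ==> (!!i. i \<in> I ==> f i \<in> L2 M) ==> (%q. \<Sum>i\<in>I. f i q) \<in> L2 M"
proof (induction I rule: finite_induct)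
 case empty
 thus ?case by (simp add: L2_def)
next
 case (insert i I)
 have "(%q. f i q - (-1) * (\<Sum>i\<in>I. f i q)) \<in> L2 M"
  using insert by (intro L2_diff L2_cmult) auto
 thus ?case using insert by simp
qed

text \<open>Pythagoras, one mode at a time. From the equality, nonnegativity of the left side gives
  Bessel's inequality and its convergence to 0 gives Parseval's identity.\<close>

lemma L2_projection_error:
 assumes on: "orthonormal_basis_L2 M ps" and f: "f \<in> L2 M"
 shows "(LINT q|M. (f q - (\<Sum>n<N. L2_inner M f (ps n) * ps n q))^2) = (LINT q|M. (f q)^2) - (\<Sum>n<N. (L2_inner M f (ps n))^2)"
proof (induction N)
 case (Suc N)
 let ?c = "%n. L2_inner M f (ps n)"
 let ?S = "%q. f q - (\<Sum>n<N. ?c n * ps n q)"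
 have ps: "ps n \<in> L2 M" and orth: "L2_inner M (ps m) (ps n) = (if m = n then 1 else 0)" for m n
  using on by (auto simp: orthonormal_basis_L2_def)
 have S: "?S \<in> L2 M" by (intro L2_diff f L2_sum L2_cmult ps) auto
 have int: "integrable M (%q. ?S q * ps N q)" "integrable M (%q. (?S q)^2)" "integrable M (%q. (ps N q)^2)"
  using L2_mult_integrable[OF S ps] S ps by (auto simp: L2_def)
 have ip: "(LINT q|M. ?S q * ps N q) = ?c N"
 proof -
  have "(LINT q|M. ?S q * ps N q) = (LINT q|M. f q * ps N q - (\<Sum>n<N. ?c n * (ps n q * ps N q)))"
   by (simp add: left_diff_distrib sum_distrib_right mult.assoc)
  also have "... = ?c N - (\<Sum>n<N. ?c n * L2_inner M (ps n) (ps N))"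
  proof (subst LINT_diff)
   show "integrable M (%q. f q * ps N q)" by (rule L2_mult_integrable[OF f ps])
   show "integrable M (%q. \<Sum>n<N. ?c n * (ps n q * ps N q))"
   by (rule Bochner_Integration.integrable_sum, rule integrable_mult_right, rule L2_mult_integrable[OF ps ps])
   show "(LINT q|M. f q * ps N q) - (LINT q|M. (\<Sum>n<N. ?c n * (ps n q * ps N q))) = ?c N - (\<Sum>n<N. ?c n * L2_inner M (ps n) (ps N))"
   by (simp add: LINT_sum[OF integrable_mult_right[OF L2_mult_integrable[OF ps ps]]] L2_inner_def)
  qed
  also have "(\<Sum>n<N. ?c n * L2_inner M (ps n) (ps N)) = 0" by (simp add: orth)
  finally show ?thesis by simp
 qed
 have nrm: "(LINT q|M. (ps N q)^2) = 1" using orth[of N N] by (simp add: L2_inner_def power2_eq_square)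
 have "(LINT q|M. (f q - (\<Sum>n<Suc N. ?c n * ps n q))^2) = (LINT q|M. (?S q)^2 - 2 * ?c N * (?S q * ps N q) + (?c N)^2 * (ps N q)^2)"
  by (intro LINT_cong refl) (simp add: power2_eq_square algebra_simps)
 also have "... = (LINT q|M. (?S q)^2) - 2 * ?c N * ?c N + (?c N)^2 * 1"
  using int by (simp add: ip nrm)
 finally show ?case using Suc by (simp add: power2_eq_square)
qed simp

definition L2c :: "'a measure => ('a => complex) => bool" where
 "L2c M F \<longleftrightarrow> F \<in> borel_measurable M \<and> integrable M (%q. (cmod (F q))^2)"

definition coef :: "'a measure => (nat => 'a => real) => ('a => complex) => nat => complex" where
 "coef M ps F n = (CLINT q|M. F q * of_real (ps n q))"

lemma L2c_ReIm:
 assumes "L2c M F" shows "(%q. Re (F q)) \<in> L2 M" "(%q. Im (F q)) \<in> L2 M"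
proof -
 have m: "F \<in> borel_measurable M" and i: "integrable M (%q. (cmod (F q))^2)" using assms by (auto simp: L2c_def)
 have "integrable M (%q. (Re (F q))^2)"
  by (rule LINT_bound[OF i]) (use m in "auto simp: cmod_power2")
 moreover have "integrable M (%q. (Im (F q))^2)"
  by (rule LINT_bound[OF i]) (use m in "auto simp: cmod_power2")
 ultimately show "(%q. Re (F q)) \<in> L2 M" "(%q. Im (F q)) \<in> L2 M" using m by (auto simp: L2_def)
qed

lemma L2cI:
 assumes "(%q. Re (F q)) \<in> L2 M" "(%q. Im (F q)) \<in> L2 M" shows "L2c M F"
proof -
 have "(%q. Complex (Re (F q)) (Im (F q))) \<in> borel_measurable M"
  unfolding Complex_eq using assms by (auto simp: L2_def)
 thus ?thesis using assms by (auto simp: L2c_def L2_def cmod_power2)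
qed

lemma L2c_mult_integrable:
 assumes F: "L2c M F" and g: "g \<in> L2 M" shows "integrable M (%q. F q * complex_of_real (g q))"
proof (rule LINT_bound[where f="%q. (cmod (F q))^2 + (g q)^2"])
 show "AE q in M. norm (F q * complex_of_real (g q)) <= norm ((cmod (F q))^2 + (g q)^2)"
 proof (intro AE_I2)
  fix q
  have "2 * (cmod (F q) * \<bar>g q\<bar>) <= (cmod (F q))^2 + (g q)^2"
   using sum_squares_bound[of "cmod (F q)" "\<bar>g q\<bar>"] by (simp add: mult.assoc)
  moreover have "0 <= cmod (F q) * \<bar>g q\<bar>" by simp
  ultimately have "cmod (F q) * \<bar>g q\<bar> <= (cmod (F q))^2 + (g q)^2" by linarith
  thus "norm (F q * complex_of_real (g q)) <= norm ((cmod (F q))^2 + (g q)^2)" by (simp add: norm_mult)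
 qed
qed (use assms in "auto simp: L2_def L2c_def")

lemma coef_ReIm:
 assumes F: "L2c M F" and ps: "ps n \<in> L2 M"
 shows "Re (coef M ps F n) = L2_inner M (%q. Re (F q)) (ps n)" "Im (coef M ps F n) = L2_inner M (%q. Im (F q)) (ps n)"
proof -
 note i = L2c_mult_integrable[OF F ps]
 have "Re (coef M ps F n) = (LINT q|M. Re (F q * of_real (ps n q)))" unfolding coef_def by (rule integral_Re[OF i, symmetric])
 thus "Re (coef M ps F n) = L2_inner M (%q. Re (F q)) (ps n)" by (simp add: L2_inner_def)
 have "Im (coef M ps F n) = (LINT q|M. Im (F q * of_real (ps n q)))" unfolding coef_def by (rule integral_Im[OF i, symmetric])
 thus "Im (coef M ps F n) = L2_inner M (%q. Im (F q)) (ps n)" by (simp add: L2_inner_def)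
qed

lemma L2c_projection_error:
 assumes on: "orthonormal_basis_L2 M ps" and F: "L2c M F"
 shows "L2c M (%q. F q - (\<Sum>n<N. coef M ps F n * of_real (ps n q)))"
  and "(LINT q|M. (cmod (F q - (\<Sum>n<N. coef M ps F n * of_real (ps n q))))^2) = (LINT q|M. (cmod (F q))^2) - (\<Sum>n<N. (cmod (coef M ps F n))^2)"
  and "(%N. (LINT q|M. (cmod (F q))^2) - (\<Sum>n<N. (cmod (coef M ps F n))^2)) ----> 0"
proof -
 have ps: "ps n \<in> L2 M" for n using on by (auto simp: orthonormal_basis_L2_def)
 note ReIm = L2c_ReIm[OF F] and c = coef_ReIm[OF F ps]
 let ?E = "%N q. F q - (\<Sum>n<N. coef M ps F n * of_real (ps n q))"
 have Re: "Re (?E N q) = Re (F q) - (\<Sum>n<N. L2_inner M (%q. Re (F q)) (ps n) * ps n q)"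
  and Im: "Im (?E N q) = Im (F q) - (\<Sum>n<N. L2_inner M (%q. Im (F q)) (ps n) * ps n q)" for N q
  by (simp_all add: c)
 have E2: "(%q. Re (?E N q)) \<in> L2 M" "(%q. Im (?E N q)) \<in> L2 M" for N
  unfolding Re Im by (intro L2_diff ReIm L2_sum L2_cmult ps; simp)+
 show "L2c M (?E N)" by (rule L2cI) (rule E2)+
 have split: "(LINT q|M. (cmod (G q))^2) = (LINT q|M. (Re (G q))^2) + (LINT q|M. (Im (G q))^2)"
  if "(%q. Re (G q)) \<in> L2 M" "(%q. Im (G q)) \<in> L2 M" for G :: "'a => complex"
  unfolding cmod_power2 using that by (intro Bochner_Integration.integral_add) (auto simp: L2_def)
 have eq: "(LINT q|M. (cmod (?E N q))^2) = (LINT q|M. (cmod (F q))^2) - (\<Sum>n<N. (cmod (coef M ps F n))^2)" for N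
  unfolding split[OF E2] split[OF ReIm] Re Im L2_projection_error[OF on ReIm(1)] L2_projection_error[OF on ReIm(2)]
  by (simp add: cmod_power2 c sum.distrib)
 thus "(LINT q|M. (cmod (?E N q))^2) = (LINT q|M. (cmod (F q))^2) - (\<Sum>n<N. (cmod (coef M ps F n))^2)" .
 have sq: "(%N. LINT q|M. (f q - (\<Sum>n<N. L2_inner M f (ps n) * ps n q))^2) ----> 0" if "f \<in> L2 M" for f
 proof -
  have "(%N. L2_norm M (%q. f q - (\<Sum>n<N. L2_inner M f (ps n) * ps n q))) ----> 0"
   using on that by (auto simp: orthonormal_basis_L2_def)
  from tendsto_power[OF this, of 2] show ?thesis by (simp add: L2_norm_def)
 qed
 have "(%N. LINT q|M. (cmod (?E N q))^2) ----> 0 + 0"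
  unfolding split[OF E2] Re Im by (intro tendsto_add sq ReIm)
 thus "(%N. (LINT q|M. (cmod (F q))^2) - (\<Sum>n<N. (cmod (coef M ps F n))^2)) ----> 0"
  unfolding eq by simp
qed

lemma bessel:
 assumes "orthonormal_basis_L2 M ps" and "L2c M F"
 shows "(\<Sum>n<N. (cmod (coef M ps F n))^2) <= (LINT q|M. (cmod (F q))^2)"
proof -
 have "0 <= (LINT q|M. (cmod (F q - (\<Sum>n<N. coef M ps F n * of_real (ps n q))))^2)"
  by (rule LINT_nonneg) simp
 thus ?thesis using L2c_projection_error(2)[OF assms, of N] by linarith
qed

text \<open>Meant for the tails of the mode expansion, whose smallness must be uniform in time. If
  it fails, points where \<open>f n\<close> is at least \<open>e\<close> accumulate somewhere, and
  by monotonicity and continuity no \<open>f n\<close> drops below \<open>e\<close> at the limit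
  point.\<close>

lemma dini_decreasing:
 fixes f :: "nat => real => real"
 assumes cont: "!!n. continuous_on {a..b} (f n)"
  and dec: "!!n m s. s \<in> {a..b} ==> n <= m ==> f m s <= f n s"
  and lim: "!!s. s \<in> {a..b} ==> (%n. f n s) ----> 0" and e: "0 < e"
 shows "\<exists>n. \<forall>m\<ge>n. \<forall>s\<in>{a..b}. f m s < e"
proof (rule ccontr)
 assume "\<not> ?thesis"
 hence "\<forall>n. \<exists>s\<in>{a..b}. e <= f n s" by (metis dec linorder_not_less order_trans)
 then obtain s where s: "!!n. s n \<in> {a..b}" "!!n. e <= f n (s n)" by metis
 obtain l r where l: "l \<in> {a..b}" "strict_mono (r :: nat => nat)" "(s \<circ> r) ----> l"
  using compact_Icc[of a b] s(1) unfolding compact_def by blast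
 have "e <= f n l" for n
 proof (rule LIMSEQ_le_const)
  show "(%i. f n ((s \<circ> r) i)) ----> f n l"
   by (rule continuous_on_tendsto_compose[OF cont l(3,1)]) (use s(1) in auto)
  show "\<exists>N. \<forall>i\<ge>N. e <= f n ((s \<circ> r) i)"
  proof (intro exI[of _ n] allI impI)
   fix i assume "n <= i"
   hence "n <= r i" using seq_suble[OF l(2), of i] by linarith
   thus "e <= f n ((s \<circ> r) i)" using dec[OF s(1), of n "r i" "r i"] s(2)[of "r i"] by simp
  qed
 qed
 thus False using LIMSEQ_le_const[OF lim[OF l(1)], of e] e by fastforce
qed

text \<open>The cube provides two continuous derivatives, so that two derivatives in
  \<open>x\<close> can be moved from the solution to the window.\<close>

definition window :: "real => real => real" where
 "window R x = (max 0 (1 - (x / R)^2)) ^ 3"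
definition window' :: "real => real => real" where
 "window' R x = - 6 * x / R^2 * (max 0 (1 - (x / R)^2))^2"
definition window'' :: "real => real => real" where
 "window'' R x = - 6 / R^2 * (max 0 (1 - (x / R)^2))^2 + 24 * x^2 / R ^ 4 * max 0 (1 - (x / R)^2)"

lemma window_outside: "0 < R ==> R <= abs x ==> window R x = 0 \<and> window' R x = 0 \<and> window'' R x = 0"
proof -
 assume "0 < R" "R <= abs x"
 hence "1 <= \<bar>x / R\<bar>" by (simp add: abs_divide)
 hence "1 <= (x / R)^2" by (metis one_power2 power2_abs power_mono zero_le_one)
 hence "max 0 (1 - (x / R)^2) = 0" by simp
 thus ?thesis by (simp add: window_def window'_def window''_def)
qed

lemma window_01: "0 <= window R x" "window R x <= 1"
 by (auto simp: window_def intro!: power_le_one)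

lemma window'_le: assumes "1 <= R" shows "\<bar>window' R x\<bar> <= 6 / R" "\<bar>window'' R x\<bar> <= 30 / R"
proof -
 define y where "y = max 0 (1 - (x / R)^2)"
 have y: "0 <= y" "y <= 1" by (auto simp: y_def)
 hence y2: "0 <= y^2" "y^2 <= 1" by (auto intro: power_le_one)
 have R2: "R <= R^2" using assms by (simp add: power2_eq_square)
 have "\<bar>window' R x\<bar> <= 6 / R \<and> \<bar>window'' R x\<bar> <= 30 / R"
 proof (cases "abs x < R")
  case True
  have "\<bar>window' R x\<bar> = 6 * abs x / R^2 * y^2" by (simp add: window'_def y_def abs_mult)
  also have "... <= 6 * R / R^2 * 1" using True y2 assms by (intro mult_mono divide_right_mono) auto
  also have "... = 6 / R" using assms by (simp add: power2_eq_square)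
  finally have 1: "\<bar>window' R x\<bar> <= 6 / R" .
  have "x^2 <= R^2" using True power_mono[of "abs x" R 2] by simp
  hence a: "24 * x^2 / R ^ 4 * y <= 24 * R^2 / R ^ 4 * 1" using y assms by (intro mult_mono divide_right_mono) auto
  have b: "24 * R^2 / R ^ 4 = 24 / R^2" using assms by (simp add: power2_eq_square power4_eq_xxxx)
  have c: "6 / R^2 * y^2 <= 6 / R^2" using y2 assms by (intro mult_left_le) auto
  have d: "0 <= 24 * x^2 / R ^ 4 * y" "0 <= 6 / R^2 * y^2" using y by auto
  have "window'' R x = - (6 / R^2 * y^2) + 24 * x^2 / R ^ 4 * y" by (simp add: window''_def y_def)
  hence "\<bar>window'' R x\<bar> <= 6 / R^2 + 24 / R^2" using a b c d by linarith
  also have "... = 30 / R^2" by simp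
  also have "... <= 30 / R" using R2 assms by (intro divide_left_mono) auto
  finally show ?thesis using 1 by simp
 qed (use window_outside[of R x] assms in auto)
 thus "\<bar>window' R x\<bar> <= 6 / R" "\<bar>window'' R x\<bar> <= 30 / R" by auto
qed

lemma window_continuous: "0 < R ==> continuous_on UNIV (window R)"
 unfolding window_def by (intro continuous_intros) auto

lemma window_measurable [measurable]:
 "window R \<in> borel_measurable borel" "window' R \<in> borel_measurable borel" "window'' R \<in> borel_measurable borel"
 unfolding window_def[abs_def] window'_def[abs_def] window''_def[abs_def] by measurable

lemma window_tendsto_1: "(%j. window (real (Suc j)) x) ----> 1"
proof -
 have *: "(%j. 1 / real (Suc j)) ----> 0" by (rule LIMSEQ_inverse_real_of_nat[unfolded inverse_eq_divide])
 have "(%j. (max 0 (1 - (x * (1 / real (Suc j)))^2)) ^ 3) ----> (max 0 (1 - (x * 0)^2)) ^ 3"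
  by (intro tendsto_intros *)
 thus ?thesis by (simp add: window_def)
qed


lemma integral_Cauchy_Schwarz:
 assumes f: "f \<in> L2 M" and g: "g \<in> L2 M"
 shows "(LINT q|M. f q * g q)^2 <= (LINT q|M. (f q)^2) * (LINT q|M. (g q)^2)"
proof (cases "(LINT q|M. (g q)^2) = 0")
 case True
 hence "AE q in M. (g q)^2 = 0"
  using integral_nonneg_eq_0_iff_AE[of M "%q. (g q)^2"] g by (simp add: L2_def)
 hence "AE q in M. f q * g q = 0" by eventually_elim simp
 hence "(LINT q|M. f q * g q) = 0" by (rule integral_eq_zero_AE)
 thus ?thesis using True by simp
next
 case False
 define I where "I = (LINT q|M. f q * g q)"
 define V where "V = (LINT q|M. (g q)^2)"
 have "0 <= V" unfolding V_def by (rule LINT_nonneg) simp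
 moreover have "V \<noteq> 0" using False by (simp only: V_def not_False_eq_True)
 ultimately have V: "0 < V" by linarith
 note i = L2_mult_integrable[OF f g]
 have "0 <= (LINT q|M. (f q - I / V * g q)^2)" by (rule LINT_nonneg) simp
 also have "... = (LINT q|M. (f q)^2 - 2 * (I / V) * (f q * g q) + (I / V)^2 * (g q)^2)"
  by (intro LINT_cong refl) (simp add: power2_eq_square algebra_simps)
 also have "... = (LINT q|M. (f q)^2) - 2 * (I / V) * I + (I / V)^2 * V"
  using f g i by (simp add: L2_def I_def V_def)
 also have "... = (LINT q|M. (f q)^2) - I^2 / V" using V by (simp add: power2_eq_square field_simps)
 finally show ?thesis using V by (simp add: I_def[symmetric] V_def[symmetric] field_simps)
qed

lemma L2_norm_sq: "(L2_norm M f)^2 = (LINT q|M. (f q)^2)"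
 by (simp add: L2_norm_def)

lemma L2_norm_nonneg: "0 <= L2_norm M f"
 by (simp add: L2_norm_def)

lemma L2_norm_triangle:
 assumes f: "f \<in> L2 M" and g: "g \<in> L2 M" and h: "h \<in> borel_measurable M" and le: "!!q. \<bar>h q\<bar> <= \<bar>f q\<bar> + \<bar>g q\<bar>"
 shows "h \<in> L2 M" "L2_norm M h <= L2_norm M f + L2_norm M g"
proof -
 have fa: "(%q. \<bar>f q\<bar>) \<in> L2 M" "(%q. \<bar>g q\<bar>) \<in> L2 M" using f g by (auto simp: L2_def)
 note i = L2_mult_integrable[OF fa]
 have le2: "(h q)^2 <= (f q)^2 + 2 * (\<bar>f q\<bar> * \<bar>g q\<bar>) + (g q)^2" for q
  using power_mono[OF le[of q], of 2] by (simp add: power2_sum)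
 have int: "integrable M (%q. (f q)^2 + 2 * (\<bar>f q\<bar> * \<bar>g q\<bar>) + (g q)^2)" using f g i by (simp add: L2_def)
 have h2: "integrable M (%q. (h q)^2)"
 proof (rule LINT_bound[OF int])
  show "AE q in M. norm ((h q)^2) <= norm ((f q)^2 + 2 * (\<bar>f q\<bar> * \<bar>g q\<bar>) + (g q)^2)"
  proof (intro AE_I2)
   fix q show "norm ((h q)^2) <= norm ((f q)^2 + 2 * (\<bar>f q\<bar> * \<bar>g q\<bar>) + (g q)^2)"
   using order_trans[OF le2[of q] abs_ge_self] by simp
  qed
 qed (use h in simp)
 thus "h \<in> L2 M" using h by (simp add: L2_def)
 have cs: "(LINT q|M. \<bar>f q\<bar> * \<bar>g q\<bar>) <= L2_norm M f * L2_norm M g"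
 proof (rule power2_le_imp_le)
  show "(LINT q|M. \<bar>f q\<bar> * \<bar>g q\<bar>)^2 <= (L2_norm M f * L2_norm M g)^2"
   using integral_Cauchy_Schwarz[OF fa] by (simp add: power_mult_distrib L2_norm_sq)
 qed (simp add: L2_norm_nonneg)
 have "(LINT q|M. (h q)^2) <= (LINT q|M. (f q)^2 + 2 * (\<bar>f q\<bar> * \<bar>g q\<bar>) + (g q)^2)"
  by (rule integral_mono[OF h2 int le2])
 also have "... = (LINT q|M. (f q)^2) + 2 * (LINT q|M. \<bar>f q\<bar> * \<bar>g q\<bar>) + (LINT q|M. (g q)^2)"
  using f g i by (simp add: L2_def)
 also have "... <= (L2_norm M f + L2_norm M g)^2"
  using cs by (simp add: power2_sum L2_norm_sq)
 finally show "L2_norm M h <= L2_norm M f + L2_norm M g"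
  unfolding L2_norm_def[of M h] by (intro real_le_lsqrt) (auto simp: L2_norm_nonneg)
qed

lemma L2c_cmod: "L2c M F ==> (%q. cmod (F q)) \<in> L2 M"
 by (auto simp: L2c_def L2_def)

lemma orthonormal_sum_norm:
 assumes on: "orthonormal_basis_L2 M ps"
 shows "(LINT q|M. (\<Sum>n<N. v n * ps n q)^2) = (\<Sum>n<N. (v n)^2)"
proof -
 have ps: "ps n \<in> L2 M" and orth: "L2_inner M (ps m) (ps n) = (if m = n then 1 else 0)" for m n
  using on by (auto simp: orthonormal_basis_L2_def)
 let ?f = "%q. \<Sum>n<N. v n * ps n q"
 have f: "?f \<in> L2 M" by (intro L2_sum L2_cmult ps) auto
 have ip: "L2_inner M ?f (ps n) = v n" if "n < N" for n
 proof -
  have "L2_inner M ?f (ps n) = (LINT q|M. (\<Sum>m<N. v m * (ps m q * ps n q)))"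
   by (simp add: L2_inner_def sum_distrib_right mult.assoc)
  also have "... = (\<Sum>m<N. v m * L2_inner M (ps m) (ps n))"
   by (simp add: LINT_sum[OF integrable_mult_right[OF L2_mult_integrable[OF ps ps]]] L2_inner_def)
  also have "... = (\<Sum>m<N. if m = n then v m else 0)" by (intro sum.cong refl) (simp add: orth)
  also have "... = v n" using that by simp
  finally show ?thesis .
 qed
 have "(\<Sum>n<N. L2_inner M ?f (ps n) * ps n q) = ?f q" for q by (intro sum.cong refl) (simp add: ip)
 hence "0 = (LINT q|M. (?f q)^2) - (\<Sum>n<N. (L2_inner M ?f (ps n))^2)"
  using L2_projection_error[OF on f, of N] by simp
 thus ?thesis by (simp add: ip)
qed

text \<open>The matrix is the compression of multiplication by \<open>chi\<close> to the first
  \<open>N\<close> modes; Bessel's inequality makes the bound independent of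
  \<open>N\<close>.\<close>

lemma matrix_bound:
 assumes on: "orthonormal_basis_L2 M ps" and chim: "chi \<in> borel_measurable M" and chib: "!!q. \<bar>chi q\<bar> <= X"
 shows "(\<Sum>i<N. (\<Sum>j<N. (LINT q|M. chi q * ps i q * ps j q) * v j)^2) <= X^2 * (\<Sum>j<N. (v j)^2)"
proof -
 have ps: "ps n \<in> L2 M" for n using on by (auto simp: orthonormal_basis_L2_def)
 let ?S = "%q. \<Sum>n<N. v n * ps n q"
 let ?f = "%q. chi q * ?S q"
 have S: "?S \<in> L2 M" by (intro L2_sum L2_cmult ps) auto
 have le: "(?f q)^2 <= X^2 * (?S q)^2" for q
  unfolding power_mult_distrib using power_mono[OF chib[of q], of 2] by (intro mult_right_mono) auto
 have f: "?f \<in> L2 M"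
 proof -
  have "integrable M (%q. (?f q)^2)"
   by (rule LINT_bound[where f="%q. X^2 * (?S q)^2"])
   (use S le chim in "auto simp: L2_def")
  thus ?thesis using S chim by (auto simp: L2_def)
 qed
 have chi_ps: "(%q. chi q * ps n q) \<in> L2 M" for n
 proof -
  have le: "(chi q * ps n q)^2 <= X^2 * (ps n q)^2" for q
   unfolding power_mult_distrib using power_mono[OF chib[of q], of 2] by (intro mult_right_mono) auto
  have "integrable M (%q. (chi q * ps n q)^2)"
   by (rule LINT_bound[where f="%q. X^2 * (ps n q)^2"])
   (use le ps[of n] chim in "auto simp: L2_def")
  thus ?thesis using ps[of n] chim by (auto simp: L2_def)
 qed
 have "(\<Sum>j<N. (LINT q|M. chi q * ps i q * ps j q) * v j) = L2_inner M ?f (ps i)" for i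
 proof -
  have "L2_inner M ?f (ps i) = (LINT q|M. (\<Sum>j<N. v j * (chi q * ps i q * ps j q)))"
   unfolding L2_inner_def sum_distrib_left sum_distrib_right
   by (intro LINT_cong sum.cong refl) (simp add: mult_ac)
  also have "... = (\<Sum>j<N. v j * (LINT q|M. chi q * ps i q * ps j q))"
  proof -
   have int: "integrable M (%q. v j * (chi q * ps i q * ps j q))" for j
   by (rule integrable_mult_right, rule L2_mult_integrable[OF chi_ps ps])
   show ?thesis unfolding LINT_sum[OF int] by (simp only: integral_mult_right_zero)
  qed
  finally show ?thesis by (simp add: mult.commute)
 qed
 hence "(\<Sum>i<N. (\<Sum>j<N. (LINT q|M. chi q * ps i q * ps j q) * v j)^2) = (\<Sum>i<N. (L2_inner M ?f (ps i))^2)" by simp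
 also have "... <= (LINT q|M. (?f q)^2)"
 proof -
  have "0 <= (LINT q|M. (?f q - (\<Sum>n<N. L2_inner M ?f (ps n) * ps n q))^2)"
   by (rule LINT_nonneg) simp
  thus ?thesis using L2_projection_error[OF on f, of N] by linarith
 qed
 also have "... <= (LINT q|M. X^2 * (?S q)^2)"
  using f S le by (intro integral_mono) (auto simp: L2_def)
 also have "... = X^2 * (\<Sum>j<N. (v j)^2)" by (simp add: orthonormal_sum_norm[OF on])
 finally show ?thesis .
qed

text \<open>The test function that turns the equation into one for a windowed transform, followed by
  its first two derivatives in \<open>x\<close>, written out.\<close>

definition wave :: "real => real => real => complex" where
 "wave R k x = of_real (window R x) * iexp (- (k * x))"
definition wave' :: "real => real => real => complex" where
 "wave' R k x = (of_real (window' R x) - \<i> * of_real k * of_real (window R x)) * iexp (- (k * x))"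
definition wave'' :: "real => real => real => complex" where
 "wave'' R k x = (of_real (window'' R x) - 2 * \<i> * of_real k * of_real (window' R x)
   - of_real (k^2) * of_real (window R x)) * iexp (- (k * x))"

section \<open>Transforms in x of functions on the strip\<close>

definition ptransform :: "(real \<times> 'q => real) => (real => complex) => 'q => complex" where
 "ptransform f th q = (CLINT x|lborel. of_real (f (x, q)) * th x)"

text \<open>The squared norm of such a kernel is at most \<open>2 * R * B^2\<close>. Kernels that
  carry a derivative of the window have \<open>B\<close> of order \<open>1 / R\<close>, so this is
  of order \<open>1 / R\<close> as well: the commutators vanish as the window grows, although the
  solution is only known to be square integrable in \<open>x\<close>.\<close>

definition kernel_on :: "real => real => (real => complex) => bool" where
 "kernel_on R B th \<longleftrightarrow> 0 <= R \<and> 0 <= B \<and> th \<in> borel_measurable borel \<and> (\<forall>x. cmod (th x) <= B * indicator {- R..R} x)"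

lemma kernel_square: assumes "kernel_on R B th" shows "(%x. cmod (th x)) \<in> L2 lborel" "(LINT x|lborel. (cmod (th x))^2) <= 2 * R * B^2"
proof -
 have R: "0 <= R" "0 <= B" and m [measurable]: "th \<in> borel_measurable borel" and le: "!!x. cmod (th x) <= B * indicator {- R..R} x"
  using assms by (auto simp: kernel_on_def)
 have le2: "(cmod (th x))^2 <= B^2 * indicator {- R..R} x" for x
  using power_mono[OF le[of x], of 2] by (auto simp: power_mult_distrib indicator_def split: if_splits)
 have int: "integrable lborel (%x. B^2 * indicator {- R..R} x :: real)"
  by (intro integrable_mult_right integrable_real_indicator) (auto simp: R)
 have i2: "integrable lborel (%x. (cmod (th x))^2)"
  by (rule LINT_bound[OF int]) (use le2 in "auto simp: abs_of_nonneg")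
 thus "(%x. cmod (th x)) \<in> L2 lborel" by (simp add: L2_def)
 have "(LINT x|lborel. (cmod (th x))^2) <= (LINT x|lborel. B^2 * indicator {- R..R} x)"
  by (rule integral_mono[OF i2 int le2])
 also have "... = 2 * R * B^2" using R by simp
 finally show "(LINT x|lborel. (cmod (th x))^2) <= 2 * R * B^2" .
qed

context
 fixes Q :: "'q measure"
 assumes Q: "prob_space Q"
begin

interpretation Q: prob_space Q by (rule Q)
interpretation pair: pair_sigma_finite lborel Q by unfold_locales

abbreviation "strip \<equiv> (lborel :: real measure) \<Otimes>\<^sub>M Q"

lemma kernel_integrable:
 assumes f: "f \<in> L2 strip" and k: "kernel_on R B th" and g: "g \<in> borel_measurable Q" "!!q. \<bar>g q\<bar> <= Bg"
 shows "integrable strip (%p. of_real (f p * g (snd p)) * th (fst p))"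
proof -
 have [measurable]: "f \<in> borel_measurable strip" "g \<in> borel_measurable Q" "th \<in> borel_measurable borel"
  using f g k by (auto simp: L2_def kernel_on_def)
 have kk: "integrable strip (%p. (cmod (th (fst p)))^2 * 1)"
  using pair.integrable_fst_mult_snd[of "%x. (cmod (th x))^2" "%_. 1"] kernel_square(1)[OF k] by (simp add: L2_def)
 show ?thesis
 proof (rule LINT_bound[where f="%p. abs Bg * ((f p)^2 + (cmod (th (fst p)))^2 * 1)"])
  show "integrable strip (%p. abs Bg * ((f p)^2 + (cmod (th (fst p)))^2 * 1))" using kk f by (simp add: L2_def)
  show "AE p in strip. norm (of_real (f p * g (snd p)) * th (fst p)) <= norm (abs Bg * ((f p)^2 + (cmod (th (fst p)))^2 * 1))"
  proof (intro AE_I2)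
   fix p
   have "2 * (\<bar>f p\<bar> * cmod (th (fst p))) <= (f p)^2 + (cmod (th (fst p)))^2"
   using sum_squares_bound[of "\<bar>f p\<bar>" "cmod (th (fst p))"] by (simp add: mult.assoc)
   moreover have "0 <= \<bar>f p\<bar> * cmod (th (fst p))" by simp
   ultimately have "\<bar>f p\<bar> * cmod (th (fst p)) <= (f p)^2 + (cmod (th (fst p)))^2" by linarith
   hence "\<bar>g (snd p)\<bar> * (\<bar>f p\<bar> * cmod (th (fst p))) <= abs Bg * ((f p)^2 + (cmod (th (fst p)))^2)"
   using g(2)[of "snd p"] by (intro mult_mono) auto
   thus "norm (of_real (f p * g (snd p)) * th (fst p)) <= norm (abs Bg * ((f p)^2 + (cmod (th (fst p)))^2 * 1))"
   by (simp add: norm_mult abs_mult mult_ac)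
  qed
 qed measurable
qed

lemma kernel_AE:
 assumes f: "f \<in> L2 strip" and k: "kernel_on R B th"
 shows "AE q in Q. integrable lborel (%x. of_real (f (x, q)) * th x)"
  and "AE q in Q. (%x. f (x, q)) \<in> L2 lborel"
proof -
 have [measurable]: "f \<in> borel_measurable strip" using f by (simp add: L2_def)
 from kernel_integrable[OF f k, of "%_. 1" 1]
 have "integrable strip (%(x, q). of_real (f (x, q)) * th x)" by (simp add: case_prod_unfold)
 from pair.AE_integrable_snd[OF this] show "AE q in Q. integrable lborel (%x. of_real (f (x, q)) * th x)" .
 have "integrable strip (%(x, q). (f (x, q))^2)" using f by (simp add: L2_def case_prod_unfold)
 from pair.AE_integrable_snd[OF this] show "AE q in Q. (%x. f (x, q)) \<in> L2 lborel"
  using AE_space by eventually_elim (simp add: L2_def)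
qed

lemma ptransform_measurable:
 assumes f: "f \<in> L2 strip" and k: "kernel_on R B th"
 shows "ptransform f th \<in> borel_measurable Q"
proof -
 have [measurable]: "f \<in> borel_measurable strip" "th \<in> borel_measurable borel" using f k by (auto simp: L2_def kernel_on_def)
 show ?thesis unfolding ptransform_def[abs_def] by measurable
qed

text \<open>Cauchy-Schwarz in \<open>x\<close> on almost every section, then Fubini.\<close>

lemma ptransform_L2:
 assumes f: "f \<in> L2 strip" and k: "kernel_on R B th"
 shows "L2c Q (ptransform f th)"
  and "(LINT q|Q. (cmod (ptransform f th q))^2) <= 2 * R * B^2 * (LINT p|strip. (f p)^2)"
proof -
 have R: "0 <= R" using k by (simp add: kernel_on_def)
 have f2: "integrable strip (%(x, q). (f (x, q))^2)" using f by (simp add: L2_def case_prod_unfold)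
 have int: "integrable Q (%q. 2 * R * B^2 * (LINT x|lborel. (f (x, q))^2))"
  by (rule integrable_mult_right[OF pair.integrable_snd[OF f2]])
 have le: "AE q in Q. (cmod (ptransform f th q))^2 <= 2 * R * B^2 * (LINT x|lborel. (f (x, q))^2)"
  using kernel_AE[OF f k]
 proof eventually_elim
  case (elim q)
  have fa: "(%x. \<bar>f (x, q)\<bar>) \<in> L2 lborel" using elim(2) by (auto simp: L2_def)
  have "cmod (ptransform f th q) <= (LINT x|lborel. \<bar>f (x, q)\<bar> * cmod (th x))"
   unfolding ptransform_def by (rule order_trans[OF integral_norm_bound]) (simp add: norm_mult)
  hence "(cmod (ptransform f th q))^2 <= (LINT x|lborel. \<bar>f (x, q)\<bar> * cmod (th x))^2" by (intro power_mono) auto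
  also have "... <= (LINT x|lborel. (f (x, q))^2) * (LINT x|lborel. (cmod (th x))^2)"
   using integral_Cauchy_Schwarz[OF fa kernel_square(1)[OF k]] by simp
  also have "... <= (LINT x|lborel. (f (x, q))^2) * (2 * R * B^2)"
   by (intro mult_left_mono kernel_square(2)[OF k] LINT_nonneg) simp
  finally show ?case by (simp add: mult.commute)
 qed
 have "integrable Q (%q. (cmod (ptransform f th q))^2)"
 proof (rule LINT_bound[OF int])
  show "AE q in Q. norm ((cmod (ptransform f th q))^2) <= norm (2 * R * B^2 * (LINT x|lborel. (f (x, q))^2))"
   using le by eventually_elim auto
 qed (use ptransform_measurable[OF f k] in measurable)
 thus L: "L2c Q (ptransform f th)" using ptransform_measurable[OF f k] by (simp add: L2c_def)
 have "(LINT q|Q. (cmod (ptransform f th q))^2) <= (LINT q|Q. 2 * R * B^2 * (LINT x|lborel. (f (x, q))^2))"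
  using L int le by (intro integral_mono_AE) (auto simp: L2c_def)
 also have "... = 2 * R * B^2 * (LINT p|strip. (f p)^2)"
  using pair.integral_snd[OF f2] by (simp add: case_prod_unfold)
 finally show "(LINT q|Q. (cmod (ptransform f th q))^2) <= 2 * R * B^2 * (LINT p|strip. (f p)^2)" .
qed

lemma ptransform_integral:
 assumes f: "f \<in> L2 strip" and k: "kernel_on R B th" and g: "g \<in> borel_measurable Q" "!!q. \<bar>g q\<bar> <= Bg"
 shows "(CLINT p|strip. of_real (f p * g (snd p)) * th (fst p)) = (CLINT q|Q. ptransform f th q * of_real (g q))"
proof -
 have "integrable strip (%(x, q). of_real (f (x, q) * g q) * th x)"
  using kernel_integrable[OF f k g] by (simp add: case_prod_unfold)
 from pair.integral_snd[OF this]
 have "(CLINT p|strip. of_real (f p * g (snd p)) * th (fst p)) = (CLINT q|Q. CLINT x|lborel. of_real (f (x, q) * g q) * th x)"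
  by (simp add: case_prod_unfold)
 also have "... = (CLINT q|Q. ptransform f th q * of_real (g q))"
 proof (intro LINT_cong refl)
  fix q
  have "(CLINT x|lborel. of_real (f (x, q) * g q) * th x) = (CLINT x|lborel. (of_real (f (x, q)) * th x) * of_real (g q))"
   by (simp add: mult_ac)
  thus "(CLINT x|lborel. of_real (f (x, q) * g q) * th x) = ptransform f th q * of_real (g q)"
   unfolding ptransform_def by (simp only: integral_mult_left_zero)
 qed
 finally show ?thesis .
qed

lemma ptransform_diff:
 assumes f: "f \<in> L2 strip" and g: "g \<in> L2 strip" and k: "kernel_on R B th"
 shows "AE q in Q. ptransform (%p. f p - g p) th q = ptransform f th q - ptransform g th q"
 using kernel_AE(1)[OF f k] kernel_AE(1)[OF g k]
 by eventually_elim (simp add: ptransform_def left_diff_distrib)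

text \<open>Gives the continuity in time of the profile norm. Additivity of the transform holds for
  almost every \<open>q\<close> only, since only almost every section is integrable against the
  kernel; hence the detour through an identity almost everywhere.\<close>

lemma ptransform_norm_diff:
 assumes f: "f \<in> L2 strip" and g: "g \<in> L2 strip" and k: "kernel_on R B th"
 shows "\<bar>L2_norm Q (%q. cmod (ptransform f th q)) - L2_norm Q (%q. cmod (ptransform g th q))\<bar>
   <= sqrt (2 * R) * B * L2_norm strip (%p. f p - g p)"
proof -
 note L = ptransform_L2[OF _ k]
 have R: "0 <= R" "0 <= B" using k by (auto simp: kernel_on_def)
 define D where "D q = cmod (ptransform f th q - ptransform g th q)" for q
 have Dm: "D \<in> borel_measurable Q" unfolding D_def
  using L(1)[OF f] L(1)[OF g] by (auto simp: L2c_def)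
 have fg: "(%p. f p - g p) \<in> L2 strip" by (rule L2_diff[OF f g])
 have ae: "AE q in Q. (D q)^2 = (cmod (ptransform (%p. f p - g p) th q))^2"
  using ptransform_diff[OF f g k] by eventually_elim (simp add: D_def)
 have D2: "D \<in> L2 Q"
 proof -
  have "integrable Q (%q. (D q)^2)"
   using ae L(1)[OF fg] Dm by (subst integrable_cong_AE[OF _ _ ae]) (auto simp: L2c_def)
  thus ?thesis using Dm by (simp add: L2_def)
 qed
 have "(LINT q|Q. (D q)^2) = (LINT q|Q. (cmod (ptransform (%p. f p - g p) th q))^2)"
  using L(1)[OF fg] Dm by (intro integral_cong_AE[OF _ _ ae]) (auto simp: L2c_def)
 also have "... <= (sqrt (2 * R) * B * L2_norm strip (%p. f p - g p))^2"
  using L(2)[OF fg] R by (simp add: power_mult_distrib L2_norm_sq)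
 finally have Dn: "L2_norm Q D <= sqrt (2 * R) * B * L2_norm strip (%p. f p - g p)"
  unfolding L2_norm_def[of Q D] using R by (intro real_le_lsqrt) (auto simp: L2_norm_nonneg)
 have 1: "L2_norm Q (%q. cmod (ptransform f th q)) <= L2_norm Q (%q. cmod (ptransform g th q)) + L2_norm Q D"
  by (rule L2_norm_triangle(2)[OF L2c_cmod[OF L(1)[OF g]] D2])
   (use L2c_cmod[OF L(1)[OF f]] in "auto simp: L2_def D_def intro: norm_triangle_sub")
 have 2: "L2_norm Q (%q. cmod (ptransform g th q)) <= L2_norm Q (%q. cmod (ptransform f th q)) + L2_norm Q D"
  by (rule L2_norm_triangle(2)[OF L2c_cmod[OF L(1)[OF f]] D2])
   (use L2c_cmod[OF L(1)[OF g]] in "auto simp: L2_def D_def norm_minus_commute intro: order_trans[OF norm_triangle_sub]")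
 show ?thesis using 1 2 Dn by (simp add: abs_le_iff)
qed

end

lemma kernel_wave: assumes R: "1 <= R" shows "kernel_on R 1 (wave R k)"
proof -
 have "cmod (wave R k x) <= 1 * indicator {- R..R} x" for x
  using window_01[of R x] window_outside[of R x] R by (auto simp: wave_def norm_mult indicator_def)
 thus ?thesis using R by (simp add: kernel_on_def wave_def[abs_def])
qed

lemma kernel_wave1: assumes R: "1 <= R" shows "kernel_on R (6 / R) (%x. of_real (window' R x) * iexp (- (k * x)))"
proof -
 have "cmod (of_real (window' R x) * iexp (- (k * x))) <= 6 / R * indicator {- R..R} x" for x
  using window'_le(1)[OF R, of x] window_outside[of R x] R by (auto simp: norm_mult indicator_def)
 thus ?thesis using R by (simp add: kernel_on_def)
qed

text \<open>This is \<open>wave''\<close> without the multiple \<open>- k^2\<close> of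
  \<open>wave\<close>; a derivative of the window is present in everything that remains.\<close>

lemma kernel_wave2: assumes R: "1 <= R"
 shows "kernel_on R ((30 + 12 * abs k) / R) (%x. (of_real (window'' R x) - 2 * \<i> * of_real k * of_real (window' R x)) * iexp (- (k * x)))"
proof -
 have "cmod ((of_real (window'' R x) - 2 * \<i> * of_real k * of_real (window' R x)) * iexp (- (k * x)))
   <= (30 + 12 * abs k) / R * indicator {- R..R} x" for x
 proof (cases "x \<in> {- R..R}")
  case True
  have "cmod (of_real (window'' R x) - 2 * \<i> * of_real k * of_real (window' R x)) <= \<bar>window'' R x\<bar> + 2 * abs k * \<bar>window' R x\<bar>"
   by (rule order_trans[OF norm_triangle_ineq4]) (simp add: norm_mult)
  also have "... <= 30 / R + 2 * abs k * (6 / R)"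
   using window'_le[OF R, of x] by (intro add_mono mult_left_mono) auto
  also have "... = (30 + 12 * abs k) / R" by (simp add: add_divide_distrib)
  finally show ?thesis using True by (simp add: norm_mult)
 next
  case False
  hence "R <= abs x" by auto
  thus ?thesis using window_outside[of R x] R False by simp
 qed
 thus ?thesis using R by (simp add: kernel_on_def)
qed

section \<open>The abstract channel and its Galerkin systems\<close>

lemma tendsto_if_norm_diff_le:
 fixes f :: "'a => 'b::real_normed_vector" and g :: "'a => real"
 assumes g: "(g \<longlongrightarrow> 0) F" and le: "\<forall>\<^sub>F s in F. norm (f s - l) <= norm (g s)"
 shows "(f \<longlongrightarrow> l) F"
proof -
 have "((%s. f s - l) \<longlongrightarrow> 0) F"
  by (rule Lim_null_comparison[OF le tendsto_norm_zero[OF g]])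
 thus ?thesis by (rule LIM_zero_cancel)
qed

text \<open>All that the decay argument knows of the differential equation is \<open>ode\<close>,
  the equation tested with a windowed wave times a basis function. The cross section enters only as
  a probability space with a bounded profile and an orthonormal basis of bounded functions.
  \<open>b\<close> is continuous in time into \<open>L2\<close> from time 0 on, whereas
  \<open>ode\<close> holds for positive times.\<close>

locale taylor_channel =
 fixes Q :: "'q measure" and ps :: "nat => 'q => real" and chi :: "'q => real" and mu :: "nat => real"
  and X nu A :: real and b :: "real => real \<times> 'q => real" and w :: nat
 assumes Q: "prob_space Q" and basis: "orthonormal_basis_L2 Q ps"
  and ps_bounded: "!!n. \<exists>B. \<forall>q. \<bar>ps n q\<bar> <= B" and ps0: "AE q in Q. ps 0 q = 1"
  and chi_meas: "chi \<in> borel_measurable Q" and chi_le: "!!q. \<bar>chi q\<bar> <= X" and X1: "1 <= X"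
  and chi_mean: "(LINT q|Q. chi q) = 0"
  and mu0: "mu 0 = 0" and mu1: "0 < mu 1" and mu_mono: "mono mu"
  and nu: "0 < nu" "nu <= 1" and A: "A \<noteq> 0"
  and b_L2: "!!t. 0 <= t ==> b t \<in> L2 (strip Q)"
  and b_cont: "!!t. 0 <= t ==> ((%s. L2_norm (strip Q) (%p. b s p - b t p)) \<longlongrightarrow> 0) (at t within {0..})"
  and w: "2 <= w" and b_init: "integrable (strip Q) (%p. (1 + (fst p)^2) ^ w * (b 0 p)^2)"
  and ode: "!!n R k s. 1 <= R ==> 0 < s ==>
   ((%s. CLINT p|(strip Q). of_real (b s p * ps n (snd p)) * wave R k (fst p)) has_vector_derivative
   (of_real nu * (CLINT p|(strip Q). of_real (b s p * ps n (snd p)) * wave'' R k (fst p))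
   - of_real (nu * mu n) * (CLINT p|(strip Q). of_real (b s p * ps n (snd p)) * wave R k (fst p))
   + of_real A * (CLINT p|(strip Q). of_real (b s p * (chi (snd p) * ps n (snd p))) * wave' R k (fst p)))) (at s)"
begin

sublocale Q: prob_space Q by (rule Q)
sublocale pair: pair_sigma_finite lborel Q by unfold_locales

abbreviation "pm \<equiv> (lborel :: real measure) \<Otimes>\<^sub>M Q"

lemma ps: "ps n \<in> L2 Q" and ps_meas [measurable]: "ps n \<in> borel_measurable Q"
 using basis by (auto simp: orthonormal_basis_L2_def L2_def)

declare chi_meas [measurable]

definition profile where "profile R k s = ptransform (b s) (wave R k)"
definition mode where "mode R k n s = coef Q ps (profile R k s) n"
definition Mat where "Mat i j = (LINT q|Q. chi q * ps i q * ps j q)"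

lemma profile_L2:
 assumes "1 <= R" "0 <= s"
 shows "L2c Q (profile R k s)" "(LINT q|Q. (cmod (profile R k s q))^2) <= 2 * R * (LINT p|pm. (b s p)^2)"
 using ptransform_L2[OF Q b_L2[OF assms(2)] kernel_wave[OF assms(1), of k]] by (simp_all add: profile_def)

lemma coef_eq:
 assumes k: "kernel_on R B th" and s: "0 <= s"
 shows "(CLINT p|pm. of_real (b s p * ps n (snd p)) * th (fst p)) = coef Q ps (ptransform (b s) th) n"
proof -
 obtain Bn where "!!q. \<bar>ps n q\<bar> <= Bn" using ps_bounded by blast
 from ptransform_integral[OF Q b_L2[OF s] k ps_meas this] show ?thesis by (simp add: coef_def)
qed

lemma coef_eq_chi:
 assumes k: "kernel_on R B th" and s: "0 <= s"
 shows "(CLINT p|pm. of_real (b s p * (chi (snd p) * ps n (snd p))) * th (fst p))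
   = coef Q ps (%q. of_real (chi q) * ptransform (b s) th q) n"
proof -
 obtain Bn where Bn: "!!q. \<bar>ps n q\<bar> <= Bn" using ps_bounded by blast
 have "\<bar>chi q * ps n q\<bar> <= X * Bn" for q
  unfolding abs_mult using chi_le X1 Bn by (intro mult_mono) auto
 from ptransform_integral[OF Q b_L2[OF s] k, where g="%q. chi q * ps n q", OF _ this]
 have "(CLINT p|pm. of_real (b s p * (chi (snd p) * ps n (snd p))) * th (fst p))
   = (CLINT q|Q. ptransform (b s) th q * of_real (chi q * ps n q))" by simp
 thus ?thesis unfolding coef_def by (simp only: of_real_mult mult_ac)
qed

lemma L2c_mult_chi:
 assumes F: "L2c Q F" shows "L2c Q (%q. of_real (chi q) * F q)"
  "(LINT q|Q. (cmod (of_real (chi q) * F q))^2) <= X^2 * (LINT q|Q. (cmod (F q))^2)"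
proof -
 have m [measurable]: "F \<in> borel_measurable Q" using F by (simp add: L2c_def)
 have int: "integrable Q (%q. X^2 * (cmod (F q))^2)" using F by (simp add: L2c_def)
 have le: "(cmod (of_real (chi q) * F q))^2 <= X^2 * (cmod (F q))^2" for q
  unfolding norm_mult power_mult_distrib using power_mono[OF chi_le[of q], of 2] by (intro mult_right_mono) auto
 have i: "integrable Q (%q. (cmod (of_real (chi q) * F q))^2)"
  by (rule LINT_bound[OF int]) (use le in "auto simp: abs_of_nonneg")
 thus "L2c Q (%q. of_real (chi q) * F q)" by (simp add: L2c_def)
 have "(LINT q|Q. (cmod (of_real (chi q) * F q))^2) <= (LINT q|Q. X^2 * (cmod (F q))^2)"
  by (rule integral_mono[OF i int le])
 thus "(LINT q|Q. (cmod (of_real (chi q) * F q))^2) <= X^2 * (LINT q|Q. (cmod (F q))^2)" by simp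
qed

lemma L2c_cmult:
 assumes F: "L2c Q F" shows "L2c Q (%q. c * F q)" "(LINT q|Q. (cmod (c * F q))^2) = (cmod c)^2 * (LINT q|Q. (cmod (F q))^2)"
 using F by (auto simp: L2c_def norm_mult power_mult_distrib)

lemma L2c_add3:
 assumes "L2c Q F" "L2c Q G" "L2c Q H"
 shows "L2c Q (%q. F q + G q + H q)"
  "(LINT q|Q. (cmod (F q + G q + H q))^2) <= 3 * ((LINT q|Q. (cmod (F q))^2) + (LINT q|Q. (cmod (G q))^2) + (LINT q|Q. (cmod (H q))^2))"
proof -
 have [measurable]: "F \<in> borel_measurable Q" "G \<in> borel_measurable Q" "H \<in> borel_measurable Q" using assms by (auto simp: L2c_def)
 have int: "integrable Q (%q. 3 * ((cmod (F q))^2 + (cmod (G q))^2 + (cmod (H q))^2))" using assms by (auto simp: L2c_def)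
 have le: "(cmod (F q + G q + H q))^2 <= 3 * ((cmod (F q))^2 + (cmod (G q))^2 + (cmod (H q))^2)" for q
 proof -
  have "cmod (F q + G q + H q) <= cmod (F q) + cmod (G q) + cmod (H q)"
   by (intro order_trans[OF norm_triangle_ineq] add_right_mono norm_triangle_ineq)
  hence "(cmod (F q + G q + H q))^2 <= (cmod (F q) + cmod (G q) + cmod (H q))^2" by (intro power_mono) auto
  also have "... <= 3 * ((cmod (F q))^2 + (cmod (G q))^2 + (cmod (H q))^2)"
   using sum_squares_bound[of "cmod (F q)" "cmod (G q)"] sum_squares_bound[of "cmod (F q)" "cmod (H q)"]
   sum_squares_bound[of "cmod (G q)" "cmod (H q)"] by (simp add: power2_eq_square algebra_simps)
  finally show ?thesis .
 qed
 have i: "integrable Q (%q. (cmod (F q + G q + H q))^2)"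
  by (rule LINT_bound[OF int]) (use le in "auto simp: abs_of_nonneg")
 thus "L2c Q (%q. F q + G q + H q)" by (simp add: L2c_def)
 have "(LINT q|Q. (cmod (F q + G q + H q))^2) <= (LINT q|Q. 3 * ((cmod (F q))^2 + (cmod (G q))^2 + (cmod (H q))^2))"
  by (rule integral_mono[OF i int le])
 also have "... = 3 * ((LINT q|Q. (cmod (F q))^2) + (LINT q|Q. (cmod (G q))^2) + (LINT q|Q. (cmod (H q))^2))"
  using assms by (simp add: L2c_def)
 finally show "(LINT q|Q. (cmod (F q + G q + H q))^2) <= 3 * ((LINT q|Q. (cmod (F q))^2) + (LINT q|Q. (cmod (G q))^2) + (LINT q|Q. (cmod (H q))^2))" .
qed

lemma coef_linear:
 assumes "L2c Q F" "L2c Q G"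
 shows "coef Q ps (%q. F q + G q) n = coef Q ps F n + coef Q ps G n"
  and "coef Q ps (%q. F q - G q) n = coef Q ps F n - coef Q ps G n"
  and "coef Q ps (%q. c * F q) n = c * coef Q ps F n"
 using L2c_mult_integrable[OF assms(1) ps[of n]] L2c_mult_integrable[OF assms(2) ps[of n]]
 by (simp_all add: coef_def distrib_right left_diff_distrib mult.assoc)

lemma tendsto_L2_norm_b:
 assumes "0 <= t" shows "((%s. L2_norm pm (b s)) \<longlongrightarrow> L2_norm pm (b t)) (at t within {0..})"
proof (rule tendsto_if_norm_diff_le)
 show "((%s. L2_norm pm (%p. b s p - b t p)) \<longlongrightarrow> 0) (at t within {0..})" by (rule b_cont[OF assms])
 show "\<forall>\<^sub>F s in at t within {0..}. norm (L2_norm pm (b s) - L2_norm pm (b t)) <= norm (L2_norm pm (%p. b s p - b t p))"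
  unfolding eventually_at_filter
 proof (intro always_eventually allI impI)
  fix s :: real assume "s \<in> {0..}"
  hence s: "0 <= s" by simp
  note bs = b_L2[OF s] and bt = b_L2[OF assms] and d = L2_diff[OF b_L2[OF s] b_L2[OF assms]]
  have "L2_norm pm (b s) <= L2_norm pm (b t) + L2_norm pm (%p. b s p - b t p)"
   by (rule L2_norm_triangle(2)[OF bt d]) (use bs in "auto simp: L2_def")
  moreover have "L2_norm pm (b t) <= L2_norm pm (b s) + L2_norm pm (%p. b s p - b t p)"
   by (rule L2_norm_triangle(2)[OF bs d]) (use bt in "auto simp: L2_def")
  ultimately show "norm (L2_norm pm (b s) - L2_norm pm (b t)) <= norm (L2_norm pm (%p. b s p - b t p))"
   by (simp add: L2_norm_nonneg abs_le_iff)
 qed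
qed

lemma continuous_L2_norm_b: "continuous_on {0..} (%s. L2_norm pm (b s))"
 unfolding continuous_on_def using tendsto_L2_norm_b by simp

lemma bounded_L2_norm_b: "\<exists>C\<ge>0. \<forall>s\<in>{0..t}. (LINT p|pm. (b s p)^2) <= C"
proof -
 have "compact ((%s. (L2_norm pm (b s))^2) ` {0..t})"
  by (intro compact_continuous_image continuous_intros continuous_on_subset[OF continuous_L2_norm_b]) auto
 then obtain C where C: "!!s. s \<in> {0..t} ==> \<bar>(L2_norm pm (b s))^2\<bar> <= C"
  using compact_imp_bounded by (force simp: bounded_iff)
 thus ?thesis by (intro exI[of _ "max 0 C"]) (auto simp: L2_norm_sq le_max_iff_disj)
qed

lemma continuous_profile_norm:
 assumes R: "1 <= R"
 shows "continuous_on {0..} (%s. L2_norm Q (%q. cmod (profile R k s q)))"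
 unfolding continuous_on_def
proof (intro ballI)
 fix t :: real assume "t \<in> {0..}"
 hence t: "0 <= t" by simp
 show "((%s. L2_norm Q (%q. cmod (profile R k s q))) \<longlongrightarrow> L2_norm Q (%q. cmod (profile R k t q))) (at t within {0..})"
 proof (rule tendsto_if_norm_diff_le)
  show "((%s. sqrt (2 * R) * 1 * L2_norm pm (%p. b s p - b t p)) \<longlongrightarrow> 0) (at t within {0..})"
   by (rule tendsto_mult_right_zero[OF b_cont[OF t]])
  show "\<forall>\<^sub>F s in at t within {0..}. norm (L2_norm Q (%q. cmod (profile R k s q)) - L2_norm Q (%q. cmod (profile R k t q)))
   <= norm (sqrt (2 * R) * 1 * L2_norm pm (%p. b s p - b t p))"
   unfolding eventually_at_filter
  proof (intro always_eventually allI impI)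
   fix s :: real assume "s \<in> {0..}"
   hence s: "0 <= s" by simp
   show "norm (L2_norm Q (%q. cmod (profile R k s q)) - L2_norm Q (%q. cmod (profile R k t q)))
   <= norm (sqrt (2 * R) * 1 * L2_norm pm (%p. b s p - b t p))"
   using ptransform_norm_diff[OF Q b_L2[OF s] b_L2[OF t] kernel_wave[OF R, of k]] R
   by (simp add: profile_def L2_norm_nonneg abs_mult)
  qed
 qed
qed

lemma mode_diff_le:
 assumes R: "1 <= R" and s: "0 <= s" and t: "0 <= t"
 shows "cmod (mode R k n s - mode R k n t) <= sqrt (2 * R) * L2_norm pm (%p. b s p - b t p)"
proof -
 let ?D = "%q. ptransform (%p. b s p - b t p) (wave R k) q"
 note kw = kernel_wave[OF R, of k]
 note fg = L2_diff[OF b_L2[OF s] b_L2[OF t]]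
 note D = ptransform_L2[OF Q fg kw]
 have "mode R k n s - mode R k n t = coef Q ps (%q. profile R k s q - profile R k t q) n"
  unfolding mode_def by (rule coef_linear(2)[symmetric]) (use profile_L2 R s t in auto)
 also have "... = coef Q ps ?D n"
  unfolding coef_def
 proof (rule integral_cong_AE)
  show "(%q. (profile R k s q - profile R k t q) * complex_of_real (ps n q)) \<in> borel_measurable Q"
   using profile_L2(1)[OF R s, of k] profile_L2(1)[OF R t, of k] by (auto simp: L2c_def)
  show "(%q. ?D q * complex_of_real (ps n q)) \<in> borel_measurable Q" using D(1) by (auto simp: L2c_def)
  show "AE q in Q. (profile R k s q - profile R k t q) * complex_of_real (ps n q) = ?D q * complex_of_real (ps n q)"
   using ptransform_diff[OF Q b_L2[OF s] b_L2[OF t] kw] by eventually_elim (simp add: profile_def)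
 qed
 finally have eq: "mode R k n s - mode R k n t = coef Q ps ?D n" .
 have "(cmod (coef Q ps ?D n))^2 <= (\<Sum>i<Suc n. (cmod (coef Q ps ?D i))^2)" by (simp add: sum_nonneg)
 also have "... <= (LINT q|Q. (cmod (?D q))^2)" by (rule bessel[OF basis D(1)])
 also have "... <= (sqrt (2 * R) * L2_norm pm (%p. b s p - b t p))^2" using D(2) R by (simp add: power_mult_distrib L2_norm_sq)
 finally have "(cmod (coef Q ps ?D n))^2 <= (sqrt (2 * R) * L2_norm pm (%p. b s p - b t p))^2" .
 thus ?thesis unfolding eq by (rule power2_le_imp_le) (use R in "simp add: L2_norm_nonneg")
qed

lemma continuous_mode:
 assumes R: "1 <= R" shows "continuous_on {0..} (mode R k n)"
 unfolding continuous_on_def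
proof (intro ballI)
 fix t :: real assume "t \<in> {0..}"
 hence t: "0 <= t" by simp
 show "(mode R k n \<longlongrightarrow> mode R k n t) (at t within {0..})"
 proof (rule tendsto_if_norm_diff_le)
  show "((%s. sqrt (2 * R) * L2_norm pm (%p. b s p - b t p)) \<longlongrightarrow> 0) (at t within {0..})"
   by (rule tendsto_mult_right_zero[OF b_cont[OF t]])
  show "\<forall>\<^sub>F s in at t within {0..}. norm (mode R k n s - mode R k n t) <= norm (sqrt (2 * R) * L2_norm pm (%p. b s p - b t p))"
   unfolding eventually_at_filter
   using mode_diff_le[OF R _ t] R by (intro always_eventually allI impI) (auto simp: L2_norm_nonneg abs_mult)
 qed
qed

lemma Mat_sym: "Mat i j = Mat j i"
 unfolding Mat_def by (intro LINT_cong refl) simp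

lemma Mat_0: "Mat 0 n = L2_inner Q chi (ps n)"
 unfolding Mat_def L2_inner_def
 by (rule integral_cong_AE) (use ps0 in "auto elim!: eventually_mono")

lemma Mat_00: "Mat 0 0 = 0"
proof -
 have "Mat 0 0 = (LINT q|Q. chi q)"
  unfolding Mat_def by (rule integral_cong_AE) (use ps0 in "auto elim!: eventually_mono")
 thus ?thesis using chi_mean by simp
qed

text \<open>Separates the coupling among the first \<open>N\<close> modes, given by the matrix, from
  the coupling to the tail of the expansion, which becomes part of the forcing.\<close>

lemma coef_chi_expand:
 assumes F: "L2c Q F"
 shows "coef Q ps (%q. of_real (chi q) * (F q - (\<Sum>m<N. coef Q ps F m * of_real (ps m q)))) n
  = coef Q ps (%q. of_real (chi q) * F q) n - (\<Sum>m<N. of_real (Mat n m) * coef Q ps F m)"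
proof -
 have chi_ps: "(%q. chi q * ps n q) \<in> L2 Q" for n
 proof -
  have le: "(chi q * ps n q)^2 <= X^2 * (ps n q)^2" for q
   unfolding power_mult_distrib using power_mono[OF chi_le[of q], of 2] by (intro mult_right_mono) auto
  have "integrable Q (%q. (chi q * ps n q)^2)"
   by (rule LINT_bound[where f="%q. X^2 * (ps n q)^2"])
   (use le ps[of n] in "auto simp: L2_def")
  thus ?thesis by (auto simp: L2_def)
 qed
 have i1: "integrable Q (%q. of_real (chi q) * F q * complex_of_real (ps n q))"
  using L2c_mult_integrable[OF F chi_ps[of n]] by (simp add: mult_ac)
 have i2: "integrable Q (%q. coef Q ps F m * complex_of_real (chi q * ps n q * ps m q))" for m
  by (intro integrable_mult_right integrable_of_real L2_mult_integrable[OF chi_ps ps])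
 have "coef Q ps (%q. of_real (chi q) * (F q - (\<Sum>m<N. coef Q ps F m * of_real (ps m q)))) n
  = (CLINT q|Q. of_real (chi q) * F q * complex_of_real (ps n q) - (\<Sum>m<N. coef Q ps F m * complex_of_real (chi q * ps n q * ps m q)))"
  unfolding coef_def[of Q ps "%q. of_real (chi q) * (F q - (\<Sum>m<N. coef Q ps F m * of_real (ps m q)))"]
  by (intro LINT_cong refl)
   (simp add: algebra_simps sum_distrib_left sum_distrib_right)
 also have "... = coef Q ps (%q. of_real (chi q) * F q) n - (\<Sum>m<N. CLINT q|Q. coef Q ps F m * complex_of_real (chi q * ps n q * ps m q))"
  using i1 i2 by (subst LINT_diff) (auto simp: coef_def[of Q ps "%q. of_real (chi q) * F q"] LINT_sum)
 also have "(\<Sum>m<N. CLINT q|Q. coef Q ps F m * complex_of_real (chi q * ps n q * ps m q)) = (\<Sum>m<N. of_real (Mat n m) * coef Q ps F m)"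
  by (intro sum.cong refl, subst integral_mult_right_zero, subst integral_of_real[OF L2_mult_integrable[OF chi_ps ps]])
   (simp add: Mat_def mult.commute)
 finally show ?thesis .
qed

end

context taylor_channel begin

text \<open>\<open>ker1\<close> and \<open>ker2\<close> are what remains of \<open>wave'\<close> and
  \<open>wave''\<close> after removing the multiples \<open>- i k\<close> and \<open>- k^2\<close>
  of \<open>wave\<close>; they produce the commutators with the window.\<close>

definition ker1 :: "real => real => real => complex" where
 "ker1 R k x = of_real (window' R x) * iexp (- (k * x))"
definition ker2 :: "real => real => real => complex" where
 "ker2 R k x = (of_real (window'' R x) - 2 * \<i> * of_real k * of_real (window' R x)) * iexp (- (k * x))"

lemma ker1: "1 <= R ==> kernel_on R (6 / R) (ker1 R k)"
 and ker2: "1 <= R ==> kernel_on R ((30 + 12 * abs k) / R) (ker2 R k)"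
 using kernel_wave1 kernel_wave2 by (simp_all add: ker1_def[abs_def] ker2_def[abs_def])

lemma mode_eq: "1 <= R ==> 0 <= s ==> mode R k n s = (CLINT p|pm. of_real (b s p * ps n (snd p)) * wave R k (fst p))"
 using coef_eq[OF kernel_wave] by (simp add: mode_def profile_def)

lemma mode_derivative:
 assumes R: "1 <= R" and s: "0 < s"
 shows "(mode R k n has_vector_derivative
   of_real nu * (coef Q ps (ptransform (b s) (ker2 R k)) n - of_real (k^2) * mode R k n s) - of_real (nu * mu n) * mode R k n s
   + of_real A * (coef Q ps (%q. of_real (chi q) * ptransform (b s) (ker1 R k) q) n
   - \<i> * of_real k * coef Q ps (%q. of_real (chi q) * profile R k s q) n)) (at s)"
proof -
 have s0: "0 <= s" using s by simp
 note kw = kernel_wave[OF R, of k]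
 obtain Bn where Bn: "!!q. \<bar>ps n q\<bar> <= Bn" using ps_bounded by blast
 have Bc: "\<bar>chi q * ps n q\<bar> <= X * Bn" for q
  unfolding abs_mult using chi_le X1 Bn by (intro mult_mono) auto
 have i: "integrable pm (%p. of_real (b s p * ps n (snd p)) * th (fst p))" if "kernel_on R B th" for B th
  by (rule kernel_integrable[OF Q b_L2[OF s0] that ps_meas Bn])
 have ic: "integrable pm (%p. of_real (b s p * (chi (snd p) * ps n (snd p))) * th (fst p))" if "kernel_on R B th" for B th
  using kernel_integrable[OF Q b_L2[OF s0] that, where g="%q. chi q * ps n q", OF _ Bc] by simp
 have 2: "(CLINT p|pm. of_real (b s p * ps n (snd p)) * wave'' R k (fst p))
   = coef Q ps (ptransform (b s) (ker2 R k)) n - of_real (k^2) * mode R k n s"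
 proof -
  have "(CLINT p|pm. of_real (b s p * ps n (snd p)) * wave'' R k (fst p))
   = (CLINT p|pm. of_real (b s p * ps n (snd p)) * ker2 R k (fst p) - of_real (k^2) * (of_real (b s p * ps n (snd p)) * wave R k (fst p)))"
   by (intro LINT_cong refl) (simp add: wave''_def ker2_def wave_def algebra_simps)
  also have "... = (CLINT p|pm. of_real (b s p * ps n (snd p)) * ker2 R k (fst p))
   - of_real (k^2) * (CLINT p|pm. of_real (b s p * ps n (snd p)) * wave R k (fst p))"
   by (subst LINT_diff[OF i[OF ker2[OF R]] integrable_mult_right[OF i[OF kw]]]) (simp only: integral_mult_right_zero)
  finally show ?thesis unfolding coef_eq[OF ker2[OF R] s0] mode_eq[OF R s0] .
 qed
 have 1: "(CLINT p|pm. of_real (b s p * (chi (snd p) * ps n (snd p))) * wave' R k (fst p))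
   = coef Q ps (%q. of_real (chi q) * ptransform (b s) (ker1 R k) q) n
   - \<i> * of_real k * coef Q ps (%q. of_real (chi q) * profile R k s q) n"
 proof -
  have "(CLINT p|pm. of_real (b s p * (chi (snd p) * ps n (snd p))) * wave' R k (fst p))
   = (CLINT p|pm. of_real (b s p * (chi (snd p) * ps n (snd p))) * ker1 R k (fst p)
   - (\<i> * of_real k) * (of_real (b s p * (chi (snd p) * ps n (snd p))) * wave R k (fst p)))"
   by (intro LINT_cong refl) (simp add: wave'_def ker1_def wave_def algebra_simps)
  also have "... = (CLINT p|pm. of_real (b s p * (chi (snd p) * ps n (snd p))) * ker1 R k (fst p))
   - (\<i> * of_real k) * (CLINT p|pm. of_real (b s p * (chi (snd p) * ps n (snd p))) * wave R k (fst p))"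
   by (subst LINT_diff[OF ic[OF ker1[OF R]] integrable_mult_right[OF ic[OF kw]]]) (simp only: integral_mult_right_zero)
  finally show ?thesis unfolding coef_eq_chi[OF ker1[OF R] s0] coef_eq_chi[OF kw s0] profile_def .
 qed
 note D = ode[OF R s, of n k, unfolded 2 1 mode_eq[OF R s0, symmetric]]
 show ?thesis
  by (rule has_vector_derivative_transform_within_open[OF D, of "{0<..}"]) (use s mode_eq[OF R] in auto)
qed

text \<open>In the time \<open>nu * t\<close> the forcing has three sources: the commutators of the
  window with the second and with the first derivative in \<open>x\<close>, whose squares are of
  order \<open>1 / R\<close>, and the profile times the tail of the expansion. The tails decrease to
  0 in \<open>N\<close>, so Dini's theorem makes them small on all of \<open>[0, t]\<close>.
  \<open>C0\<close> may depend on the time and on the solution, because the forcing will tend to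
  0.\<close>

lemma galerkin_truncation:
 assumes t: "0 <= t"
 shows "\<exists>C0\<ge>0. \<forall>R\<ge>1. \<forall>k. \<forall>et>0. \<forall>N'. \<exists>N\<ge>N'. \<exists>f.
  galerkin_modes N Mat mu (%n ta. mode R k n (ta / nu)) f (k * A / nu) k (sqrt (C0 * (1 + k^2) / R + et)) (nu * t) X (mu 1)"
proof -
 have le3: "a <= 3 * (x' + y' + z')" if "a <= 3 * (x + y + z)" "x <= x'" "y <= y'" "z <= z'" for a x y z x' y' z' :: real
  using that by (simp add: distrib_left)
 have le3': "3 * (x + y + z) <= v + u" if "y <= y'" "3 * z <= u" "v = 3 * x + 3 * y'" for v u x y z y' :: real
  using that by (simp add: distrib_left)
 obtain Bs where Bs: "0 <= Bs" "!!s. s \<in> {0..t} ==> (LINT p|pm. (b s p)^2) <= Bs"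
  using bounded_L2_norm_b[of t] by blast
 \<comment> \<open>The factor 3 is the price of squaring a sum of three terms; \<open>3600\<close>
   is twice the constant in \<open>(30 + 12 * abs k)^2 <= 1800 * (1 + k^2)\<close>, and
   \<open>72\<close> is \<open>2 * 6^2\<close>. \<open>Bs\<close> bounds the squared norm of the
   solution on \<open>[0, t]\<close>.\<close>
 define C0 where "C0 = 3 * (3600 + 72 * ((A / nu)^2 * X^2)) * Bs"
 have C0: "0 <= C0" using Bs by (simp add: C0_def)
 show ?thesis
 proof (rule exI[of _ C0], rule conjI[OF C0], intro allI impI)
  fix R k et :: real and N' :: nat
  assume R: "1 <= R" and et: "0 < et"
  define kp where "kp = k * A / nu"
  define tail where "tail N s = (LINT q|Q. (cmod (profile R k s q))^2) - (\<Sum>n<N. (cmod (mode R k n s))^2)" for N s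
  \<comment> \<open>Makes the contribution \<open>3 * kp^2 * X^2 * et'\<close> of the tail at most
    \<open>et\<close>; the \<open>+ 1\<close> covers \<open>kp = 0\<close>.\<close>
  define et' where "et' = et / (3 * (kp^2 * X^2) + 1)"
  have dpos: "0 < 3 * (kp^2 * X^2) + 1" by (intro add_nonneg_pos) auto
  have et': "0 < et'" using et dpos by (simp add: et'_def)
  have "\<exists>n. \<forall>m\<ge>n. \<forall>s\<in>{0..t}. tail m s < et'"
  proof (rule dini_decreasing[OF _ _ _ et'])
   show "continuous_on {0..t} (tail n)" for n
   proof -
   have eq: "tail n = (%s. (L2_norm Q (%q. cmod (profile R k s q)))^2 - (\<Sum>n<n. (cmod (mode R k n s))^2))"
   by (simp add: tail_def fun_eq_iff L2_norm_sq)
   show ?thesis unfolding eq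
   by (intro continuous_intros continuous_on_subset[OF continuous_profile_norm[OF R]] continuous_on_subset[OF continuous_mode[OF R]]) auto
   qed
   show "tail m s <= tail n s" if "n <= m" for n m s
   unfolding tail_def using that by (intro diff_left_mono sum_mono2) auto
   show "(%n. tail n s) ----> 0" if "s \<in> {0..t}" for s
   unfolding tail_def mode_def using that by (intro L2c_projection_error(3)[OF basis profile_L2(1)[OF R]]) auto
  qed
  then obtain n0 where n0: "!!m s. n0 <= m ==> s \<in> {0..t} ==> tail m s < et'" by blast
  define N where "N = max (max n0 N') 1"
  have N: "n0 <= N" "N' <= N" "0 < N" by (auto simp: N_def)
  define E where "E s q = profile R k s q - (\<Sum>m<N. coef Q ps (profile R k s) m * of_real (ps m q))" for s q
  define G where "G s q = ptransform (b s) (ker2 R k) q + of_real (A / nu) * (of_real (chi q) * ptransform (b s) (ker1 R k) q)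
   + (- \<i> * of_real kp) * (of_real (chi q) * E s q)" for s q
  define f where "f n ta = coef Q ps (G (ta / nu)) n" for n ta
  define dl where "dl = sqrt (C0 * (1 + k^2) / R + et)"
  have dl2: "dl^2 = C0 * (1 + k^2) / R + et" "0 <= dl" using C0 R et by (auto simp: dl_def)
  have E: "L2c Q (E s)" "(LINT q|Q. (cmod (E s q))^2) = tail N s" if "0 <= s" for s
   using L2c_projection_error(1,2)[OF basis profile_L2(1)[OF R that, of k], of N]
   by (auto simp: E_def[abs_def] tail_def mode_def)
  have T2: "L2c Q (ptransform (b s) (ker2 R k))" "(LINT q|Q. (cmod (ptransform (b s) (ker2 R k) q))^2) <= 3600 * (1 + k^2) / R * Bs"
   and T1: "L2c Q (ptransform (b s) (ker1 R k))" "(LINT q|Q. (cmod (ptransform (b s) (ker1 R k) q))^2) <= 72 / R * Bs"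
   if s: "s \<in> {0..t}" for s
  proof -
   have s0: "0 <= s" using s by simp
   note p2 = ptransform_L2[OF Q b_L2[OF s0] ker2[OF R, of k]]
   note p1 = ptransform_L2[OF Q b_L2[OF s0] ker1[OF R, of k]]
   show "L2c Q (ptransform (b s) (ker2 R k))" "L2c Q (ptransform (b s) (ker1 R k))" by (rule p2(1), rule p1(1))
   have "(30 + 12 * abs k)^2 <= 1800 * (1 + k^2)"
   proof -
   have "720 * abs k <= 900 + 144 * k^2"
   using sum_squares_bound[of 30 "12 * abs k"] by (simp add: power_mult_distrib)
   moreover have "(30 + 12 * abs k)^2 = 900 + 720 * abs k + 144 * k^2"
   by (simp add: power2_sum power_mult_distrib)
   moreover have "1800 * (1 + k^2) = 1800 + 1800 * k^2" by (simp add: distrib_left)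
   ultimately show ?thesis using zero_le_power2[of k] by linarith
   qed
   hence "2 * R * ((30 + 12 * abs k) / R)^2 <= 2 * R * (1800 * (1 + k^2) / R^2)"
   unfolding power_divide using R by (intro mult_left_mono divide_right_mono) auto
   also have "... = 3600 * (1 + k^2) / R" using R by (simp add: power2_eq_square)
   finally have "2 * R * ((30 + 12 * abs k) / R)^2 * (LINT p|pm. (b s p)^2) <= 3600 * (1 + k^2) / R * Bs"
   using Bs(2)[OF s] R by (intro mult_mono) auto
   thus "(LINT q|Q. (cmod (ptransform (b s) (ker2 R k) q))^2) <= 3600 * (1 + k^2) / R * Bs"
   using p2(2) by linarith
   have "2 * R * (6 / R)^2 = 72 / R" using R by (simp add: power2_eq_square)
   hence "2 * R * (6 / R)^2 * (LINT p|pm. (b s p)^2) <= 72 / R * Bs"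
   using Bs(2)[OF s] R by (intro mult_mono) auto
   thus "(LINT q|Q. (cmod (ptransform (b s) (ker1 R k) q))^2) <= 72 / R * Bs"
   using p1(2) by linarith
  qed
  have G: "L2c Q (G s)" "(LINT q|Q. (cmod (G s q))^2) <= dl^2" if s: "s \<in> {0..t}" for s
  proof -
   have s0: "0 <= s" using s by simp
   note c1 = L2c_mult_chi[OF T1(1)[OF s]] and cE = L2c_mult_chi[OF E(1)[OF s0]]
   note a1 = L2c_cmult[OF c1(1), of "of_real (A / nu)"] and aE = L2c_cmult[OF cE(1), of "- \<i> * of_real kp"]
   note g = L2c_add3[OF T2(1)[OF s] a1(1) aE(1)]
   show "L2c Q (G s)" unfolding G_def[abs_def] by (rule g(1))
   have "(cmod (of_real (A / nu)))^2 * (LINT q|Q. (cmod (of_real (chi q) * ptransform (b s) (ker1 R k) q))^2)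
   <= (A / nu)^2 * (X^2 * (72 / R * Bs))"
   proof -
   have "(cmod (of_real (A / nu)))^2 = (A / nu)^2" by (simp only: norm_of_real power2_abs)
   moreover have "(LINT q|Q. (cmod (of_real (chi q) * ptransform (b s) (ker1 R k) q))^2) <= X^2 * (72 / R * Bs)"
   using T1(2)[OF s] by (intro order_trans[OF c1(2)] mult_left_mono) auto
   ultimately show ?thesis by (simp only:) (intro mult_left_mono, auto)
   qed
   moreover have "(cmod (- \<i> * of_real kp))^2 * (LINT q|Q. (cmod (of_real (chi q) * E s q))^2) <= kp^2 * (X^2 * et')"
   proof (intro mult_mono)
   have "(LINT q|Q. (cmod (E s q))^2) <= et'" using E(2)[OF s0] n0[OF N(1) s] by simp
   hence "X^2 * (LINT q|Q. (cmod (E s q))^2) <= X^2 * et'" by (intro mult_left_mono) auto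
   thus "(LINT q|Q. (cmod (of_real (chi q) * E s q))^2) <= X^2 * et'" using cE(2) by linarith
   qed (auto simp: norm_mult)
   ultimately have "(LINT q|Q. (cmod (G s q))^2) <= 3 * (3600 * (1 + k^2) / R * Bs + (A / nu)^2 * (X^2 * (72 / R * Bs)) + kp^2 * (X^2 * et'))"
   unfolding G_def by (rule le3[OF g(2)[unfolded a1(2) aE(2)] T2(2)[OF s]])
   also have "... <= C0 * (1 + k^2) / R + et"
   proof -
   have "72 / R * Bs * 1 <= 72 / R * Bs * (1 + k^2)" using R Bs by (intro mult_left_mono) auto
   hence "(A / nu)^2 * (X^2 * (72 / R * Bs)) <= (A / nu)^2 * (X^2 * (72 / R * Bs * (1 + k^2)))" by (intro mult_left_mono) auto
   moreover have "3 * (kp^2 * (X^2 * et')) <= et"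
   proof -
   have "(3 * (kp^2 * X^2)) * et' <= (3 * (kp^2 * X^2) + 1) * et'" using et' by (intro mult_right_mono) auto
   also have "... = et" using dpos by (simp add: et'_def)
   finally show ?thesis by (simp add: mult_ac)
   qed
   moreover have "C0 * (1 + k^2) / R = 3 * (3600 * (1 + k^2) / R * Bs) + 3 * ((A / nu)^2 * (X^2 * (72 / R * Bs * (1 + k^2))))"
   unfolding C0_def by (simp add: algebra_simps add_divide_distrib)
   ultimately show ?thesis by (rule le3')
   qed
   finally show "(LINT q|Q. (cmod (G s q))^2) <= dl^2" unfolding dl2 .
  qed
  have "galerkin_modes N Mat mu (%n ta. mode R k n (ta / nu)) f kp k dl (nu * t) X (mu 1)"
  proof
   show "0 < N" by (rule N)
   show "Mat i j = Mat j i" for i j by (rule Mat_sym)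
   show "Mat 0 0 = 0" "mu 0 = 0" "0 < mu 1" "1 <= X" "0 <= dl" by (fact Mat_00 mu0 mu1 X1 dl2)+
   show "mu 1 <= mu n" if "0 < n" for n using mu_mono that by (simp add: monoD)
   show "0 <= nu * t" using nu t by simp
   show "(\<Sum>i<N. (\<Sum>j<N. Mat i j * v j)^2) <= X^2 * (\<Sum>j<N. (v j)^2)" for v
   unfolding Mat_def by (rule matrix_bound[OF basis chi_meas chi_le])
   show "continuous_on {0..nu * t} (%ta. mode R k n (ta / nu))" for n
   by (rule continuous_on_compose2[OF continuous_mode[OF R]]) (use nu in "auto intro!: continuous_intros")
   fix ta assume ta: "0 < ta" "ta < nu * t"
   hence s: "0 < ta / nu" "ta / nu \<in> {0..t}" using nu by (auto simp: divide_le_eq mult.commute)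
   have s0: "0 <= ta / nu" using s by simp
   show "(\<Sum>n<N. (cmod (f n ta))^2) <= dl^2"
   unfolding f_def using bessel[OF basis G(1)[OF s(2)], of N] G(2)[OF s(2)] by linarith
   fix n
   define s where "s = ta / nu"
   have sp: "0 < s" "s \<in> {0..t}" "0 <= s" using s s0 by (auto simp: s_def)
   define z where "z = mode R k n s"
   define g2 where "g2 = coef Q ps (ptransform (b s) (ker2 R k)) n"
   define g1 where "g1 = coef Q ps (%q. of_real (chi q) * ptransform (b s) (ker1 R k) q) n"
   define gE where "gE = coef Q ps (%q. of_real (chi q) * E s q) n"
   define gM where "gM = (\<Sum>j<N. of_real (Mat n j) * mode R k j s)"
   have expand: "coef Q ps (%q. of_real (chi q) * profile R k s q) n = gE + gM"
   using coef_chi_expand[OF profile_L2(1)[OF R sp(3), of k], of N n] by (simp add: gE_def E_def gM_def mode_def)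
   have feq: "f n ta = g2 + of_real (A / nu) * g1 + (- \<i> * of_real kp) * gE"
   proof -
   note c1 = L2c_mult_chi(1)[OF T1(1)[OF sp(2)]] and cE = L2c_mult_chi(1)[OF E(1)[OF sp(3)]]
   note a1 = L2c_cmult(1)[OF c1, of "of_real (A / nu)"] and aE = L2c_cmult(1)[OF cE, of "- \<i> * of_real kp"]
   have T2a: "L2c Q (%q. ptransform (b s) (ker2 R k) q + of_real (A / nu) * (of_real (chi q) * ptransform (b s) (ker1 R k) q))"
   using L2c_add3(1)[OF T2(1)[OF sp(2)] a1, of "%_. 0"] by (simp add: L2c_def)
   have "f n ta = coef Q ps (%q. (ptransform (b s) (ker2 R k) q + of_real (A / nu) * (of_real (chi q) * ptransform (b s) (ker1 R k) q))
   + (- \<i> * of_real kp) * (of_real (chi q) * E s q)) n"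
   unfolding f_def s_def[symmetric] G_def[abs_def] ..
   also have "... = g2 + of_real (A / nu) * g1 + (- \<i> * of_real kp) * gE"
   unfolding coef_linear(1)[OF T2a aE] coef_linear(1)[OF T2(1)[OF sp(2)] a1] coef_linear(3)[OF c1 c1] coef_linear(3)[OF cE cE]
   by (simp add: g2_def g1_def gE_def)
   finally show ?thesis .
   qed
   have "((%ta. ta / nu) has_vector_derivative (1 / nu)) (at ta)"
   unfolding has_real_derivative_iff_has_vector_derivative[symmetric] using nu(1) by (auto intro!: derivative_eq_intros)
   from vector_diff_chain_at[OF this mode_derivative[OF R s(1), of k n]]
   have D: "((%ta. mode R k n (ta / nu)) has_vector_derivative
   (1 / nu) *\<^sub>R (of_real nu * (g2 - of_real (k^2) * z) - of_real (nu * mu n) * z + of_real A * (g1 - \<i> * of_real k * (gE + gM)))) (at ta)"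
   unfolding s_def[symmetric] expand by (simp add: o_def g2_def g1_def z_def)
   have nz: "nu \<noteq> 0" using nu(1) by simp
   have "(1 / nu) *\<^sub>R (of_real nu * (g2 - of_real (k^2) * z) - of_real (nu * mu n) * z + of_real A * (g1 - \<i> * of_real k * (gE + gM)))
   = - of_real (mu n + k^2) * z - \<i> * of_real kp * gM + f n ta"
   unfolding feq kp_def scaleR_conv_of_real using nz by (simp add: field_simps)
   with D show "((%ta. mode R k n (ta / nu)) has_vector_derivative
   (- of_real (mu n + k^2) * mode R k n (ta / nu) - \<i> * of_real kp * (\<Sum>j<N. of_real (Mat n j) * mode R k j (ta / nu)) + f n ta)) (at ta)"
   by (simp add: z_def gM_def s_def)
  qed
  thus "\<exists>N\<ge>N'. \<exists>f. galerkin_modes N Mat mu (%n ta. mode R k n (ta / nu)) f (k * A / nu) k (sqrt (C0 * (1 + k^2) / R + et)) (nu * t) X (mu 1)"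
   using N(2) unfolding kp_def dl_def by blast
 qed
qed

end

section \<open>Weighted initial data and their transforms\<close>

lemma integrable_cauchy_density: "integrable lborel (%x::real. 1 / (1 + x^2))"
 using integrable_inverse_1_plus_square
 by (simp add: set_integrable_def einterval_def inverse_eq_divide)

text \<open>Equal to \<open>pi\<close>. It enters as the constant of Cauchy-Schwarz against the
  weight \<open>1 + x^2\<close>.\<close>

definition cmass :: real where "cmass = (LINT x|lborel. 1 / (1 + x^2))"

lemma cmass_nonneg: "0 <= cmass"
 unfolding cmass_def by (rule LINT_nonneg) (simp add: add_nonneg_nonneg)

context taylor_channel begin

definition W where "W = (LINT p|pm. (1 + (fst p)^2) ^ w * (b 0 p)^2)"
definition C1 where "C1 = (LINT p|pm. b 0 p)"
text \<open>Will bound both the mass and the first absolute moment of the initial datum; the 2 stems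
  from \<open>(1 + |x|)^2 <= 2 * (1 + x^2)\<close>.\<close>

definition m1 where "m1 = sqrt (2 * cmass * W)"
text \<open>Kept as a function of the frequency: its uniform bound is not integrable, and at high
  frequencies it is its integral, controlled by Plancherel's inequality, that counts.\<close>

definition H where "H R k = (LINT q|Q. (cmod (profile R k 0 q))^2)"

lemma b0_meas [measurable]: "b 0 \<in> borel_measurable pm" using b_L2[of 0] by (simp add: L2_def)

lemma W_nonneg: "0 <= W" unfolding W_def by (rule LINT_nonneg) (simp add: add_nonneg_nonneg)

lemma weight_ge: "1 + x^2 <= (1 + x^2) ^ w" "1 <= (1 + x^2) ^ w" "(1 + x^2)^2 <= (1 + x^2) ^ w" for x :: real
proof -
 show "(1 + x^2)^2 <= (1 + x^2) ^ w" using w by (intro power_increasing) auto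
 show "1 <= (1 + x^2) ^ w" by (rule one_le_power) simp
 show "1 + x^2 <= (1 + x^2) ^ w" using power_increasing[of 1 w "1 + x^2"] w by simp
qed

lemma b0_L2_le_W: "(LINT p|pm. (b 0 p)^2) <= W"
 unfolding W_def
proof (rule integral_mono[OF _ b_init])
 show "integrable pm (%p. (b 0 p)^2)" using b_L2[of 0] by (simp add: L2_def)
 show "(b 0 p)^2 <= (1 + (fst p)^2) ^ w * (b 0 p)^2" for p
  using mult_right_mono[OF weight_ge(2)[of "fst p"], of "(b 0 p)^2"] by simp
qed

lemma H_le: assumes R: "1 <= R" shows "H R k <= cmass * W" "0 <= H R k"
proof -
 show "0 <= H R k" unfolding H_def by (rule LINT_nonneg) simp
 define g where "g p = (1 + (fst p)^2) ^ w * (b 0 p)^2" for p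
 have gi: "integrable pm (%(x, q). g (x, q))" using b_init by (simp add: g_def case_prod_unfold)
 have le: "AE q in Q. (cmod (profile R k 0 q))^2 <= cmass * (LINT x|lborel. g (x, q))"
  using pair.AE_integrable_snd[OF gi] AE_space
 proof eventually_elim
  case (elim q)
  hence [measurable]: "(%x. b 0 (x, q)) \<in> borel_measurable borel" by simp
  define u where "u x = sqrt (1 + x^2) * \<bar>b 0 (x, q)\<bar>" for x
  define v :: "real => real" where "v x = 1 / sqrt (1 + x^2)" for x
  have u2: "(u x)^2 <= g (x, q)" for x
   unfolding u_def g_def power_mult_distrib using weight_ge(1)[of x]
   by (simp add: add_nonneg_nonneg mult_right_mono)
  have ui: "integrable lborel (%x. (u x)^2)"
  proof (rule LINT_bound[OF elim(1)])
   show "AE x in lborel. norm ((u x)^2) <= norm (g (x, q))"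
   by (intro AE_I2) (use order_trans[OF u2 abs_ge_self] in simp)
  qed (simp add: u_def)
  have v2: "(v x)^2 = 1 / (1 + x^2)" for x by (simp add: v_def power_divide add_nonneg_nonneg)
  have "u \<in> borel_measurable lborel" "v \<in> borel_measurable lborel"
   unfolding u_def[abs_def] v_def[abs_def] by measurable
  hence uL: "u \<in> L2 lborel" "v \<in> L2 lborel"
   using ui integrable_cauchy_density by (auto simp: L2_def v2)
  have uv: "u x * v x = \<bar>b 0 (x, q)\<bar>" for x
  proof -
   have "0 < 1 + x^2" by (simp add: add_pos_nonneg)
   thus ?thesis by (simp add: u_def v_def)
  qed
  have "cmod (profile R k 0 q) <= (LINT x|lborel. cmod (of_real (b 0 (x, q)) * wave R k x))"
   unfolding profile_def ptransform_def by (rule integral_norm_bound)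
  also have "... <= (LINT x|lborel. u x * v x)"
  proof (rule integral_mono')
   show "integrable lborel (%x. u x * v x)" by (rule L2_mult_integrable[OF uL])
   show "cmod (of_real (b 0 (x, q)) * wave R k x) <= u x * v x" for x
   unfolding uv using window_01[of R x] by (simp add: wave_def norm_mult mult_left_le)
  qed (simp add: uv)
  finally have "(cmod (profile R k 0 q))^2 <= (LINT x|lborel. u x * v x)^2" by (intro power_mono) auto
  also have "... <= (LINT x|lborel. (u x)^2) * (LINT x|lborel. (v x)^2)" by (rule integral_Cauchy_Schwarz[OF uL])
  also have "... <= (LINT x|lborel. g (x, q)) * cmass"
   unfolding v2 cmass_def[symmetric]
   by (intro mult_right_mono integral_mono[OF ui elim(1) u2] cmass_nonneg)
  finally show ?case by (simp add: mult.commute)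
 qed
 have "H R k <= (LINT q|Q. cmass * (LINT x|lborel. g (x, q)))"
  unfolding H_def
  by (rule integral_mono_AE[OF _ _ le])
   (use profile_L2(1)[OF R, of 0 k] pair.integrable_snd[OF gi] in "auto simp: L2c_def")
 also have "... = cmass * W"
  using pair.integral_snd[OF gi] by (simp add: W_def g_def case_prod_unfold)
 finally show "H R k <= cmass * W" .
qed

text \<open>Cauchy-Schwarz against the weight: since \<open>2 <= w\<close>, the quotient
  \<open>(1 + |x|)^2 / (1 + x^2)^w\<close> is at most \<open>2 / (1 + x^2)\<close> and hence
  integrable.\<close>

lemma first_moment:
 shows "integrable pm (%p. (1 + \<bar>fst p\<bar>) * \<bar>b 0 p\<bar>)" "(LINT p|pm. (1 + \<bar>fst p\<bar>) * \<bar>b 0 p\<bar>) <= m1"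
proof -
 define u where "u p = sqrt ((1 + (fst p)^2) ^ w) * \<bar>b 0 p\<bar>" for p :: "real \<times> 'q"
 define v where "v p = (1 + \<bar>fst p\<bar>) / sqrt ((1 + (fst p)^2) ^ w)" for p :: "real \<times> 'q"
 have pos: "0 < (1 + x^2) ^ w" for x :: real by (simp add: add_pos_nonneg)
 have u2: "(u p)^2 = (1 + (fst p)^2) ^ w * (b 0 p)^2" for p
  using pos[of "fst p"] by (simp add: u_def power_mult_distrib less_imp_le)
 have v2: "(v p)^2 <= 2 * (1 / (1 + (fst p)^2) * 1)" for p
 proof -
  let ?x = "fst p"
  have p1: "0 < 1 + ?x^2" by (simp add: add_pos_nonneg)
  have "(v p)^2 = (1 + \<bar>?x\<bar>)^2 / (1 + ?x^2) ^ w" using pos[of ?x] by (simp add: v_def power_divide less_imp_le)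
  also have "... <= (2 * (1 + ?x^2)) / (1 + ?x^2)^2"
  proof (rule frac_le[OF _ _ zero_less_power[OF p1] weight_ge(3)])
   show "(1 + \<bar>?x\<bar>)^2 <= 2 * (1 + ?x^2)" using sum_squares_bound[of 1 "\<bar>?x\<bar>"] by (simp add: power2_sum)
   show "0 <= 2 * (1 + ?x^2)" using p1 by simp
  qed
  also have "... = 2 * (1 / (1 + ?x^2) * 1)"
  proof -
   obtain d where d: "d = 1 + ?x^2" by blast
   show ?thesis using p1 unfolding d[symmetric] by (simp add: power2_eq_square)
  qed
  finally show ?thesis .
 qed
 have ci: "integrable pm (%p. 1 / (1 + (fst p)^2) * 1)"
  using pair.integrable_fst_mult_snd[OF integrable_cauchy_density, of "%_. 1"] by simp
 have cI: "(LINT p|pm. 1 / (1 + (fst p)^2) * 1) = cmass"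
 proof -
  have "integrable pm (%(x, q). 1 / (1 + x^2) * 1)" using ci by (simp add: case_prod_unfold)
  from pair.integral_fst[OF this] show ?thesis
   by (simp add: case_prod_unfold cmass_def Q.prob_space)
 qed
 have um: "u \<in> borel_measurable pm" "v \<in> borel_measurable pm" unfolding u_def[abs_def] v_def[abs_def] by measurable
 have uL: "u \<in> L2 pm" using um b_init by (simp add: L2_def u2)
 have vi: "integrable pm (%p. (v p)^2)"
  by (rule LINT_bound[OF integrable_mult_right[OF ci, of 2]])
   (use um v2 in "auto intro: order_trans[OF _ abs_ge_self] simp del: mult_1_right")
 have vL: "v \<in> L2 pm" using um vi by (simp add: L2_def)
 have uv: "u p * v p = (1 + \<bar>fst p\<bar>) * \<bar>b 0 p\<bar>" for p
 proof -
  obtain c where c: "c = sqrt ((1 + (fst p)^2) ^ w)" by blast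
  have "0 < c" unfolding c by (rule real_sqrt_gt_zero[OF pos])
  thus ?thesis unfolding u_def v_def c[symmetric] by simp
 qed
 show "integrable pm (%p. (1 + \<bar>fst p\<bar>) * \<bar>b 0 p\<bar>)" using L2_mult_integrable[OF uL vL] by (simp add: uv)
 have "(LINT p|pm. (v p)^2) <= (LINT p|pm. 2 * (1 / (1 + (fst p)^2) * 1))"
  by (rule integral_mono[OF vi integrable_mult_right[OF ci] v2])
 also have "... = 2 * cmass" unfolding integral_mult_right_zero cI ..
 finally have vI: "(LINT p|pm. (v p)^2) <= 2 * cmass" .
 have "(LINT p|pm. (1 + \<bar>fst p\<bar>) * \<bar>b 0 p\<bar>)^2 <= (LINT p|pm. (u p)^2) * (LINT p|pm. (v p)^2)"
  using integral_Cauchy_Schwarz[OF uL vL] by (simp add: uv)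
 also have "... <= W * (2 * cmass)"
  unfolding u2 W_def[symmetric] by (intro mult_left_mono vI W_nonneg)
 finally show "(LINT p|pm. (1 + \<bar>fst p\<bar>) * \<bar>b 0 p\<bar>) <= m1"
  unfolding m1_def by (intro real_le_rsqrt) (simp add: mult_ac)
qed

lemma m1_nonneg: "0 <= m1" using W_nonneg cmass_nonneg by (simp add: m1_def)

lemma b0_integrable: "integrable pm (b 0)"
 by (rule LINT_bound[OF first_moment(1)])
   (auto intro!: AE_I2 simp: abs_mult mult_le_cancel_right1)

lemma C1_le: "abs C1 <= m1"
proof -
 have "abs C1 <= (LINT p|pm. \<bar>b 0 p\<bar>)" unfolding C1_def by (rule integral_abs_bound)
 also have "... <= (LINT p|pm. (1 + \<bar>fst p\<bar>) * \<bar>b 0 p\<bar>)"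
  using b0_integrable first_moment(1) by (intro integral_mono) (auto simp: mult_le_cancel_right1)
 finally show ?thesis using first_moment(2) by linarith
qed

lemma cmod_iexp_minus_1: "cmod (iexp x - 1) <= abs x"
 using iexp_approx1[of x 0] by simp

text \<open>The finite first moment makes the transform of the initial mean Lipschitz at frequency
  0, where its value is the total mass. \<open>e\<close> is the mass cut off by the window, which is
  the same for all frequencies.\<close>

lemma mode_0_initial:
 "\<exists>e. e ----> 0 \<and> (\<forall>j k. cmod (mode (real (Suc j)) k 0 0 - of_real C1) <= abs k * m1 + e j)"
proof -
 define e where "e j = (LINT p|pm. (1 - window (real (Suc j)) (fst p)) * \<bar>b 0 p\<bar>)" for j
 have bint: "integrable pm (%p. \<bar>b 0 p\<bar>)" using b0_integrable by simp
 have ei: "integrable pm (%p. (1 - window (real (Suc j)) (fst p)) * \<bar>b 0 p\<bar>)" for j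
  by (rule LINT_bound[OF bint])
   (use window_01 in "auto intro!: AE_I2 mult_left_le_one_le simp: abs_mult")
 have "e ----> (LINT p|pm. (1 - 1) * \<bar>b 0 p\<bar>)"
  unfolding e_def
 proof (rule integral_dominated_convergence[OF _ _ bint])
  show "AE p in pm. (%j. (1 - window (real (Suc j)) (fst p)) * \<bar>b 0 p\<bar>) ----> (1 - 1) * \<bar>b 0 p\<bar>"
   by (intro AE_I2 tendsto_intros window_tendsto_1)
  show "AE p in pm. norm ((1 - window (real (Suc j)) (fst p)) * \<bar>b 0 p\<bar>) <= \<bar>b 0 p\<bar>" for j
   using window_01 by (auto intro!: AE_I2 mult_left_le_one_le simp: abs_mult)
 qed auto
 hence e0: "e ----> 0" by simp
 have "cmod (mode (real (Suc j)) k 0 0 - of_real C1) <= abs k * m1 + e j" for j k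
 proof -
  let ?R = "real (Suc j)"
  have R: "1 <= ?R" by simp
  have wi: "integrable pm (%p. of_real (b 0 p) * wave ?R k (fst p))"
   using kernel_integrable[OF Q b_L2[OF order_refl] kernel_wave[OF R, of k], of "%_. 1" 1] by simp
  have "mode ?R k 0 0 = (CLINT p|pm. of_real (b 0 p) * wave ?R k (fst p))"
  proof -
   have "mode ?R k 0 0 = (CLINT q|Q. ptransform (b 0) (wave ?R k) q * of_real (ps 0 q))"
   by (simp add: mode_def profile_def coef_def)
   also have "... = (CLINT q|Q. ptransform (b 0) (wave ?R k) q * of_real 1)"
   by (rule integral_cong_AE)
   (use ps0 ptransform_measurable[OF Q b_L2[OF order_refl] kernel_wave[OF R, of k]] in "auto elim!: eventually_mono")
   also have "... = (CLINT p|pm. of_real (b 0 p * 1) * wave ?R k (fst p))"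
   by (rule ptransform_integral[OF Q b_L2[OF order_refl] kernel_wave[OF R, of k], of "%_. 1" 1, symmetric]) auto
   finally show ?thesis by simp
  qed
  moreover have "of_real C1 = (CLINT p|pm. of_real (b 0 p))" by (simp add: C1_def)
  ultimately have "mode ?R k 0 0 - of_real C1 = (CLINT p|pm. of_real (b 0 p) * wave ?R k (fst p) - of_real (b 0 p))"
   using wi b0_integrable by simp
  hence "cmod (mode ?R k 0 0 - of_real C1) <= (LINT p|pm. cmod (of_real (b 0 p) * wave ?R k (fst p) - of_real (b 0 p)))"
   by simp
  also have "... <= (LINT p|pm. abs k * ((1 + \<bar>fst p\<bar>) * \<bar>b 0 p\<bar>) + (1 - window ?R (fst p)) * \<bar>b 0 p\<bar>)"
  proof (rule integral_mono)
   show "integrable pm (%p. cmod (of_real (b 0 p) * wave ?R k (fst p) - of_real (b 0 p)))" using wi b0_integrable by simp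
   show "integrable pm (%p. abs k * ((1 + \<bar>fst p\<bar>) * \<bar>b 0 p\<bar>) + (1 - window ?R (fst p)) * \<bar>b 0 p\<bar>)"
   using first_moment(1) ei by simp
   fix p :: "real \<times> 'q"
   let ?x = "fst p"
   have "wave ?R k ?x - 1 = of_real (window ?R ?x) * (iexp (- (k * ?x)) - 1) - of_real (1 - window ?R ?x)"
   by (simp add: wave_def algebra_simps)
   hence "cmod (wave ?R k ?x - 1) <= \<bar>window ?R ?x\<bar> * cmod (iexp (- (k * ?x)) - 1) + \<bar>1 - window ?R ?x\<bar>"
   by (metis norm_triangle_ineq4 norm_mult norm_of_real)
   also have "... <= 1 * (abs k * \<bar>?x\<bar>) + (1 - window ?R ?x)"
   using window_01[of ?R ?x] cmod_iexp_minus_1[of "- (k * ?x)"] by (intro add_mono mult_mono) (auto simp: abs_mult)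
   also have "... <= abs k * (1 + \<bar>?x\<bar>) + (1 - window ?R ?x)" by (simp add: algebra_simps)
   finally have "cmod (wave ?R k ?x - 1) * \<bar>b 0 p\<bar> <= (abs k * (1 + \<bar>?x\<bar>) + (1 - window ?R ?x)) * \<bar>b 0 p\<bar>" by (rule mult_right_mono) simp
   moreover have "cmod (of_real (b 0 p) * wave ?R k ?x - of_real (b 0 p)) = cmod (wave ?R k ?x - 1) * \<bar>b 0 p\<bar>"
   by (metis mult.commute mult.right_neutral norm_mult norm_of_real right_diff_distrib)
   ultimately show "cmod (of_real (b 0 p) * wave ?R k ?x - of_real (b 0 p)) <= abs k * ((1 + \<bar>?x\<bar>) * \<bar>b 0 p\<bar>) + (1 - window ?R ?x) * \<bar>b 0 p\<bar>"
   by (simp add: algebra_simps)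
  qed
  also have "... = abs k * (LINT p|pm. (1 + \<bar>fst p\<bar>) * \<bar>b 0 p\<bar>) + e j"
   unfolding e_def using first_moment(1) ei by (subst Bochner_Integration.integral_add) auto
  also have "... <= abs k * m1 + e j" using first_moment(2) by (intro add_right_mono mult_left_mono) auto
  finally show ?thesis .
 qed
 with e0 show ?thesis by blast
qed

lemma profile_fourier: "profile R k t q = fourier (%x. b t (x, q) * window R x) k"
 by (simp add: profile_def ptransform_def fourier_def wave_def mult.assoc)

text \<open>Plancherel's inequality on almost every section \<open>q\<close>, integrated over the
  cross section. Tonelli's theorem first provides integrability on the product; only then may the
  order of integration be exchanged.\<close>

lemma H_transform:
 assumes R: "1 <= R" and s: "0 < s"
 shows "H R \<in> borel_measurable borel" "integrable lborel (%k. exp (- (s^2 * k^2 / 2)) * H R k)"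
  "(LINT k|lborel. exp (- (s^2 * k^2 / 2)) * H R k) <= 2 * pi * W"
proof -
 have [measurable]: "(%(k, q). profile R k 0 q) \<in> borel_measurable pm"
  unfolding profile_def ptransform_def wave_def by measurable
 have pmm [measurable]: "(%p. profile R (fst p) 0 (snd p)) \<in> borel_measurable pm"
  unfolding profile_def ptransform_def wave_def by measurable
 show Hm [measurable]: "H R \<in> borel_measurable borel" unfolding H_def[abs_def] by measurable
 define g where "g k q = exp (- (s^2 * k^2 / 2)) * (cmod (profile R k 0 q))^2" for k q
 have gm [measurable]: "(%(k, q). g k q) \<in> borel_measurable pm" unfolding g_def case_prod_unfold by measurable
 have b2: "integrable pm (%(x, q). (b 0 (x, q))^2)" using b_L2[of 0] by (simp add: L2_def case_prod_unfold)
 have ae: "AE q in Q. integrable lborel (%k. g k q) \<and> (LINT k|lborel. g k q) <= 2 * pi * (LINT x|lborel. (b 0 (x, q))^2)"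
  using kernel_AE(2)[OF Q b_L2[OF order_refl] kernel_wave[OF R, of 0]] pair.AE_integrable_snd[OF b2] AE_space
 proof eventually_elim
  case (elim q)
  have [measurable]: "(%x. b 0 (x, q)) \<in> borel_measurable borel" using elim(1) by (simp add: L2_def)
  define f where "f x = b 0 (x, q) * window R x" for x
  have fm [measurable]: "f \<in> borel_measurable borel" unfolding f_def by measurable
  have f2: "integrable lborel (%x. (f x)^2)"
   unfolding f_def using integrable_window_square[of "%x. b 0 (x, q)" "window R"] elim(2) window_01[of R]
   by (simp add: mult.commute abs_le_iff order_trans[OF _ window_01(1)])
  have fi: "integrable lborel f"
  proof -
   have "(%x. b 0 (x, q)) \<in> L2 lborel" by (rule elim(1))
   from L2_mult_integrable[OF this kernel_square(1)[OF kernel_wave[OF R, of 0]]]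
   have "integrable lborel (%x. b 0 (x, q) * cmod (wave R 0 x))" .
   moreover have "cmod (wave R 0 x) = window R x" for x using window_01(1)[of R x] by (simp add: wave_def norm_mult)
   ultimately show ?thesis by (simp add: f_def[abs_def])
  qed
  have geq: "g k q = exp (- (s^2 * k^2 / 2)) * (cmod (fourier f k))^2" for k
   by (simp add: g_def profile_fourier f_def[abs_def])
  have "integrable lborel (%k. g k q)" unfolding geq by (rule integrable_smoothed_energy[OF fi s])
  moreover have "(LINT k|lborel. g k q) <= 2 * pi * (LINT x|lborel. (f x)^2)"
   unfolding geq using smoothed_energy_le[OF fi f2 s] by (simp add: smoothed_energy_def)
  moreover have "(LINT x|lborel. (f x)^2) <= (LINT x|lborel. (b 0 (x, q))^2)"
  proof (rule integral_mono[OF f2])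
   show "integrable lborel (%x. (b 0 (x, q))^2)" using elim(2) by simp
   show "(f x)^2 <= (b 0 (x, q))^2" for x
   using window_01[of R x]
   by (simp add: f_def power_mult_distrib mult_left_le power_le_one)
  qed
  ultimately show ?case by (smt (verit) mult_left_mono pi_gt_zero)
 qed
 have nn: "(\<integral>\<^sup>+p. ennreal (case p of (k, q) => g k q) \<partial>pm) < \<infinity>"
 proof -
  have "(\<integral>\<^sup>+p. ennreal (case p of (k, q) => g k q) \<partial>pm) = (\<integral>\<^sup>+q. (\<integral>\<^sup>+k. ennreal (g k q) \<partial>lborel) \<partial>Q)"
   using pair.nn_integral_snd[of "%p. ennreal (case p of (k, q) => g k q)"] by simp
  also have "... <= (\<integral>\<^sup>+q. ennreal (2 * pi * (LINT x|lborel. (b 0 (x, q))^2)) \<partial>Q)"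
  proof (rule nn_integral_mono_AE)
   show "AE q in Q. (\<integral>\<^sup>+k. ennreal (g k q) \<partial>lborel) <= ennreal (2 * pi * (LINT x|lborel. (b 0 (x, q))^2))"
   using ae by eventually_elim (auto simp: nn_integral_eq_integral g_def intro!: ennreal_leI)
  qed
  also have "... < \<infinity>"
  proof -
   have "integrable Q (%q. 2 * pi * (LINT x|lborel. (b 0 (x, q))^2))"
   by (rule integrable_mult_right[OF pair.integrable_snd[OF b2]])
   thus ?thesis by (subst nn_integral_eq_integral) auto
  qed
  finally show ?thesis .
 qed
 have gi: "integrable pm (%(k, q). g k q)"
  using nn by (intro integrableI_nonneg) (auto simp: g_def)
 have Heq: "exp (- (s^2 * k^2 / 2)) * H R k = (LINT q|Q. g k q)" for k by (simp add: H_def g_def)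
 show "integrable lborel (%k. exp (- (s^2 * k^2 / 2)) * H R k)" unfolding Heq by (rule pair.integrable_fst[OF gi])
 have "(LINT k|lborel. exp (- (s^2 * k^2 / 2)) * H R k) = (LINT q|Q. LINT k|lborel. g k q)"
  unfolding Heq by (rule pair.Fubini_integral[OF gi, symmetric])
 also have "... <= (LINT q|Q. 2 * pi * (LINT x|lborel. (b 0 (x, q))^2))"
  by (rule integral_mono_AE[OF pair.integrable_snd[OF gi] integrable_mult_right[OF pair.integrable_snd[OF b2]]])
   (use ae in "auto elim!: eventually_mono")
 also have "... = 2 * pi * (LINT p|pm. (b 0 p)^2)" using pair.integral_snd[OF b2] by (simp add: case_prod_unfold)
 also have "... <= 2 * pi * W" using b0_L2_le_W by (intro mult_left_mono) auto
 finally show "(LINT k|lborel. exp (- (s^2 * k^2 / 2)) * H R k) <= 2 * pi * W" .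
qed

text \<open>The windowed transform of this function is the windowed mode, so Plancherel's inequality
  in \<open>x\<close> leads back from the modes to the solution.\<close>

definition section_mode where "section_mode n t x = (LINT q|Q. b t (x, q) * ps n q)"

lemma fourier_section_mode:
 assumes R: "1 <= R" and t: "0 <= t"
 shows "fourier (%x. window R x * section_mode n t x) k = mode R k n t"
proof -
 obtain Bn where Bn: "!!q. \<bar>ps n q\<bar> <= Bn" using ps_bounded by blast
 have "integrable pm (%(x, q). of_real (b t (x, q) * ps n q) * wave R k x)"
  using kernel_integrable[OF Q b_L2[OF t] kernel_wave[OF R, of k] ps_meas Bn] by (simp add: case_prod_unfold)
 from pair.integral_fst[OF this] have "mode R k n t = (CLINT x|lborel. CLINT q|Q. of_real (b t (x, q) * ps n q) * wave R k x)"
  unfolding mode_eq[OF R t] by (simp add: case_prod_unfold)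
 also have "... = (CLINT x|lborel. of_real (window R x * section_mode n t x) * iexp (- (k * x)))"
 proof (intro LINT_cong refl)
  fix x
  have "(CLINT q|Q. of_real (b t (x, q) * ps n q) * wave R k x) = (CLINT q|Q. of_real (b t (x, q) * ps n q)) * wave R k x"
   by (rule integral_mult_left_zero)
  also have "(CLINT q|Q. of_real (b t (x, q) * ps n q)) = complex_of_real (section_mode n t x)"
   unfolding section_mode_def by (rule integral_complex_of_real)
  finally show "(CLINT q|Q. of_real (b t (x, q) * ps n q) * wave R k x) = of_real (window R x * section_mode n t x) * iexp (- (k * x))"
   by (simp add: wave_def mult_ac)
 qed
 finally show ?thesis by (simp add: fourier_def)
qed

lemma section_mode_L2:
 assumes t: "0 <= t"
 shows "section_mode n t \<in> borel_measurable borel" "integrable lborel (%x. (section_mode n t x)^2)"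
proof -
 have [measurable]: "b t \<in> borel_measurable pm" using b_L2[OF t] by (simp add: L2_def)
 show m: "section_mode n t \<in> borel_measurable borel" unfolding section_mode_def[abs_def] by measurable
 have b2: "integrable pm (%(x, q). (b t (x, q))^2)" using b_L2[OF t] by (simp add: L2_def case_prod_unfold)
 have "AE x in lborel. (section_mode n t x)^2 <= (LINT q|Q. (b t (x, q))^2)"
  using pair.AE_integrable_fst[OF b2]
 proof eventually_elim
  case (elim x)
  have "(%q. b t (x, q)) \<in> L2 Q" using elim by (simp add: L2_def)
  from integral_Cauchy_Schwarz[OF this ps[of n]]
  have "(section_mode n t x)^2 <= (LINT q|Q. (b t (x, q))^2) * (LINT q|Q. (ps n q)^2)" by (simp add: section_mode_def)
  moreover have "(LINT q|Q. (ps n q)^2) = 1"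
   using basis by (auto simp: orthonormal_basis_L2_def L2_inner_def power2_eq_square)
  ultimately show ?case by simp
 qed
 hence le: "AE x in lborel. norm ((section_mode n t x)^2) <= norm (LINT q|Q. (b t (x, q))^2)"
  by eventually_elim (auto intro: order_trans[OF _ abs_ge_self])
 show "integrable lborel (%x. (section_mode n t x)^2)"
  by (rule LINT_bound[OF pair.integrable_fst[OF b2] _ le]) (use m in measurable)
qed

end

section \<open>Convergence to the Gaussian\<close>

lemma fourier_normal_density:
 assumes sg: "0 < sg"
 shows "fourier (normal_density 0 sg) k = of_real (exp (- (sg^2 * k^2 / 2)))"
proof -
 have nd: "normal_density 0 sg x = exp (- ((1 / sg)^2 * x^2 / 2)) / sqrt (2 * pi * sg^2)" for x
  by (simp add: normal_density_def power_divide)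
 have "fourier (normal_density 0 sg) k
   = (CLINT x|lborel. of_real (1 / sqrt (2 * pi * sg^2)) * (of_real (exp (- ((1 / sg)^2 * x^2 / 2))) * iexp (x * (- k))))"
  unfolding fourier_def nd by (intro LINT_cong refl) (simp add: mult_ac)
 also have "... = of_real (1 / sqrt (2 * pi * sg^2)) * of_real (2 * pi * normal_density 0 (1 / sg) (- k))"
  by (subst integral_mult_right_zero, subst gaussian_transform) (use sg in auto)
 also have "... = of_real (exp (- (sg^2 * k^2 / 2)))"
 proof -
  have "1 / sqrt (2 * pi * sg^2) * (2 * pi * normal_density 0 (1 / sg) (- k)) = exp (- (sg^2 * k^2 / 2))"
   using sg by (simp add: normal_density_def real_sqrt_mult real_sqrt_divide power_divide field_simps
   flip: power2_eq_square)
  thus ?thesis by (metis of_real_mult)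
 qed
 finally show ?thesis .
qed

lemma fourier_window_tendsto:
 assumes f: "integrable lborel f"
 shows "(%j. fourier (%x. window (real (Suc j)) x * f x) k) ----> fourier f k"
 unfolding fourier_def
proof (rule integral_dominated_convergence[where w="%x. \<bar>f x\<bar>"])
 show "integrable lborel (%x. \<bar>f x\<bar>)" using f by simp
 show "AE x in lborel. (%j. of_real (window (real (Suc j)) x * f x) * iexp (- (k * x))) ----> of_real (f x) * iexp (- (k * x))"
 proof (intro AE_I2)
  fix x
  have "(%j. of_real (window (real (Suc j)) x * f x) * iexp (- (k * x))) ----> of_real (1 * f x) * iexp (- (k * x))"
   by (intro tendsto_intros window_tendsto_1)
  thus "(%j. of_real (window (real (Suc j)) x * f x) * iexp (- (k * x))) ----> of_real (f x) * iexp (- (k * x))" by simp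
 qed
 show "AE x in lborel. cmod (of_real (window (real (Suc j)) x * f x) * iexp (- (k * x))) <= \<bar>f x\<bar>" for j
  using window_01[of "real (Suc j)"] by (intro AE_I2) (simp add: norm_mult abs_mult mult_left_le_one_le)
qed (use borel_measurable_integrable[OF f] in measurable)

lemma integrable_window_mult:
 assumes R: "0 < R" and g: "g \<in> borel_measurable borel" "integrable lborel (%x. (g x)^2)"
 shows "integrable lborel (%x. window R x * g x)"
proof -
 have "window R \<in> L2 lborel"
  unfolding L2_def
 proof (safe)
  show "integrable lborel (%x. (window R x)^2)"
  proof (rule LINT_bound[of _ "indicator {- R..R} :: real => real"])
   show "integrable lborel (indicator {- R..R} :: real => real)"
   by (simp add: integrable_indicator_iff emeasure_lborel_Icc_eq)
   show "AE x in lborel. norm ((window R x)^2) <= norm (indicator {- R..R} x :: real)"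
   using window_outside[OF R] window_01[of R] by (intro AE_I2) (auto simp: indicator_def power_le_one)
  qed simp
 qed simp
 from L2_mult_integrable[OF this, of g] g show ?thesis by (simp add: L2_def)
qed

context taylor_channel begin

abbreviation "md j == mode (real (Suc j))"

text \<open>The Gaussian gets the same window as the solution: the difference of the transforms is
  then the transform of a single windowed function.\<close>

definition gauss_transform where
 "gauss_transform sg j k = fourier (%x. window (real (Suc j)) x * normal_density 0 sg x) k"

definition mode_error where
 "mode_error sg t j k n = md j k n t - (if n = 0 then of_real C1 * gauss_transform sg j k else 0)"

lemma gauss_transform_tendsto:
 "0 < sg ==> (%j. gauss_transform sg j k) ----> of_real (exp (- (sg^2 * k^2 / 2)))"
 unfolding gauss_transform_def by (subst fourier_normal_density[symmetric])
   (simp_all add: fourier_window_tendsto integrable_normal_density del: of_nat_Suc)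

lemma gauss_transform_le: assumes sg: "0 < sg" shows "cmod (gauss_transform sg j k) <= 1"
proof -
 have i: "integrable lborel (normal_density 0 sg)" using sg by (rule integrable_normal_density)
 have "cmod (gauss_transform sg j k) <= (LINT x|lborel. \<bar>window (real (Suc j)) x * normal_density 0 sg x\<bar>)"
  unfolding gauss_transform_def by (rule cmod_fourier_le)
 also have "... <= (LINT x|lborel. normal_density 0 sg x)"
  by (rule integral_mono'[OF i])
   (use window_01[of "real (Suc j)"] in "auto simp: abs_mult mult_left_le_one_le")
 also have "... = 1" using sg by (rule integral_normal_density)
 finally show ?thesis .
qed

text \<open>Successive replacements: the mean mode at time \<open>t\<close> by \<open>P'\<close>
  times the initial one, \<open>P'\<close> by \<open>P\<close>, the initial mean mode by the mass
  \<open>C1\<close>, \<open>P\<close> by the Gaussian value \<open>p\<close>, and \<open>p\<close>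
  by the transform of the windowed Gaussian. \<open>P'\<close> may vary with \<open>j\<close>, since
  it will contain a partial sum of the Taylor constant.\<close>

lemma mode_error_low:
 assumes sg: "0 < sg" and P: "0 <= P" and e: "0 < e"
  and ev: "!!e. 0 < e ==> EVS j. \<exists>N P'. 0 < N \<and> N' <= N \<and> \<bar>P' - P\<bar> <= e \<and>
   (cmod (md j k 0 t - of_real P' * md j k 0 0))\<^sup>2
   + (\<Sum>n=1..<N. (cmod (md j k n t))^2) <= E + e"
 defines "p \<equiv> exp (- (sg^2 * k^2 / 2))"
 shows "EVS j. (\<Sum>n<N'. (cmod (mode_error sg t j k n))^2)
  <= 2 * E + 2 * (m1 * (P * abs k + \<bar>P - p\<bar>))^2 + e"
proof -
 obtain e0 where e0: "e0 ----> 0" "!!j k. cmod (md j k 0 0 - of_real C1) <= abs k * m1 + e0 j"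
  using mode_0_initial by blast
 define M where "M = m1 * (P * abs k + \<bar>P - p\<bar>)"
 define Z where "Z = abs k * m1 + 1 + m1"
 have M0: "0 <= M" using m1_nonneg P by (simp add: M_def)
 \<comment> \<open>All vanishing errors are collected in one parameter \<open>r\<close>; continuity
   of \<open>h\<close> at 0 then yields the tolerance \<open>e\<close>.\<close>
 define h where "h r = 2 * (E + r) + 2 * (M + r * (Z + P + m1))^2" for r
 have "isCont h 0" unfolding h_def[abs_def] by (intro continuous_intros)
 hence "h \<midarrow>0\<rightarrow> h 0" by (simp add: isCont_def)
 hence "\<forall>\<^sub>F r in at_right 0. h r < h 0 + e"
  using e by (intro order_tendstoD(2)[of h "h 0"]) (auto simp: filterlim_at_split)
 hence "\<exists>b>0. \<forall>y>0. y < b --> h y < h 0 + e" by (simp add: eventually_at_right_field)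
 then obtain b where b: "0 < b" "!!y. 0 < y ==> y < b ==> h y < h 0 + e" by blast
 define r where "r = min (b / 2) 1"
 have r: "0 < r" "r <= 1" "h r < h 0 + e" using b by (auto simp: r_def intro!: b(2))
 have "EVS j. dist (e0 j) 0 < r" by (rule tendstoD[OF e0(1) r(1)])
 moreover have "EVS j. dist (gauss_transform sg j k) (of_real p) < r"
  unfolding p_def by (rule tendstoD[OF gauss_transform_tendsto[OF sg] r(1)])
 ultimately show ?thesis using ev[OF r(1)]
 proof eventually_elim
  case (elim j)
  let ?z0 = "md j k 0 0" and ?zT = "md j k 0 t" and ?g = "gauss_transform sg j k"
  from elim(3) obtain N P' where N: "0 < N" "N' <= N" and P': "\<bar>P' - P\<bar> <= r"
   and le: "(cmod (?zT - of_real P' * ?z0))^2 + (\<Sum>n=1..<N. (cmod (md j k n t))^2) <= E + r" by blast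
  have z01: "cmod (?z0 - of_real C1) <= abs k * m1 + r" using e0(2)[of j k] elim(1) by simp
  have z0: "cmod ?z0 <= Z"
  proof -
   have "cmod ?z0 <= cmod (?z0 - of_real C1) + cmod (of_real C1 :: complex)" using norm_triangle_ineq[of "?z0 - of_real C1" "of_real C1"] by simp
   thus ?thesis using z01 r C1_le by (simp add: Z_def)
  qed
  have "of_real P' * ?z0 - of_real C1 * ?g = of_real (P' - P) * ?z0 + of_real P * (?z0 - of_real C1)
   + of_real C1 * of_real (P - p) + of_real C1 * (of_real p - ?g)" by (simp add: algebra_simps)
  hence "cmod (of_real P' * ?z0 - of_real C1 * ?g) <= \<bar>P' - P\<bar> * cmod ?z0 + P * cmod (?z0 - of_real C1)
   + abs C1 * \<bar>P - p\<bar> + abs C1 * cmod (of_real p - ?g)"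
   by (simp only:) (intro norm_triangle_le add_mono; simp add: norm_mult P del: of_real_diff)
  also have "... <= r * Z + P * (abs k * m1 + r) + m1 * \<bar>P - p\<bar> + m1 * r"
   using elim(2) P P' z0 z01 C1_le m1_nonneg r
   by (intro add_mono mult_mono mult_left_mono) (auto simp: dist_norm norm_minus_commute)
  also have "... = M + r * (Z + P + m1)" by (simp add: M_def algebra_simps)
  finally have c: "cmod (of_real P' * ?z0 - of_real C1 * ?g) <= M + r * (Z + P + m1)" .
  have "(cmod (?zT - of_real C1 * ?g))^2 <= 2 * (cmod (?zT - of_real P' * ?z0))^2 + 2 * (cmod (of_real P' * ?z0 - of_real C1 * ?g))^2"
  proof -
   have "cmod (?zT - of_real C1 * ?g) <= cmod (?zT - of_real P' * ?z0) + cmod (of_real P' * ?z0 - of_real C1 * ?g)"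
   by (rule order_trans[OF _ norm_triangle_ineq]) simp
   hence "(cmod (?zT - of_real C1 * ?g))^2 <= (cmod (?zT - of_real P' * ?z0) + cmod (of_real P' * ?z0 - of_real C1 * ?g))^2"
   by (intro power_mono) auto
   thus ?thesis
   using sum_squares_bound[of "cmod (?zT - of_real P' * ?z0)" "cmod (of_real P' * ?z0 - of_real C1 * ?g)"]
   by (simp add: power2_sum)
  qed
  moreover have "(cmod (of_real P' * ?z0 - of_real C1 * ?g))^2 <= (M + r * (Z + P + m1))^2" using c by (intro power_mono) auto
  moreover have "(\<Sum>n<N'. (cmod (mode_error sg t j k n))^2) <= (cmod (?zT - of_real C1 * ?g))^2 + (\<Sum>n=1..<N. (cmod (md j k n t))^2)"
  proof -
   have "(\<Sum>n<N'. (cmod (mode_error sg t j k n))^2) <= (\<Sum>n<N. (cmod (mode_error sg t j k n))^2)"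
   using N by (intro sum_mono2) auto
   also have "{..<N} = insert 0 {1..<N}" using N by auto
   finally show ?thesis by (simp add: mode_error_def)
  qed
  moreover have "0 <= (\<Sum>n=1..<N. (cmod (md j k n t))^2)" by (intro sum_nonneg) auto
  ultimately have "(\<Sum>n<N'. (cmod (mode_error sg t j k n))^2) <= 2 * E + 2 * r + 2 * (M + r * (Z + P + m1))^2" using le by linarith
  also have "... = h r" by (simp add: h_def)
  also have "... <= 2 * E + 2 * M^2 + e" using r(3) by (simp add: h_def)
  finally show ?case unfolding M_def .
 qed
qed

lemma mode_error_sum_le:
 assumes N: "0 < N" "N' <= N"
 shows "(\<Sum>n<N'. (cmod (mode_error sg t j k n))^2)
  <= 2 * (\<Sum>n<N. (cmod (md j k n t))^2) + 2 * (m1 * cmod (gauss_transform sg j k))^2"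
proof -
 let ?g = "gauss_transform sg j k"
 have pw: "(cmod (mode_error sg t j k n))^2 <= 2 * (cmod (md j k n t))^2 + (if n = 0 then 2 * (m1 * cmod ?g)^2 else 0)" for n
 proof (cases "n = 0")
  case True
  have "cmod (mode_error sg t j k n) <= cmod (md j k n t) + abs C1 * cmod ?g"
   using True by (auto simp: mode_error_def norm_mult intro!: order_trans[OF norm_triangle_ineq4])
  also have "abs C1 * cmod ?g <= m1 * cmod ?g" by (intro mult_right_mono C1_le) simp
  finally have "(cmod (mode_error sg t j k n))^2 <= (cmod (md j k n t) + m1 * cmod ?g)^2" by (intro power_mono) auto
  thus ?thesis using True sum_squares_bound[of "cmod (md j k n t)" "m1 * cmod ?g"]
   by (simp add: power2_sum)
 qed (simp add: mode_error_def)
 have "(\<Sum>n<N'. (cmod (mode_error sg t j k n))^2) <= (\<Sum>n<N. (cmod (mode_error sg t j k n))^2)"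
  using N by (intro sum_mono2) auto
 also have "... <= (\<Sum>n<N. 2 * (cmod (md j k n t))^2 + (if n = 0 then 2 * (m1 * cmod ?g)^2 else 0))"
  by (intro sum_mono pw)
 finally show ?thesis using N by (simp add: sum.distrib sum_distrib_left)
qed

text \<open>Away from frequency 0 the solution and the Gaussian are small separately, so no
  cancellation is used. \<open>E\<close> depends on \<open>j\<close>, since it will contain the
  profile of the windowed initial datum.\<close>

lemma mode_error_high:
 assumes sg: "0 < sg" and e: "0 < e"
  and ev: "!!e. 0 < e ==> EVS j. \<exists>N. 0 < N \<and> N' <= N \<and>
   (\<Sum>n<N. (cmod (md j k n t))^2) <= E j + e"
 defines "p \<equiv> exp (- (sg^2 * k^2 / 2))"
 shows "EVS j. (\<Sum>n<N'. (cmod (mode_error sg t j k n))^2) <= 2 * E j + 2 * (m1 * p)^2 + e"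
proof -
 have "(%j. 2 * (m1 * cmod (gauss_transform sg j k))^2) ----> 2 * (m1 * cmod (of_real p))^2"
  unfolding p_def by (intro tendsto_intros gauss_transform_tendsto sg)
 hence "EVS j. 2 * (m1 * cmod (gauss_transform sg j k))^2 < 2 * (m1 * p)^2 + e / 2"
  by (rule order_tendstoD(2)) (use e in "simp add: p_def")
 moreover have "EVS j. \<exists>N. 0 < N \<and> N' <= N \<and> (\<Sum>n<N. (cmod (md j k n t))^2) <= E j + e / 4"
  using e by (intro ev) simp
 ultimately show ?thesis
 proof eventually_elim
  case (elim j)
  from elim(2) obtain N where "0 < N" "N' <= N" "(\<Sum>n<N. (cmod (md j k n t))^2) <= E j + e / 4" by blast
  thus ?case using mode_error_sum_le[of N N' sg t j k] elim(1) by linarith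
 qed
qed

text \<open>The window has radius \<open>j + 1\<close> and the tail tolerance is
  \<open>1 / (j + 1)\<close>; the latter is the \<open>+ 1\<close> under the root.\<close>

abbreviation window_galerkin where
 "window_galerkin C0 t k j N f \<equiv> galerkin_modes N Mat mu (%n ta. md j k n (ta / nu)) f (k * A / nu) k
  (sqrt ((C0 * (1 + k^2) + 1) / real (Suc j))) (nu * t) X (mu 1)"

lemma galerkin_sequence:
 assumes t: "0 <= t"
 obtains C0 where "0 <= C0" and "!!k Nj. \<exists>N f. \<forall>j. Nj j <= N j \<and>
  window_galerkin C0 t k j (N j) (f j)"
proof -
 obtain C0 where C0: "0 <= C0" and g: "!!R k et N'. 1 <= R ==> 0 < et ==> \<exists>N\<ge>N'. \<exists>f.
  galerkin_modes N Mat mu (%n ta. mode R k n (ta / nu)) f (k * A / nu) k (sqrt (C0 * (1 + k^2) / R + et)) (nu * t) X (mu 1)"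
  using galerkin_truncation[OF t] by blast
 have "\<exists>N f. \<forall>j. Nj j <= N j \<and> window_galerkin C0 t k j (N j) (f j)" for k Nj
 proof -
  have "\<exists>N f. Nj j <= N \<and> window_galerkin C0 t k j N f" for j
   using g[of "real (Suc j)" "1 / real (Suc j)" "Nj j" k] by (auto simp: add_divide_distrib)
  thus ?thesis by metis
 qed
 thus thesis using that C0 by blast
qed

lemma sqrt_inverse_tendsto_0: "(%j. sqrt (c / real (Suc j))) ----> 0"
proof -
 have "(%j. c / real (Suc j)) ----> 0"
  using tendsto_mult_right_zero[OF LIMSEQ_inverse_real_of_nat, of c] by (simp add: field_class.field_divide_inverse)
 from tendsto_real_sqrt[OF this] show ?thesis by simp
qed

lemma initial_modes_le: "(\<Sum>n<N. (cmod (md j k n 0))^2) <= H (real (Suc j)) k"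
 unfolding mode_def H_def by (rule bessel[OF basis profile_L2(1)]) auto

end

section \<open>Decay at a fixed frequency\<close>

lemma exp_neg_mono: "a <= b ==> 0 <= x ==> exp (- (b * x)) <= exp (- (a * x))" for a b x :: real
 by (simp add: mult_right_mono)

text \<open>Two adjustments make the estimate integrable over all frequencies, with a bound that
  stays finite at \<open>T = 0\<close>. In the exponentials \<open>T\<close> is replaced by
  \<open>T + 1\<close> at the cost \<open>exp (c * \<xi>0^2)\<close>. The Gaussian at time
  \<open>T + 1\<close> is compared with the exponential at time \<open>T\<close> through
  \<open>1 - exp (- th) <= th <= D * \<xi>0 * |\<xi>|\<close>, an error of first order in
  \<open>\<xi>\<close> like the one from \<open>k\<close>.\<close>

lemma low_frequency_arith:
 fixes th \<xi> :: real
 assumes th: "d * \<xi>^2 <= th" "th <= D * \<xi>^2" and k: "abs k <= l * abs \<xi>" and \<xi>: "abs \<xi> <= \<xi>0"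
  and c: "0 < c" "c <= c0" "c <= 2 * d" and C: "0 <= C" and T: "0 <= T" and D: "0 <= D" and l: "0 <= l"
  and E: "E <= C * Y * (\<xi>^2 * exp (- (c0 * \<xi>^2) * T) + exp (- c0 * T))" and Y: "0 <= Y" and m: "m^2 = 2 * Y" "0 <= m"
 shows "2 * E + 2 * (m * (exp (- th * T) * abs k + \<bar>exp (- th * T) - exp (- th * (T + 1))\<bar>))^2
  <= exp (c * \<xi>0^2) * (2 * C + 4 * (l + D * \<xi>0)^2) * Y * (\<xi>^2 * exp (- (c * \<xi>^2) * (T + 1)) + exp (- c * T) * exp (- (c * \<xi>^2)))"
proof -
 define G where "G = \<xi>^2 * exp (- (c * \<xi>^2) * (T + 1)) + exp (- c * T) * exp (- (c * \<xi>^2))"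
 define X where "X = exp (c * \<xi>0^2)"
 have th0: "0 <= th" using th(1) c by (intro order_trans[OF _ th(1)]) auto
 have sq: "\<xi>^2 <= \<xi>0^2" using \<xi> power_mono[of "abs \<xi>" \<xi>0 2] by simp
 have X1: "1 <= X * exp (- (c * \<xi>^2))" using sq c by (simp add: X_def exp_add[symmetric] mult_left_mono)
 have \<xi>T: "exp (- (c * \<xi>^2) * T) <= X * exp (- (c * \<xi>^2) * (T + 1))"
 proof -
  have "exp (- (c * \<xi>^2) * (T + 1)) = exp (- (c * \<xi>^2) * T) * exp (- (c * \<xi>^2))"
   by (simp add: exp_add[symmetric] algebra_simps)
  thus ?thesis using mult_left_mono[OF X1, of "exp (- (c * \<xi>^2) * T)"] by (simp add: mult_ac)
 qed
 have "\<xi>^2 * exp (- (c0 * \<xi>^2) * T) + exp (- c0 * T) <= \<xi>^2 * exp (- (c * \<xi>^2) * T) + exp (- c * T)"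
  using exp_neg_mono[of "c" "c0" "\<xi>^2 * T"] exp_neg_mono[of c c0 T] c T
  by (intro add_mono mult_left_mono) (auto simp: mult.assoc)
 also have "... <= \<xi>^2 * (X * exp (- (c * \<xi>^2) * (T + 1))) + exp (- c * T) * (X * exp (- (c * \<xi>^2)))"
  using \<xi>T X1 mult_left_mono[OF X1, of "exp (- c * T)"] by (intro add_mono mult_left_mono) auto
 also have "... = X * G" by (simp add: G_def algebra_simps)
 finally have g0: "\<xi>^2 * exp (- (c0 * \<xi>^2) * T) + exp (- c0 * T) <= X * G" .
 hence E': "E <= C * Y * (X * G)"
  using C Y by (intro order_trans[OF E] mult_left_mono) auto
 have "exp (- th * T) - exp (- th * (T + 1)) = exp (- th * T) * (1 - exp (- th))"
  by (simp add: exp_add[symmetric] algebra_simps)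
 moreover have "0 <= 1 - exp (- th)" "1 - exp (- th) <= th" using th0 exp_ge_add_one_self[of "- th"] by auto
 ultimately have "\<bar>exp (- th * T) - exp (- th * (T + 1))\<bar> <= exp (- th * T) * th" by (simp add: abs_mult mult_left_mono)
 moreover have "th <= D * \<xi>0 * abs \<xi>"
 proof -
  have "D * (abs \<xi> * abs \<xi>) <= D * (\<xi>0 * abs \<xi>)" using \<xi> D by (intro mult_left_mono mult_right_mono) auto
  thus ?thesis using th(2) by (simp add: power2_eq_square mult.assoc abs_mult[symmetric])
 qed
 ultimately have "\<bar>exp (- th * T) - exp (- th * (T + 1))\<bar> <= exp (- th * T) * (D * \<xi>0 * abs \<xi>)"
  by (meson exp_ge_zero mult_left_mono order_trans)
 hence "exp (- th * T) * abs k + \<bar>exp (- th * T) - exp (- th * (T + 1))\<bar>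
   <= exp (- th * T) * (l * abs \<xi>) + exp (- th * T) * (D * \<xi>0 * abs \<xi>)"
  using k by (intro add_mono mult_left_mono) auto
 hence "exp (- th * T) * abs k + \<bar>exp (- th * T) - exp (- th * (T + 1))\<bar> <= exp (- th * T) * ((l + D * \<xi>0) * abs \<xi>)"
  unfolding distrib_left distrib_right .
 from power_mono[OF mult_left_mono[OF this m(2)], of 2] m(2)
 have "(m * (exp (- th * T) * abs k + \<bar>exp (- th * T) - exp (- th * (T + 1))\<bar>))^2 <= (m * (exp (- th * T) * ((l + D * \<xi>0) * abs \<xi>)))^2"
  by simp
 also have "... = 2 * Y * (l + D * \<xi>0)^2 * (\<xi>^2 * exp (- (2 * th) * T))"
 proof -
  have "(exp (- th * T))^2 = exp (- (2 * th) * T)" by (simp add: exp_double[symmetric])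
  thus ?thesis unfolding power_mult_distrib m(1) power2_abs by (simp add: mult_ac)
 qed
 also have "... <= 2 * Y * (l + D * \<xi>0)^2 * (X * G)"
 proof (rule mult_left_mono)
  have "c * \<xi>^2 <= 2 * th" using mult_right_mono[OF c(3), of "\<xi>^2"] th(1) by simp
  hence "exp (- (2 * th) * T) <= exp (- (c * \<xi>^2) * T)" using exp_neg_mono[of "c * \<xi>^2" "2 * th" T] T by simp
  from order_trans[OF this \<xi>T] have "\<xi>^2 * exp (- (2 * th) * T) <= \<xi>^2 * (X * exp (- (c * \<xi>^2) * (T + 1)))"
   by (rule mult_left_mono) simp
  also have "... <= X * G" by (simp add: G_def X_def distrib_left mult_ac)
  finally show "\<xi>^2 * exp (- (2 * th) * T) <= X * G" .
 qed (use Y in simp)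
 finally have "(m * (exp (- th * T) * abs k + \<bar>exp (- th * T) - exp (- th * (T + 1))\<bar>))^2 <= 2 * Y * (l + D * \<xi>0)^2 * (X * G)" .
 with E' show ?thesis unfolding G_def[symmetric] X_def[symmetric] by (simp add: algebra_simps)
qed

lemma high_frequency_arith:
 fixes th :: real
 assumes th: "k^2 <= th" "c <= 2 * th" and T: "0 <= T" and m: "m^2 = 2 * Y" and Y: "0 <= Y"
 shows "2 * (m * exp (- th * (T + 1)))^2 <= 4 * Y * (exp (- c * T) * exp (- (2 * k^2)))"
proof -
 have "exp (- (2 * th) * (T + 1)) = exp (- (2 * th * T)) * exp (- (2 * th))"
  by (simp add: exp_add[symmetric] algebra_simps)
 also have "... <= exp (- c * T) * exp (- (2 * k^2))"
  using th T exp_neg_mono[of c "2 * th" T] by (intro mult_mono) auto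
 finally have "4 * Y * exp (- (2 * th) * (T + 1)) <= 4 * Y * (exp (- c * T) * exp (- (2 * k^2)))"
  using Y by (intro mult_left_mono) auto
 moreover have "(exp (- th * (T + 1)))^2 = exp (- (2 * th) * (T + 1))" by (simp add: exp_double[symmetric] algebra_simps)
 ultimately show ?thesis using m by (simp add: power_mult_distrib)
qed

text \<open>This and the next three definitions name parts of \<open>modes_low\<close> and
  \<open>modes_high\<close>, so that one choice of constants can be handed to every channel.\<close>

definition low_estimate where
 "low_estimate K m d0 c C kp Z T L \<longleftrightarrow> (\<forall>N M mu z f k dl.
   galerkin_modes N M mu z f kp k dl T K m --> d0 <= (\<Sum>n=1..<N. (M 0 n)^2 / mu n) --> dl <= 1
   --> (\<Sum>n<N. (cmod (z n 0))^2) <= Z^2 -->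
   (cmod (z 0 T - of_real (exp (- (k^2 + kp^2 * (\<Sum>n=1..<N. (M 0 n)^2 / mu n)) * T)) * z 0 0))\<^sup>2
   + (\<Sum>n=1..<N. (cmod (z n T))^2)
   <= C * Z^2 * (kp^2 * exp (- (c * kp^2) * T) + exp (- c * T)) + L * dl)"

definition high_estimate where
 "high_estimate K m d0 c kp Z T L \<longleftrightarrow> (\<forall>N M mu z f k dl.
   galerkin_modes N M mu z f kp k dl T K m --> d0 <= (\<Sum>n=1..<N. (M 0 n)^2 / mu n) --> dl <= 1
   --> (\<Sum>n<N. (cmod (z n 0))^2) <= Z^2 -->
   (\<Sum>n<N. (cmod (z n T))^2) <= 3 * exp (- c * T) * (\<Sum>n<N. (cmod (z n 0))^2) + L * dl)"

definition low_bound where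
 "low_bound K m d0 kp0 c C \<longleftrightarrow> (\<forall>kp Z T. abs kp <= kp0 --> 0 <= Z --> 0 <= T --> (\<exists>L\<ge>0. low_estimate K m d0 c C kp Z T L))"

definition high_bound where
 "high_bound K m d0 kp0 c \<longleftrightarrow> (\<forall>kp Z T. kp0 <= abs kp --> 0 <= Z --> 0 <= T --> (\<exists>L\<ge>0. high_estimate K m d0 c kp Z T L))"

context taylor_channel begin

definition taylor_constant where "taylor_constant = (\<Sum>m. (L2_inner Q chi (ps (Suc m)))^2 / mu (Suc m))"

text \<open>The first two terms are the error at low frequencies, its algebraic part and its initial
  layer; the last two belong to high frequencies. \<open>a * k\<close> is the coupling frequency
  \<open>A / nu * k\<close>, or \<open>k\<close> itself if the mean decouples.\<close>

definition decay_profile where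
 "decay_profile a c T j k = W * ((a * k)^2 * exp (- (c * (a * k)^2) * (T + 1)) + exp (- c * T) * exp (- (c * (a * k)^2)))
  + exp (- c * T) * (H (real (Suc j)) k + W * exp (- (2 * k^2)))"

definition decays where
 "decays sg t a c B \<longleftrightarrow> (\<forall>N' k e. 0 < e --> (\<forall>\<^sub>F j in sequentially.
   (\<Sum>n<N'. (cmod (mode_error sg t j k n))^2) <= B * decay_profile a c (nu * t) j k + e))"

lemma mu_ge: "0 < n ==> mu 1 <= mu n"
 using mu_mono by (auto simp: mono_def)

lemma taylor_constant_sums: "(%m. (L2_inner Q chi (ps (Suc m)))^2 / mu (Suc m)) sums taylor_constant"
proof -
 have cL: "chi \<in> L2 Q"
  unfolding L2_def
 proof safe
  show "integrable Q (%q. (chi q)^2)"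
   by (rule Q.integrable_const_bound[of _ "X^2"])
   (use power_mono[OF chi_le abs_ge_zero, of _ 2] in auto)
 qed simp
 have "summable (%m. (L2_inner Q chi (ps (Suc m)))^2 / mu (Suc m))"
 proof (rule summable_comparison_test')
  have le: "(\<Sum>n<N. (L2_inner Q chi (ps n))^2) <= (LINT q|Q. (chi q)^2)" for N
  proof -
   have "0 <= (LINT q|Q. (chi q - (\<Sum>n<N. L2_inner Q chi (ps n) * ps n q))^2)"
   by (rule LINT_nonneg) simp
   thus ?thesis using L2_projection_error[OF basis cL, of N] by linarith
  qed
  have "summable (%n. (L2_inner Q chi (ps n))^2)"
   by (rule summableI_nonneg_bounded[OF _ le]) simp
  hence "summable (%n. (L2_inner Q chi (ps (Suc n)))^2)" using summable_Suc_iff[of "%n. (L2_inner Q chi (ps n))^2"] by simp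
  thus "summable (%n. (L2_inner Q chi (ps (Suc n)))^2 / mu 1)" by (rule summable_divide)
  show "norm ((L2_inner Q chi (ps (Suc n)))^2 / mu (Suc n)) <= (L2_inner Q chi (ps (Suc n)))^2 / mu 1" for n
   using mu_ge[of "Suc n"] mu1 by (auto intro!: divide_left_mono)
 qed
 thus ?thesis unfolding taylor_constant_def by (rule summable_sums)
qed

lemma taylor_constant_nonneg: "0 <= taylor_constant"
 by (rule sums_le[OF _ sums_zero taylor_constant_sums]) (use mu_ge mu1 less_le_trans in "auto intro!: divide_nonneg_pos")

lemma taylor_partial_sums: "(%N. \<Sum>n=1..<N. (Mat 0 n)^2 / mu n) ----> taylor_constant"
proof -
 have "(%N. \<Sum>m<N. (L2_inner Q chi (ps (Suc m)))^2 / mu (Suc m)) ----> taylor_constant"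
  using taylor_constant_sums by (simp add: sums_def)
 moreover have "(\<Sum>n\<in>{1..<Suc N}. (Mat 0 n)^2 / mu n) = (\<Sum>m<N. (L2_inner Q chi (ps (Suc m)))^2 / mu (Suc m))" for N
  unfolding Mat_0 by (induction N) auto
 ultimately have "(%N. \<Sum>n\<in>{1..<Suc N}. (Mat 0 n)^2 / mu n) ----> taylor_constant" by simp
 thus ?thesis by (rule filterlim_sequentially_Suc[THEN iffD1])
qed

lemma eventually_small:
 assumes e: "0 < e" shows "EVS j. sqrt (c / real (Suc j)) <= 1 \<and> L * sqrt (c / real (Suc j)) <= e"
proof -
 have "(%j. L * sqrt (c / real (Suc j))) ----> 0"
  by (rule tendsto_mult_right_zero[OF sqrt_inverse_tendsto_0])
 hence "EVS j. L * sqrt (c / real (Suc j)) < e" using e by (rule order_tendstoD)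
 moreover have "EVS j. sqrt (c / real (Suc j)) < 1"
  by (rule order_tendstoD(2)[OF sqrt_inverse_tendsto_0]) simp
 ultimately show ?thesis by eventually_elim simp
qed

lemma initial_modes_le_Z: "(\<Sum>n<N. (cmod (md j k n 0))^2) <= (sqrt (cmass * W))^2"
proof -
 have "(\<Sum>n<N. (cmod (md j k n 0))^2) <= cmass * W"
  by (rule order_trans[OF initial_modes_le H_le(1)]) simp
 thus ?thesis using W_nonneg cmass_nonneg by simp
qed

lemma m1_sq: "m1^2 = 2 * (cmass * W)"
 using W_nonneg cmass_nonneg by (simp add: m1_def)

lemma decay_profile_ge:
 shows "W * ((a * k)^2 * exp (- (c * (a * k)^2) * (T + 1)) + exp (- c * T) * exp (- (c * (a * k)^2))) <= decay_profile a c T j k"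
  and "exp (- c * T) * (H (real (Suc j)) k + W * exp (- (2 * k^2))) <= decay_profile a c T j k"
 using W_nonneg H_le(2)[of "real (Suc j)" k] by (simp_all add: decay_profile_def)

lemma low_conclusion:
 assumes le: "S <= x * (cmass * W) * ((a * k)^2 * exp (- (c * (a * k)^2) * (T + 1)) + exp (- c * T) * exp (- (c * (a * k)^2))) + e"
  and B: "x * cmass <= B" "0 <= x"
 shows "S <= B * decay_profile a c T j k + e"
proof -
 let ?G = "(a * k)^2 * exp (- (c * (a * k)^2) * (T + 1)) + exp (- c * T) * exp (- (c * (a * k)^2))"
 have "x * (cmass * W) * ?G = x * cmass * (W * ?G)" by (simp add: mult_ac)
 also have "... <= B * decay_profile a c T j k"
  by (rule mult_mono[OF B(1) decay_profile_ge(1)])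
   (use B W_nonneg cmass_nonneg order_trans[OF mult_nonneg_nonneg] in "auto intro!: order_trans[OF mult_nonneg_nonneg B(1)]")
 finally show ?thesis using le by linarith
qed

lemma high_conclusion:
 assumes le: "S <= 8 * (exp (- c * T) * H (real (Suc j)) k) + 4 * (cmass * W) * (exp (- c * T) * exp (- (2 * k^2))) + e"
  and B: "8 + 4 * cmass <= B"
 shows "S <= B * decay_profile a c T j k + e"
proof -
 let ?h = "exp (- c * T) * H (real (Suc j)) k" and ?g = "W * (exp (- c * T) * exp (- (2 * k^2)))"
 have h: "0 <= ?h" "0 <= ?g" using W_nonneg H_le(2)[of "real (Suc j)" k] by auto
 have "S <= 8 * ?h + 4 * cmass * ?g + e" using le by (simp add: mult_ac)
 also have "... <= (8 + 4 * cmass) * (?h + ?g) + e"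
 proof -
  have "8 * a + 4 * q * b + e <= (8 + 4 * q) * (a + b) + e" if "0 <= a" "0 <= b" "0 <= q" for a b q :: real
   using mult_nonneg_nonneg[OF that(3,1)] that by (simp add: algebra_simps)
  from this[OF h cmass_nonneg] show ?thesis .
 qed
 also have "... <= B * decay_profile a c T j k + e"
 proof (intro add_right_mono mult_mono B)
  show "?h + ?g <= decay_profile a c T j k" using decay_profile_ge(2)[of c T j k a] by (simp add: algebra_simps)
  show "0 <= B" using B cmass_nonneg by linarith
 qed (use h in simp)
 finally show ?thesis .
qed

text \<open>With this \<open>sg\<close> the Gaussian value is \<open>exp (- th * (T + 1))\<close>,
  where \<open>th\<close> is the decay rate of the mean. The frequency is fixed while
  \<open>j\<close> varies, so one of the two regimes applies to all \<open>j\<close>.\<close>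

lemma decays_pos:
 assumes t: "0 <= t" and d: "0 < taylor_constant" and sg: "0 < sg"
  "sg^2 / 2 = (1 + (A / nu)^2 * taylor_constant) * (nu * t + 1)"
  and low: "low_bound X (mu 1) (taylor_constant / 2) kp0 c0 C" "0 <= C" "0 < kp0"
  and high: "high_bound X (mu 1) (taylor_constant / 2) kp0 c1"
  and c: "0 < c" "c <= c0" "c <= c1" "c <= 2 * taylor_constant" "c <= 2 * taylor_constant * kp0^2"
  and B: "exp (c * kp0^2) * (2 * C + 4 * (1 / abs A + (1 / A^2 + taylor_constant) * kp0)^2) * cmass <= B" "8 + 4 * cmass <= B"
 shows "decays sg t (A / nu) c B"
 unfolding decays_def
proof (intro allI impI)
 fix N' k and e :: real assume e: "0 < e"
 define d0 where "d0 = taylor_constant"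
 define T where "T = nu * t"
 define kp where "kp = A / nu * k"
 define th where "th = k^2 + kp^2 * d0"
 define Z where "Z = sqrt (cmass * W)"
 have T: "0 <= T" using t nu by (simp add: T_def)
 have Z: "0 <= Z" "Z^2 = cmass * W" using W_nonneg cmass_nonneg by (auto simp: Z_def)
 have p: "exp (- (sg^2 * k^2 / 2)) = exp (- th * (T + 1))"
 proof -
  have "sg^2 * k^2 / 2 = sg^2 / 2 * k^2" by simp
  also have "... = th * (T + 1)" unfolding sg(2) th_def kp_def d0_def T_def power_mult_distrib by (simp add: algebra_simps)
  finally show ?thesis by simp
 qed
 \<comment> \<open>Here \<open>nu <= 1\<close> makes the constant \<open>1 / abs A\<close>
   independent of \<open>nu\<close>.\<close>
 have k: "abs k <= 1 / abs A * abs kp"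
 proof -
  have "abs k = nu * (1 / abs A * abs kp)" using A nu by (simp add: kp_def abs_mult)
  also have "... <= 1 * (1 / abs A * abs kp)" using nu by (intro mult_right_mono) auto
  finally show ?thesis by simp
 qed
 obtain C0 where C0: "!!k Nj. \<exists>N f. \<forall>j. Nj j <= N j \<and> window_galerkin C0 t k j (N j) (f j)" using galerkin_sequence[OF t] by metis
 let ?dl = "%j. sqrt ((C0 * (1 + k^2) + 1) / real (Suc j))"
 let ?d = "%N. \<Sum>n=1..<N. (Mat 0 n)^2 / mu n"
 \<comment> \<open>Truncations beyond \<open>n0 j\<close> have two properties: their partial sums of
   the Taylor constant converge as \<open>j\<close> grows, and these sums are at least half of the
   constant, the lower bound that both regimes require.\<close>
 have "\<forall>j. \<exists>n0. \<forall>N\<ge>n0. \<bar>?d N - d0\<bar> < min (1 / real (Suc j)) (d0 / 2)"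
 proof
  fix j
  have "\<forall>\<^sub>F N in sequentially. dist (?d N) d0 < min (1 / real (Suc j)) (d0 / 2)"
   unfolding d0_def by (rule tendstoD[OF taylor_partial_sums]) (use d in simp)
  thus "\<exists>n0. \<forall>N\<ge>n0. \<bar>?d N - d0\<bar> < min (1 / real (Suc j)) (d0 / 2)"
   by (simp add: eventually_sequentially dist_real_def)
 qed
 then obtain n0 where n0: "!!j N. n0 j <= N ==> \<bar>?d N - d0\<bar> < min (1 / real (Suc j)) (d0 / 2)" by metis
 obtain N f where N: "!!j. max (n0 j) N' <= N j" and gm: "!!j. galerkin_modes (N j) Mat mu (%n ta. md j k n (ta / nu)) (f j) kp k (?dl j) T X (mu 1)"
  using C0[of "%j. max (n0 j) N'" k] by (auto simp: kp_def T_def mult.commute)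
 have Npos: "0 < N j" for j using gm[of j] by (rule galerkin_modes.N)
 have dN: "\<bar>?d (N j) - d0\<bar> < 1 / real (Suc j)" "d0 / 2 <= ?d (N j)" for j
 proof -
  have "\<bar>?d (N j) - d0\<bar> < min (1 / real (Suc j)) (d0 / 2)" by (rule n0) (use N[of j] in simp)
  hence "\<bar>?d (N j) - d0\<bar> < 1 / real (Suc j)" "\<bar>?d (N j) - d0\<bar> < d0 / 2" by (simp_all only: min_less_iff_conj)
  thus "\<bar>?d (N j) - d0\<bar> < 1 / real (Suc j)" "d0 / 2 <= ?d (N j)" by linarith+
 qed
 have dlim: "(%j. ?d (N j)) ----> d0"
 proof (rule LIM_zero_cancel, rule Lim_null_comparison)
  show "EVS j. norm (?d (N j) - d0) <= 1 / real (Suc j)" using dN(1) by (intro always_eventually) (auto intro: less_imp_le)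
  show "(%j. 1 / real (Suc j)) ----> 0" using LIMSEQ_inverse_real_of_nat by (simp add: field_class.field_divide_inverse)
 qed
 have Tn: "T / nu = t" using nu by (simp add: T_def)
 have zZ: "(\<Sum>n<N j. (cmod (md j k n (0 / nu)))^2) <= Z^2" for j
  using initial_modes_le_Z by (simp add: Z_def)
 show "EVS j. (\<Sum>n<N'. (cmod (mode_error sg t j k n))^2) <= B * decay_profile (A / nu) c (nu * t) j k + e"
 proof (cases "abs kp <= kp0")
  case True
  let ?E = "C * (cmass * W) * (kp^2 * exp (- (c0 * kp^2) * T) + exp (- c0 * T))"
  obtain L where L: "0 <= L" and LL: "low_estimate X (mu 1) (d0 / 2) c0 C kp Z T L"
   using low(1) True Z(1) T unfolding low_bound_def d0_def by blast
  have Lb: "(cmod (md j k 0 t - of_real (exp (- (k^2 + kp^2 * ?d (N j)) * T)) * md j k 0 0))^2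
   + (\<Sum>n\<in>{1..<N j}. (cmod (md j k n t))^2) <= ?E + L * ?dl j"
   if "?dl j <= 1" for j
   using LL[unfolded low_estimate_def, rule_format, OF gm dN(2) that zZ] unfolding Tn Z(2) by simp
  have Plim: "(%j. exp (- (k^2 + kp^2 * ?d (N j)) * T)) ----> exp (- th * T)"
   unfolding th_def by (intro tendsto_intros dlim)
  have "EVS j. (\<Sum>n<N'. (cmod (mode_error sg t j k n))^2)
   <= 2 * ?E + 2 * (m1 * (exp (- th * T) * abs k + \<bar>exp (- th * T) - exp (- (sg^2 * k^2 / 2))\<bar>))^2 + e"
  proof (rule mode_error_low[OF sg(1) _ e])
   fix e :: real assume e: "0 < e"
   show "EVS j. \<exists>N P'. 0 < N \<and> N' <= N \<and> \<bar>P' - exp (- th * T)\<bar> <= e \<and>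
   (cmod (md j k 0 t - of_real P' * md j k 0 0))\<^sup>2
   + (\<Sum>n=1..<N. (cmod (md j k n t))^2) <= ?E + e"
   using tendstoD[OF Plim e] eventually_small[OF e, of "C0 * (1 + k^2) + 1" L]
   proof eventually_elim
   case (elim j)
   show ?case
   proof (intro exI conjI)
   show "0 < N j" by (rule Npos)
   show "N' <= N j" using N[of j] by simp
   show "\<bar>exp (- (k^2 + kp^2 * ?d (N j)) * T) - exp (- th * T)\<bar> <= e" using elim(1) by (simp add: dist_real_def)
   show "(cmod (md j k 0 t - of_real (exp (- (k^2 + kp^2 * ?d (N j)) * T)) * md j k 0 0))^2
   + (\<Sum>n\<in>{1..<N j}. (cmod (md j k n t))^2) <= ?E + e"
   using Lb[of j] elim(2) by linarith
   qed
   qed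
  qed simp
  thus ?thesis
  proof eventually_elim
   case (elim j)
   have "2 * ?E + 2 * (m1 * (exp (- th * T) * abs k + \<bar>exp (- th * T) - exp (- th * (T + 1))\<bar>))^2
   <= exp (c * kp0^2) * (2 * C + 4 * (1 / abs A + (1 / A^2 + d0) * kp0)^2) * (cmass * W) * (kp^2 * exp (- (c * kp^2) * (T + 1)) + exp (- c * T) * exp (- (c * kp^2)))"
   proof (rule low_frequency_arith[of d0 kp th "1 / A^2 + d0" k "1 / abs A" kp0 c c0 C T ?E "cmass * W" m1])
   show "d0 * kp^2 <= th" by (simp add: th_def mult.commute)
   have "k^2 <= 1 / A^2 * kp^2" using power_mono[OF k, of 2] by (simp add: power_mult_distrib power_divide)
   thus "th <= (1 / A^2 + d0) * kp^2" by (simp add: th_def algebra_simps)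
   qed (use k True c low(2) T d W_nonneg cmass_nonneg m1_sq m1_nonneg in "auto simp: d0_def")
   hence "(\<Sum>n<N'. (cmod (mode_error sg t j k n))^2) <= exp (c * kp0^2) * (2 * C + 4 * (1 / abs A + (1 / A^2 + d0) * kp0)^2) * (cmass * W)
   * ((A / nu * k)^2 * exp (- (c * (A / nu * k)^2) * (T + 1)) + exp (- c * T) * exp (- (c * (A / nu * k)^2))) + e"
   using elim unfolding p kp_def by linarith
   thus ?case unfolding T_def
   by (rule low_conclusion) (use B(1) low(2) in "auto simp: d0_def")
  qed
 next
  case False
  hence hi: "kp0 <= abs kp" by simp
  obtain L where L: "0 <= L" and LL: "high_estimate X (mu 1) (d0 / 2) c1 kp Z T L"
   using high hi Z(1) T unfolding high_bound_def d0_def by blast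
  have Lb: "(\<Sum>n<N j. (cmod (md j k n t))^2)
   <= 3 * exp (- c1 * T) * (\<Sum>n<N j. (cmod (md j k n (0 / nu)))^2) + L * ?dl j"
   if "?dl j <= 1" for j
   using LL[unfolded high_estimate_def, rule_format, OF gm dN(2) that zZ] unfolding Tn by simp
  have "EVS j. (\<Sum>n<N'. (cmod (mode_error sg t j k n))^2)
   <= 2 * (4 * (exp (- c * T) * H (real (Suc j)) k)) + 2 * (m1 * exp (- (sg^2 * k^2 / 2)))^2 + e"
  proof (rule mode_error_high[OF sg(1) e])
   fix e :: real assume e: "0 < e"
   show "EVS j. \<exists>N. 0 < N \<and> N' <= N \<and>
   (\<Sum>n<N. (cmod (md j k n t))^2) <= 4 * (exp (- c * T) * H (real (Suc j)) k) + e"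
   using eventually_small[OF e, of "C0 * (1 + k^2) + 1" L]
   proof eventually_elim
   case (elim j)
   have 1: "exp (- c1 * T) * (\<Sum>n<N j. (cmod (md j k n (0 / nu)))^2) <= exp (- c * T) * H (real (Suc j)) k"
   using exp_neg_mono[OF c(3) T] initial_modes_le by (intro mult_mono) (auto intro: sum_nonneg)
   have 2: "0 <= exp (- c * T) * H (real (Suc j)) k" using H_le(2)[of "real (Suc j)" k] by simp
   have "(\<Sum>n<N j. (cmod (md j k n t))^2) <= 4 * (exp (- c * T) * H (real (Suc j)) k) + e"
   proof -
   have dl: "?dl j <= 1" "L * ?dl j <= e" using elim by auto
   have "3 * exp (- c1 * T) * y = 3 * (exp (- c1 * T) * y)" for y by simp
   thus ?thesis using Lb[OF dl(1)] dl(2) 1 2 by linarith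
   qed
   thus ?case using Npos[of j] N[of j] by (intro exI[of _ "N j"]) auto
   qed
  qed
  thus ?thesis
  proof eventually_elim
   case (elim j)
   have "2 * (m1 * exp (- th * (T + 1)))^2 <= 4 * (cmass * W) * (exp (- c * T) * exp (- (2 * k^2)))"
   proof (rule high_frequency_arith)
   show "k^2 <= th" using d by (simp add: th_def d0_def)
   have "kp0^2 * d0 <= kp^2 * d0" using power_mono[OF hi, of 2] low(3) d by (intro mult_right_mono) (auto simp: d0_def)
   hence "c <= 2 * (kp^2 * d0)" using c(5) by (simp add: d0_def mult_ac)
   moreover have "kp^2 * d0 <= th" by (simp add: th_def)
   ultimately show "c <= 2 * th" by linarith
   qed (use T m1_sq W_nonneg cmass_nonneg in auto)
   thus ?case using elim unfolding p T_def[symmetric] by (intro high_conclusion B(2)) linarith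
  qed
 qed
qed

text \<open>The equation of the mean no longer contains \<open>kp\<close>, so the natural frequency
  is \<open>k\<close> itself and the threshold is 1. The \<open>18\<close> is
  \<open>2 * C + 4 * (l + D * \<xi>0)^2\<close> of \<open>low_frequency_arith\<close> with all of
  these equal to 1.\<close>

lemma decays_zero:
 assumes t: "0 <= t" and d: "!!n. Mat 0 n = 0" and sg: "0 < sg" "sg^2 / 2 = nu * t + 1"
  and c: "0 < c" "c <= mu 1" "c <= 2"
  and B: "exp c * 18 * cmass <= B" "8 + 4 * cmass <= B"
 shows "decays sg t 1 c B"
 unfolding decays_def
proof (intro allI impI)
 fix N' k and e :: real assume e: "0 < e"
 define T where "T = nu * t"
 define Z where "Z = sqrt (cmass * W)"
 have T: "0 <= T" using t nu by (simp add: T_def)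
 have Z: "0 <= Z" "Z^2 = cmass * W" using W_nonneg cmass_nonneg by (auto simp: Z_def)
 have p: "exp (- (sg^2 * k^2 / 2)) = exp (- (k^2) * (T + 1))"
 proof -
  have "sg^2 * k^2 / 2 = sg^2 / 2 * k^2" by simp
  thus ?thesis unfolding sg(2) T_def by (simp add: mult.commute)
 qed
 obtain C0 where C0: "!!k Nj. \<exists>N f. \<forall>j. Nj j <= N j \<and> window_galerkin C0 t k j (N j) (f j)" using galerkin_sequence[OF t] by metis
 let ?dl = "%j. sqrt ((C0 * (1 + k^2) + 1) / real (Suc j))"
 obtain N f where N: "!!j. N' <= N j" and gm: "!!j. galerkin_modes (N j) Mat mu (%n ta. md j k n (ta / nu)) (f j) (k * A / nu) k (?dl j) T X (mu 1)"
  using C0[of "%j. N'" k] by (auto simp: T_def)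
 have Npos: "0 < N j" for j using gm[of j] by (rule galerkin_modes.N)
 have Tn: "T / nu = t" using nu by (simp add: T_def)
 have zZ: "(\<Sum>n<N j. (cmod (md j k n (0 / nu)))^2) <= Z^2" for j
  using initial_modes_le_Z by (simp add: Z_def)
 let ?P = "exp (- (k^2) * T)"
 let ?S0 = "%j. \<Sum>n<N j. (cmod (md j k n 0))^2"
 from modes_decoupled[OF Z(1) T] obtain L where L: "0 <= L"
  and LL: "\<forall>N M mu z f kp k dl K m. galerkin_modes N M mu z f kp k dl T K m --> (\<forall>n. M 0 n = 0) --> dl <= 1
   --> (\<Sum>n<N. (cmod (z n 0))^2) <= Z^2 -->
   (cmod (z 0 T - of_real (exp (- (k^2) * T)) * z 0 0))\<^sup>2 + (\<Sum>n=1..<N. (cmod (z n T))^2)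
   <= exp (- m * T) * (\<Sum>n<N. (cmod (z n 0))^2) + L * dl" by blast
 have Lb: "(cmod (md j k 0 t - of_real ?P * md j k 0 0))^2
   + (\<Sum>n\<in>{1..<N j}. (cmod (md j k n t))^2) <= exp (- mu 1 * T) * ?S0 j + L * ?dl j"
  if "?dl j <= 1" for j
  using LL[rule_format, OF gm d that zZ] unfolding Tn by simp
 show "EVS j. (\<Sum>n<N'. (cmod (mode_error sg t j k n))^2) <= B * decay_profile 1 c (nu * t) j k + e"
 proof (cases "abs k <= 1")
  case True
  let ?E = "exp (- mu 1 * T) * (cmass * W)"
  have "EVS j. (\<Sum>n<N'. (cmod (mode_error sg t j k n))^2)
   <= 2 * ?E + 2 * (m1 * (?P * abs k + \<bar>?P - exp (- (sg^2 * k^2 / 2))\<bar>))^2 + e"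
  proof (rule mode_error_low[OF sg(1) _ e])
   fix e :: real assume e: "0 < e"
   show "EVS j. \<exists>N P'. 0 < N \<and> N' <= N \<and> \<bar>P' - ?P\<bar> <= e \<and>
   (cmod (md j k 0 t - of_real P' * md j k 0 0))\<^sup>2
   + (\<Sum>n=1..<N. (cmod (md j k n t))^2) <= ?E + e"
   using eventually_small[OF e, of "C0 * (1 + k^2) + 1" L]
   proof eventually_elim
   case (elim j)
   have "exp (- mu 1 * T) * ?S0 j <= ?E" using zZ[of j] by (intro mult_left_mono) (auto simp: Z(2))
   hence "(cmod (md j k 0 t - of_real ?P * md j k 0 0))^2
   + (\<Sum>n\<in>{1..<N j}. (cmod (md j k n t))^2) <= ?E + e" using Lb[of j] elim by linarith
   thus ?case using Npos[of j] N[of j] e by (intro exI[of _ "N j"] exI[of _ ?P]) auto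
   qed
  qed simp
  thus ?thesis
  proof eventually_elim
   case (elim j)
   have "2 * ?E + 2 * (m1 * (exp (- (k^2) * T) * abs k + \<bar>exp (- (k^2) * T) - exp (- (k^2) * (T + 1))\<bar>))^2
   <= exp (c * 1^2) * (2 * 1 + 4 * (1 + 1 * 1)^2) * (cmass * W) * (k^2 * exp (- (c * k^2) * (T + 1)) + exp (- c * T) * exp (- (c * k^2)))"
   by (rule low_frequency_arith[of 1 k "k^2" 1 k 1 1 c "mu 1" 1 T ?E "cmass * W" m1])
   (use True c T W_nonneg cmass_nonneg m1_sq m1_nonneg in "auto simp: distrib_left mult_ac")
   hence "(\<Sum>n<N'. (cmod (mode_error sg t j k n))^2) <= exp c * 18 * (cmass * W)
   * ((1 * k)^2 * exp (- (c * (1 * k)^2) * (T + 1)) + exp (- c * T) * exp (- (c * (1 * k)^2))) + e"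
   using elim unfolding p by simp
   thus ?case unfolding T_def by (rule low_conclusion) (use B(1) in auto)
  qed
 next
  case False
  have "1^2 <= \<bar>k\<bar>\<^sup>2" using False by (intro power_mono) auto
  hence k1: "1 <= k^2" by simp
  have "EVS j. (\<Sum>n<N'. (cmod (mode_error sg t j k n))^2)
   <= 2 * (4 * (exp (- c * T) * H (real (Suc j)) k)) + 2 * (m1 * exp (- (sg^2 * k^2 / 2)))^2 + e"
  proof (rule mode_error_high[OF sg(1) e])
   fix e :: real assume e: "0 < e"
   hence e2: "0 < e / 2" by simp
   show "EVS j. \<exists>N. 0 < N \<and> N' <= N \<and>
   (\<Sum>n<N. (cmod (md j k n t))^2) <= 4 * (exp (- c * T) * H (real (Suc j)) k) + e"
   using eventually_small[OF e2, of "C0 * (1 + k^2) + 1" L]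
   proof eventually_elim
   case (elim j)
   let ?z0 = "md j k 0 0" and ?zT = "md j k 0 t" and ?h = "exp (- c * T) * H (real (Suc j)) k"
   have S0: "0 <= ?S0 j" "?S0 j <= H (real (Suc j)) k" using initial_modes_le by (auto intro: sum_nonneg)
   have a: "exp (- mu 1 * T) * ?S0 j <= ?h" using exp_neg_mono[OF c(2) T] S0 by (intro mult_mono) auto
   have "(cmod ?z0)^2 <= ?S0 j" using Npos[of j] member_le_sum[of 0 "{..<N j}" "%n. (cmod (md j k n 0))^2"] by simp
   moreover have "(?P)^2 <= exp (- c * T)"
   proof -
   have "c <= 2 * k^2" using c(3) k1 by linarith
   from exp_neg_mono[OF this T] show ?thesis by (simp add: exp_double[symmetric] algebra_simps)
   qed
   ultimately have b: "?P^2 * (cmod ?z0)^2 <= ?h" using S0 by (intro mult_mono) auto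
   have "(cmod ?zT)^2 <= 2 * (cmod (?zT - of_real ?P * ?z0))^2 + 2 * (?P^2 * (cmod ?z0)^2)"
   proof -
   have "cmod ?zT <= cmod (?zT - of_real ?P * ?z0) + ?P * cmod ?z0"
   using norm_triangle_ineq[of "?zT - of_real ?P * ?z0" "of_real ?P * ?z0"] by (simp add: norm_mult)
   hence "(cmod ?zT)^2 <= (cmod (?zT - of_real ?P * ?z0) + ?P * cmod ?z0)^2" by (intro power_mono) auto
   thus ?thesis using sum_squares_bound[of "cmod (?zT - of_real ?P * ?z0)" "?P * cmod ?z0"]
   by (simp add: power2_sum power_mult_distrib)
   qed
   moreover have "{..<N j} = insert 0 {1..<N j}" using Npos[of j] by auto
   hence "(\<Sum>n<N j. (cmod (md j k n t))^2) = (cmod ?zT)^2 + (\<Sum>n\<in>{1..<N j}. (cmod (md j k n t))^2)" by simp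
   moreover have "0 <= (\<Sum>n\<in>{1..<N j}. (cmod (md j k n t))^2)" by (intro sum_nonneg) auto
   ultimately have "(\<Sum>n<N j. (cmod (md j k n t))^2) <= 4 * ?h + e"
   using Lb[of j] elim a b by linarith
   thus ?case using Npos[of j] N[of j] by (intro exI[of _ "N j"]) auto
   qed
  qed
  thus ?thesis
  proof eventually_elim
   case (elim j)
   have "2 * (m1 * exp (- (k^2) * (T + 1)))^2 <= 4 * (cmass * W) * (exp (- c * T) * exp (- (2 * k^2)))"
   by (rule high_frequency_arith) (use k1 c T m1_sq W_nonneg cmass_nonneg in auto)
   thus ?case using elim unfolding p T_def[symmetric] by (intro high_conclusion B(2)) linarith
  qed
 qed
qed

end

section \<open>Integration over the frequencies\<close>

lemma integrable_rescale:
 fixes h :: "real => real"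
 assumes h: "integrable lborel h" and a: "a \<noteq> 0"
 shows "integrable lborel (%k. h (a * k))" "(LINT k|lborel. h (a * k)) = (LINT k|lborel. h k) / abs a"
 using lborel_integrable_real_affine[OF h a, of 0] lborel_integral_real_affine[OF a, of h 0] a by auto

definition gauss_mass :: "real => real" where "gauss_mass c = (LINT k|lborel. exp (- (c * k^2)))"
definition gauss_moment :: "real => real" where "gauss_moment c = (LINT k|lborel. k^2 * exp (- (c * k^2)))"

lemma gauss_mass: "0 < c ==> integrable lborel (%k::real. exp (- (c * k^2)))" "0 <= gauss_mass c"
 using integrable_gaussian[of "sqrt (2 * c)"] by (simp_all add: gauss_mass_def)

lemma gauss_moment: assumes c: "0 < c" shows "integrable lborel (%k::real. k^2 * exp (- (c * k^2)))" "0 <= gauss_moment c"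
proof -
 have "integrable lborel (%k. sqrt (2 * pi) / (2 * c) * (std_normal_density (sqrt (2 * c) * k) * (sqrt (2 * c) * k) ^ 2))"
  using c by (intro integrable_mult_right integrable_rescale(1) integrable_std_normal_moment) auto
 also have "(%k. sqrt (2 * pi) / (2 * c) * (std_normal_density (sqrt (2 * c) * k) * (sqrt (2 * c) * k) ^ 2))
  = (%k. k^2 * exp (- (c * k^2)))"
  using c by (simp add: fun_eq_iff std_normal_density_def power_mult_distrib)
 finally show "integrable lborel (%k::real. k^2 * exp (- (c * k^2)))" .
 show "0 <= gauss_moment c" unfolding gauss_moment_def by (rule LINT_nonneg) simp
qed

lemma exp_le_power_three_halves:
 fixes c T :: real
 assumes c: "0 < c" and T: "0 <= T"
 shows "exp (- c * T) <= (1 + 2 / c)^2 / ((1 + T) * sqrt (1 + T))"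
proof -
 have "1 + T <= (1 + 2 / c) * (1 + c * T / 2)" using c T by (simp add: field_simps)
 also have "... <= (1 + 2 / c) * exp (c * T / 2)" using c by (intro mult_left_mono exp_ge_add_one_self) (auto simp: add_nonneg_nonneg)
 finally have "(1 + T)^2 <= ((1 + 2 / c) * exp (c * T / 2))^2" using T by (intro power_mono) auto
 also have "... = (1 + 2 / c)^2 * exp (c * T)" by (simp add: power_mult_distrib exp_double[symmetric])
 finally have le: "(1 + T)^2 * exp (- c * T) <= (1 + 2 / c)^2"
  by (simp add: exp_minus field_simps)
 have "sqrt (1 + T) <= 1 + T" using T by (intro real_le_lsqrt) (auto simp: power2_eq_square)
 hence "(1 + T) * sqrt (1 + T) <= (1 + T)^2" using T unfolding power2_eq_square by (intro mult_left_mono) auto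
 from order_trans[OF mult_right_mono[OF this exp_ge_zero] le]
 have "(1 + T) * sqrt (1 + T) * exp (- c * T) <= (1 + 2 / c)^2" .
 moreover have "0 < (1 + T) * sqrt (1 + T)" using T by simp
 ultimately show ?thesis by (simp only: pos_le_divide_eq mult.commute)
qed

text \<open>One summand for each term of \<open>decay_profile\<close>: \<open>a0\<close> comes from
  the substitution \<open>a * k\<close>, and \<open>(1 + 2 / c)^2\<close> from trading
  \<open>exp (- c * T)\<close> for the power of \<open>1 + T\<close>.\<close>

definition decay_constant where
 "decay_constant c a0 = gauss_moment c / a0 + (1 + 2 / c)^2 * (gauss_mass c / a0 + 2 * pi + gauss_mass 2)"

context taylor_channel begin

text \<open>Scaling gives the rate: in the term
  \<open>(a * k)^2 * exp (- (c * (a * k)^2) * (T + 1))\<close> the square contributes the power 1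
  and the integration the power 1/2 of \<open>1 / (T + 1)\<close>. The smoothing factor is dropped
  from all terms except the one with \<open>H\<close>, whose integral is controlled together with
  it.\<close>

lemma decay_profile_integral:
 assumes s: "0 < s" and a: "a0 <= abs a" "0 < a0" and c: "0 < c" and T: "0 <= T"
 shows "decay_profile a c T j \<in> borel_measurable borel"
  "integrable lborel (%k. exp (- (s^2 * k^2 / 2)) * decay_profile a c T j k)"
  "(LINT k|lborel. exp (- (s^2 * k^2 / 2)) * decay_profile a c T j k) <= decay_constant c a0 * W / ((1 + T) * sqrt (1 + T))"
proof -
 have Hm [measurable]: "H (real (Suc j)) \<in> borel_measurable borel" by (rule H_transform(1)[OF _ s]) simp
 note Hs = H_transform[of "real (Suc j)", OF _ s]
 have a0: "a \<noteq> 0" using a by auto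
 show m [measurable]: "decay_profile a c T j \<in> borel_measurable borel"
  unfolding decay_profile_def[abs_def] by measurable
 let ?r = "sqrt (T + 1)"
 define h1 where "h1 k = W * ((a * k)^2 * exp (- (c * (a * k)^2) * (T + 1)))" for k
 define h2 where "h2 k = W * (exp (- c * T) * exp (- (c * (a * k)^2)))" for k
 define h3 where "h3 k = exp (- c * T) * (exp (- (s^2 * k^2 / 2)) * H (real (Suc j)) k)" for k
 define h4 where "h4 k = exp (- c * T) * (W * exp (- (2 * k^2)))" for k
 have T1: "0 < T + 1" using T by simp
 have h1e: "h1 k = W / (T + 1) * ((a * ?r * k)^2 * exp (- (c * (a * ?r * k)^2)))" for k
  using T1 by (simp add: h1_def power_mult_distrib mult_ac)
 have ar: "a * ?r \<noteq> 0" using a0 T1 by simp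
 have i1: "integrable lborel h1" unfolding h1e[abs_def]
  by (intro integrable_mult_right integrable_rescale(1)[of "%k. k^2 * exp (- (c * k^2))"] gauss_moment c ar)
 have I1: "(LINT k|lborel. h1 k) = W / (T + 1) * (gauss_moment c / (abs a * ?r))"
  unfolding h1e gauss_moment_def integral_mult_right_zero
  by (subst integrable_rescale(2)[of "%k. k^2 * exp (- (c * k^2))", OF gauss_moment(1)[OF c] ar]) (use T1 in "simp add: abs_mult")
 have i2: "integrable lborel h2" unfolding h2_def[abs_def]
  by (intro integrable_mult_right integrable_rescale(1)[of "%k. exp (- (c * k^2))"] gauss_mass c a0)
 have I2: "(LINT k|lborel. h2 k) = W * (exp (- c * T) * (gauss_mass c / abs a))"
  unfolding h2_def gauss_mass_def integral_mult_right_zero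
  by (subst integrable_rescale(2)[of "%k. exp (- (c * k^2))", OF gauss_mass(1)[OF c] a0]) simp
 have i3: "integrable lborel h3" unfolding h3_def[abs_def] by (intro integrable_mult_right Hs) simp
 have I3: "(LINT k|lborel. h3 k) <= exp (- c * T) * (2 * pi * W)"
  unfolding h3_def integral_mult_right_zero by (intro mult_left_mono Hs) auto
 have i4: "integrable lborel h4" unfolding h4_def[abs_def] by (intro integrable_mult_right gauss_mass) simp
 have I4: "(LINT k|lborel. h4 k) = exp (- c * T) * (W * gauss_mass 2)"
  unfolding h4_def gauss_mass_def integral_mult_right_zero ..
 have nn: "0 <= h1 k" "0 <= h2 k" "0 <= h4 k" for k using W_nonneg by (auto simp: h1_def h2_def h4_def)
 have eq: "exp (- (s^2 * k^2 / 2)) * decay_profile a c T j k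
   = exp (- (s^2 * k^2 / 2)) * (h1 k + h2 k + h4 k) + h3 k" for k
  by (simp add: decay_profile_def h1_def h2_def h3_def h4_def algebra_simps)
 have le: "exp (- (s^2 * k^2 / 2)) * decay_profile a c T j k <= h1 k + h2 k + h4 k + h3 k" for k
  unfolding eq using nn[of k] by (intro add_right_mono mult_left_le_one_le) auto
 have nnl: "0 <= exp (- (s^2 * k^2 / 2)) * decay_profile a c T j k" for k
  using W_nonneg H_le(2)[of "real (Suc j)" k] by (simp add: decay_profile_def)
 have it: "integrable lborel (%k. h1 k + h2 k + h4 k + h3 k)" using i1 i2 i3 i4 by simp
 show int: "integrable lborel (%k. exp (- (s^2 * k^2 / 2)) * decay_profile a c T j k)"
  by (rule LINT_bound[OF it])
   (auto intro!: AE_I2 order_trans[OF _ abs_ge_self] le simp: abs_of_nonneg nnl)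
 have "(LINT k|lborel. exp (- (s^2 * k^2 / 2)) * decay_profile a c T j k) <= (LINT k|lborel. h1 k + h2 k + h4 k + h3 k)"
  by (rule integral_mono[OF int it le])
 also have "... = (LINT k|lborel. h1 k) + (LINT k|lborel. h2 k) + (LINT k|lborel. h4 k) + (LINT k|lborel. h3 k)"
  using i1 i2 i3 i4 by simp
 also have "... <= W / (T + 1) * (gauss_moment c / (a0 * ?r)) + W * (exp (- c * T) * (gauss_mass c / a0))
   + exp (- c * T) * (W * gauss_mass 2) + exp (- c * T) * (2 * pi * W)"
  unfolding I1 I2 I4 using I3 a W_nonneg T1 gauss_mass(2)[of c] gauss_moment(2)[OF c]
  by (intro add_mono mult_left_mono divide_left_mono mult_right_mono) auto
 also have "... = W * gauss_moment c / a0 / ((1 + T) * sqrt (1 + T)) + exp (- c * T) * (W * (gauss_mass c / a0 + 2 * pi + gauss_mass 2))"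
  by (simp add: algebra_simps)
 also have "... <= W * gauss_moment c / a0 / ((1 + T) * sqrt (1 + T))
   + (1 + 2 / c)^2 / ((1 + T) * sqrt (1 + T)) * (W * (gauss_mass c / a0 + 2 * pi + gauss_mass 2))"
  using W_nonneg a gauss_mass(2) by (intro add_left_mono mult_right_mono exp_le_power_three_halves c T mult_nonneg_nonneg add_nonneg_nonneg) auto
 also have "... = decay_constant c a0 * W / ((1 + T) * sqrt (1 + T))"
  by (simp add: decay_constant_def algebra_simps add_divide_distrib)
 finally show "(LINT k|lborel. exp (- (s^2 * k^2 / 2)) * decay_profile a c T j k) <= decay_constant c a0 * W / ((1 + T) * sqrt (1 + T))" .
qed

definition section_error where
 "section_error sg t n x = section_mode n t x - (if n = 0 then C1 * normal_density 0 sg x else 0)"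

lemma normal_density_L2: "0 < sg ==> normal_density 0 sg \<in> L2 lborel"
proof -
 assume sg: "0 < sg"
 have "integrable lborel (%x. 1 / sqrt (2 * pi * sg^2) * normal_density 0 sg x)"
  by (rule integrable_mult_right) (rule integrable_normal_density[OF sg])
 hence "integrable lborel (%x. (normal_density 0 sg x)^2)"
 proof (rule LINT_bound)
  show "AE x in lborel. norm ((normal_density 0 sg x)^2) <= norm (1 / sqrt (2 * pi * sg^2) * normal_density 0 sg x)"
  proof (intro AE_I2)
   fix x
   have "normal_density 0 sg x <= 1 / sqrt (2 * pi * sg^2)"
   unfolding normal_density_def by (rule mult_left_le) auto
   from mult_right_mono[OF this normal_density_nonneg]
   show "norm ((normal_density 0 sg x)^2) <= norm (1 / sqrt (2 * pi * sg^2) * normal_density 0 sg x)"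
   by (simp add: power2_eq_square abs_mult)
  qed
 qed simp
 thus ?thesis by (simp add: L2_def)
qed

lemma fourier_section_error:
 assumes t: "0 <= t" and sg: "0 < sg"
 shows "fourier (%x. window (real (Suc j)) x * section_error sg t n x) k = mode_error sg t j k n"
proof -
 let ?w = "window (real (Suc j))"
 have i: "integrable lborel (%x. ?w x * section_mode n t x)"
  by (rule integrable_window_mult) (use section_mode_L2[OF t] in auto)
 have iG: "integrable lborel (%x. ?w x * normal_density 0 sg x)"
  by (rule integrable_window_mult) (use normal_density_L2[OF sg] in "auto simp: L2_def")
 have fm: "fourier (%x. ?w x * section_mode n t x) k = md j k n t"
  by (rule fourier_section_mode) (use t in auto)
 show ?thesis
 proof (cases "n = 0")
  case True
  have "fourier (%x. ?w x * section_error sg t n x) k = fourier (%x. ?w x * section_mode n t x - C1 * (?w x * normal_density 0 sg x)) k"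
   using True by (simp add: section_error_def algebra_simps)
  also have "... = fourier (%x. ?w x * section_mode n t x) k - fourier (%x. C1 * (?w x * normal_density 0 sg x)) k"
   by (rule fourier_diff[OF i integrable_mult_right[OF iG]])
  also have "fourier (%x. C1 * (?w x * normal_density 0 sg x)) k = of_real C1 * gauss_transform sg j k"
   by (simp add: fourier_def gauss_transform_def mult.assoc)
  finally show ?thesis using True fm by (simp add: mode_error_def)
 next
  case False
  thus ?thesis using fm by (simp add: section_error_def mode_error_def)
 qed
qed

text \<open>Provides the majorant for letting \<open>j\<close> tend to infinity under the frequency
  integral. It grows like \<open>k^2\<close> because the squared forcing does; the Gaussian
  smoothing compensates this.\<close>

lemma mode_error_dominated:
 assumes t: "0 <= t" and sg: "0 < sg"
 obtains \<alpha> bt where "!!N' j k. (\<Sum>n<N'. (cmod (mode_error sg t j k n))^2) <= \<alpha> + bt * k^2"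
proof -
 define T where "T = nu * t"
 have T: "0 <= T" using t nu by (simp add: T_def)
 obtain C0 where C00: "0 <= C0" and C0: "!!k Nj. \<exists>N f. \<forall>j. Nj j <= N j \<and> window_galerkin C0 t k j (N j) (f j)"
  using galerkin_sequence[OF t] by metis
 have "(\<Sum>n<N'. (cmod (mode_error sg t j k n))^2)
  <= (2 * (exp T * (cmass * W + 4 * (C0 + 1) * T)) + 2 * m1^2) + (8 * exp T * C0 * T) * k^2" for N' j k
 proof -
  obtain N f where N: "N' <= N j" and gm: "window_galerkin C0 t k j (N j) (f j)" using C0[of "%_. N'" k] by auto
  note gm = gm[folded T_def]
  have Tn: "T / nu = t" using nu by (simp add: T_def)
  let ?q = "C0 * (1 + k^2) + 1"
  have q: "0 <= ?q" using C00 by simp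
  have "(sqrt (?q / real (Suc j)))^2 = ?q / real (Suc j)" using q by simp
  also have "... <= ?q / 1" using q by (intro divide_left_mono) auto
  finally have dl: "(sqrt (?q / real (Suc j)))^2 <= ?q" by simp
  have "(\<Sum>n<N j. (cmod (md j k n t))^2)
   <= exp T * ((\<Sum>n<N j. (cmod (md j k n 0))^2) + 4 * (sqrt (?q / real (Suc j)))^2 * T)"
   using modes_apriori[OF gm] unfolding Tn by simp
  also have "... <= exp T * (cmass * W + 4 * ?q * T)"
   using order_trans[OF initial_modes_le H_le(1)] dl T
   by (intro mult_left_mono add_mono mult_right_mono) auto
  finally have S: "(\<Sum>n<N j. (cmod (md j k n t))^2) <= exp T * (cmass * W + 4 * ?q * T)" .
  have "(\<Sum>n<N'. (cmod (mode_error sg t j k n))^2)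
   <= 2 * (\<Sum>n<N j. (cmod (md j k n t))^2) + 2 * (m1 * cmod (gauss_transform sg j k))^2"
   by (rule mode_error_sum_le[OF galerkin_modes.N[OF gm] N])
  also have "... <= 2 * (exp T * (cmass * W + 4 * ?q * T)) + 2 * (m1 * 1)^2"
   using S gauss_transform_le[OF sg, of j k] m1_nonneg by (intro add_mono mult_left_mono power_mono) auto
  finally show ?thesis by (simp add: algebra_simps)
 qed
 thus thesis by (rule that)
qed

text \<open>Parseval's identity in the cross section for almost every \<open>x\<close>, then
  dominated convergence in \<open>N\<close>. The Gaussian changes the mean mode only, since all
  other basis functions have integral 0.\<close>

lemma section_error_parseval:
 assumes t: "0 <= t" and sg: "0 < sg"
  and le: "!!N. (\<Sum>n<N. LINT x|lborel. (section_error sg t n x)^2) <= K"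
 shows "(LINT p|pm. (b t p - C1 * normal_density 0 sg (fst p))^2) <= K"
proof -
 let ?G = "normal_density 0 sg"
 define d where "d p = b t p - C1 * ?G (fst p)" for p
 have GL: "(%p. ?G (fst p)) \<in> L2 pm"
  using pair.integrable_fst_mult_snd[of "%x. (?G x)^2" "%_. 1"] normal_density_L2[OF sg] by (simp add: L2_def)
 have dL: "d \<in> L2 pm" unfolding d_def[abs_def] by (intro L2_diff b_L2[OF t] L2_cmult GL)
 hence [measurable]: "d \<in> borel_measurable pm" by (simp add: L2_def)
 have d2: "integrable pm (%(x, q). (d (x, q))^2)" using dL by (simp add: L2_def case_prod_unfold)
 have b2: "integrable pm (%(x, q). (b t (x, q))^2)" using b_L2[OF t] by (simp add: L2_def case_prod_unfold)
 have ps_int: "(LINT q|Q. ps n q) = (if n = 0 then 1 else 0)" for n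
 proof -
  have "(LINT q|Q. ps n q) = L2_inner Q (ps 0) (ps n)"
   unfolding L2_inner_def by (rule integral_cong_AE) (use ps0 in "auto elim!: eventually_mono")
  thus ?thesis using basis by (simp add: orthonormal_basis_L2_def)
 qed
 have ae: "AE x in lborel. (%q. d (x, q)) \<in> L2 Q \<and> (\<forall>n. L2_inner Q (%q. d (x, q)) (ps n) = section_error sg t n x)"
  using pair.AE_integrable_fst[OF d2] pair.AE_integrable_fst[OF b2]
 proof eventually_elim
  case (elim x)
  have [measurable]: "b t \<in> borel_measurable pm" using b_L2[OF t] by (simp add: L2_def)
  have bL: "(%q. b t (x, q)) \<in> L2 Q" using elim(2) by (simp add: L2_def)
  have ps_i: "integrable Q (ps n)" for n
   using L2_mult_integrable[OF ps[of n], of "%_. 1"] by (simp add: L2_def)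
  have "L2_inner Q (%q. d (x, q)) (ps n) = (LINT q|Q. b t (x, q) * ps n q - C1 * ?G x * ps n q)" for n
   by (simp add: L2_inner_def d_def left_diff_distrib)
  also have "... n = section_error sg t n x" for n
   using L2_mult_integrable[OF bL ps[of n]] ps_i[of n] by (simp add: section_error_def section_mode_def ps_int)
  finally show ?case using elim(1) by (simp add: L2_def)
 qed
 define I where "I x = (LINT q|Q. (d (x, q))^2)" for x
 have Ii: "integrable lborel I" unfolding I_def using pair.integrable_fst[OF d2] by simp
 have sm [measurable]: "section_error sg t n \<in> borel_measurable borel" for n
  unfolding section_error_def[abs_def] using section_mode_L2(1)[OF t, of n] by measurable
 have lim: "AE x in lborel. (%N. \<Sum>n<N. (section_error sg t n x)^2) ----> I x"
  and dom: "AE x in lborel. norm (\<Sum>n<N. (section_error sg t n x)^2) <= I x" for N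
 proof -
  show "AE x in lborel. (%N. \<Sum>n<N. (section_error sg t n x)^2) ----> I x"
   using ae
  proof eventually_elim
   case (elim x)
   have "(%k. L2_norm Q (%q. d (x, q) - (\<Sum>n<k. L2_inner Q (%q. d (x, q)) (ps n) * ps n q))) ----> 0"
   proof -
   have all: "\<forall>f\<in>L2 Q. (%k. L2_norm Q (%p. f p - (\<Sum>n<k. L2_inner Q f (ps n) * ps n p))) ----> 0"
   using basis unfolding orthonormal_basis_L2_def by blast
   show ?thesis by (rule bspec[OF all conjunct1[OF elim]])
   qed
   from tendsto_power[OF this, of 2] have "(%N. I x - (\<Sum>n<N. (section_error sg t n x)^2)) ----> 0"
   using L2_projection_error[OF basis, of "%q. d (x, q)"] elim by (simp add: L2_norm_sq I_def)
   from tendsto_diff[OF tendsto_const[of "I x"] this] show ?case by simp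
  qed
  show "AE x in lborel. norm (\<Sum>n<N. (section_error sg t n x)^2) <= I x"
   using ae
  proof eventually_elim
   case (elim x)
   have "0 <= (LINT q|Q. (d (x, q) - (\<Sum>n<N. L2_inner Q (%q. d (x, q)) (ps n) * ps n q))^2)"
   by (rule LINT_nonneg) simp
   hence "(\<Sum>n<N. (section_error sg t n x)^2) <= I x"
   unfolding L2_projection_error[OF basis conjunct1[OF elim]] using elim by (simp add: I_def)
   thus ?case by (simp add: abs_of_nonneg sum_nonneg)
  qed
 qed
 have se2: "integrable lborel (%x. (section_error sg t n x)^2)" for n
 proof (rule LINT_bound[OF Ii])
  show "AE x in lborel. norm ((section_error sg t n x)^2) <= norm (I x)"
   using dom[of "Suc n"]
  proof eventually_elim
   case (elim x)
   have "(section_error sg t n x)^2 <= (\<Sum>n<Suc n. (section_error sg t n x)^2)" by (simp add: sum_nonneg)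
   thus ?case using elim by simp
  qed
 qed simp
 have "(%N. LINT x|lborel. (\<Sum>n<N. (section_error sg t n x)^2)) ----> (LINT x|lborel. I x)"
  by (rule integral_dominated_convergence[OF _ _ Ii lim dom]) (use Ii in auto)
 hence "(LINT x|lborel. I x) <= K"
  by (rule LIMSEQ_le_const2) (use le se2 in "auto simp: LINT_sum")
 thus ?thesis using pair.integral_fst[OF d2] by (simp add: I_def d_def case_prod_unfold)
qed

theorem decay_estimate:
 assumes t: "0 <= t" and sg: "0 < sg" and cont: "!!n. continuous_on UNIV (section_mode n t)"
  and dec: "decays sg t a c B" and c: "0 < c" and a: "a0 <= abs a" "0 < a0" and B: "0 <= B"
 shows "(LINT p|pm. (b t p - C1 * normal_density 0 sg (fst p))^2)
  <= B * decay_constant c a0 * W / ((1 + nu * t) * sqrt (1 + nu * t))"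
proof (rule section_error_parseval[OF t sg])
 fix N
 let ?Bd = "B * (decay_constant c a0 * W / ((1 + nu * t) * sqrt (1 + nu * t)))"
 have T: "0 <= nu * t" using t nu by simp
 obtain \<alpha> bt where D: "!!N' j k. (\<Sum>n<N'. (cmod (mode_error sg t j k n))^2) <= \<alpha> + bt * k^2"
  using mode_error_dominated[OF t sg] by blast
 have prof_nn: "0 <= decay_profile a c (nu * t) j k" for j k
  using W_nonneg H_le(2)[of "real (Suc j)" k] by (simp add: decay_profile_def)
 have se2: "integrable lborel (%x. (section_error sg t n x)^2)" for n
 proof -
  have "section_mode n t \<in> L2 lborel" using section_mode_L2[OF t, of n] by (simp add: L2_def)
  from L2_diff[OF this L2_cmult[OF normal_density_L2[OF sg], of C1]] this
  show ?thesis by (cases "n = 0") (auto simp: L2_def section_error_def)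
 qed
 have "pi * (\<Sum>n<N. LINT x|lborel. (section_error sg t n x)^2) <= ?Bd"
 proof (rule windowed_plancherel_bound[where c="%j. window (real (Suc j))" and r="%j. real (Suc j)"
   and B="%j k. B * decay_profile a c (nu * t) j k" and D="%k. \<alpha> + bt * k^2"])
  show "continuous_on UNIV (section_error sg t n)" for n
   unfolding section_error_def[abs_def] normal_density_def
   by (cases "n = 0") (use sg in "auto intro!: continuous_intros cont")
  show "integrable lborel (%x. (section_error sg t n x)^2)" for n by (rule se2)
  show "continuous_on UNIV (window (real (Suc j)))" for j by (rule window_continuous) simp
  show "window (real (Suc j)) x = 0" if "x \<notin> {- real (Suc j)..real (Suc j)}" for j x
   using window_outside[of "real (Suc j)" x] that by auto
  show "(%j. window (real (Suc j)) x) ----> 1" for x by (rule window_tendsto_1)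
  show "(%k. B * decay_profile a c (nu * t) j k) \<in> borel_measurable borel" for j
   using decay_profile_integral(1)[OF zero_less_one a c T, of j] by measurable
  fix s :: real assume s: "0 < s"
  note di = decay_profile_integral[OF s a c T]
  show "integrable lborel (%k. exp (- (s^2 * k^2 / 2)) * (B * decay_profile a c (nu * t) j k))" for j
   using integrable_mult_right[OF di(2)[of j], of B] by (simp add: mult_ac)
  show "(LINT k|lborel. exp (- (s^2 * k^2 / 2)) * (B * decay_profile a c (nu * t) j k)) <= ?Bd" for j
  proof -
   have "(LINT k|lborel. exp (- (s^2 * k^2 / 2)) * (B * decay_profile a c (nu * t) j k))
   = (LINT k|lborel. B * (exp (- (s^2 * k^2 / 2)) * decay_profile a c (nu * t) j k))" by (simp only: mult.left_commute)
   also have "... = B * (LINT k|lborel. exp (- (s^2 * k^2 / 2)) * decay_profile a c (nu * t) j k)" by (rule integral_mult_right_zero)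
   also have "... <= ?Bd" by (intro mult_left_mono di(3) B)
   finally show ?thesis .
  qed
  show "integrable lborel (%k. exp (- (s^2 * k^2 / 2)) * (\<alpha> + bt * k^2))"
  proof -
   have "integrable lborel (%k. \<alpha> * exp (- (s^2 / 2 * k^2)) + bt * (k^2 * exp (- (s^2 / 2 * k^2))))"
   using s by (intro Bochner_Integration.integrable_add integrable_mult_right gauss_mass gauss_moment) auto
   thus ?thesis by (simp add: algebra_simps)
  qed
 qed (use window_01 prof_nn B D dec in "auto simp: fourier_section_error[OF t sg] decays_def simp del: of_nat_Suc")
 moreover have "1 * (\<Sum>n<N. LINT x|lborel. (section_error sg t n x)^2) <= pi * (\<Sum>n<N. LINT x|lborel. (section_error sg t n x)^2)"
  using pi_ge_two by (intro mult_right_mono sum_nonneg) auto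
 ultimately show "(\<Sum>n<N. LINT x|lborel. (section_error sg t n x)^2) <= B * decay_constant c a0 * W / ((1 + nu * t) * sqrt (1 + nu * t))"
  by simp
qed

end


lemma (in taylor_channel) Mat_0_eq_0: assumes "taylor_constant = 0" shows "Mat 0 n = 0"
proof (cases n)
 case 0
 have "Mat 0 0 = (LINT q|Q. chi q)"
  unfolding Mat_0 L2_inner_def by (rule integral_cong_AE) (use ps0 in "auto elim!: eventually_mono")
 thus ?thesis using 0 chi_mean by simp
next
 case (Suc m)
 have pos: "0 < mu (Suc m)" for m using mu_ge[of "Suc m"] mu1 by simp
 have "\<forall>m. (L2_inner Q chi (ps (Suc m)))^2 / mu (Suc m) = 0"
  using suminf_eq_zero_iff[OF sums_summable[OF taylor_constant_sums]] assms pos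
  by (simp add: taylor_constant_def less_imp_le)
 hence "(L2_inner Q chi (ps (Suc m)))^2 / mu (Suc m) = 0" by blast
 thus ?thesis using Suc pos[of m] by (simp add: Mat_0)
qed

text \<open>\<open>K\<close> precedes \<open>nu\<close>, the solution, the weight and the time. This
  is possible because all constants are built from \<open>X\<close>, \<open>mu\<close>,
  \<open>A\<close> and the Taylor constant; by \<open>nu <= 1\<close>, \<open>abs A\<close> is a
  lower bound for the absolute value of the coupling \<open>A / nu\<close>.\<close>

theorem taylor_decay:
 fixes Q :: "'q measure" and A X :: real and ps :: "nat => 'q => real" and chi :: "'q => real"
 assumes X: "1 <= X" and mu: "0 < mu 1" and A: "A \<noteq> 0"
 defines "d \<equiv> taylor_channel.taylor_constant Q ps chi mu"
 shows "\<exists>K\<ge>0. \<forall>nu b w t. taylor_channel Q ps chi mu X nu A b w --> 0 <= t -->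
  (\<forall>n. continuous_on UNIV (taylor_channel.section_mode Q ps b n t)) -->
  (LINT p|(strip Q). (b t p - taylor_channel.C1 Q b * normal_density 0 (sqrt (2 * ((1 + (A / nu)^2 * d) * (nu * t + 1)))) (fst p))^2)
   <= K * taylor_channel.W Q b w / ((1 + nu * t) * sqrt (1 + nu * t))"
proof (cases "0 < d")
 case True
 hence d2: "0 < d / 2" by simp
 from modes_low[OF X mu d2, folded low_estimate_def low_bound_def] obtain kp0 c0 C where kp0: "0 < kp0" and c0: "0 < c0" and C: "0 <= C"
  and low: "low_bound X (mu 1) (d / 2) kp0 c0 C"
  by blast
 from modes_high[OF X mu d2 kp0, folded high_estimate_def high_bound_def] obtain c1 where c1: "0 < c1" and high: "high_bound X (mu 1) (d / 2) kp0 c1"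
  by blast
 define c where "c = min (min c0 c1) (min (2 * d) (2 * d * kp0^2))"
 have c: "0 < c" "c <= c0" "c <= c1" "c <= 2 * d" "c <= 2 * d * kp0^2" using c0 c1 True kp0 by (auto simp: c_def)
 define B where "B = max (exp (c * kp0^2) * (2 * C + 4 * (1 / abs A + (1 / A^2 + d) * kp0)^2) * cmass) (8 + 4 * cmass)"
 have B: "0 <= B" using cmass_nonneg by (simp add: B_def le_max_iff_disj)
 show ?thesis
 proof (intro exI[of _ "B * decay_constant c \<bar>A\<bar>"] conjI allI impI)
  show "0 <= B * decay_constant c \<bar>A\<bar>"
   unfolding decay_constant_def using B A c(1) gauss_mass(2) gauss_moment(2)[OF c(1)] by simp
  fix nu b w t
  assume "taylor_channel Q ps chi mu X nu A b w" and t: "(0::real) <= t"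
   and cont: "\<forall>n. continuous_on UNIV (taylor_channel.section_mode Q ps b n t)"
  then interpret taylor_channel Q ps chi mu X nu A b w by simp
  let ?sg = "sqrt (2 * ((1 + (A / nu)^2 * d) * (nu * t + 1)))"
  have pos: "0 < (1 + (A / nu)^2 * d) * (nu * t + 1)" 
  proof (rule mult_pos_pos)
   show "0 < 1 + (A / nu)^2 * d" using True by (simp add: add_pos_nonneg)
   show "0 < nu * t + 1" using t nu by (simp add: add_nonneg_pos)
  qed
  have sg: "0 < ?sg" "?sg^2 / 2 = (1 + (A / nu)^2 * d) * (nu * t + 1)"
  proof -
   show "0 < ?sg" using pos by simp
   have "?sg^2 = 2 * ((1 + (A / nu)^2 * d) * (nu * t + 1))" by (rule real_sqrt_pow2) (use pos in linarith)
   thus "?sg^2 / 2 = (1 + (A / nu)^2 * d) * (nu * t + 1)" by simp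
  qed
  have "decays ?sg t (A / nu) c B"
   unfolding d_def
   by (rule decays_pos[OF t _ sg(1)[unfolded d_def] sg(2)[unfolded d_def] low[unfolded d_def] C kp0 high[unfolded d_def] c(1-3)])
   (use True c in "simp_all add: d_def[symmetric] B_def")
  moreover have "abs A <= \<bar>A / nu\<bar>" using nu mult_right_mono[of nu 1 "abs A"] by (simp add: field_simps)
  ultimately show "(LINT p|(strip Q). (b t p - C1 * normal_density 0 ?sg (fst p))^2)
   <= B * decay_constant c \<bar>A\<bar> * W / ((1 + nu * t) * sqrt (1 + nu * t))"
   using cont A by (intro decay_estimate t sg c(1) B) auto
 qed
next
 case False
 define c where "c = min (mu 1) 2"
 have c: "0 < c" "c <= mu 1" "c <= 2" using mu by (auto simp: c_def)
 define B where "B = max (exp c * 18 * cmass) (8 + 4 * cmass)"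
 have B: "0 <= B" using cmass_nonneg by (simp add: B_def le_max_iff_disj)
 show ?thesis
 proof (intro exI[of _ "B * decay_constant c 1"] conjI allI impI)
  show "0 <= B * decay_constant c 1"
   unfolding decay_constant_def using B c(1) gauss_mass(2) gauss_moment(2)[OF c(1)] by simp
  fix nu b w t
  assume "taylor_channel Q ps chi mu X nu A b w" and t: "(0::real) <= t"
   and cont: "\<forall>n. continuous_on UNIV (taylor_channel.section_mode Q ps b n t)"
  then interpret taylor_channel Q ps chi mu X nu A b w by simp
  have d0: "taylor_constant = 0" using False taylor_constant_nonneg by (simp add: d_def)
  let ?sg = "sqrt (2 * ((1 + (A / nu)^2 * d) * (nu * t + 1)))"
  have sg: "0 < ?sg" "?sg^2 / 2 = nu * t + 1"
   using t nu d0 by (simp_all add: d_def add_nonneg_pos)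
  have "decays ?sg t 1 c B"
   by (rule decays_zero[OF t Mat_0_eq_0[OF d0] sg c]) (simp_all add: B_def)
  thus "(LINT p|(strip Q). (b t p - C1 * normal_density 0 ?sg (fst p))^2)
   <= B * decay_constant c 1 * W / ((1 + nu * t) * sqrt (1 + nu * t))"
   using cont by (intro decay_estimate t sg c(1) B) auto
 qed
qed

section \<open>The advection-diffusion equation\<close>

lemma integrable_compact:
 fixes h :: "'a::euclidean_space => real"
 shows "compact K ==> continuous_on K h ==> integrable lborel (%p. indicator K p * h p)"
 using borel_integrable_compact[of K h] by simp

lemma fubini_compact_product:
 fixes h :: "real \<times> 'b::euclidean_space => real"
 assumes K: "compact I" "compact Om" and h: "continuous_on (I \<times> Om) h"
 shows "(LINT p|lborel. indicator (I \<times> Om) p * h p) = (LINT x|lborel. indicator I x * (LINT q|lborel. indicator Om q * h (x, q)))"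
  and "(LINT p|lborel. indicator (I \<times> Om) p * h p) = (LINT q|lborel. indicator Om q * (LINT x|lborel. indicator I x * h (x, q)))"
proof -
 let ?f = "%p. indicator (I \<times> Om) p * h p"
 have i: "integrable (lborel \<Otimes>\<^sub>M lborel) (%(x, q). ?f (x, q))"
  using integrable_compact[OF compact_Times[OF K] h] unfolding lborel_prod by (simp add: case_prod_unfold)
 have e1: "?f (x, q) = indicator I x * (indicator Om q * h (x, q))" and e2: "?f (x, q) = indicator Om q * (indicator I x * h (x, q))" for x q
  by (simp_all add: indicator_times)
 have "(LINT p|lborel. ?f p) = (LINT p|(lborel \<Otimes>\<^sub>M lborel). ?f p)" unfolding lborel_prod ..
 also have "... = (LINT x|lborel. LINT q|lborel. ?f (x, q))" using lborel_pair.integral_fst[OF i] by (simp add: case_prod_unfold)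
 finally show "(LINT p|lborel. ?f p) = (LINT x|lborel. indicator I x * (LINT q|lborel. indicator Om q * h (x, q)))"
  by (simp only: e1 integral_mult_right_zero)
 have "(LINT p|lborel. ?f p) = (LINT p|(lborel \<Otimes>\<^sub>M lborel). ?f p)" unfolding lborel_prod ..
 also have "... = (LINT q|lborel. LINT x|lborel. ?f (x, q))" using lborel_pair.integral_snd[OF i] by (simp add: case_prod_unfold)
 finally show "(LINT p|lborel. ?f p) = (LINT q|lborel. indicator Om q * (LINT x|lborel. indicator I x * h (x, q)))"
  by (simp only: e2 integral_mult_right_zero)
qed

lemma DERIV_continuous_UNIV: "(!!x. (f has_real_derivative f' x) (at x)) ==> continuous_on UNIV f"
 by (meson DERIV_isCont continuous_at_imp_continuous_on)

lemma interval_parts: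
 fixes f g :: "real => real"
 assumes R: "0 <= R" and f: "!!x. (f has_real_derivative f' x) (at x)" and f': "continuous_on UNIV f'"
  and g: "!!x. (g has_real_derivative g' x) (at x)" and g': "continuous_on UNIV g'"
  and 0: "g R = 0" "g (- R) = 0"
 shows "(LINT x|lborel. indicator {- R..R} x * (f' x * g x)) = - (LINT x|lborel. indicator {- R..R} x * (f x * g' x))"
proof -
 have fc: "continuous_on UNIV f" "continuous_on UNIV g"
  by (rule DERIV_continuous_UNIV[OF f], rule DERIV_continuous_UNIV[OF g])
 have c: "continuous_on {- R..R} f" "continuous_on {- R..R} g" "continuous_on {- R..R} f'" "continuous_on {- R..R} g'"
  by (rule continuous_on_subset[OF _ subset_UNIV], fact)+
 have i: "integrable lborel (%x. indicator {- R..R} x * (f' x * g x))" "integrable lborel (%x. indicator {- R..R} x * (f x * g' x))"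
  by (rule integrable_compact[OF compact_Icc continuous_on_mult[OF c(3,2)]])
   (rule integrable_compact[OF compact_Icc continuous_on_mult[OF c(1,4)]])
 have "(LINT x|lborel. indicator {- R..R} x *\<^sub>R (f' x * g x + f x * g' x)) = f R * g R - f (- R) * g (- R)"
 proof (rule integral_FTC_Icc)
  show "- R <= R" using R by simp
  show "((%x. f x * g x) has_vector_derivative f' x * g x + f x * g' x) (at x within {- R..R})" for x
  proof -
   have "((%x. f x * g x) has_real_derivative f' x * g x + f x * g' x) (at x)"
   using DERIV_mult[OF f[of x] g[of x]] by (simp add: mult.commute)
   from this[unfolded has_real_derivative_iff_has_vector_derivative] show ?thesis by (rule has_vector_derivative_at_within)
  qed
  show "continuous_on {- R..R} (%x. f' x * g x + f x * g' x)"
   by (intro continuous_on_add continuous_on_mult c)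
 qed
 hence "(LINT x|lborel. indicator {- R..R} x * (f' x * g x) + indicator {- R..R} x * (f x * g' x)) = 0"
  by (simp add: 0 distrib_left)
 thus ?thesis using i by simp
qed

text \<open>The derivative in the parameter is bounded on the compact product and thereby dominates
  the difference quotients.\<close>

lemma leibniz_compact:
 fixes f f' :: "real => 'a::euclidean_space => real"
 assumes K: "compact K" and s: "a < s" "s < b"
  and der: "!!s p. a < s ==> s < b ==> p \<in> K ==> ((%s. f s p) has_real_derivative f' s p) (at s)"
  and c: "!!s. a < s ==> s < b ==> continuous_on K (f s)"
  and c': "continuous_on ({a..b} \<times> K) (%(s, p). f' s p)"
 shows "((%s. LINT p|lborel. indicator K p * f s p) has_real_derivative (LINT p|lborel. indicator K p * f' s p)) (at s)"
proof -
 have "compact ((%(s, p). f' s p) ` ({a..b} \<times> K))" by (intro compact_continuous_image c' compact_Times K) auto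
 from compact_imp_bounded[OF this] obtain B where "\<forall>y\<in>(%(s, p). f' s p) ` ({a..b} \<times> K). norm y <= B"
  unfolding bounded_iff by blast
 hence B: "\<bar>f' s p\<bar> <= B" if "s \<in> {a..b}" "p \<in> K" for s p using that by force
 let ?F = "%s. LINT p|lborel. indicator K p * f s p"
 have int: "integrable lborel (%p. indicator K p * f s p)" if "a < s" "s < b" for s
  by (rule integrable_compact[OF K c[OF that]])
 have int': "integrable lborel (%p. indicator K p * f' s p)"
 proof (rule integrable_compact[OF K])
  have "continuous_on K (%p. (%(s, p). f' s p) (s, p))"
   using s by (intro continuous_on_compose2[OF c'] continuous_intros) auto
  thus "continuous_on K (f' s)" by simp
 qed
 have "((%y. (?F y - ?F s) / (y - s)) \<longlongrightarrow> (LINT p|lborel. indicator K p * f' s p)) (at s within {a<..<b})"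
  unfolding tendsto_at_iff_sequentially comp_def
 proof (intro allI impI)
  fix X assume X: "\<forall>i. X i \<in> {a<..<b} - {s}" and lim: "X ----> s"
  have eq: "(?F (X i) - ?F s) / (X i - s) = (LINT p|lborel. indicator K p * ((f (X i) p - f s p) / (X i - s)))" for i
  proof -
   have "(LINT p|lborel. indicator K p * ((f (X i) p - f s p) / (X i - s)))
   = (LINT p|lborel. (indicator K p * f (X i) p - indicator K p * f s p) / (X i - s))"
   by (simp add: right_diff_distrib diff_divide_distrib)
   also have "... = (?F (X i) - ?F s) / (X i - s)"
   unfolding integral_divide_zero using int[of "X i"] int[of s] X s by (subst LINT_diff) auto
   finally show ?thesis ..
  qed
  have conv: "(%i. (f (X i) p - f s p) / (X i - s)) ----> f' s p" if "p \<in> K" for p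
  proof -
   have "((%y. (f y p - f s p) / (y - s)) \<longlongrightarrow> f' s p) (at s)"
   using der[OF s that] by (simp add: has_field_derivative_iff)
   thus ?thesis unfolding tendsto_at_iff_sequentially comp_def using X lim by auto
  qed
  have bnd: "\<bar>(f (X i) p - f s p) / (X i - s)\<bar> <= B" if "p \<in> K" for i p
  proof -
   have "norm (f (X i) p - f s p) <= B * norm (X i - s)"
   by (rule field_differentiable_bound[where S="{a<..<b}" and f'="%s. f' s p"])
   (use X s B that der in "auto intro: has_field_derivative_at_within")
   moreover have "0 < \<bar>X i - s\<bar>" using X by auto
   ultimately show ?thesis by (simp add: abs_divide divide_le_eq)
  qed
  show "(%i. (?F (X i) - ?F s) / (X i - s)) ----> (LINT p|lborel. indicator K p * f' s p)"
   unfolding eq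
  proof (rule integral_dominated_convergence[where w="%p. indicator K p * B"])
   show "integrable lborel (%p. indicator K p * B)" by (rule integrable_compact[OF K continuous_on_const])
   show "AE p in lborel. (%i. indicator K p * ((f (X i) p - f s p) / (X i - s))) ----> indicator K p * f' s p"
   using conv by (intro AE_I2) (auto simp: indicator_def)
   show "AE p in lborel. norm (indicator K p * ((f (X i) p - f s p) / (X i - s))) <= indicator K p * B" for i
   using bnd by (intro AE_I2) (auto simp: indicator_def)
   show "(%p. indicator K p * f' s p) \<in> borel_measurable lborel" using int' by (rule borel_measurable_integrable)
   show "(%p. indicator K p * ((f (X i) p - f s p) / (X i - s))) \<in> borel_measurable lborel" for i
   proof -
   have "(%p. indicator K p * ((f (X i) p - f s p) / (X i - s)))
   = (%p. (indicator K p * f (X i) p - indicator K p * f s p) / (X i - s))"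
   by (simp add: fun_eq_iff right_diff_distrib diff_divide_distrib)
   thus ?thesis using int[of "X i"] int[of s] X s by simp
   qed
  qed
 qed
 moreover have "at s within {a<..<b} = at s" by (rule at_within_open) (use s in auto)
 ultimately show ?thesis unfolding has_field_derivative_iff by (simp only:)
qed

lemma Basis_real_prod: "(\<Sum>b\<in>Basis. f b) = f (1, 0) + (\<Sum>b\<in>Basis. f (0, b))"
 for f :: "real \<times> 'b::euclidean_space => real"
proof -
 have "(Basis :: (real \<times> 'b) set) = insert (1, 0) ((%b. (0, b)) ` (Basis :: 'b set))" by (auto simp: Basis_prod_def)
 hence "(\<Sum>b\<in>Basis. f b) = (\<Sum>b\<in>insert (1, 0) ((%b. (0, b)) ` (Basis :: 'b set)). f b)" by simp
 also have "... = f (1, 0) + (\<Sum>b\<in>(%b. (0, b)) ` (Basis :: 'b set). f b)" by (subst sum.insert) auto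
 also have "(\<Sum>b\<in>(%b. (0, b)) ` (Basis :: 'b set). f b) = (\<Sum>b\<in>Basis. f (0, b))"
  by (subst sum.reindex) (auto simp: inj_on_def)
 finally show ?thesis .
qed

lemma has_derivative_ddir:
 "f differentiable (at p within S) ==> (f has_derivative (%v. ddir S v f p)) (at p within S)"
 unfolding ddir_def by (rule frechet_derivative_works[THEN iffD1])

lemma Ck_on_2D:
 assumes "Ck_on 2 S f"
 shows "!!p. p \<in> S ==> (f has_derivative (%v. ddir S v f p)) (at p within S)"
  and "!!p v. p \<in> S ==> (ddir S v f has_derivative (%w. ddir S w (ddir S v f) p)) (at p within S)"
  and "!!v w. continuous_on S (ddir S w (ddir S v f))"
  and "continuous_on S f" and "!!v. continuous_on S (ddir S v f)"
proof -
 have C: "f differentiable_on S" "!!v. ddir S v f differentiable_on S" "!!v w. continuous_on S (ddir S w (ddir S v f))"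
  using assms by (auto simp: numeral_2_eq_2)
 thus "continuous_on S (ddir S w (ddir S v f))" for v w by blast
 show "(f has_derivative (%v. ddir S v f p)) (at p within S)" if "p \<in> S" for p
  using C(1) that by (intro has_derivative_ddir) (auto simp: differentiable_on_def)
 show "(ddir S v f has_derivative (%w. ddir S w (ddir S v f) p)) (at p within S)" if "p \<in> S" for p v
  using C(2)[of v] that by (intro has_derivative_ddir) (auto simp: differentiable_on_def)
 show "continuous_on S f" "continuous_on S (ddir S v f)" for v
  using C by (auto intro: differentiable_imp_continuous_on)
qed

text \<open>At fixed \<open>q\<close>, integration by parts in \<open>x\<close>, where
  \<open>et\<close> removes the boundary values; at fixed \<open>x\<close>, Green's identity, where
  the two Neumann conditions remove the boundary terms. Integrations are exchanged on a compact
  product only. \<open>U1\<close> and \<open>U2\<close> are kept abstract because they will be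
  restrictions of space-time derivatives.\<close>

lemma weak_identity:
 fixes U :: "real \<times> 'b::euclidean_space => real" and et :: "real => real"
 assumes comp: "compact Om" and smooth: "smooth_boundary Om" and ph: "neumann_eigenfunction Om ph mu"
  and U: "!!x q. q \<in> Om ==> (U has_derivative U1 (x, q)) (at (x, q) within UNIV \<times> Om)"
  and U1: "!!x q v. q \<in> Om ==> ((%p. U1 p v) has_derivative U2 v (x, q)) (at (x, q) within UNIV \<times> Om)"
  and U2: "!!v w. continuous_on (UNIV \<times> Om) (%p. U2 v p w)"
  and neumann: "!!x q n. q \<in> frontier Om ==> outward_normal Om q n ==> U1 (x, q) (0, n) = 0"
  and et: "!!x. (et has_real_derivative et' x) (at x)" "!!x. (et' has_real_derivative et'' x) (at x)" "continuous_on UNIV et''"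
  and R: "0 <= R" and et0: "et R = 0" "et (- R) = 0" "et' R = 0" "et' (- R) = 0"
 defines "K \<equiv> {- R..R} \<times> Om"
 shows "(LINT p|lborel. indicator K p * ((\<Sum>b\<in>Basis. U2 b p b) * ph (snd p) * et (fst p)))
   = (LINT p|lborel. indicator K p * (U p * ph (snd p) * et'' (fst p))) - mu * (LINT p|lborel. indicator K p * (U p * ph (snd p) * et (fst p)))"
  and "continuous_on Om c ==> (LINT p|lborel. indicator K p * (U1 p (1, 0) * c (snd p) * et (fst p)))
   = - (LINT p|lborel. indicator K p * (U p * c (snd p) * et' (fst p)))"
proof -
 have ph_C: "Ck_on 2 Om ph" using ph by (simp add: neumann_eigenfunction_def)
 note ph_D = Ck_on_2D[OF ph_C]
 have cU: "continuous_on (UNIV \<times> Om) U" "continuous_on (UNIV \<times> Om) (%p. U1 p v)" for v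
  unfolding continuous_on_eq_continuous_within by (auto intro: has_derivative_continuous[OF U] has_derivative_continuous[OF U1])
 have cI: "compact {- R..R}" by simp
 have KS: "K \<subseteq> UNIV \<times> Om" by (auto simp: K_def)
 have et_c: "continuous_on UNIV et" "continuous_on UNIV et'"
  by (rule DERIV_continuous_UNIV[OF et(1)], rule DERIV_continuous_UNIV[OF et(2)])
 have cx: "continuous_on K (%p. g (fst p))" if "continuous_on UNIV g" for g :: "real => real"
  by (rule continuous_on_compose2[OF that]) (auto intro: continuous_intros)
 have cq: "continuous_on K (%p. g (snd p))" if "continuous_on Om g" for g :: "'b => real"
  by (rule continuous_on_compose2[OF that]) (auto intro!: continuous_intros simp: K_def)
 have cK: "continuous_on K g" if "continuous_on (UNIV \<times> Om) g" for g :: "real \<times> 'b => real"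
  by (rule continuous_on_subset[OF that KS])
 have lx: "continuous_on UNIV (%x. g (x, q))" if "continuous_on (UNIV \<times> Om) g" "q \<in> Om" for g :: "real \<times> 'b => real" and q
  by (rule continuous_on_compose2[OF that(1)]) (use that(2) in "auto intro!: continuous_intros")
 have lq: "continuous_on Om (%q. g (x, q))" if "continuous_on (UNIV \<times> Om) g" for g :: "real \<times> 'b => real" and x
  by (rule continuous_on_compose2[OF that(1)]) (auto intro!: continuous_intros)
 have dx: "((%x. U (x, q)) has_real_derivative U1 (x, q) (1, 0)) (at x)"
  "((%x. U1 (x, q) v) has_real_derivative U2 v (x, q) (1, 0)) (at x)" if q: "q \<in> Om" for x q v
 proof -
  have l: "((%x. (x, q)) has_derivative (%h. (h, 0))) (at x within UNIV)"
   by (rule has_derivative_Pair[OF has_derivative_ident has_derivative_const])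
  have *: "((%x. g (x, q)) has_real_derivative G (x, q) (1, 0)) (at x)"
   if g: "!!x q. q \<in> Om ==> (g has_derivative G (x, q)) (at (x, q) within UNIV \<times> Om)" for g G
  proof -
   have "((%x. g (x, q)) has_derivative (%h. G (x, q) (h, 0))) (at x within UNIV)"
   by (rule has_derivative_in_compose2[OF _ _ _ l, of "UNIV \<times> Om"]) (use g q in auto)
   moreover have "G (x, q) (h, 0) = G (x, q) (1, 0) * h" for h
   using linear_scale[OF has_derivative_linear[OF g[OF q]], of x h "(1, 0)"] by (simp add: mult.commute)
   hence "(%h. G (x, q) (h, 0)) = (*) (G (x, q) (1, 0))" by (rule ext)
   ultimately show ?thesis by (simp only: has_field_derivative_def)
  qed
  show "((%x. U (x, q)) has_real_derivative U1 (x, q) (1, 0)) (at x)" by (rule *[OF U])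
  show "((%x. U1 (x, q) v) has_real_derivative U2 v (x, q) (1, 0)) (at x)" by (rule *[OF U1])
 qed
 have parts1: "(LINT x|lborel. indicator {- R..R} x * (U1 (x, q) (1, 0) * g x)) = - (LINT x|lborel. indicator {- R..R} x * (U (x, q) * g' x))"
  if "q \<in> Om" "!!x. (g has_real_derivative g' x) (at x)" "continuous_on UNIV g'" "g R = 0" "g (- R) = 0" for q g g'
  by (rule interval_parts[OF R dx(1)[OF that(1)] lx[OF cU(2) that(1)] that(2-5)])
 have parts2: "(LINT x|lborel. indicator {- R..R} x * (U2 (1, 0) (x, q) (1, 0) * et x)) = (LINT x|lborel. indicator {- R..R} x * (U (x, q) * et'' x))"
  if q: "q \<in> Om" for q
 proof -
  have "(LINT x|lborel. indicator {- R..R} x * (U2 (1, 0) (x, q) (1, 0) * et x)) = - (LINT x|lborel. indicator {- R..R} x * (U1 (x, q) (1, 0) * et' x))"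
   by (rule interval_parts[OF R dx(2)[OF q] lx[OF U2 q] et(1) et_c(2) et0(1,2)])
  thus ?thesis using parts1[OF q et(2,3) et0(3,4)] by simp
 qed
 have green: "(LINT q|lborel. indicator Om q * ((\<Sum>b\<in>Basis. U2 (0, b) (x, q) (0, b)) * ph q)) = - mu * (LINT q|lborel. indicator Om q * (U (x, q) * ph q))" for x
 proof -
  have l: "((%q. (x, q)) has_derivative (%h. (0, h))) (at q within Om)" for q
   by (rule has_derivative_Pair[OF has_derivative_const has_derivative_ident])
  have *: "((%q. g (x, q)) has_derivative (%h. G (x, q) (0, h))) (at q within Om)"
   if g: "!!x q. q \<in> Om ==> (g has_derivative G (x, q)) (at (x, q) within UNIV \<times> Om)" and q: "q \<in> Om" for g G q
   by (rule has_derivative_in_compose2[OF _ _ q l, of "UNIV \<times> Om"]) (use g q in auto)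
  have "(LINT q|lborel. indicator Om q * (ph q * (\<Sum>b\<in>Basis. U2 (0, b) (x, q) (0, b)) - U (x, q) * (\<Sum>b\<in>Basis. ddir Om b (ddir Om b ph) q))) = 0"
  proof (rule green_neumann[where ?f1.0="%q v. ddir Om v ph q" and ?f2.0="%v q w. ddir Om w (ddir Om v ph) q"
   and g="%q. U (x, q)" and ?g1.0="%q v. U1 (x, q) (0, v)" and ?g2.0="%v q w. U2 (0, v) (x, q) (0, w)", OF comp smooth])
   show "((%q. U (x, q)) has_derivative (%v. U1 (x, q) (0, v))) (at q within Om)" if "q \<in> Om" for q
   by (rule *[OF U that])
   show "((%q. U1 (x, q) (0, v)) has_derivative (%w. U2 (0, v) (x, q) (0, w))) (at q within Om)" if "q \<in> Om" for q v
   by (rule *[OF U1 that])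
   show "continuous_on Om (%q. U2 (0, v) (x, q) (0, w))" for v w by (rule lq[OF U2])
   show "ddir Om n ph q = 0" if "q \<in> frontier Om" "outward_normal Om q n" for q n
   using ph that by (auto simp: neumann_eigenfunction_def)
   show "U1 (x, q) (0, n) = 0" if "q \<in> frontier Om" "outward_normal Om q n" for q n by (rule neumann[OF that])
  qed (use ph_D in auto)
  moreover have "indicator Om q * (ph q * (\<Sum>b\<in>Basis. U2 (0, b) (x, q) (0, b)) - U (x, q) * (\<Sum>b\<in>Basis. ddir Om b (ddir Om b ph) q))
   = indicator Om q * ((\<Sum>b\<in>Basis. U2 (0, b) (x, q) (0, b)) * ph q) + mu * (indicator Om q * (U (x, q) * ph q))" for q
   using ph by (cases "q \<in> Om") (auto simp: neumann_eigenfunction_def laplacian_on_def)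
  moreover have "integrable lborel (%q. indicator Om q * ((\<Sum>b\<in>Basis. U2 (0, b) (x, q) (0, b)) * ph q))"
   "integrable lborel (%q. indicator Om q * (U (x, q) * ph q))"
   by (intro integrable_compact comp continuous_on_mult continuous_on_sum lq[OF U2] ph_D(4) lq[OF cU(1)])+
  ultimately show ?thesis by simp
 qed
 show "(LINT p|lborel. indicator K p * (U1 p (1, 0) * c (snd p) * et (fst p)))
   = - (LINT p|lborel. indicator K p * (U p * c (snd p) * et' (fst p)))" if c: "continuous_on Om c"
 proof -
  have k1: "continuous_on ({- R..R} \<times> Om) (%p. U1 p (1, 0) * c (snd p) * et (fst p))"
   "continuous_on ({- R..R} \<times> Om) (%p. U p * c (snd p) * et' (fst p))"
   unfolding K_def[symmetric] by (intro continuous_on_mult cK[OF cU(1)] cK[OF cU(2)] cq[OF c] cx[OF et_c(1)] cx[OF et_c(2)])+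
  have "indicator Om q * (LINT x|lborel. indicator {- R..R} x * (U1 (x, q) (1, 0) * c q * et x))
   = - (indicator Om q * (LINT x|lborel. indicator {- R..R} x * (U (x, q) * c q * et' x)))" for q
  proof (cases "q \<in> Om")
   case True
   have "(LINT x|lborel. indicator {- R..R} x * (U1 (x, q) (1, 0) * c q * et x)) = c q * (LINT x|lborel. indicator {- R..R} x * (U1 (x, q) (1, 0) * et x))"
   unfolding integral_mult_right_zero[symmetric] by (simp only: mult_ac)
   also have "... = - (c q * (LINT x|lborel. indicator {- R..R} x * (U (x, q) * et' x)))"
   unfolding parts1[OF True et(1) et_c(2) et0(1,2)] by simp
   also have "c q * (LINT x|lborel. indicator {- R..R} x * (U (x, q) * et' x)) = (LINT x|lborel. indicator {- R..R} x * (U (x, q) * c q * et' x))"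
   unfolding integral_mult_right_zero[symmetric] by (simp only: mult_ac)
   finally show ?thesis by simp
  qed simp
  thus ?thesis unfolding K_def fubini_compact_product(2)[OF cI comp k1(1)] fubini_compact_product(2)[OF cI comp k1(2)] by simp
 qed
 have kx: "continuous_on ({- R..R} \<times> Om) (%p. U2 (1, 0) p (1, 0) * ph (snd p) * et (fst p))"
  and kx': "continuous_on ({- R..R} \<times> Om) (%p. U p * ph (snd p) * et'' (fst p))"
  and kq: "continuous_on ({- R..R} \<times> Om) (%p. (\<Sum>b\<in>Basis. U2 (0, b) p (0, b)) * ph (snd p) * et (fst p))"
  and kq': "continuous_on ({- R..R} \<times> Om) (%p. U p * ph (snd p) * et (fst p))"
  unfolding K_def[symmetric] by (intro continuous_on_mult continuous_on_sum cK[OF cU(1)] cK[OF U2] cq[OF ph_D(4)] cx[OF et_c(1)] cx[OF et(3)])+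
 have X: "(LINT p|lborel. indicator K p * (U2 (1, 0) p (1, 0) * ph (snd p) * et (fst p))) = (LINT p|lborel. indicator K p * (U p * ph (snd p) * et'' (fst p)))"
 proof -
  have "indicator Om q * (LINT x|lborel. indicator {- R..R} x * (U2 (1, 0) (x, q) (1, 0) * ph q * et x))
   = indicator Om q * (LINT x|lborel. indicator {- R..R} x * (U (x, q) * ph q * et'' x))" for q
  proof (cases "q \<in> Om")
   case True
   have "(LINT x|lborel. indicator {- R..R} x * (U2 (1, 0) (x, q) (1, 0) * ph q * et x)) = ph q * (LINT x|lborel. indicator {- R..R} x * (U2 (1, 0) (x, q) (1, 0) * et x))"
   unfolding integral_mult_right_zero[symmetric] by (simp only: mult_ac)
   also have "... = (LINT x|lborel. indicator {- R..R} x * (U (x, q) * ph q * et'' x))"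
   unfolding parts2[OF True] integral_mult_right_zero[symmetric] by (simp only: mult_ac)
   finally show ?thesis by simp
  qed simp
  thus ?thesis unfolding K_def fubini_compact_product(2)[OF cI comp kx] fubini_compact_product(2)[OF cI comp kx']
   by (simp only: fst_conv snd_conv)
 qed
 have Y: "(LINT p|lborel. indicator K p * ((\<Sum>b\<in>Basis. U2 (0, b) p (0, b)) * ph (snd p) * et (fst p))) = - mu * (LINT p|lborel. indicator K p * (U p * ph (snd p) * et (fst p)))"
 proof -
  have "(LINT q|lborel. indicator Om q * ((\<Sum>b\<in>Basis. U2 (0, b) (x, q) (0, b)) * ph q * et x)) = - mu * (LINT q|lborel. indicator Om q * (U (x, q) * ph q * et x))" for x
   using green[of x] by (simp only: mult.assoc[symmetric] integral_mult_left_zero)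
  hence "indicator {- R..R} x * (LINT q|lborel. indicator Om q * ((\<Sum>b\<in>Basis. U2 (0, b) (x, q) (0, b)) * ph q * et x))
   = - mu * (indicator {- R..R} x * (LINT q|lborel. indicator Om q * (U (x, q) * ph q * et x)))" for x by simp
  thus ?thesis unfolding K_def fubini_compact_product(1)[OF cI comp kq] fubini_compact_product(1)[OF cI comp kq']
   by (simp only: fst_conv snd_conv integral_mult_right_zero)
 qed
 have "(LINT p|lborel. indicator K p * ((\<Sum>b\<in>Basis. U2 b p b) * ph (snd p) * et (fst p)))
  = (LINT p|lborel. indicator K p * (U2 (1, 0) p (1, 0) * ph (snd p) * et (fst p)) + indicator K p * ((\<Sum>b\<in>Basis. U2 (0, b) p (0, b)) * ph (snd p) * et (fst p)))"
  unfolding Basis_real_prod by (simp only: distrib_left distrib_right)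
 also have "... = (LINT p|lborel. indicator K p * (U2 (1, 0) p (1, 0) * ph (snd p) * et (fst p))) + (LINT p|lborel. indicator K p * ((\<Sum>b\<in>Basis. U2 (0, b) p (0, b)) * ph (snd p) * et (fst p)))"
  by (intro Bochner_Integration.integral_add) (auto simp: K_def intro!: integrable_compact compact_Times comp kx kq)
 finally show "(LINT p|lborel. indicator K p * ((\<Sum>b\<in>Basis. U2 b p b) * ph (snd p) * et (fst p)))
   = (LINT p|lborel. indicator K p * (U p * ph (snd p) * et'' (fst p))) - mu * (LINT p|lborel. indicator K p * (U p * ph (snd p) * et (fst p)))"
  unfolding X Y by simp
qed

section \<open>Derivatives of the windowed waves\<close>

lemma DERIV_positive_part_power:
 "((%y::real. (max 0 y) ^ Suc (Suc n)) has_real_derivative real (Suc (Suc n)) * (max 0 y) ^ Suc n) (at y)"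
proof (cases "y = 0")
 case True
 have "((%h. (max 0 h) ^ Suc (Suc n) / h) \<longlongrightarrow> 0) (at (0::real))"
 proof (rule Lim_null_comparison)
  show "\<forall>\<^sub>F h in at (0::real). norm ((max 0 h) ^ Suc (Suc n) / h) <= abs h ^ Suc n"
  proof (intro always_eventually allI)
   fix h :: real
   show "norm ((max 0 h) ^ Suc (Suc n) / h) <= abs h ^ Suc n"
   proof (cases "0 < h")
   case False
   hence "max 0 h ^ Suc (Suc n) / h = 0" by simp
   thus ?thesis by (simp only: norm_zero) (rule zero_le_power, simp)
   qed simp
  qed
  have "((%h::real. abs h ^ Suc n) \<longlongrightarrow> \<bar>0\<bar> ^ Suc n) (at 0)" by (intro tendsto_intros)
  thus "((%h::real. abs h ^ Suc n) \<longlongrightarrow> 0) (at 0)" by simp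
 qed
 thus ?thesis using True by (simp add: has_field_derivative_iff)
next
 case False
 then consider "0 < y" | "y < 0" by linarith
 thus ?thesis
 proof cases
  case 1
  have d: "((%y::real. y ^ Suc (Suc n)) has_real_derivative real (Suc (Suc n)) * y ^ Suc n) (at y)"
   using DERIV_pow[of "Suc (Suc n)" y] by simp
  have "((%y::real. (max 0 y) ^ Suc (Suc n)) has_real_derivative real (Suc (Suc n)) * y ^ Suc n) (at y)"
   by (rule has_field_derivative_transform_within_open[OF d, of "{0<..}"]) (use 1 in auto)
  thus ?thesis using 1 by simp
 next
  case 2
  have "((%y::real. (max 0 y) ^ Suc (Suc n)) has_real_derivative 0) (at y)"
   by (rule has_field_derivative_transform_within_open[OF DERIV_const, of "{..<0}"]) (use 2 in auto)
  thus ?thesis using 2 by (simp add: max_def)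
 qed
qed

lemma DERIV_window:
 assumes R: "0 < R"
 shows "(window R has_real_derivative window' R x) (at x)" "(window' R has_real_derivative window'' R x) (at x)"
proof -
 let ?y = "%x. 1 - (x / R)^2"
 have y: "(?y has_real_derivative - (2 * x / R^2)) (at x)"
  using R by (auto intro!: derivative_eq_intros simp: power2_eq_square)
 have "((%x. (max 0 (?y x)) ^ Suc (Suc 1)) has_real_derivative real (Suc (Suc 1)) * (max 0 (?y x)) ^ Suc 1 * (- (2 * x / R^2))) (at x)"
  by (rule DERIV_chain2[OF DERIV_positive_part_power y])
 thus "(window R has_real_derivative window' R x) (at x)"
  unfolding window_def[abs_def] window'_def by (simp add: numeral_3_eq_3 power2_eq_square mult_ac)
 have m2: "((%x. (max 0 (?y x)) ^ Suc (Suc 0)) has_real_derivative real (Suc (Suc 0)) * (max 0 (?y x)) ^ Suc 0 * (- (2 * x / R^2))) (at x)"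
  by (rule DERIV_chain2[OF DERIV_positive_part_power y])
 have l: "((%x. - 6 * x / R^2) has_real_derivative - 6 / R^2) (at x)"
  using DERIV_cdivide[OF DERIV_cmult[OF DERIV_ident], of "- 6" "R^2" x] by simp
 have w': "window' R = (%x. - 6 * x / R^2 * (max 0 (?y x)) ^ Suc (Suc 0))"
  by (simp add: fun_eq_iff window'_def power2_eq_square)
 show "(window' R has_real_derivative window'' R x) (at x)"
  unfolding w' by (rule DERIV_cong[OF DERIV_mult[OF l m2]])
   (simp add: window''_def power2_eq_square power4_eq_xxxx mult_ac)
qed

lemma window''_continuous: "0 < R ==> continuous_on UNIV (window'' R)"
 unfolding window''_def[abs_def] by (intro continuous_intros) auto

text \<open>The form covers both \<open>wave\<close>, with \<open>h = 0\<close>, and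
  \<open>wave'\<close>, with \<open>h\<close> equal to \<open>k\<close> times the window, so one
  computation gives both derivatives.\<close>

lemma has_vector_derivative_modulated:
 assumes g: "(g has_real_derivative g') (at x)" and h: "(h has_real_derivative h') (at x)"
 shows "((%x. (of_real (g x) - \<i> * of_real (h x)) * iexp (- (k * x))) has_vector_derivative
  (of_real g' - \<i> * of_real h' - \<i> * of_real k * (of_real (g x) - \<i> * of_real (h x))) * iexp (- (k * x))) (at x)"
proof -
 have e: "((%x. iexp (- (k * x))) has_vector_derivative - \<i> * of_real k * iexp (- (k * x))) (at x)"
 proof -
  have "((%z. exp (- \<i> * of_real k * z)) has_field_derivative - \<i> * of_real k * exp (- \<i> * of_real k * of_real x)) (at (of_real x))"
   by (auto intro!: derivative_eq_intros)
  from has_vector_derivative_real_field[OF this] show ?thesis by (simp add: mult_ac)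
 qed
 have gh: "((%x. of_real (g x) - \<i> * of_real (h x)) has_vector_derivative of_real g' - \<i> * of_real h') (at x)"
  using g h by (intro has_vector_derivative_diff has_vector_derivative_mult_right has_vector_derivative_of_real)
   (auto simp: has_real_derivative_iff_has_vector_derivative)
 from has_vector_derivative_mult[OF gh e] show ?thesis by (simp add: algebra_simps)
qed

lemma wave_derivative:
 assumes R: "0 < R"
 shows "(wave R k has_vector_derivative wave' R k x) (at x)" "(wave' R k has_vector_derivative wave'' R k x) (at x)"
proof -
 note w = DERIV_window[OF R]
 have "((%x. (of_real (window R x) - \<i> * of_real 0) * iexp (- (k * x))) has_vector_derivative
  (of_real (window' R x) - \<i> * of_real 0 - \<i> * of_real k * (of_real (window R x) - \<i> * of_real 0)) * iexp (- (k * x))) (at x)"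
  by (rule has_vector_derivative_modulated[OF w(1) DERIV_const])
 thus "(wave R k has_vector_derivative wave' R k x) (at x)"
  unfolding wave_def[abs_def] wave'_def by simp
 have "((%x. (of_real (window' R x) - \<i> * of_real (k * window R x)) * iexp (- (k * x))) has_vector_derivative
  (of_real (window'' R x) - \<i> * of_real (k * window' R x) - \<i> * of_real k * (of_real (window' R x) - \<i> * of_real (k * window R x))) * iexp (- (k * x))) (at x)"
  by (rule has_vector_derivative_modulated[OF w(2) DERIV_cmult[OF w(1)]])
 thus "(wave' R k has_vector_derivative wave'' R k x) (at x)"
  unfolding wave'_def[abs_def] wave''_def by (simp add: algebra_simps power2_eq_square)
qed

lemma wave_outside: "0 < R ==> R <= abs x ==> wave R k x = 0 \<and> wave' R k x = 0 \<and> wave'' R k x = 0"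
 using window_outside[of R x] by (simp add: wave_def wave'_def wave''_def)

lemma wave''_continuous: "0 < R ==> continuous_on UNIV (wave'' R k)"
proof -
 assume R: "0 < R"
 note d = DERIV_continuous_UNIV[OF DERIV_window(1)[OF R]] DERIV_continuous_UNIV[OF DERIV_window(2)[OF R]]
 show ?thesis unfolding wave''_def[abs_def]
  by (intro continuous_intros d window''_continuous[OF R])
qed

lemma continuous_ReIm:
 assumes "!!x. (f has_vector_derivative f' x) (at x)"
 shows "continuous_on UNIV f"
 by (rule continuous_at_imp_continuous_on) (auto intro: has_vector_derivative_continuous[OF assms])

text \<open>The derivatives within space-time restrict to slices: at a fixed point of the cylinder
  the time slice is open and yields ordinary derivatives, at a fixed time the slice is the closed
  cylinder. Test functions are real here; the waves are treated through their real and imaginary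
  parts.\<close>

lemma weak_ode:
 fixes Om :: "(real \<times> real) set" and u :: "real => real \<times> real \<times> real => real"
 assumes comp: "compact Om" and smooth: "smooth_boundary Om" and ph: "neumann_eigenfunction Om ph mu"
  and sol: "advection_diffusion_solution Om nu A chi u" and chi: "continuous_on Om chi"
  and et: "!!x. (et has_real_derivative et' x) (at x)" "!!x. (et' has_real_derivative et'' x) (at x)" "continuous_on UNIV et''"
  and R: "0 <= R" and et0: "et R = 0" "et (- R) = 0" "et' R = 0" "et' (- R) = 0" and s: "0 < s"
 defines "K \<equiv> {- R..R} \<times> Om"
 shows "((%s. LINT p|lborel. indicator K p * (u s p * ph (snd p) * et (fst p))) has_real_derivative
   nu * (LINT p|lborel. indicator K p * (u s p * ph (snd p) * et'' (fst p)))
   - nu * mu * (LINT p|lborel. indicator K p * (u s p * ph (snd p) * et (fst p)))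
   + A * (LINT p|lborel. indicator K p * (u s p * (chi (snd p) * ph (snd p)) * et' (fst p)))) (at s)"
proof -
 define S where "S = {0::real<..} \<times> (UNIV :: real set) \<times> Om"
 define w where "w = (%(t, p). u t p)"
 have C: "Ck_on 2 S w"
  and pde: "!!t x q. 0 < t ==> q \<in> Om ==> ddir S (1, 0) w (t, x, q) =
   nu * (\<Sum>b\<in>Basis. ddir S (0, b) (ddir S (0, b) w) (t, x, q)) - A * chi q * ddir S (0, 1, 0) w (t, x, q)"
  and nm: "!!t x q n. 0 < t ==> q \<in> frontier Om ==> outward_normal Om q n ==> ddir S (0, 0, n) w (t, x, q) = 0"
  using sol by (auto simp: advection_diffusion_solution_def Let_def S_def w_def)
 note D = Ck_on_2D[OF C]
 have ph_c: "continuous_on Om ph" using ph Ck_on_2D(4) by (auto simp: neumann_eigenfunction_def)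
 have cK: "compact K" unfolding K_def by (intro compact_Times comp) simp
 note et_c = DERIV_continuous_UNIV[OF et(1)] DERIV_continuous_UNIV[OF et(2)]
 have cS: "continuous_on K (%p. g (t, p))" if "continuous_on S g" "0 < t" for g :: "real \<times> real \<times> real \<times> real => real" and t
  by (rule continuous_on_compose2[OF that(1)]) (use that(2) in "auto simp: S_def K_def intro!: continuous_intros")
 have cx: "continuous_on K (%p. et (fst p))" "continuous_on K (%p. et'' (fst p))" "continuous_on K (%p. et' (fst p))"
  by (rule continuous_on_compose2[OF et_c(1)] continuous_on_compose2[OF et(3)] continuous_on_compose2[OF et_c(2)]; auto intro: continuous_intros)+
 have cq: "continuous_on K (%p. ph (snd p))" "continuous_on K (%p. chi (snd p))"
  by (rule continuous_on_compose2[OF ph_c] continuous_on_compose2[OF chi]; auto simp: K_def intro!: continuous_intros)+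
 have uw: "u t p = w (t, p)" for t p by (simp add: w_def)
 have leib: "((%s. LINT p|lborel. indicator K p * (u s p * ph (snd p) * et (fst p))) has_real_derivative
   (LINT p|lborel. indicator K p * (ddir S (1, 0) w (s, p) * ph (snd p) * et (fst p)))) (at s)"
 \<comment> \<open>A compact time interval around \<open>s\<close> that stays away from time 0,
   where only continuity in \<open>L2\<close> is known.\<close>
 proof (rule leibniz_compact[OF cK, of "s / 2" s "2 * s"])
  fix t p assume t: "s / 2 < t" "t < 2 * s" and p: "p \<in> K"
  have t0: "0 < t" using s t by simp
  have "((%t. w (t, p)) has_derivative (%h. ddir S (h, 0) w (t, p))) (at t within {0<..})"
  proof (rule has_derivative_in_compose2[OF D(1) _ _ has_derivative_Pair[OF has_derivative_ident has_derivative_const]])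
   show "(%t. (t, p)) ` {0<..} \<subseteq> S" using p by (auto simp: S_def K_def)
   show "t \<in> {0<..}" using t0 by simp
  qed
  moreover have "at t within {0<..} = at t" by (rule at_within_open) (use t0 in auto)
  moreover have "ddir S (h, 0) w (t, p) = ddir S (1, 0) w (t, p) * h" for h
  proof -
   have "(t, p) \<in> S" using p t0 by (auto simp: S_def K_def)
   from linear_scale[OF has_derivative_linear[OF D(1)[OF this]], of h "(1, 0)"] show ?thesis by (simp add: mult.commute)
  qed
  hence "(%h. ddir S (h, 0) w (t, p)) = (*) (ddir S (1, 0) w (t, p))" by (rule ext)
  ultimately have "((%t. u t p) has_real_derivative ddir S (1, 0) w (t, p)) (at t)"
   unfolding uw by (simp only: has_field_derivative_def)
  from DERIV_cmult_right[OF DERIV_cmult_right[OF this]]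
  show "((%t. u t p * ph (snd p) * et (fst p)) has_real_derivative ddir S (1, 0) w (t, p) * ph (snd p) * et (fst p)) (at t)" .
 next
  fix t assume "s / 2 < t" "t < 2 * s"
  hence "0 < t" using s by simp
  thus "continuous_on K (%p. u t p * ph (snd p) * et (fst p))"
   unfolding uw by (intro continuous_on_mult cS[OF D(4)] cq cx)
 next
  have "continuous_on ({s / 2..2 * s} \<times> K) (%z. ddir S (1, 0) w z)"
   by (rule continuous_on_subset[OF D(5)]) (use s in "auto simp: S_def K_def")
  moreover have "continuous_on ({s / 2..2 * s} \<times> K) (%z. ph (snd (snd z)) * et (fst (snd z)))"
   by (rule continuous_on_compose2[OF continuous_on_mult[OF cq(1) cx(1)]]) (auto intro!: continuous_intros)
  ultimately show "continuous_on ({s / 2..2 * s} \<times> K) (%(t, p). ddir S (1, 0) w (t, p) * ph (snd p) * et (fst p))"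
   by (auto dest: continuous_on_mult simp: case_prod_unfold mult.assoc)
 qed (use s in auto)
 have ders: "((%p. g (s, p)) has_derivative (%v. G (0, v))) (at (x, q) within UNIV \<times> Om)"
  if g: "(g has_derivative G) (at (s, x, q) within S)" and q: "q \<in> Om" for g G x q
 proof -
  have img: "(%p. (s, p)) ` (UNIV \<times> Om) \<subseteq> S" using s by (auto simp: S_def)
  show ?thesis
   by (rule has_derivative_in_compose[OF has_derivative_Pair[OF has_derivative_const has_derivative_ident]])
   (rule has_derivative_subset[OF g img])
 qed
 have inS: "(s, x, q) \<in> S" if "q \<in> Om" for x q using s that by (simp add: S_def)
 have U2c: "continuous_on (UNIV \<times> Om) (%p. ddir S (0, v') (ddir S (0, v) w) (s, p))" for v v'
  by (rule continuous_on_compose2[OF D(3)]) (use s in "auto simp: S_def intro!: continuous_intros")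
 have us: "(%p. w (s, p)) = u s" by (simp add: w_def fun_eq_iff)
 have d1: "(u s has_derivative (%v. ddir S (0, v) w (s, x, q))) (at (x, q) within UNIV \<times> Om)" if "q \<in> Om" for x q
  using ders[OF D(1)[OF inS[OF that]] that] unfolding us .
 have d2: "((%p. ddir S (0, v) w (s, p)) has_derivative (%v'. ddir S (0, v') (ddir S (0, v) w) (s, x, q))) (at (x, q) within UNIV \<times> Om)"
  if "q \<in> Om" for x q v
  by (rule ders[OF D(2)[OF inS[OF that]] that])
 note wi = weak_identity[OF comp smooth ph, where U="u s" and ?U1.0="%p v. ddir S (0, v) w (s, p)" and ?U2.0="%v p v'. ddir S (0, v') (ddir S (0, v) w) (s, p)",
   OF d1 d2 U2c nm[OF s] et R et0, folded K_def, simplified]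
 have "(LINT p|lborel. indicator K p * (ddir S (1, 0) w (s, p) * ph (snd p) * et (fst p)))
  = (LINT p|lborel. nu * (indicator K p * ((\<Sum>b\<in>Basis. ddir S (0, b) (ddir S (0, b) w) (s, p)) * ph (snd p) * et (fst p)))
   - A * (indicator K p * (ddir S (0, 1, 0) w (s, p) * (chi (snd p) * ph (snd p)) * et (fst p))))"
 proof (intro LINT_cong refl)
  fix p
  show "indicator K p * (ddir S (1, 0) w (s, p) * ph (snd p) * et (fst p))
   = nu * (indicator K p * ((\<Sum>b\<in>Basis. ddir S (0, b) (ddir S (0, b) w) (s, p)) * ph (snd p) * et (fst p)))
   - A * (indicator K p * (ddir S (0, 1, 0) w (s, p) * (chi (snd p) * ph (snd p)) * et (fst p)))"
  proof (cases "p \<in> K")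
   case True
   hence "ddir S (1, 0) w (s, p) = nu * (\<Sum>b\<in>Basis. ddir S (0, b) (ddir S (0, b) w) (s, p)) - A * chi (snd p) * ddir S (0, 1, 0) w (s, p)"
   using pde[OF s, of "snd p" "fst p"] by (simp add: K_def mem_Times_iff)
   thus ?thesis unfolding \<open>ddir S (1, 0) w (s, p) = _\<close> by (simp add: algebra_simps)
  qed simp
 qed
 also have "... = nu * (LINT p|lborel. indicator K p * ((\<Sum>b\<in>Basis. ddir S (0, b) (ddir S (0, b) w) (s, p)) * ph (snd p) * et (fst p)))
   - A * (LINT p|lborel. indicator K p * (ddir S (0, 1, 0) w (s, p) * (chi (snd p) * ph (snd p)) * et (fst p)))"
 proof -
  have "integrable lborel (%p. indicator K p * ((\<Sum>b\<in>Basis. ddir S (0, b) (ddir S (0, b) w) (s, p)) * ph (snd p) * et (fst p)))"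
   "integrable lborel (%p. indicator K p * (ddir S (0, 1, 0) w (s, p) * (chi (snd p) * ph (snd p)) * et (fst p)))"
   by (intro integrable_compact cK continuous_on_mult continuous_on_sum cS[OF D(3) s] cS[OF D(5) s] cq cx)+
  thus ?thesis by simp
 qed
 also have "... = nu * (LINT p|lborel. indicator K p * (u s p * ph (snd p) * et'' (fst p)))
   - nu * mu * (LINT p|lborel. indicator K p * (u s p * ph (snd p) * et (fst p)))
   + A * (LINT p|lborel. indicator K p * (u s p * (chi (snd p) * ph (snd p)) * et' (fst p)))"
  unfolding wi(1) wi(2)[OF continuous_on_mult[OF chi ph_c]] by (simp add: algebra_simps)
 finally show ?thesis using leib by simp
qed

text \<open>Lebesgue measure on a set is complete, but a product of complete measures is in general
  not complete, so it would differ from Lebesgue measure on the cylinder. A density over Borel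
  measure on the whole space behaves well under products; functions are transferred to it by Borel
  versions.\<close>

definition cross_measure :: "'a::euclidean_space set => 'a measure" where
 "cross_measure S = density lborel (%p. ennreal (indicator S p))"

lemma sets_cross_measure [simp, measurable_cong]: "sets (cross_measure S) = sets borel"
 and space_cross_measure [simp]: "space (cross_measure S) = UNIV"
 by (simp_all add: cross_measure_def)

lemma cross_measure_transfer:
 fixes f g :: "'a::euclidean_space => real"
 assumes S: "S \<in> sets borel" and f: "f \<in> borel_measurable (lebesgue_on S)" and g: "g \<in> borel_measurable borel"
  and eq: "AE p in lebesgue. p \<in> S --> g p = f p"
 shows "integrable (lebesgue_on S) f \<longleftrightarrow> integrable (cross_measure S) g"
  and "(LINT p|lebesgue_on S. f p) = (LINT p|cross_measure S. g p)"
proof -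
 have SL: "S \<inter> space lebesgue \<in> sets lebesgue" using S by simp
 have fm: "(%p. indicator S p *\<^sub>R f p) \<in> borel_measurable lebesgue"
  using f borel_measurable_restrict_space_iff[OF SL, of f] by simp
 have gm: "(%p. indicator S p *\<^sub>R g p) \<in> borel_measurable lborel"
  using S g by measurable
 hence gm': "(%p. indicator S p *\<^sub>R g p) \<in> borel_measurable lebesgue"
  by (rule measurable_completion)
 have ae: "AE p in lebesgue. indicator S p *\<^sub>R f p = indicator S p *\<^sub>R g p"
  using eq by eventually_elim (auto simp: indicator_def)
 have Sm: "indicator S \<in> borel_measurable lborel" using S by simp
 show "integrable (lebesgue_on S) f \<longleftrightarrow> integrable (cross_measure S) g"
 proof -
  have "integrable (lebesgue_on S) f \<longleftrightarrow> integrable lebesgue (%p. indicator S p *\<^sub>R f p)" by (rule integrable_restrict_space[OF SL])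
  also have "... \<longleftrightarrow> integrable lebesgue (%p. indicator S p *\<^sub>R g p)" by (rule integrable_cong_AE[OF fm gm' ae])
  also have "... \<longleftrightarrow> integrable lborel (%p. indicator S p *\<^sub>R g p)" by (rule integrable_completion[OF gm])
  also have "... \<longleftrightarrow> integrable (cross_measure S) g"
   unfolding cross_measure_def by (rule integrable_density[symmetric]) (use g Sm in auto)
  finally show ?thesis .
 qed
 have "(LINT p|lebesgue_on S. f p) = (LINT p|lebesgue. indicator S p *\<^sub>R f p)" by (rule integral_restrict_space[OF SL])
 also have "... = (LINT p|lebesgue. indicator S p *\<^sub>R g p)" by (rule integral_cong_AE[OF fm gm' ae])
 also have "... = (LINT p|lborel. indicator S p *\<^sub>R g p)" by (rule integral_completion[OF gm])
 also have "... = (LINT p|cross_measure S. g p)"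
  unfolding cross_measure_def by (rule integral_density[symmetric]) (use g Sm in auto)
 finally show "(LINT p|lebesgue_on S. f p) = (LINT p|cross_measure S. g p)" .
qed

lemma cross_measure_integral:
 fixes g :: "'a::euclidean_space => real"
 assumes S: "S \<in> sets borel" and g: "g \<in> borel_measurable borel"
 shows "integrable (cross_measure S) g \<longleftrightarrow> integrable lborel (%p. indicator S p * g p)"
  and "(LINT p|cross_measure S. g p) = (LINT p|lborel. indicator S p * g p)"
 using integrable_density[of g lborel "indicator S"] integral_density[of g lborel "indicator S"] S g
 by (auto simp: cross_measure_def)

lemma L2_transfer:
 fixes f g :: "'a::euclidean_space => real"
 assumes S: "S \<in> sets borel" and f: "f \<in> borel_measurable (lebesgue_on S)" and g: "g \<in> borel_measurable borel"
  and eq: "AE p in lebesgue. p \<in> S --> g p = f p"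
 shows "f \<in> L2 (lebesgue_on S) \<longleftrightarrow> g \<in> L2 (cross_measure S)"
  and "L2_norm (lebesgue_on S) f = L2_norm (cross_measure S) g"
proof -
 have f2: "(%p. (f p)^2) \<in> borel_measurable (lebesgue_on S)" using f by measurable
 have g2: "(%p. (g p)^2) \<in> borel_measurable borel" using g by measurable
 have eq2: "AE p in lebesgue. p \<in> S --> (g p)\<^sup>2 = (f p)^2" using eq by eventually_elim auto
 note t = cross_measure_transfer[OF S f2 g2 eq2]
 show "f \<in> L2 (lebesgue_on S) \<longleftrightarrow> g \<in> L2 (cross_measure S)" using f g t(1) by (simp add: L2_def)
 show "L2_norm (lebesgue_on S) f = L2_norm (cross_measure S) g" using t(2) by (simp add: L2_norm_def)
qed

lemma strip_cross_measure:
 fixes Om :: "'b::euclidean_space set"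
 assumes S: "Om \<in> sets borel" and p: "prob_space (cross_measure Om)"
 shows "(lborel :: real measure) \<Otimes>\<^sub>M cross_measure Om = cross_measure (UNIV \<times> Om)"
proof -
 have "density (lborel :: real measure) (%_. 1) \<Otimes>\<^sub>M density lborel (%p. ennreal (indicator Om p))
  = density (lborel \<Otimes>\<^sub>M lborel) (%(x, y). 1 * ennreal (indicator Om y))"
 proof (rule pair_measure_density)
  interpret prob_space "cross_measure Om" by fact
  show "sigma_finite_measure (density lborel (%p. ennreal (indicator Om p)))"
   using sigma_finite_measure_axioms by (simp add: cross_measure_def)
 qed (use S in "auto intro: sigma_finite_lborel")
 thus ?thesis
  unfolding cross_measure_def lborel_prod density_1
  by (simp add: case_prod_unfold indicator_times)
qed

lemma continuous_section_integral:
 fixes h :: "real \<times> 'b::euclidean_space => real"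
 assumes comp: "compact Om" and h: "continuous_on (UNIV \<times> Om) h"
 shows "continuous_on UNIV (%x. LINT q|lborel. indicator Om q * h (x, q))"
proof (rule continuous_at_imp_continuous_on, rule ballI)
 fix x0 :: real
 let ?J = "{x0 - 1..x0 + 1} \<times> Om"
 have "compact (h ` ?J)"
  by (intro compact_continuous_image continuous_on_subset[OF h] compact_Times comp) auto
 from compact_imp_bounded[OF this] obtain B where B: "!!p. p \<in> ?J ==> \<bar>h p\<bar> <= B"
  unfolding bounded_iff by auto
 have int: "integrable lborel (%q. indicator Om q * h (x, q))" for x
  by (intro integrable_compact comp continuous_on_compose2[OF h]) (auto intro!: continuous_intros)
 have "((%x. LINT q|lborel. indicator Om q * h (x, q)) \<longlongrightarrow> (LINT q|lborel. indicator Om q * h (x0, q))) (at x0 within {x0 - 1<..<x0 + 1})"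
  unfolding tendsto_at_iff_sequentially comp_def
 proof (intro allI impI)
  fix X assume X: "\<forall>i. X i \<in> {x0 - 1<..<x0 + 1} - {x0}" and lim: "X ----> x0"
  show "(%i. LINT q|lborel. indicator Om q * h (X i, q)) ----> (LINT q|lborel. indicator Om q * h (x0, q))"
  proof (rule integral_dominated_convergence[where w="%q. indicator Om q * B"])
   show "integrable lborel (%q. indicator Om q * B)" by (rule integrable_compact[OF comp continuous_on_const])
   show "AE q in lborel. (%i. indicator Om q * h (X i, q)) ----> indicator Om q * h (x0, q)"
   proof (intro AE_I2)
   fix q
   show "(%i. indicator Om q * h (X i, q)) ----> indicator Om q * h (x0, q)"
   proof (cases "q \<in> Om")
   case True
   have "(%i. h (X i, q)) ----> h (x0, q)"
   by (rule continuous_on_tendsto_compose[OF h]) (use True in "auto intro!: tendsto_intros lim")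
   thus ?thesis by (rule tendsto_mult_left)
   qed simp
   qed
   show "AE q in lborel. norm (indicator Om q * h (X i, q)) <= indicator Om q * B" for i
   proof (intro AE_I2)
   fix q
   have "x0 - 1 < X i \<and> X i < x0 + 1" using X by auto
   thus "norm (indicator Om q * h (X i, q)) <= indicator Om q * B"
   using B[of "(X i, q)"] by (cases "q \<in> Om") auto
   qed
  qed (rule borel_measurable_integrable[OF int])+
 qed
 moreover have "at x0 within {x0 - 1<..<x0 + 1} = at x0" by (rule at_within_open) auto
 ultimately show "isCont (%x. LINT q|lborel. indicator Om q * h (x, q)) x0"
  unfolding isCont_def by simp
qed

lemma has_vector_derivative_Complex:
 "(f has_real_derivative f') (at x) ==> (g has_real_derivative g') (at x) ==>
  ((%x. Complex (f x) (g x)) has_vector_derivative Complex f' g') (at x)"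
 by (simp add: has_vector_derivative_complex_iff)

lemma integral_Complex:
 assumes "integrable M f" "integrable M g"
 shows "(CLINT p|M. Complex (f p) (g p)) = Complex (LINT p|M. f p) (LINT p|M. g p)"
proof -
 have "(CLINT p|M. Complex (f p) (g p)) = (CLINT p|M. of_real (f p) + \<i> * of_real (g p))"
  by (intro LINT_cong refl) (simp add: complex_eq_iff)
 also have "... = of_real (LINT p|M. f p) + \<i> * of_real (LINT p|M. g p)"
  using assms by simp
 finally show ?thesis by (simp add: complex_eq_iff)
qed

lemma DERIV_ReIm:
 assumes "(f has_vector_derivative f') (at x)"
 shows "((%x. Re (f x)) has_real_derivative Re f') (at x)" "((%x. Im (f x)) has_real_derivative Im f') (at x)"
 using assms by (simp_all add: has_vector_derivative_complex_iff)

section \<open>The concrete problem and the final estimate\<close>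

locale taylor_problem =
 fixes Om :: "(real \<times> real) set" and chi :: "real \<times> real => real" and A :: real
  and ps :: "nat => real \<times> real => real" and mu :: "nat => real"
 assumes comp: "compact Om" and smooth: "smooth_boundary Om" and vol: "measure lebesgue Om = 1"
  and chi: "continuous_on Om chi" and chi_mean: "(LINT q|lebesgue_on Om. chi q) = 0" and A: "A \<noteq> 0"
  and basis: "orthonormal_basis_L2 (lebesgue_on Om) ps"
  and eigen: "!!n. neumann_eigenfunction Om (ps n) (mu n)" and ps0: "!!q. q \<in> Om ==> ps 0 q = 1"
  and mu: "mu 0 = 0" "0 < mu 1" "mono mu"
begin

abbreviation "Q \<equiv> cross_measure Om"
abbreviation "psi n q \<equiv> indicator Om q * ps n q"
abbreviation "ch q \<equiv> indicator Om q * chi q"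

lemma borel: "Om \<in> sets borel" "UNIV \<times> Om \<in> sets (borel :: (real \<times> real \<times> real) measure)"
proof -
 have "closed Om" using comp by (rule compact_imp_closed)
 thus "Om \<in> sets borel" "UNIV \<times> Om \<in> sets (borel :: (real \<times> real \<times> real) measure)"
  using closed_Times[OF closed_UNIV] by (auto intro: borel_closed)
qed

lemma prob_Q: "prob_space Q"
proof
 have "emeasure Q (space Q) = (\<integral>\<^sup>+q. indicator Om q \<partial>lborel)"
  unfolding cross_measure_def using borel by (subst emeasure_density) (auto simp: ennreal_indicator)
 also have "... = emeasure lborel Om" using borel by simp
 also have "... = ennreal (measure lborel Om)" using emeasure_compact_finite[OF comp] by (intro emeasure_eq_ennreal_measure) auto
 also have "measure lborel Om = 1" using vol borel by (simp add: measure_completion)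
 finally show "emeasure Q (space Q) = 1" by simp
qed

lemma strip: "(lborel :: real measure) \<Otimes>\<^sub>M Q = cross_measure (UNIV \<times> Om)"
 by (rule strip_cross_measure[OF borel(1) prob_Q])

lemma ps_cont: "continuous_on Om (ps n)"
 using eigen[of n] Ck_on_2D(4) by (auto simp: neumann_eigenfunction_def)

lemma indicator_borel: "continuous_on Om g ==> (%q. indicator Om q * g q) \<in> borel_measurable borel" for g :: "real \<times> real => real"
 using borel_measurable_continuous_on_indicator[OF borel(1), of g] by simp

lemma indicator_bounded: "continuous_on Om g ==> \<exists>B. \<forall>q. \<bar>indicator Om q * g q\<bar> <= B" for g :: "real \<times> real => real"
proof -
 assume "continuous_on Om g"
 from compact_imp_bounded[OF compact_continuous_image[OF this comp]] obtain B where B: "!!q. q \<in> Om ==> \<bar>g q\<bar> <= B"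
  unfolding bounded_iff by auto
 have "\<bar>indicator Om q * g q\<bar> <= max B 0" for q using B[of q] by (cases "q \<in> Om") auto
 thus ?thesis by blast
qed

lemma continuous_lebesgue: "continuous_on Om g ==> g \<in> borel_measurable (lebesgue_on Om)" for g :: "real \<times> real => real"
 using borel(1) by (intro continuous_imp_measurable_on_sets_lebesgue) auto

lemma basis_Q: "orthonormal_basis_L2 Q psi"
 unfolding orthonormal_basis_L2_def
proof (intro conjI allI ballI)
 have ps_m: "ps n \<in> borel_measurable (lebesgue_on Om)" for n by (rule continuous_lebesgue[OF ps_cont])
 have pm: "psi n \<in> borel_measurable borel" for n by (rule indicator_borel[OF ps_cont])
 have eq: "AE q in lebesgue. q \<in> Om --> psi n q = ps n q" for n by (intro AE_I2) simp
 show "psi n \<in> L2 Q" for n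
  using L2_transfer(1)[OF borel(1) ps_m pm eq] basis by (simp add: orthonormal_basis_L2_def)
 show "L2_inner Q (psi m) (psi n) = (if m = n then 1 else 0)" for m n
 proof -
  have "L2_inner (lebesgue_on Om) (ps m) (ps n) = L2_inner Q (psi m) (psi n)"
   unfolding L2_inner_def
   by (rule cross_measure_transfer(2)[OF borel(1)]) (use ps_m pm in auto)
  thus ?thesis using basis by (simp add: orthonormal_basis_L2_def)
 qed
 fix f assume f: "f \<in> L2 Q"
 hence fb: "f \<in> borel_measurable borel" by (simp add: L2_def cong: measurable_cong_sets)
 hence fl: "f \<in> borel_measurable (lebesgue_on Om)"
  by (intro measurable_restrict_space1 measurable_completion) simp
 have fL: "f \<in> L2 (lebesgue_on Om)" using L2_transfer(1)[OF borel(1) fl fb] f by simp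
 have ip: "L2_inner (lebesgue_on Om) f (ps n) = L2_inner Q f (psi n)" for n
  unfolding L2_inner_def by (rule cross_measure_transfer(2)[OF borel(1)]) (use fl fb ps_m pm in auto)
 have "L2_norm (lebesgue_on Om) (%p. f p - (\<Sum>n<k. L2_inner (lebesgue_on Om) f (ps n) * ps n p))
  = L2_norm Q (%p. f p - (\<Sum>n<k. L2_inner Q f (psi n) * psi n p))" for k
  unfolding ip by (rule L2_transfer(2)[OF borel(1)]) (use fl fb ps_m pm in "auto intro!: AE_I2")
 moreover have "(%k. L2_norm (lebesgue_on Om) (%p. f p - (\<Sum>n<k. L2_inner (lebesgue_on Om) f (ps n) * ps n p))) ----> 0"
  using basis fL unfolding orthonormal_basis_L2_def by blast
 ultimately show "(%k. L2_norm Q (%p. f p - (\<Sum>n<k. L2_inner Q f (psi n) * psi n p))) ----> 0" by simp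
qed

lemma ch_mean: "(LINT q|Q. ch q) = 0"
 using cross_measure_transfer(2)[OF borel(1) continuous_lebesgue[OF chi] indicator_borel[OF chi]] chi_mean by simp

lemma ch_inner: "L2_inner (lebesgue_on Om) chi (ps n) = L2_inner Q ch (psi n)"
 unfolding L2_inner_def
 by (rule cross_measure_transfer(2)[OF borel(1)])
   (use continuous_lebesgue[OF chi] continuous_lebesgue[OF ps_cont] indicator_borel[OF chi] indicator_borel[OF ps_cont] in auto)

end

locale taylor_solution = taylor_problem +
 fixes nu :: real and u :: "real => real \<times> real \<times> real => real" and m :: nat
 assumes nu: "0 < nu" "nu <= 1" and sol: "advection_diffusion_solution Om nu A chi u"
  and m: "2 <= m" and init: "u 0 \<in> weighted_L2 m Om"
begin

abbreviation "S \<equiv> (UNIV :: real set) \<times> Om"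

lemma u_L2: "0 <= t ==> u t \<in> L2 (cylinder Om)" and u_meas: "0 <= t ==> u t \<in> borel_measurable (cylinder Om)"
 using sol by (auto simp: advection_diffusion_solution_def L2_def)

text \<open>Only measurability with respect to the completed measure is known at time \<open>0\<close>;
 the initial datum is replaced by a Borel function.\<close>

definition u0 where "u0 = (SOME g. g \<in> borel_measurable borel \<and> (AE p in lborel. indicator S p * u 0 p = g p))"

lemma u0: "u0 \<in> borel_measurable borel" "AE p in lborel. indicator S p * u 0 p = u0 p"
proof -
 have SL: "S \<inter> space lebesgue \<in> sets lebesgue" using borel(2) by simp
 have "(%p. indicator S p * u 0 p) \<in> borel_measurable lebesgue"
  using u_meas[of 0] borel_measurable_restrict_space_iff[OF SL, of "u 0"] by simp
 from completion_ex_borel_measurable_real[OF this]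
 have "\<exists>g. g \<in> borel_measurable borel \<and> (AE p in lborel. indicator S p * u 0 p = g p)" by auto
 from someI_ex[OF this] show "u0 \<in> borel_measurable borel" "AE p in lborel. indicator S p * u 0 p = u0 p"
  unfolding u0_def by auto
qed

text \<open>At positive times the solution is continuous on the closed cylinder, so its extension by
  0 is Borel already; time 0 gets the substitute \<open>u0\<close>.\<close>

definition b where "b t p = indicator S p * (if t = 0 then u0 p else u t p)"

lemma cont_u: assumes "0 < t" shows "continuous_on S (u t)"
proof -
 define T where "T = {0::real<..} \<times> S"
 have "Ck_on 2 T (%(t, p). u t p)"
  using sol by (simp add: advection_diffusion_solution_def Let_def T_def)
 from Ck_on_2D(4)[OF this] have c: "continuous_on T (%(t, p). u t p)" .
 have "continuous_on S (%p. (%(t, p). u t p) (t, p))"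
  by (rule continuous_on_compose2[OF c]) (use assms in "auto simp: T_def intro!: continuous_intros")
 thus ?thesis by simp
qed

lemma b_meas: assumes "0 <= t" shows "b t \<in> borel_measurable borel"
proof (cases "t = 0")
 case True
 have "b t = (%p. indicator S p * u0 p)" using True by (simp add: b_def fun_eq_iff)
 thus ?thesis using u0(1) borel(2) by simp
next
 case False
 have "(%p. indicator S p *\<^sub>R u t p) \<in> borel_measurable borel"
  using borel_measurable_continuous_on_indicator[OF borel(2) cont_u] False assms by simp
 thus ?thesis using False by (simp add: b_def[abs_def])
qed

lemma b_AE: assumes "0 <= t" shows "AE p in lebesgue. p \<in> S --> b t p = u t p"
proof (cases "t = 0")
 case True
 have "AE p in lebesgue. indicator S p * u 0 p = u0 p" using u0(2) by (rule AE_completion)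
 thus ?thesis
 proof eventually_elim
  case (elim p)
  show ?case
  proof
   assume "p \<in> S"
   thus "b t p = u t p" using elim True by (simp add: b_def)
  qed
 qed
qed (simp add: b_def)

lemma b_L2: "0 <= t ==> b t \<in> L2 (strip Q)"
 unfolding strip using L2_transfer(1)[OF borel(2) u_meas b_meas b_AE] u_L2 by blast

lemma b_cont: assumes t: "0 <= t"
 shows "((%s. L2_norm (strip Q) (%p. b s p - b t p)) \<longlongrightarrow> 0) (at t within {0..})"
proof -
 have "((%s. L2_norm (cylinder Om) (%p. u s p - u t p)) \<longlongrightarrow> 0) (at t within {0..})"
  using sol t by (simp add: advection_diffusion_solution_def)
 moreover have "L2_norm (cylinder Om) (%p. u s p - u t p) = L2_norm (strip Q) (%p. b s p - b t p)" if s: "0 <= s" for s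
  unfolding strip
 proof (rule L2_transfer(2)[OF borel(2)])
  show "AE p in lebesgue. p \<in> S --> b s p - b t p = u s p - u t p"
   using b_AE[OF s] b_AE[OF t] by eventually_elim auto
 qed (use u_meas b_meas s t in auto)
 hence "\<forall>\<^sub>F s in at t within {0..}. L2_norm (cylinder Om) (%p. u s p - u t p) = L2_norm (strip Q) (%p. b s p - b t p)"
  unfolding eventually_at_filter by (intro always_eventually) auto
 ultimately show ?thesis by (rule Lim_transform_eventually)
qed

lemma weighted_transfer:
 "integrable (cylinder Om) (%(x, q). (1 + x^2) ^ m * (u 0 (x, q))^2) \<longleftrightarrow> integrable (strip Q) (%p. (1 + (fst p)^2) ^ m * (b 0 p)^2)"
 "(LINT (x, q)|cylinder Om. (1 + x^2) ^ m * (u 0 (x, q))^2) = (LINT p|(strip Q). (1 + (fst p)^2) ^ m * (b 0 p)^2)"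
proof -
 have [measurable]: "u 0 \<in> borel_measurable (cylinder Om)" "b 0 \<in> borel_measurable borel" using u_meas b_meas by auto
 have wb: "(%p::real \<times> real \<times> real. (1 + (fst p)^2) ^ m) \<in> borel_measurable borel"
  by (intro borel_measurable_continuous_onI continuous_intros)
 have wl: "(%p::real \<times> real \<times> real. (1 + (fst p)^2) ^ m) \<in> borel_measurable (cylinder Om)"
  using wb by (intro measurable_restrict_space1 measurable_completion) simp
 have f: "(%(x, q). (1 + x^2) ^ m * (u 0 (x, q))^2) \<in> borel_measurable (cylinder Om)"
  unfolding case_prod_unfold using wl by (intro borel_measurable_times) auto
 have g: "(%p. (1 + (fst p)^2) ^ m * (b 0 p)^2) \<in> borel_measurable borel"
  using wb by (intro borel_measurable_times) auto
 have ae: "AE p in lebesgue. p \<in> S --> (1 + (fst p)^2) ^ m * (b 0 p)^2 = (%(x, q). (1 + x^2) ^ m * (u 0 (x, q))^2) p"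
  using b_AE[OF order_refl] by eventually_elim (simp add: case_prod_unfold)
 note * = cross_measure_transfer[OF borel(2) f g ae, folded strip]
 show "integrable (cylinder Om) (%(x, q). (1 + x^2) ^ m * (u 0 (x, q))^2) \<longleftrightarrow> integrable (strip Q) (%p. (1 + (fst p)^2) ^ m * (b 0 p)^2)"
  by (rule *(1))
 show "(LINT (x, q)|cylinder Om. (1 + x^2) ^ m * (u 0 (x, q))^2) = (LINT p|(strip Q). (1 + (fst p)^2) ^ m * (b 0 p)^2)"
  by (rule *(2))
qed

lemma windowed_integral:
 fixes th :: "real => real" and c :: "real \<times> real => real"
 assumes t: "0 < t" and c: "continuous_on Om c" and th: "continuous_on UNIV th" "\<forall>x. R <= abs x --> th x = 0"
 shows "integrable (strip Q) (%p. b t p * (indicator Om (snd p) * c (snd p)) * th (fst p))"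
  and "(LINT p|(strip Q). b t p * (indicator Om (snd p) * c (snd p)) * th (fst p))
   = (LINT p|lborel. indicator ({- R..R} \<times> Om) p * (u t p * c (snd p) * th (fst p)))"
proof -
 have bm [measurable]: "b t \<in> borel_measurable borel" using b_meas t by simp
 have th_m: "(%p::real \<times> real \<times> real. th (fst p)) \<in> borel_measurable borel"
  by (intro borel_measurable_continuous_onI continuous_on_compose2[OF th(1)] continuous_intros) auto
 have cm: "(%p::real \<times> real \<times> real. indicator Om (snd p) * c (snd p)) \<in> borel_measurable borel"
  by (rule measurable_compose[OF _ indicator_borel[OF c]]) (intro borel_measurable_continuous_onI continuous_intros)
 have g: "(%p. b t p * (indicator Om (snd p) * c (snd p)) * th (fst p)) \<in> borel_measurable borel"
  by (intro borel_measurable_times bm cm th_m)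
 have eq: "indicator S p * (b t p * (indicator Om (snd p) * c (snd p)) * th (fst p))
   = indicator ({- R..R} \<times> Om) p * (u t p * c (snd p) * th (fst p))" for p
 proof (cases "p \<in> {- R..R} \<times> Om")
  case True
  thus ?thesis using t by (auto simp: b_def mem_Times_iff)
 next
  case False
  hence "snd p \<notin> Om \<or> \<not> (- R <= fst p \<and> fst p <= R)" by (auto simp: mem_Times_iff)
  hence "snd p \<notin> Om \<or> R <= \<bar>fst p\<bar>" by linarith
  hence "th (fst p) = 0 \<or> snd p \<notin> Om" using th(2) by blast
  thus ?thesis using False by auto
 qed
 have int: "integrable lborel (%p. indicator ({- R..R} \<times> Om) p * (u t p * c (snd p) * th (fst p)))"
 proof (rule integrable_compact)
  show "compact ({- R..R} \<times> Om)" by (intro compact_Times comp) simp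
  have "continuous_on ({- R..R} \<times> Om) (%p. c (snd p))" "continuous_on ({- R..R} \<times> Om) (%p. th (fst p))"
   by (rule continuous_on_compose2[OF c] continuous_on_compose2[OF th(1)]; auto intro!: continuous_intros)+
  thus "continuous_on ({- R..R} \<times> Om) (%p. u t p * c (snd p) * th (fst p))"
   by (intro continuous_on_mult continuous_on_subset[OF cont_u[OF t]]) auto
 qed
 show "integrable (strip Q) (%p. b t p * (indicator Om (snd p) * c (snd p)) * th (fst p))"
  unfolding strip cross_measure_integral(1)[OF borel(2) g] eq by (rule int)
 show "(LINT p|(strip Q). b t p * (indicator Om (snd p) * c (snd p)) * th (fst p))
   = (LINT p|lborel. indicator ({- R..R} \<times> Om) p * (u t p * c (snd p) * th (fst p)))"
  unfolding strip cross_measure_integral(2)[OF borel(2) g] eq ..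
qed

lemma complex_windowed_integral:
 fixes th :: "real => complex" and c :: "real \<times> real => real"
 assumes t: "0 < t" and c: "continuous_on Om c" and th: "continuous_on UNIV th" "\<forall>x. R <= abs x --> th x = 0"
 shows "(CLINT p|(strip Q). of_real (b t p * (indicator Om (snd p) * c (snd p))) * th (fst p))
   = Complex (LINT p|lborel. indicator ({- R..R} \<times> Om) p * (u t p * c (snd p) * Re (th (fst p))))
   (LINT p|lborel. indicator ({- R..R} \<times> Om) p * (u t p * c (snd p) * Im (th (fst p))))"
proof -
 have r: "continuous_on UNIV (%x. Re (th x))" "\<forall>x. R <= abs x --> Re (th x) = 0"
  and i: "continuous_on UNIV (%x. Im (th x))" "\<forall>x. R <= abs x --> Im (th x) = 0"
  using th by (auto intro!: continuous_intros)
 note wr = windowed_integral[OF t c r] and wi = windowed_integral[OF t c i]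
 have "of_real x * z = Complex (x * Re z) (x * Im z)" for x z by (simp add: complex_eq_iff)
 hence "(CLINT p|(strip Q). of_real (b t p * (indicator Om (snd p) * c (snd p))) * th (fst p))
  = (CLINT p|(strip Q). Complex (b t p * (indicator Om (snd p) * c (snd p)) * Re (th (fst p)))
   (b t p * (indicator Om (snd p) * c (snd p)) * Im (th (fst p))))" by (simp only:)
 also note integral_Complex[OF wr(1) wi(1)]
 finally show ?thesis unfolding wr(2) wi(2) .
qed

text \<open>Real and imaginary part of the wave are admissible in \<open>weak_ode\<close> one by
  one; the two real equations are then reassembled.\<close>

lemma mode_ode:
 assumes R: "1 <= R" and s: "0 < s"
 shows "((%s. CLINT p|(strip Q). of_real (b s p * psi n (snd p)) * wave R k (fst p)) has_vector_derivative
   (of_real nu * (CLINT p|(strip Q). of_real (b s p * psi n (snd p)) * wave'' R k (fst p))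
   - of_real (nu * mu n) * (CLINT p|(strip Q). of_real (b s p * psi n (snd p)) * wave R k (fst p))
   + of_real A * (CLINT p|(strip Q). of_real (b s p * (ch (snd p) * psi n (snd p))) * wave' R k (fst p)))) (at s)"
proof -
 have R0: "0 < R" using R by simp
 note d = wave_derivative[OF R0, of k] and o = wave_outside[OF R0, of _ k]
 note wc = continuous_ReIm[OF d(1)] continuous_ReIm[OF d(2)] wave''_continuous[OF R0, of k]
 let ?I = "%s c th. LINT p|lborel. indicator ({- R..R} \<times> Om) p * (u s p * c (snd p) * th (fst p))"
 have cc: "continuous_on Om (%q. chi q * ps n q)" by (intro continuous_on_mult chi ps_cont)
 note ci = complex_windowed_integral[OF _ ps_cont[of n]] complex_windowed_integral[OF _ cc]
 have chp: "ch q * psi n q = indicator Om q * (chi q * ps n q)" for q by (simp add: indicator_def)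
 have Rr: "0 <= R" using R by simp
 have c2: "continuous_on UNIV (%x. Re (wave'' R k x))" "continuous_on UNIV (%x. Im (wave'' R k x))"
  using wc(3) by (auto intro!: continuous_intros)
 have z: "Re (wave R k R) = 0" "Re (wave R k (- R)) = 0" "Re (wave' R k R) = 0" "Re (wave' R k (- R)) = 0"
  "Im (wave R k R) = 0" "Im (wave R k (- R)) = 0" "Im (wave' R k R) = 0" "Im (wave' R k (- R)) = 0"
  using o[of R] o[of "- R"] R by auto
 note ode = weak_ode[OF comp smooth eigen[of n] sol chi _ _ _ Rr _ _ _ _ s]
 note re = ode[OF DERIV_ReIm(1)[OF d(1)] DERIV_ReIm(1)[OF d(2)] c2(1) z(1-4)]
  and im = ode[OF DERIV_ReIm(2)[OF d(1)] DERIV_ReIm(2)[OF d(2)] c2(2) z(5-8)]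
 have w0: "(CLINT p|(strip Q). of_real (b t p * psi n (snd p)) * wave R k (fst p))
   = Complex (?I t (ps n) (%x. Re (wave R k x))) (?I t (ps n) (%x. Im (wave R k x)))" if "0 < t" for t
  by (rule ci(1)[OF that wc(1)]) (use o in auto)
 have w2: "(CLINT p|(strip Q). of_real (b s p * psi n (snd p)) * wave'' R k (fst p))
   = Complex (?I s (ps n) (%x. Re (wave'' R k x))) (?I s (ps n) (%x. Im (wave'' R k x)))"
  by (rule ci(1)[OF s wc(3)]) (use o in auto)
 have w1: "(CLINT p|(strip Q). of_real (b s p * (ch (snd p) * psi n (snd p))) * wave' R k (fst p))
   = Complex (?I s (%q. chi q * ps n q) (%x. Re (wave' R k x))) (?I s (%q. chi q * ps n q) (%x. Im (wave' R k x)))"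
  unfolding chp by (rule ci(2)[OF s wc(2)]) (use o in auto)
 have "((%t. CLINT p|(strip Q). of_real (b t p * psi n (snd p)) * wave R k (fst p)) has_vector_derivative
   Complex (nu * ?I s (ps n) (%x. Re (wave'' R k x)) - nu * mu n * ?I s (ps n) (%x. Re (wave R k x)) + A * ?I s (%q. chi q * ps n q) (%x. Re (wave' R k x)))
   (nu * ?I s (ps n) (%x. Im (wave'' R k x)) - nu * mu n * ?I s (ps n) (%x. Im (wave R k x)) + A * ?I s (%q. chi q * ps n q) (%x. Im (wave' R k x)))) (at s)"
  by (rule has_vector_derivative_transform_within_open[OF has_vector_derivative_Complex[OF re im], of "{0<..}"]) (use s w0 in auto)
 moreover have "Complex (nu * x1 - nu * mu n * y1 + A * z1) (nu * x2 - nu * mu n * y2 + A * z2)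
   = of_real nu * Complex x1 x2 - of_real (nu * mu n) * Complex y1 y2 + of_real A * Complex z1 z2" for x1 x2 y1 y2 z1 z2
  by (simp add: complex_eq_iff)
 ultimately show ?thesis unfolding w0[OF s] w1 w2 by (simp only:)
qed

lemma channel:
 assumes X: "1 <= X" "!!q. \<bar>ch q\<bar> <= X"
 shows "taylor_channel Q psi ch mu X nu A b m"
proof (rule taylor_channel.intro)
 show "prob_space Q" by (rule prob_Q)
 show "orthonormal_basis_L2 Q psi" by (rule basis_Q)
 show "\<exists>B. \<forall>q. \<bar>psi n q\<bar> <= B" for n by (rule indicator_bounded[OF ps_cont])
 show "AE q in Q. psi 0 q = 1"
  unfolding cross_measure_def using borel(1) ps0 by (subst AE_density) (auto simp: indicator_def)
 show "ch \<in> borel_measurable Q" using indicator_borel[OF chi] by simp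
 show "\<bar>ch q\<bar> <= X" for q by (rule X(2))
 show "1 <= X" by (rule X(1))
 show "(LINT q|Q. ch q) = 0" by (rule ch_mean)
 show "mu 0 = 0" "0 < mu 1" "mono mu" by (fact mu)+
 show "integrable (strip Q) (%p. (1 + (fst p)^2) ^ m * (b 0 p)^2)"
  using init weighted_transfer(1) by (simp add: weighted_L2_def)
 show "0 < nu" "nu <= 1" "A \<noteq> 0" "2 <= m" by (fact nu A m)+
qed (rule b_L2, assumption, rule b_cont, assumption, rule mode_ode)

text \<open>The Plancherel estimate asks for continuity in \<open>x\<close>; it is available at
  positive times, where the solution is classical.\<close>

lemma section_mode_cont:
 assumes t: "0 < t"
 shows "continuous_on UNIV (%x. LINT q|Q. b t (x, q) * psi n q)"
proof -
 have "(LINT q|Q. b t (x, q) * psi n q) = (LINT q|lborel. indicator Om q * (u t (x, q) * ps n q))" for x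
 proof -
  have [measurable]: "b t \<in> borel_measurable borel" using b_meas t by simp
  have bx: "(%q. b t (x, q)) \<in> borel_measurable borel" by measurable
  have g: "(%q. b t (x, q) * psi n q) \<in> borel_measurable borel" by (intro borel_measurable_times bx indicator_borel[OF ps_cont])
  show ?thesis
   unfolding cross_measure_integral(2)[OF borel(1) g]
   by (intro LINT_cong refl) (use t in "auto simp: b_def indicator_def")
 qed
 moreover have "continuous_on (UNIV \<times> Om) (%p. u t p * ps n (snd p))"
  by (intro continuous_on_mult cont_u[OF t] continuous_on_compose2[OF ps_cont[of n]]) (auto intro!: continuous_intros)
 from continuous_section_integral[OF comp this]
 have "continuous_on UNIV (%x. LINT q|lborel. indicator Om q * (u t (x, q) * ps n q))" by simp
 ultimately show ?thesis by simp
qed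

lemma L2_norm_solution:
 assumes t: "0 <= t" and G: "G \<in> borel_measurable borel"
 shows "L2_norm (cylinder Om) (%(x, q). u t (x, q) - c * G x) = sqrt (LINT p|(strip Q). (b t p - c * G (fst p))^2)"
proof -
 have Gb: "(%p::real \<times> real \<times> real. G (fst p)) \<in> borel_measurable borel"
  by (rule measurable_compose[OF _ G]) (intro borel_measurable_continuous_onI continuous_intros)
 hence Gl: "(%p::real \<times> real \<times> real. G (fst p)) \<in> borel_measurable (cylinder Om)"
  by (intro measurable_restrict_space1 measurable_completion) simp
 have "L2_norm (cylinder Om) (%p. u t p - c * G (fst p)) = L2_norm (strip Q) (%p. b t p - c * G (fst p))"
  unfolding strip
 proof (rule L2_transfer(2)[OF borel(2)])
  show "AE p in lebesgue. p \<in> S --> b t p - c * G (fst p) = u t p - c * G (fst p)"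
   using b_AE[OF t] by eventually_elim auto
 qed (use Gb Gl u_meas[OF t] b_meas[OF t] in auto)
 thus ?thesis by (simp add: L2_norm_def case_prod_unfold)
qed

lemma total_mass: "(LINT p|cylinder Om. u 0 p) = (LINT p|(strip Q). b 0 p)"
 unfolding strip by (rule cross_measure_transfer(2)[OF borel(2) u_meas b_meas b_AE]) auto

end

text \<open>Time 0 is treated separately: the initial datum need not be continuous in
  \<open>x\<close>, so the decay estimate does not apply, but no decay is claimed there either. The
  time shift gives the Gaussian a width of at least 1 and so bounds it by 1.\<close>

lemma (in taylor_channel) initial_estimate:
 assumes sg: "1 <= sg"
 shows "(LINT p|pm. (b 0 p - C1 * normal_density 0 sg (fst p))^2) <= (2 + 4 * cmass) * W"
proof -
 let ?G = "normal_density 0 sg"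
 have sg0: "0 < sg" using sg by simp
 have G1: "?G x <= 1" for x
 proof -
  have "?G x <= 1 / sqrt (2 * pi * sg^2)" unfolding normal_density_def by (rule mult_left_le) auto
  also have "... <= 1"
  proof -
   have "1 * 1 <= (2 * pi) * sg^2" using sg pi_ge_two by (intro mult_mono one_le_power) auto
   thus ?thesis by simp
  qed
  finally show ?thesis .
 qed
 have GL: "(%p. ?G (fst p)) \<in> L2 pm" and GI: "(LINT p|pm. (?G (fst p))^2) <= 1"
 proof -
  have i: "integrable pm (%p. (?G (fst p))^2 * 1)"
   using normal_density_L2[OF sg0] by (intro pair.integrable_fst_mult_snd[of "%x. (?G x)^2" "%_. 1"]) (auto simp: L2_def)
  thus "(%p. ?G (fst p)) \<in> L2 pm" by (simp add: L2_def)
  have "(LINT p|pm. (?G (fst p))^2) = (LINT x|lborel. (?G x)^2)"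
   using pair.integral_fst[of "%x q. (?G x)^2"] i by (simp add: case_prod_unfold Q.prob_space)
  also have "... <= (LINT x|lborel. ?G x)"
  proof (rule integral_mono)
   show "integrable lborel (%x. (?G x)^2)" using normal_density_L2[OF sg0] by (simp add: L2_def)
   show "integrable lborel ?G" by (rule integrable_normal_density[OF sg0])
   show "(?G x)^2 <= ?G x" for x using mult_left_mono[OF G1[of x] normal_density_nonneg[of 0 sg x]] by (simp add: power2_eq_square)
  qed
  also have "... = 1" by (rule integral_normal_density[OF sg0])
  finally show "(LINT p|pm. (?G (fst p))^2) <= 1" .
 qed
 have bL: "b 0 \<in> L2 pm" by (rule b_L2) simp
 have i: "integrable pm (%p. 2 * (b 0 p)^2)" "integrable pm (%p. 2 * C1^2 * (?G (fst p))^2)"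
  using bL GL by (auto simp: L2_def)
 have "(LINT p|pm. (b 0 p - C1 * ?G (fst p))^2) <= (LINT p|pm. 2 * (b 0 p)^2 + 2 * C1^2 * (?G (fst p))^2)"
 proof (rule integral_mono)
  show "integrable pm (%p. (b 0 p - C1 * ?G (fst p))^2)" using L2_diff[OF bL L2_cmult[OF GL, of C1]] by (simp add: L2_def)
  show "integrable pm (%p. 2 * (b 0 p)^2 + 2 * C1^2 * (?G (fst p))^2)" using i by simp
  show "(b 0 p - C1 * ?G (fst p))^2 <= 2 * (b 0 p)^2 + 2 * C1^2 * (?G (fst p))^2" for p
   using zero_le_power2[of "b 0 p + C1 * ?G (fst p)"] by (simp add: power2_diff power2_sum power_mult_distrib)
 qed
 also have "... = 2 * (LINT p|pm. (b 0 p)^2) + 2 * C1^2 * (LINT p|pm. (?G (fst p))^2)" using i by simp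
 also have "... <= 2 * W + 2 * m1^2 * 1"
  using b0_L2_le_W GI power_mono[OF C1_le, of 2]
  by (intro add_mono mult_mono) (auto intro: LINT_nonneg)
 also have "... = (2 + 4 * cmass) * W" by (simp add: m1_sq algebra_simps)
 finally show ?thesis .
qed

text \<open>The variance is twice diffusivity times time, and multiplying the time by
  \<open>nu\<close> and dividing the diffusivity by \<open>nu\<close> turns the shift
  \<open>1 / nu\<close> into 1.\<close>

lemma heat_gaussian_eq_normal_density:
 assumes "0 < nu" "0 <= d" "0 <= t"
 shows "heat_gaussian (nu + A^2 * d / nu) (t + 1 / nu) x
  = normal_density 0 (sqrt (2 * ((1 + (A / nu)^2 * d) * (nu * t + 1)))) x"
proof -
 let ?s = "(1 + (A / nu)^2 * d) * (nu * t + 1)"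
 have s: "0 <= ?s" using assms by (intro mult_nonneg_nonneg add_nonneg_nonneg) auto
 have "(nu + A^2 * d / nu) * (t + 1 / nu) = ?s"
  using assms by (simp add: field_simps power2_eq_square)
 moreover have "4 * y * z = 2 * (2 * (y * z))" "4 * pi * y * z = 2 * pi * (2 * (y * z))" for y z :: real by simp_all
 ultimately have "4 * (nu + A^2 * d / nu) * (t + 1 / nu) = 2 * (2 * ?s)" "4 * pi * (nu + A^2 * d / nu) * (t + 1 / nu) = 2 * pi * (2 * ?s)"
  by (simp_all only:)
 moreover have "(sqrt (2 * ?s))^2 = 2 * ?s" by (rule real_sqrt_pow2) (use s in linarith)
 ultimately show ?thesis by (simp only: heat_gaussian_def normal_density_def) simp
qed

lemma powr_three_quarters_sq: "0 < x ==> (x powr (3 / 4))^2 = x * sqrt x"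
proof -
 assume x: "0 < x"
 have "(x powr (3 / 4))^2 = x powr (1 + 1 / 2)" using x by (simp add: powr_power)
 also have "... = x * sqrt x" using x by (simp only: powr_add powr_one powr_half_sqrt less_imp_le)
 finally show ?thesis .
qed

theorem (in taylor_problem) uniform_decay:
 "\<exists>K\<ge>0. \<forall>nu u m t. taylor_solution Om chi A ps mu nu u m --> 0 <= t -->
  L2_norm (cylinder Om) (%(x, q). u t (x, q) - (LINT p|cylinder Om. u 0 p)
   * heat_gaussian (nu + A^2 * mu_norm_sq Om ps mu chi / nu) (t + 1 / nu) x)
   <= K * weighted_L2_norm m Om (u 0) / (1 + nu * t) powr (3 / 4)"
proof -
 obtain B where B: "!!q. \<bar>ch q\<bar> <= B" using indicator_bounded[OF chi] by blast
 define X where "X = max B 1"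
 have X: "1 <= X" "!!q. \<bar>ch q\<bar> <= X" using B by (auto simp: X_def max.coboundedI1)
 define d where "d = taylor_channel.taylor_constant Q psi ch mu"
 from taylor_decay[of X mu A Q psi ch, OF X(1) mu(2) A, folded d_def] obtain K where K0: "0 <= K" and K: "!!nu b w t. taylor_channel Q psi ch mu X nu A b w ==> 0 <= t ==>
  (\<forall>n. continuous_on UNIV (taylor_channel.section_mode Q psi b n t)) ==>
  (LINT p|(strip Q). (b t p - taylor_channel.C1 Q b * normal_density 0 (sqrt (2 * ((1 + (A / nu)^2 * d) * (nu * t + 1)))) (fst p))^2)
   <= K * taylor_channel.W Q b w / ((1 + nu * t) * sqrt (1 + nu * t))" by blast
 \<comment> \<open>Covers positive times by \<open>K\<close> and time 0 by the constant of
   \<open>initial_estimate\<close>.\<close>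
 define K1 where "K1 = max K (2 + 4 * cmass)"
 have K1: "K <= K1" "2 + 4 * cmass <= K1" "0 <= K1" using K0 by (auto simp: K1_def)
 show ?thesis
 proof (intro exI[of _ "sqrt K1"] conjI allI impI)
  show "0 <= sqrt K1" using K1 by simp
  fix nu :: real and u :: "real => real \<times> real \<times> real => real" and m and t :: real
  assume "taylor_solution Om chi A ps mu nu u m" and t: "0 <= t"
  then interpret taylor_solution Om chi A ps mu nu u m by simp
  interpret c: taylor_channel Q psi ch mu X nu A b m by (rule channel[OF X])
  have d: "d = mu_norm_sq Om ps mu chi" "0 <= d"
   using c.taylor_constant_nonneg by (simp_all add: d_def c.taylor_constant_def mu_norm_sq_def ch_inner)
  let ?sg = "sqrt (2 * ((1 + (A / nu)^2 * d) * (nu * t + 1)))"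
  let ?x = "1 + nu * t"
  have x: "0 < ?x" using nu t by (simp add: add_pos_nonneg)
  have "(LINT p|(strip Q). (b t p - c.C1 * normal_density 0 ?sg (fst p))^2) <= K1 * c.W / (?x * sqrt ?x)"
  proof (cases "t = 0")
   case True
   have "1 * 1 <= 2 * (1 + (A / nu)^2 * d)" using d(2) by (intro mult_mono) auto
   hence "1 <= sqrt (2 * (1 + (A / nu)^2 * d))" by simp
   from c.initial_estimate[OF this] show ?thesis
   using True mult_right_mono[OF K1(2) c.W_nonneg] by simp
  next
   case False
   have "\<forall>n. continuous_on UNIV (c.section_mode n t)"
   using section_mode_cont[of t] False t by (simp add: c.section_mode_def[abs_def])
   from K[OF c.taylor_channel_axioms t this]
   have "(LINT p|(strip Q). (b t p - c.C1 * normal_density 0 ?sg (fst p))^2) <= K * c.W / (?x * sqrt ?x)" .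
   also have "... <= K1 * c.W / (?x * sqrt ?x)"
   using K1(1) c.W_nonneg x by (intro divide_right_mono mult_right_mono) auto
   finally show ?thesis .
  qed
  hence "L2_norm (cylinder Om) (%(x, q). u t (x, q) - c.C1 * normal_density 0 ?sg x) <= sqrt (K1 * c.W / (?x * sqrt ?x))"
   by (subst L2_norm_solution[OF t]) auto
  also have "... = sqrt K1 * sqrt c.W / ?x powr (3 / 4)"
   unfolding powr_three_quarters_sq[OF x, symmetric] by (simp add: real_sqrt_divide real_sqrt_mult)
  also have "sqrt c.W = weighted_L2_norm m Om (u 0)"
   by (simp add: weighted_L2_norm_def weighted_transfer(2) c.W_def)
  also have "c.C1 = (LINT p|cylinder Om. u 0 p)" by (simp add: c.C1_def total_mass)
  finally show "L2_norm (cylinder Om) (%(x, q). u t (x, q) - (LINT p|cylinder Om. u 0 p)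
   * heat_gaussian (nu + A^2 * mu_norm_sq Om ps mu chi / nu) (t + 1 / nu) x)
   <= sqrt K1 * weighted_L2_norm m Om (u 0) / (1 + nu * t) powr (3 / 4)"
   using heat_gaussian_eq_normal_density[OF nu(1) d(2) t, of A] by (simp add: d(1))
 qed
qed

lemma lebesgue_on_integral_compact:
 fixes g :: "'a::euclidean_space => real"
 assumes K: "compact K" and g: "continuous_on K g"
 shows "(LINT q|lebesgue_on K. g q) = (LINT q|lborel. indicator K q * g q)"
proof -
 have Kb: "K \<in> sets borel" using compact_imp_closed[OF K] by (rule borel_closed)
 have gb: "(%q. indicator K q * g q) \<in> borel_measurable borel"
  using borel_measurable_continuous_on_indicator[OF Kb g] by simp
 have gl: "g \<in> borel_measurable (lebesgue_on K)"
  using Kb g by (intro continuous_imp_measurable_on_sets_lebesgue) auto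
 have ae: "AE q in lebesgue. q \<in> K --> indicator K q * g q = g q" by (intro AE_I2) simp
 have "(LINT q|lebesgue_on K. g q) = (LINT q|lborel. indicator K q * (indicator K q * g q))"
  unfolding cross_measure_transfer(2)[OF Kb gl gb ae] cross_measure_integral(2)[OF Kb gb] ..
 thus ?thesis by (simp add: mult.assoc[symmetric] indicator_inter_arith[symmetric])
qed

theorem corollary2p1:
  fixes \<Omega> :: "(real \<times> real) set"
    and V chi :: "real \<times> real \<Rightarrow> real"
    and A :: real
    and \<psi> :: "nat \<Rightarrow> real \<times> real \<Rightarrow> real"
    and \<mu> :: "nat \<Rightarrow> real"
    and N :: nat
  assumes "compact \<Omega>" and "smooth_boundary \<Omega>" and "measure lebesgue \<Omega> = 1"
    and "smooth_on \<Omega> V"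
    and "A = (LINT q|lebesgue_on \<Omega>. V q) / measure lebesgue \<Omega>" and "A \<noteq> 0"
    and "\<forall>q\<in>\<Omega>. V q = A * (1 + chi q)"
    and "orthonormal_basis_L2 (lebesgue_on \<Omega>) \<psi>"
    and "\<forall>n. neumann_eigenfunction \<Omega> (\<psi> n) (\<mu> n)"
    and "\<forall>q\<in>\<Omega>. \<psi> 0 q = 1"
    and "\<mu> 0 = 0" and "0 < \<mu> 1" and "mono \<mu>"
    and "N \<ge> 4"
  shows "\<exists>\<nu>\<^sub>0>0. \<exists>C\<^sub>2 :: real \<Rightarrow> real. \<forall>\<nu> u.
    0 < \<nu> \<longrightarrow> \<nu> < \<nu>\<^sub>0 \<longrightarrow>
    advection_diffusion_solution \<Omega> \<nu> A chi u \<longrightarrow> u 0 \<in> weighted_L2 (N + 1) \<Omega> \<longrightarrow>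
    (\<exists>C\<^sub>1. C\<^sub>1 = (LINT p|cylinder \<Omega>. u 0 p) \<and>
      (\<forall>t\<ge>0.
        L2_norm (cylinder \<Omega>)
          (\<lambda>(x, q). u t (x, q)
             - C\<^sub>1 * heat_gaussian (\<nu> + A\<^sup>2 * mu_norm_sq \<Omega> \<psi> \<mu> chi / \<nu>) (t + 1 / \<nu>) x)
        \<le> C\<^sub>2 (weighted_L2_norm (N + 1) \<Omega> (u 0)) / (1 + \<nu> * t) powr (3 / 4)))"
proof -
 have "Ck_on 0 \<Omega> V" using assms(4) unfolding smooth_on_def by blast
 hence V: "continuous_on \<Omega> V" by simp
 \<comment> \<open>Outside \<open>\<Omega>\<close> nothing is known of \<open>chi\<close>;
   continuity and mean are derived from the values of \<open>V\<close> on
   \<open>\<Omega>\<close>.\<close>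
 have chi_eq: "chi q = V q / A - 1" if "q \<in> \<Omega>" for q using assms(6,7) that by simp
 have chi: "continuous_on \<Omega> chi"
  by (rule continuous_on_eq[of _ "%q. V q / A - 1"]) (use V chi_eq assms(6) in "auto intro!: continuous_intros")
 have b: "\<Omega> \<in> sets borel" using compact_imp_closed[OF assms(1)] by (rule borel_closed)
 have "(LINT q|lebesgue_on \<Omega>. chi q) = (LINT q|lborel. indicator \<Omega> q * V q / A - indicator \<Omega> q * 1)"
  unfolding lebesgue_on_integral_compact[OF assms(1) chi]
  by (intro LINT_cong refl) (auto simp: indicator_def chi_eq)
 also have "... = (LINT q|lborel. indicator \<Omega> q * V q) / A - (LINT q|lborel. indicator \<Omega> q * 1)"
  using integrable_compact[OF assms(1) V] integrable_compact[OF assms(1) continuous_on_const[of _ 1]]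
  by simp
 also have "(LINT q|lborel. indicator \<Omega> q * V q) = A"
  using assms(5) lebesgue_on_integral_compact[OF assms(1) V] by (simp add: assms(3))
 also have "(LINT q|lborel. indicator \<Omega> q * 1) = measure lborel \<Omega>" using b by simp
 also have "... = 1" using assms(3) b by (simp add: measure_completion)
 finally have chi_mean: "(LINT q|lebesgue_on \<Omega>. chi q) = 0" using assms(6) by simp
 interpret taylor_problem \<Omega> chi A \<psi> \<mu>
  by (rule taylor_problem.intro) (use assms chi chi_mean in auto)
 obtain K where K: "!!\<nu> u m t. taylor_solution \<Omega> chi A \<psi> \<mu> \<nu> u m ==> 0 <= t ==>
  L2_norm (cylinder \<Omega>) (%(x, q). u t (x, q) - (LINT p|cylinder \<Omega>. u 0 p)
   * heat_gaussian (\<nu> + A^2 * mu_norm_sq \<Omega> \<psi> \<mu> chi / \<nu>) (t + 1 / \<nu>) x)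
   <= K * weighted_L2_norm m \<Omega> (u 0) / (1 + \<nu> * t) powr (3 / 4)" using uniform_decay by blast
 show ?thesis
 \<comment> \<open>The threshold 1 ensures \<open>|A| <= |A| / \<nu>\<close>, the source of the
   uniformity in \<open>\<nu>\<close>. The estimate is linear in the weighted norm, so
   \<open>C\<^sub>2\<close> is multiplication by a constant.\<close>
 proof (rule exI[of _ 1], intro conjI, simp, rule exI[of _ "%M. K * M"], intro allI impI)
  fix \<nu> u assume \<nu>: "0 < \<nu>" "\<nu> < 1" and sol: "advection_diffusion_solution \<Omega> \<nu> A chi u" and u0: "u 0 \<in> weighted_L2 (N + 1) \<Omega>"
  have "taylor_solution \<Omega> chi A \<psi> \<mu> \<nu> u (N + 1)"
   by (intro taylor_solution.intro taylor_solution_axioms.intro taylor_problem_axioms) (use \<nu> sol u0 assms(14) in auto)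
  from K[OF this]
  show "\<exists>C\<^sub>1. C\<^sub>1 = (LINT p|cylinder \<Omega>. u 0 p) \<and>
   (\<forall>t\<ge>0. L2_norm (cylinder \<Omega>) (%(x, q). u t (x, q)
   - C\<^sub>1 * heat_gaussian (\<nu> + A^2 * mu_norm_sq \<Omega> \<psi> \<mu> chi / \<nu>) (t + 1 / \<nu>) x)
   <= K * weighted_L2_norm (N + 1) \<Omega> (u 0) / (1 + \<nu> * t) powr (3 / 4))" by blast
 qed
qed

end
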